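(* Let $d\ge1$, $m>0$, and let $L=A_m+W$, where $W$ is a bounded radial real function on $\mathbb{R}^d$ with $W(x)\to W_\infty$ as $|x|\to\infty$. Let $\phi_1,\phi_2$ be the first two radial eigenfunctions of $L$, with eigenvalues $\lambda_1<\lambda_2<m+W_\infty$, $\phi_1>0$, and put $\mu=\lambda_2-\lambda_1>0$. Let $\Phi_j=\mathcal U\phi_j$ be their massive harmonic extensions to $\mathbb{R}^{d+1}_+$ (so that $\Phi_1>0$ on $\overline{\mathbb{R}^{d+1}_+}$) and set $\Xi=\Phi_2/\Phi_1$, $\Xi_0=\Xi|_{y=0}=\phi_2/\phi_1$. Then $\Xi$ satisfies, in the weak sense on $\mathcal H_{\mathrm{rad}}$, $$\operatorname{div}\big(\Phi_1^2\nabla\Xi\big)=0\ \text{ in }\mathbb{R}^{d+1}_+,\qquad -\Phi_1^2\,\partial_y\Xi\big|_{y=0}=\mu\,\phi_1^2\,\Xi_0 .$$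
   Context: $A_m=\sqrt{-\Delta+m^2}$ is the self-adjoint operator on $L^2(\mathbb{R}^d)$ with Fourier symbol $\sqrt{|\xi|^2+m^2}$. $\mathbb{R}^{d+1}_+=\{(x,y):x\in\mathbb{R}^d,\ y>0\}$, and $\nabla,\operatorname{div}$ are taken in $(x,y)$. For $u\in H^{1/2}(\mathbb{R}^d)$, the massive harmonic extension $U=\mathcal U u$ is the unique finite-energy solution ($\int_{\mathbb{R}^{d+1}_+}(|\nabla U|^2+m^2U^2)<\infty$) of $\Delta_xU+\partial_{yy}U-m^2U=0$ in $\mathbb{R}^{d+1}_+$, $U(\cdot,0)=u$; in Fourier variables $\widehat U(\xi,y)=\hat u(\xi)e^{-y\sqrt{|\xi|^2+m^2}}$. Radial eigenvalues/eigenfunctions of $L$ are those of $L$ restricted to the radial subspace of $L^2(\mathbb{R}^d)$; $\inf\sigma_{\mathrm{ess}}(L)=m+W_\infty$. $\mathcal H_{\mathrm{rad}}$ is the space of functions $U$ on $\mathbb{R}^{d+1}_+$, radial in $x$, with trace $U_0=U|_{y=0}$, for which $\int_{\mathbb{R}^{d+1}_+}(|\nabla U|^2+m^2U^2)+\int_{\mathbb{R}^d}WU_0^2$ and $\int_{\mathbb{R}^d}U_0^2$ are finite. The weak sense on $\mathcal H_{\mathrm{rad}}$ means $\int_{\mathbb{R}^{d+1}_+}\Phi_1^2\nabla\Xi\cdot\nabla\varphi=\mu\int_{\mathbb{R}^d}\phi_1^2\,\Xi_0\,\varphi|_{y=0}$ for test functions $\varphi\in\mathcal H_{\mathrm{rad}}$.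 *)

theory Defs
  imports "HOL-Analysis.Analysis"
begin

text \<open>
  R^d is a type \<open>'a::euclidean_space\<close> with \<open>d = DIM('a)\<close>, and (x, y) is a point of \<open>'a \<times> real\<close>.
  Elements of \<open>L\<^sup>2\<close> are represented by Borel functions, with equality almost everywhere.
\<close>

definition sq_integrable :: "('a::euclidean_space \<Rightarrow> 'b::euclidean_space) \<Rightarrow> bool" where
  "sq_integrable f \<longleftrightarrow> f \<in> borel_measurable lborel \<and> integrable lborel (\<lambda>x. (norm (f x))\<^sup>2)"

definition fourier_integral :: "('a::euclidean_space \<Rightarrow> complex) \<Rightarrow> 'a \<Rightarrow> complex" where
  "fourier_integral f \<xi> = (LINT x|lborel. cis (- (x \<bullet> \<xi>)) * f x)"

text \<open>
  The Fourier-Plancherel transform on \<open>L\<^sup>2\<close>, as a relation: the \<open>L\<^sup>2\<close> limit of the Fourier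
  integrals of the truncations of f to balls. No normalising factor is needed, since the transform
  is only used to conjugate multiplication operators.
\<close>
definition L2_fourier :: "('a::euclidean_space \<Rightarrow> complex) \<Rightarrow> ('a \<Rightarrow> complex) \<Rightarrow> bool" where
  "L2_fourier f g \<longleftrightarrow> sq_integrable f \<and> sq_integrable g \<and>
     (\<lambda>n::nat. \<integral>\<^sup>+\<xi>. ennreal ((cmod (fourier_integral
          (\<lambda>x. indicator (cball 0 (real n)) x * f x) \<xi> - g \<xi>))\<^sup>2) \<partial>lborel) \<longlonglongrightarrow> 0"

text \<open>
  The graph of \<open>A\<^sub>m\<close>: \<open>massive_op m u v\<close> says that u is in the domain and \<open>A\<^sub>m u = v\<close>. The domain
  condition is the square integrability of the symbol times the transform of u.
\<close>
definition massive_op :: "real \<Rightarrow> ('a::euclidean_space \<Rightarrow> complex) \<Rightarrow> ('a \<Rightarrow> complex) \<Rightarrow> bool" where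
  "massive_op m u v \<longleftrightarrow>
     (\<exists>uh. L2_fourier u uh \<and>
           L2_fourier v (\<lambda>\<xi>. complex_of_real (sqrt ((norm \<xi>)\<^sup>2 + m\<^sup>2)) * uh \<xi>))"

text \<open>The graph of \<open>L = A\<^sub>m + W\<close>; for bounded W its domain is that of \<open>A\<^sub>m\<close>.\<close>
definition schroedinger_op ::
  "real \<Rightarrow> ('a::euclidean_space \<Rightarrow> real) \<Rightarrow> ('a \<Rightarrow> complex) \<Rightarrow> ('a \<Rightarrow> complex) \<Rightarrow> bool" where
  "schroedinger_op m W u v \<longleftrightarrow> sq_integrable v \<and>
     (\<exists>w. massive_op m u w \<and> (AE x in lborel. v x = w x + complex_of_real (W x) * u x))"

definition ae_radial :: "('a::euclidean_space \<Rightarrow> 'b) \<Rightarrow> bool" where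
  "ae_radial f \<longleftrightarrow> (\<exists>g. AE x in lborel. f x = g (norm x))"

definition radial_eigenfunction ::
  "real \<Rightarrow> ('a::euclidean_space \<Rightarrow> real) \<Rightarrow> real \<Rightarrow> ('a \<Rightarrow> complex) \<Rightarrow> bool" where
  "radial_eigenfunction m W \<kappa> u \<longleftrightarrow>
     schroedinger_op m W u (\<lambda>x. complex_of_real \<kappa> * u x) \<and> ae_radial u \<and>
     \<not> (AE x in lborel. u x = 0)"

definition radial_eigenvalue :: "real \<Rightarrow> ('a::euclidean_space \<Rightarrow> real) \<Rightarrow> real \<Rightarrow> bool" where
  "radial_eigenvalue m W \<kappa> \<longleftrightarrow> (\<exists>u. radial_eigenfunction m W \<kappa> u)"

definition partial_deriv :: "'b::euclidean_space \<Rightarrow> ('b \<Rightarrow> real) \<Rightarrow> 'b \<Rightarrow> real" where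
  "partial_deriv b f p = frechet_derivative f (at p) b"

definition gradient :: "('b::euclidean_space \<Rightarrow> real) \<Rightarrow> 'b \<Rightarrow> 'b" where
  "gradient f p = (\<Sum>b\<in>Basis. partial_deriv b f p *\<^sub>R b)"

text \<open>On \<open>'a \<times> real\<close> this is the full Laplacian, in x and y together.\<close>
definition laplacian :: "('b::euclidean_space \<Rightarrow> real) \<Rightarrow> 'b \<Rightarrow> real" where
  "laplacian f p = (\<Sum>b\<in>Basis. partial_deriv b (partial_deriv b f) p)"

text \<open>\<open>C\<^sup>k\<close> functions; only meaningful for open S, since \<open>partial_deriv\<close> is unrestricted.\<close>
primrec Ck_on :: "nat \<Rightarrow> 'b::euclidean_space set \<Rightarrow> ('b \<Rightarrow> real) \<Rightarrow> bool" where
  "Ck_on 0 S f \<longleftrightarrow> continuous_on S f"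
| "Ck_on (Suc k) S f \<longleftrightarrow> f differentiable_on S \<and> (\<forall>b\<in>Basis. Ck_on k S (partial_deriv b f))"

text \<open>\<open>C\<^sub>c\<^sup>\<infinity>\<close> functions with support in \<open>\<Omega>\<close>, extended by zero.\<close>
definition test_function :: "'b::euclidean_space set \<Rightarrow> ('b \<Rightarrow> real) \<Rightarrow> bool" where
  "test_function \<Omega> \<psi> \<longleftrightarrow> (\<forall>k. Ck_on k UNIV \<psi>) \<and>
     compact (closure {p. \<psi> p \<noteq> 0}) \<and> closure {p. \<psi> p \<noteq> 0} \<subseteq> \<Omega>"

definition locally_integrable ::
  "'b::euclidean_space set \<Rightarrow> ('b \<Rightarrow> 'c::euclidean_space) \<Rightarrow> bool" where
  "locally_integrable \<Omega> f \<longleftrightarrow> (\<forall>K. compact K \<and> K \<subseteq> \<Omega> \<longrightarrow> set_integrable lborel K f)"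

definition weak_gradient ::
  "'b::euclidean_space set \<Rightarrow> ('b \<Rightarrow> real) \<Rightarrow> ('b \<Rightarrow> 'b) \<Rightarrow> bool" where
  "weak_gradient \<Omega> U G \<longleftrightarrow> locally_integrable \<Omega> U \<and> locally_integrable \<Omega> G \<and>
     (\<forall>\<psi>. test_function \<Omega> \<psi> \<longrightarrow>
        (\<forall>b\<in>Basis. (LINT p:\<Omega>|lborel. U p * partial_deriv b \<psi> p)
                 = - (LINT p:\<Omega>|lborel. (G p \<bullet> b) * \<psi> p)))"

definition half_space :: "('a::euclidean_space \<times> real) set" where
  "half_space = {p. 0 < snd p}"

text \<open>
  The trace at y = 0 of a finite-energy function: \<open>U(\<cdot>,y) \<rightarrow> U\<^sub>0\<close> in \<open>L\<^sup>2\<close> as \<open>y \<down> 0\<close>. As U is only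
  defined up to null sets, the limit disregards a null set of heights y.
\<close>
definition has_trace :: "('a::euclidean_space \<times> real \<Rightarrow> real) \<Rightarrow> ('a \<Rightarrow> real) \<Rightarrow> bool" where
  "has_trace U U0 \<longleftrightarrow> U0 \<in> borel_measurable lborel \<and>
     (\<forall>\<epsilon>>0. \<exists>\<delta>>0. AE y in lborel. 0 < y \<and> y < \<delta> \<longrightarrow>
        (\<integral>\<^sup>+x. ennreal ((U (x, y) - U0 x)\<^sup>2) \<partial>lborel) < ennreal \<epsilon>)"

text \<open>
  The massive harmonic extension, as a relation. By elliptic regularity the weak solution has a
  smooth representative on the open half-space; U is that one, with the given boundary
  values u on y = 0, so that U is a function on the closed half-space.
\<close>
definition massive_extension ::
  "real \<Rightarrow> ('a::euclidean_space \<Rightarrow> real) \<Rightarrow> ('a \<times> real \<Rightarrow> real) \<Rightarrow> bool" where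
  "massive_extension m u U \<longleftrightarrow>
     Ck_on 2 half_space U \<and>
     (\<forall>p\<in>half_space. laplacian U p - m\<^sup>2 * U p = 0) \<and>
     set_integrable lborel half_space (\<lambda>p. (norm (gradient U p))\<^sup>2 + m\<^sup>2 * (U p)\<^sup>2) \<and>
     has_trace U u \<and> (\<forall>x. U (x, 0) = u x)"

text \<open>
  \<open>H_rad m W U G U0\<close>: U belongs to the radial energy space, with weak gradient G and trace U0
  (both determined by U up to null sets).
\<close>
definition H_rad ::
  "real \<Rightarrow> ('a::euclidean_space \<Rightarrow> real) \<Rightarrow> ('a \<times> real \<Rightarrow> real) \<Rightarrow>
     ('a \<times> real \<Rightarrow> 'a \<times> real) \<Rightarrow> ('a \<Rightarrow> real) \<Rightarrow> bool" where
  "H_rad m W U G U0 \<longleftrightarrow>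
     weak_gradient half_space U G \<and> has_trace U U0 \<and>
     (\<exists>g. AE p in lborel. p \<in> half_space \<longrightarrow> U p = g (norm (fst p)) (snd p)) \<and>
     set_integrable lborel half_space (\<lambda>p. (norm (G p))\<^sup>2 + m\<^sup>2 * (U p)\<^sup>2) \<and>
     integrable lborel (\<lambda>x. W x * (U0 x)\<^sup>2) \<and> integrable lborel (\<lambda>x. (U0 x)\<^sup>2)"

text \<open>
  The weak form on the radial energy space of
  \<open>div (\<Phi>\<^sub>1\<^sup>2 \<nabla>\<Xi>) = 0\<close> for \<open>y > 0\<close>, \<open>-\<Phi>\<^sub>1\<^sup>2 \<partial>\<^sub>y\<Xi> = \<mu> \<phi>\<^sub>1\<^sup>2 \<Xi>\<^sub>0\<close> on \<open>y = 0\<close>.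
  Differentiability of \<open>\<Xi>\<close> and existence of both integrals are required explicitly, as
  \<open>frechet_derivative\<close> and the Bochner integral are total functions.
\<close>
definition weak_solution_rad ::
  "real \<Rightarrow> ('a::euclidean_space \<Rightarrow> real) \<Rightarrow> real \<Rightarrow> ('a \<times> real \<Rightarrow> real) \<Rightarrow> ('a \<Rightarrow> real) \<Rightarrow>
     ('a \<times> real \<Rightarrow> real) \<Rightarrow> ('a \<Rightarrow> real) \<Rightarrow> bool" where
  "weak_solution_rad m W \<mu> \<Phi>1 \<phi>1 \<Xi> \<Xi>0 \<longleftrightarrow>
     \<Xi> differentiable_on half_space \<and>
     (\<forall>\<phi> G \<phi>0. H_rad m W \<phi> G \<phi>0 \<longrightarrow>
        set_integrable lborel half_space (\<lambda>p. (\<Phi>1 p)\<^sup>2 * (gradient \<Xi> p \<bullet> G p)) \<and>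
        integrable lborel (\<lambda>x. (\<phi>1 x)\<^sup>2 * \<Xi>0 x * \<phi>0 x) \<and>
        (LINT p:half_space|lborel. (\<Phi>1 p)\<^sup>2 * (gradient \<Xi> p \<bullet> G p))
          = \<mu> * (LINT x|lborel. (\<phi>1 x)\<^sup>2 * \<Xi>0 x * \<phi>0 x))"

end

(*
  Write V y = exp (-y A_m) phi.  On the Fourier side V is an absolutely convergent, smooth integral for
  y > 0; by subordination it is also convolution with an explicit positive kernel of mass exp (-m y).
  The two forms are linked by the multiplication formula with Gaussians, so the Plancherel theorem is
  never needed.  A finite-energy extension has the same trace as V and differs from it by a solution
  with zero trace, which vanishes by Green's identity for its square; hence it equals V.  This gives
  positivity, the bound by the supremum of the boundary data, and d/dy V = -exp (-y A_m) A_m phi, whose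
  trace is (W - lambda) phi.  Eigenfunctions are bounded because
  phi = V eps + int_0^eps exp (-s A_m) A_m phi ds with |A_m phi| <= C |phi| and the integral term contracting for small eps.
  The field F = Phi_1 grad Phi_2 - Phi_2 grad Phi_1 = Phi_1^2 grad Xi is then square integrable and
  divergence free, with normal trace -mu phi_1 phi_2, and testing it against the energy space proves
  the claim.
*)
theory Submission
  imports Defs "HOL-Probability.Probability"
begin

section \<open>Calculus of gradients and Lebesgue integrals\<close>

text \<open>The data are controlled only through energies and L^2 traces: a trace is tested at
  almost every height and says nothing about tangential derivatives. Boundary terms are therefore
  produced by cutoffs that near y = 0 depend essentially on y alone, so that only the normal
  component of a field meets the boundary; that component is accessible because the y-derivative of
  exp (-y A_m) phi is again a Poisson extension. Boundedness of the eigenfunctions is needed for the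
  products: a product of two L^2 functions is only L^1, whereas Phi_1 grad Phi_2 with bounded Phi_1
  is square integrable and its normal component has an L^2 trace, which can be paired with an
  arbitrary element of the energy space. In that trace the potential cancels, since A_m phi_j =
  (lambda_j - W) phi_j gives phi_2 A_m phi_1 - phi_1 A_m phi_2 = -mu phi_1 phi_2. Positivity of m
  enters as exponential decay in y and as the weight m^2 in the energy; both put the extensions
  themselves, not only their gradients, into L^2 of the half-space, which uniqueness
  requires.\<close>

lemma nn_integral_lborel_affine:
  fixes f :: "'a::euclidean_space \<Rightarrow> ennreal"
  assumes [measurable]: "f \<in> borel_measurable borel" and "c \<noteq> 0"
  shows "(\<integral>\<^sup>+x. f x \<partial>lborel) = ennreal (\<bar>c\<bar> ^ DIM('a)) * (\<integral>\<^sup>+x. f (t + c *\<^sub>R x) \<partial>lborel)"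
  by (subst lborel_affine[OF \<open>c \<noteq> 0\<close>, of t])
     (simp add: nn_integral_density nn_integral_distr nn_integral_cmult)

lemma lborel_integrable_affine_iff:
  fixes f :: "'a::euclidean_space \<Rightarrow> 'b::{banach, second_countable_topology}"
  assumes [measurable]: "f \<in> borel_measurable borel" and "c \<noteq> 0"
  shows "integrable lborel (\<lambda>x. f (t + c *\<^sub>R x)) \<longleftrightarrow> integrable lborel f"
proof -
  have "ennreal (\<bar>c\<bar> ^ DIM('a)) * a < \<top> \<longleftrightarrow> a < \<top>" for a
    using \<open>c \<noteq> 0\<close> by (auto simp: ennreal_mult_less_top)
  then show ?thesis
    unfolding integrable_iff_bounded
    using nn_integral_lborel_affine[of "\<lambda>x. ennreal (norm (f x))" c t] \<open>c \<noteq> 0\<close> by simp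
qed

lemma lborel_integral_affine:
  fixes f :: "'a::euclidean_space \<Rightarrow> 'b::{banach, second_countable_topology}"
  assumes [measurable]: "f \<in> borel_measurable borel" and "c \<noteq> 0"
  shows "(LINT x|lborel. f x) = \<bar>c\<bar> ^ DIM('a) *\<^sub>R (LINT x|lborel. f (t + c *\<^sub>R x))"
  by (subst lborel_affine[OF \<open>c \<noteq> 0\<close>, of t])
     (simp add: integral_density integral_distr)

lemma lborel_integral_shift:
  fixes f :: "'a::euclidean_space \<Rightarrow> 'b::{banach, second_countable_topology}"
  assumes "f \<in> borel_measurable borel"
  shows "(LINT x|lborel. f (x + t)) = (LINT x|lborel. f x)"
  using lborel_integral_affine[OF assms, of 1 t] by (simp add: add.commute)

lemma lborel_integral_reflect:
  fixes f :: "'a::euclidean_space \<Rightarrow> 'b::{banach, second_countable_topology}"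
  assumes "f \<in> borel_measurable borel"
  shows "(LINT x|lborel. f (t - x)) = (LINT x|lborel. f x)"
  using lborel_integral_affine[OF assms, of "-1" t] by simp

lemma nn_integral_shift:
  fixes f :: "'a::euclidean_space \<Rightarrow> ennreal"
  assumes "f \<in> borel_measurable borel"
  shows "(\<integral>\<^sup>+x. f (x + t) \<partial>lborel) = (\<integral>\<^sup>+x. f x \<partial>lborel)"
  using nn_integral_lborel_affine[OF assms, of 1 t] by (simp add: add.commute)

lemma nn_integral_reflect:
  fixes f :: "'a::euclidean_space \<Rightarrow> ennreal"
  assumes "f \<in> borel_measurable borel"
  shows "(\<integral>\<^sup>+x. f (t - x) \<partial>lborel) = (\<integral>\<^sup>+x. f x \<partial>lborel)"
  using nn_integral_lborel_affine[OF assms, of "-1" t] by simp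

section \<open>Gradients as \<open>GDERIV\<close> derivatives, and functions of compact
  support\<close>

lemma GDERIV_unique: "GDERIV f p :> a \<Longrightarrow> GDERIV f p :> b \<Longrightarrow> a = b"
proof -
  assume "GDERIV f p :> a" "GDERIV f p :> b"
  then have "(\<lambda>h. h \<bullet> a) = (\<lambda>h. h \<bullet> b)"
    unfolding gderiv_def by (rule has_derivative_unique)
  then have "\<forall>h. h \<bullet> a = h \<bullet> b" by metis
  then show "a = b" by (simp add: vector_eq_ldot)
qed

lemma GDERIV_transform_open:
  assumes "GDERIV f p :> a" "open S" "p \<in> S" "\<And>q. q \<in> S \<Longrightarrow> f q = g q"
  shows "GDERIV g p :> a"
  using assms unfolding gderiv_def by (metis has_derivative_transform_within_open)

lemma GDERIV_partial_deriv: "GDERIV f p :> a \<Longrightarrow> partial_deriv b f p = a \<bullet> b"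
  unfolding gderiv_def partial_deriv_def
  by (metis frechet_derivative_at inner_commute)

lemma GDERIV_gradient: "GDERIV f p :> a \<Longrightarrow> gradient f p = a"
  by (simp add: gradient_def GDERIV_partial_deriv euclidean_representation)

lemma differentiable_GDERIV_gradient:
  fixes f :: "'b::euclidean_space \<Rightarrow> real"
  assumes "f differentiable at p"
  shows "GDERIV f p :> gradient f p"
proof -
  let ?d = "frechet_derivative f (at p)"
  have d: "(f has_derivative ?d) (at p)"
    using assms frechet_derivative_works by blast
  then interpret linear ?d by (rule has_derivative_linear)
  have "?d h = h \<bullet> gradient f p" for h
  proof -
    have "?d h = ?d (\<Sum>b\<in>Basis. (h \<bullet> b) *\<^sub>R b)" by (simp add: euclidean_representation)
    also have "\<dots> = (\<Sum>b\<in>Basis. (h \<bullet> b) * ?d b)" by (simp add: sum scale)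
    also have "\<dots> = h \<bullet> gradient f p"
      by (simp add: gradient_def partial_deriv_def inner_sum_right mult.commute)
    finally show ?thesis .
  qed
  then show ?thesis using d unfolding gderiv_def by presburger
qed

lemma gradient_inner_Basis: "b \<in> Basis \<Longrightarrow> gradient f p \<bullet> b = partial_deriv b f p"
  by (simp add: gradient_def)

lemma GDERIV_continuous: "GDERIV f p :> a \<Longrightarrow> isCont f p"
  unfolding gderiv_def by (rule has_derivative_continuous)

lemma GDERIV_along_line:
  assumes "GDERIV f (p + s *\<^sub>R v) :> a"
  shows "((\<lambda>s. f (p + s *\<^sub>R v)) has_real_derivative (a \<bullet> v)) (at s)"
proof -
  have "((\<lambda>s. p + s *\<^sub>R v) has_derivative (\<lambda>h. h *\<^sub>R v)) (at s)"
    by (auto intro!: derivative_eq_intros)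
  from has_derivative_compose[OF this, of f "\<lambda>h. h \<bullet> a"] assms
  show ?thesis unfolding gderiv_def has_field_derivative_def
    by (simp add: inner_commute mult.commute fun_eq_iff mult_commute_abs)
qed

lemma GDERIV_mvt:
  fixes f :: "'b::euclidean_space \<Rightarrow> real"
  assumes "\<And>p. GDERIV f p :> g p"
  shows "\<exists>s\<in>{0<..<1}. f (p + v) - f p = g (p + s *\<^sub>R v) \<bullet> v"
proof -
  have "\<exists>z>0. z < (1::real) \<and> f (p + 1 *\<^sub>R v) - f (p + 0 *\<^sub>R v) = (1 - 0) * (g (p + z *\<^sub>R v) \<bullet> v)"
    by (intro MVT2 GDERIV_along_line assms) auto
  then show ?thesis by auto
qed

lemma GDERIV_zero_outside:
  assumes "closed K" "\<And>p. p \<notin> K \<Longrightarrow> f p = 0" "GDERIV f p :> a" "p \<notin> K"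
  shows "a = 0"
proof -
  have "GDERIV (\<lambda>_. 0) p :> a"
    using assms(1,2,4) by (intro GDERIV_transform_open[OF assms(3), of "- K"]) auto
  then show ?thesis using GDERIV_const GDERIV_unique by blast
qed

lemma compact_support_bounded:
  fixes g :: "'b::euclidean_space \<Rightarrow> 'c::real_normed_vector"
  assumes "compact K" "continuous_on UNIV g" "\<And>p. p \<notin> K \<Longrightarrow> g p = 0"
  obtains B where "B > 0" "\<And>p. norm (g p) \<le> B"
proof -
  have "bounded (g ` K)"
    by (meson assms compact_continuous_image compact_imp_bounded continuous_on_subset subset_UNIV)
  then obtain B where B: "\<And>p. p \<in> K \<Longrightarrow> norm (g p) \<le> B"
    by (auto simp: bounded_iff)
  have "norm (g p) \<le> max B 1" for p
    using B[of p] assms(3)[of p] by (cases "p \<in> K") auto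
  then show ?thesis using that[of "max B 1"] by auto
qed

lemma compact_support_integrable:
  fixes g :: "'b::euclidean_space \<Rightarrow> 'c::{banach, second_countable_topology}"
  assumes "compact K" "continuous_on UNIV g" "\<And>p. p \<notin> K \<Longrightarrow> g p = 0"
  shows "integrable lborel g"
proof -
  have "integrable lborel (\<lambda>x. indicator K x *\<^sub>R g x)"
    by (rule borel_integrable_compact) (use assms continuous_on_subset[OF assms(2)] in auto)
  moreover have "(\<lambda>x. indicator K x *\<^sub>R g x) = g"
    using assms(3) by (auto simp: fun_eq_iff indicator_def)
  ultimately show ?thesis by simp
qed

text \<open>Difference quotients integrate to zero by translation invariance; no Fubini argument is needed.\<close>
lemma integral_derivative_compact_support:
  fixes f :: "'b::euclidean_space \<Rightarrow> real"
  assumes d: "\<And>p. GDERIV f p :> g p" and c: "continuous_on UNIV g"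
    and K: "compact K" and z: "\<And>p. p \<notin> K \<Longrightarrow> f p = 0"
  shows "integrable lborel (\<lambda>p. g p \<bullet> v)" "(LINT p|lborel. g p \<bullet> v) = 0"
proof -
  have gz: "p \<notin> K \<Longrightarrow> g p = 0" for p
    using GDERIV_zero_outside[OF compact_imp_closed[OF K] z d] .
  show int: "integrable lborel (\<lambda>p. g p \<bullet> v)"
    by (rule compact_support_integrable[OF K]) (use gz c in \<open>auto intro: continuous_intros\<close>)
  obtain B where B: "B > 0" "\<And>p. norm (g p) \<le> B"
    using compact_support_bounded[OF K c gz] by blast
  obtain R where R: "\<And>p. p \<in> K \<Longrightarrow> norm p \<le> R"
    using compact_imp_bounded[OF K] by (auto simp: bounded_iff)
  have fcont: "continuous_on UNIV f"
    using d GDERIV_continuous by (auto simp: continuous_on_eq_continuous_at)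
  then have [measurable]: "f \<in> borel_measurable borel"
    by (rule borel_measurable_continuous_onI)
  have fint: "integrable lborel f" by (rule compact_support_integrable[OF K fcont z])
  define h where "h n = 1 / real (Suc n)" for n
  have h: "0 < h n" "h n \<le> 1" for n by (auto simp: h_def)
  have h0: "h \<longlonglongrightarrow> 0" unfolding h_def by (rule LIMSEQ_Suc[OF lim_1_over_n])
  define q where "q n p = (f (p + h n *\<^sub>R v) - f p) / h n" for n p
  have "(\<lambda>n. LINT p|lborel. q n p) \<longlonglongrightarrow> (LINT p|lborel. g p \<bullet> v)"
  \<comment> \<open>By the mean value theorem \<open>q n p\<close> is the value of \<open>g\<close>
    times \<open>v\<close> at a point at distance at most \<open>norm v\<close> from
    \<open>p\<close>. So \<open>q n\<close> vanishes outside the ball of radius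
    \<open>R + norm v\<close> and is bounded by \<open>B * norm v\<close>.\<close>
  proof (rule integral_dominated_convergence[where w="\<lambda>p. indicator (cball 0 (R + norm v)) p *\<^sub>R (B * norm v)"])
    show "integrable lborel (\<lambda>p::'b. indicator (cball 0 (R + norm v)) p *\<^sub>R (B * norm v))"
      by (rule borel_integrable_compact) auto
    show "AE p in lborel. (\<lambda>n. q n p) \<longlonglongrightarrow> g p \<bullet> v"
    proof (rule AE_I2)
      fix p
      have "((\<lambda>s. f (p + s *\<^sub>R v)) has_real_derivative (g p \<bullet> v)) (at 0)"
        by (rule GDERIV_along_line) (simp add: d)
      then have "((\<lambda>s. (f (p + s *\<^sub>R v) - f p) / s) \<longlongrightarrow> g p \<bullet> v) (at 0)"
        by (simp add: has_field_derivative_iff)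
      moreover have "filterlim h (at 0) sequentially"
        using h0 h by (simp add: filterlim_at less_imp_neq[symmetric])
      ultimately show "(\<lambda>n. q n p) \<longlonglongrightarrow> g p \<bullet> v"
        unfolding q_def by (rule filterlim_compose)
    qed
    show "AE p in lborel. norm (q n p) \<le> indicator (cball 0 (R + norm v)) p *\<^sub>R (B * norm v)" for n
    proof (rule AE_I2)
      fix p
      obtain s where s: "s \<in> {0<..<1}" "f (p + h n *\<^sub>R v) - f p = g (p + s *\<^sub>R (h n *\<^sub>R v)) \<bullet> (h n *\<^sub>R v)"
        using GDERIV_mvt[of f g, OF d] by blast
      let ?x = "p + s *\<^sub>R (h n *\<^sub>R v)"
      have q: "q n p = g ?x \<bullet> v" using s(2) h[of n] by (simp add: q_def less_imp_neq[symmetric])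
      show "norm (q n p) \<le> indicator (cball 0 (R + norm v)) p *\<^sub>R (B * norm v)"
      proof (cases "?x \<in> K")
        case True
        have "norm p = norm (?x - (s * h n) *\<^sub>R v)" by simp
        also have "\<dots> \<le> norm ?x + norm ((s * h n) *\<^sub>R v)" by (rule norm_triangle_ineq4)
        also have "\<dots> \<le> R + 1 * norm v"
        proof (rule add_mono)
          show "norm ?x \<le> R" by (rule R[OF True])
          have "\<bar>s * h n\<bar> \<le> 1"
            unfolding abs_mult using s(1) h[of n] by (intro mult_le_one) auto
          then show "norm ((s * h n) *\<^sub>R v) \<le> 1 * norm v"
            unfolding norm_scaleR by (rule mult_right_mono) simp
        qed
        finally have "p \<in> cball 0 (R + norm v)" by simp
        moreover have "norm (g ?x \<bullet> v) \<le> B * norm v"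
          using order_trans[OF Cauchy_Schwarz_ineq2 mult_right_mono[OF B(2) norm_ge_zero]] by simp
        ultimately show ?thesis using q by simp
      next
        case False
        then show ?thesis using gz[OF False] q B(1) by simp
      qed
    qed
    show "(\<lambda>p. g p \<bullet> v) \<in> borel_measurable lborel" using int by simp
    show "q n \<in> borel_measurable lborel" for n unfolding q_def by measurable
  qed
  moreover have "(LINT p|lborel. q n p) = 0" for n
  proof -
    have i: "integrable lborel (\<lambda>p. f (p + h n *\<^sub>R v))"
      using lborel_integrable_affine_iff[of f 1 "h n *\<^sub>R v"] fint by (simp add: add.commute)
    have "(LINT p|lborel. q n p) = ((LINT p|lborel. f (p + h n *\<^sub>R v)) - (LINT p|lborel. f p)) / h n"
      unfolding q_def using i fint by simp
    then show ?thesis by (simp add: lborel_integral_shift)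
  qed
  ultimately show "(LINT p|lborel. g p \<bullet> v) = 0"
    by (simp add: LIMSEQ_const_iff)
qed

lemma has_real_derivative_antiderivative:
  fixes f :: "real \<Rightarrow> real"
  assumes "continuous_on UNIV f"
  shows "((\<lambda>x. LBINT v=ereal 0..ereal x. f v) has_real_derivative f x) (at x)"
proof -
  \<comment> \<open>The interval contains the base point 0 and has \<open>x\<close> in its interior,
    so the derivative within the interval is a derivative at \<open>x\<close>, for negative
    \<open>x\<close> as well.\<close>
  let ?a = "min x 0 - 1" and ?b = "max x 0 + 1"
  have "((\<lambda>u. LBINT v=ereal 0..ereal u. f v) has_vector_derivative f x) (at x within {?a..?b})"
    by (rule interval_integral_FTC2) (auto intro: continuous_on_subset[OF assms])
  moreover have "at x within {?a..?b} = at x" by (rule at_within_Icc_at) auto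
  ultimately show ?thesis by (simp add: has_real_derivative_iff_has_vector_derivative)
qed

text \<open>The open sets \<open>\<Omega>\<close> and \<open>- K\<close> cover the space, and on the
  second one \<open>f\<close> is identically zero. Differentiability known on
  \<open>\<Omega>\<close> alone thus extends to all points, and so does continuity of the gradient
  in the next lemma.\<close>

lemma GDERIV_zero_extension:
  assumes "open \<Omega>" and d: "\<And>p. p \<in> \<Omega> \<Longrightarrow> GDERIV f p :> g p"
    and K: "compact K" "K \<subseteq> \<Omega>" and z: "\<And>p. p \<notin> K \<Longrightarrow> f p = 0"
  shows "GDERIV f p :> (if p \<in> \<Omega> then g p else 0)"
proof (cases "p \<in> \<Omega>")
  case False
  have "open (- K)" using K(1) by (simp add: compact_imp_closed open_Compl)
  then have "GDERIV f p :> 0"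
    by (rule GDERIV_transform_open[OF GDERIV_const[of 0]]) (use False K z in auto)
  then show ?thesis using False by simp
qed (simp add: d)

lemma continuous_on_zero_extension:
  fixes f :: "'b::euclidean_space \<Rightarrow> real"
  assumes "open \<Omega>" and d: "\<And>p. p \<in> \<Omega> \<Longrightarrow> GDERIV f p :> g p" and c: "continuous_on \<Omega> g"
    and K: "compact K" "K \<subseteq> \<Omega>" and z: "\<And>p. p \<notin> K \<Longrightarrow> f p = 0"
  shows "continuous_on UNIV (\<lambda>p. if p \<in> \<Omega> then g p else 0)"
proof -
  let ?g = "\<lambda>p. if p \<in> \<Omega> then g p else 0"
  have oK: "open (- K)" using K(1) by (simp add: compact_imp_closed open_Compl)
  have gz: "?g p = 0" if "p \<in> - K" for p
    using GDERIV_zero_outside[OF compact_imp_closed[OF K(1)] z GDERIV_zero_extension[OF assms(1) d K z]] that by blast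
  have "continuous_on (\<Omega> \<union> - K) ?g"
  proof (rule continuous_on_open_Un[OF \<open>open \<Omega>\<close> oK])
    show "continuous_on \<Omega> ?g" using c by (simp cong: continuous_on_cong)
    show "continuous_on (- K) ?g"
      by (subst continuous_on_cong[OF refl gz]) auto
  qed
  moreover have "\<Omega> \<union> - K = UNIV" using K(2) by blast
  ultimately show ?thesis by simp
qed

section \<open>\<open>Ck_on\<close> expressed through gradients\<close>

lemma Ck_on_cong:
  assumes "open S" "\<And>p. p \<in> S \<Longrightarrow> f p = g p"
  shows "Ck_on k S f \<longleftrightarrow> Ck_on k S g"
  using assms(2)
proof (induction k arbitrary: f g)
  case 0
  then show ?case by (simp cong: continuous_on_cong)
next
  case (Suc k)
  have D: "(f has_derivative D) (at p) \<longleftrightarrow> (g has_derivative D) (at p)" if "p \<in> S" for D p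
    using has_derivative_transform_within_open[OF _ assms(1) that] Suc.prems by metis
  have pd: "partial_deriv b f p = partial_deriv b g p" if "p \<in> S" for b p
    using D[OF that] by (simp add: partial_deriv_def frechet_derivative_def)
  have "Ck_on k S (partial_deriv b f) \<longleftrightarrow> Ck_on k S (partial_deriv b g)" for b
    by (rule Suc.IH) (rule pd)
  moreover have "f differentiable_on S \<longleftrightarrow> g differentiable_on S"
    using D \<open>open S\<close> by (auto simp: differentiable_on_eq_differentiable_at differentiable_def)
  ultimately show ?case by simp
qed

lemma Ck_on_Suc_GDERIV:
  fixes f :: "'b::euclidean_space \<Rightarrow> real"
  assumes "open S" and d: "\<And>p. p \<in> S \<Longrightarrow> GDERIV f p :> g p"
    and "\<And>b. b \<in> Basis \<Longrightarrow> Ck_on k S (\<lambda>p. g p \<bullet> b)"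
  shows "Ck_on (Suc k) S f"
proof -
  have "f differentiable_on S"
    using d \<open>open S\<close> unfolding gderiv_def differentiable_on_def differentiable_def
    by (meson has_derivative_at_withinI)
  moreover have "Ck_on k S (partial_deriv b f)" if "b \<in> Basis" for b
    using assms(3)[OF that] Ck_on_cong[OF \<open>open S\<close>, of "partial_deriv b f" "\<lambda>p. g p \<bullet> b"]
      GDERIV_partial_deriv[OF d] by auto
  ultimately show ?thesis by simp
qed

lemma Ck_on_continuous: "Ck_on k S f \<Longrightarrow> continuous_on S f"
  by (cases k) (auto intro: differentiable_imp_continuous_on)

lemma Ck_on_Suc_imp:
  assumes "open S" "Ck_on (Suc k) S f"
  shows "p \<in> S \<Longrightarrow> GDERIV f p :> gradient f p" "continuous_on S (gradient f)"
    "b \<in> Basis \<Longrightarrow> Ck_on k S (\<lambda>p. gradient f p \<bullet> b)"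
proof -
  show "p \<in> S \<Longrightarrow> GDERIV f p :> gradient f p"
    using assms differentiable_GDERIV_gradient by (auto simp: differentiable_on_eq_differentiable_at)
  show c: "b \<in> Basis \<Longrightarrow> Ck_on k S (\<lambda>p. gradient f p \<bullet> b)" for b
    using assms Ck_on_cong[OF \<open>open S\<close>, of "partial_deriv b f" "\<lambda>p. gradient f p \<bullet> b"]
    by (auto simp: gradient_inner_Basis)
  show "continuous_on S (gradient f)"
    unfolding continuous_on_componentwise[of S "gradient f"] using c Ck_on_continuous by blast
qed

section \<open>Mollification\<close>

text \<open>The classical flat function exp (-1/t), divided by a power of t. The powers close the
  family under differentiation: the derivative of index \<open>k\<close> is a combination of the
  indices \<open>k + 1\<close> and \<open>k + 2\<close>.\<close>

definition bump_profile :: "nat \<Rightarrow> real \<Rightarrow> real" where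
  "bump_profile k t = (if 0 < t then exp (- 1 / t) / t ^ k else 0)"

lemma integrable_scaleR_bounded:
  fixes h :: "'x \<Rightarrow> 'c::{banach, second_countable_topology}" and k :: "'x \<Rightarrow> real"
  assumes k: "integrable M k" and [measurable]: "h \<in> borel_measurable M"
    and B: "\<And>x. norm (h x) \<le> B"
  shows "integrable M (\<lambda>x. k x *\<^sub>R h x)"
proof (rule Bochner_Integration.integrable_bound)
  show "integrable M (\<lambda>x. \<bar>k x\<bar> * B)" using k by simp
  have "norm (k x *\<^sub>R h x) \<le> norm (\<bar>k x\<bar> * B)" for x
  proof -
    have "norm (k x *\<^sub>R h x) \<le> \<bar>k x\<bar> * B" unfolding norm_scaleR by (rule mult_left_mono[OF B]) simp
    then show ?thesis by simp
  qed
  then show "AE x in M. norm (k x *\<^sub>R h x) \<le> norm (\<bar>k x\<bar> * B)" by (rule AE_I2)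
qed (use k in measurable)

text \<open>A single term of the exponential series at \<open>1 / t\<close>, the one of order
  \<open>k + 2\<close>, already beats the division by \<open>t ^ k\<close> and leaves
  \<open>t\<^sup>2\<close>, which is what differentiability at 0 requires.\<close>

lemma bump_profile_bound: "\<bar>bump_profile k t\<bar> \<le> fact (k + 2) * t\<^sup>2"
proof (cases "0 < t")
  case True
  have "(\<lambda>n. (1 / t) ^ n /\<^sub>R fact n) sums exp (1 / t)" by (rule exp_converges)
  then have "(\<Sum>n\<in>{k+2}. (1 / t) ^ n /\<^sub>R fact n) \<le> exp (1 / t)"
    unfolding sums_iff using True by (metis (no_types, lifting) sum_le_suminf divide_nonneg_nonneg
      finite.emptyI finite.insertI inverse_nonnegative_iff_nonnegative fact_ge_zero less_imp_le scaleR_nonneg_nonneg zero_le_one zero_le_power)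
  then have 1: "(1 / t) ^ (k + 2) / fact (k + 2) \<le> exp (1 / t)"
    by (simp add: divide_inverse mult.commute)
  have *: "exp (- 1 / t) / t ^ k \<le> c * t\<^sup>2" if "0 < c" "(1 / t) ^ (k + 2) / c \<le> exp (1 / t)" for c
  proof -
    have "1 \<le> exp (1 / t) * (c * (t ^ k * t\<^sup>2))"
      using True that by (simp add: field_simps power_add power2_eq_square)
    then have "exp (- 1 / t) * 1 \<le> exp (- 1 / t) * (exp (1 / t) * (c * (t ^ k * t\<^sup>2)))"
      by (intro mult_left_mono) auto
    also have "\<dots> = c * (t ^ k * t\<^sup>2)" by (simp add: exp_minus)
    finally show ?thesis using True by (simp add: field_simps)
  qed
  show ?thesis using True *[OF fact_gt_zero 1] by (simp add: bump_profile_def)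
qed (simp add: bump_profile_def)

lemma bump_profile_deriv:
  "(bump_profile k has_real_derivative
      (bump_profile (k + 2) t - real k * bump_profile (k + 1) t)) (at t)"
proof -
  consider "t > 0" | "t < 0" | "t = 0" by linarith
  then show ?thesis
  proof cases
    case 1
    have "((\<lambda>t. exp (- 1 / t) / t ^ k) has_real_derivative
        (bump_profile (k + 2) t - real k * bump_profile (k + 1) t)) (at t)"
    proof -
      have d1: "((\<lambda>t. exp (- 1 / t)) has_real_derivative exp (- 1 / t) / t\<^sup>2) (at t)"
        using 1 by (auto intro!: derivative_eq_intros simp: power2_eq_square)
      have "t ^ k \<noteq> 0" using 1 by simp
      from DERIV_divide[OF d1 DERIV_pow this] show ?thesis
        by (rule DERIV_cong)
           (use 1 in \<open>cases k; simp add: bump_profile_def field_simps power2_eq_square power_add\<close>)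
    qed
    then show ?thesis
      by (rule has_field_derivative_transform_within_open[of _ _ _ "{0<..}"])
         (use 1 in \<open>auto simp: bump_profile_def\<close>)
  next
    case 2
    have "((\<lambda>t. 0) has_real_derivative 0) (at t)" by simp
    then have "(bump_profile k has_real_derivative 0) (at t)"
      by (rule has_field_derivative_transform_within_open[of _ _ _ "{..<0}"])
         (use 2 in \<open>auto simp: bump_profile_def\<close>)
    then show ?thesis using 2 by (simp add: bump_profile_def)
  next
    case 3
    \<comment> \<open>At 0 the difference quotient is bounded by a multiple of
      \<open>\<bar>h\<bar>\<close>, by the quadratic bound.\<close>
    have "((\<lambda>h. bump_profile k h / h) \<longlongrightarrow> 0) (at 0)"
    proof (rule Lim_null_comparison[of _ "\<lambda>h. fact (k + 2) * \<bar>h\<bar>"])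
      show "((\<lambda>h. fact (k + 2) * \<bar>h\<bar>) \<longlongrightarrow> 0) (at (0::real))"
        by (auto intro!: tendsto_eq_intros)
      have "norm (bump_profile k h / h) \<le> fact (k + 2) * \<bar>h\<bar>" if "h \<noteq> 0" for h
      proof -
        have "\<bar>bump_profile k h\<bar> \<le> fact (k + 2) * (\<bar>h\<bar> * \<bar>h\<bar>)"
          using bump_profile_bound[of k h] by (simp add: power2_eq_square)
        then show ?thesis using that
          by (simp add: abs_divide pos_divide_le_eq mult.assoc del: fact_Suc)
      qed
      then show "\<forall>\<^sub>F h in at 0. norm (bump_profile k h / h) \<le> fact (k + 2) * \<bar>h\<bar>"
        by (auto simp: eventually_at intro: exI[of _ 1])
    qed
    then show ?thesis using 3 by (simp add: has_field_derivative_iff bump_profile_def)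
  qed
qed

text \<open>Closed under partial derivatives, which makes every member \<open>C\<^sup>\<infinity>\<close>.\<close>
inductive bump_class :: "real \<Rightarrow> ('b::euclidean_space \<Rightarrow> real) \<Rightarrow> bool" for r where
  base: "bump_class r (\<lambda>p. bump_profile k (r - p \<bullet> p))"
| times: "bump_class r f \<Longrightarrow> bump_class r (\<lambda>p. (p \<bullet> v) * f p)"
| scale: "bump_class r f \<Longrightarrow> bump_class r (\<lambda>p. c * f p)"
| add: "bump_class r f \<Longrightarrow> bump_class r g \<Longrightarrow> bump_class r (\<lambda>p. f p + g p)"

lemma bump_class_support: "bump_class r f \<Longrightarrow> r < p \<bullet> p \<Longrightarrow> f p = 0"
  by (induction rule: bump_class.induct) (auto simp: bump_profile_def)

lemma bump_class_GDERIV: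
  "bump_class r f \<Longrightarrow> \<exists>g. (\<forall>p. GDERIV f p :> g p) \<and> (\<forall>b. bump_class r (\<lambda>p. g p \<bullet> b))"
proof (induction rule: bump_class.induct)
  case (base k)
  let ?d = "\<lambda>t. bump_profile (k + 2) t - real k * bump_profile (k + 1) t"
  have "GDERIV (\<lambda>p. r - p \<bullet> p) p :> (- 2) *\<^sub>R p" for p :: 'a
    unfolding gderiv_def
    by (auto intro!: derivative_eq_intros simp: inner_commute fun_eq_iff)
  then have 1: "GDERIV (\<lambda>p. bump_profile k (r - p \<bullet> p)) p :> ?d (r - p \<bullet> p) *\<^sub>R (- 2) *\<^sub>R p" for p :: 'a
    using GDERIV_DERIV_compose[OF _ bump_profile_deriv] by blast
  have "bump_class r (\<lambda>p::'a. (p \<bullet> b) * ((- 2) * bump_profile (k + 2) (r - p \<bullet> p) +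
      (2 * real k) * bump_profile (k + 1) (r - p \<bullet> p)))" for b
    by (intro bump_class.intros)
  then have "bump_class r (\<lambda>p::'a. (?d (r - p \<bullet> p) *\<^sub>R (- 2) *\<^sub>R p) \<bullet> b)" for b
    by (simp add: algebra_simps)
  with 1 show ?case by (intro exI[of _ "\<lambda>p. ?d (r - p \<bullet> p) *\<^sub>R (- 2) *\<^sub>R p"]) blast
next
  case (times f v)
  then obtain g where g: "\<forall>p. GDERIV f p :> g p" "\<forall>b. bump_class r (\<lambda>p. g p \<bullet> b)" by blast
  have "GDERIV (\<lambda>p. p \<bullet> v) p :> v" for p
    unfolding gderiv_def by (auto intro!: derivative_eq_intros)
  then have "GDERIV (\<lambda>p. (p \<bullet> v) * f p) p :> (p \<bullet> v) *\<^sub>R g p + f p *\<^sub>R v" for p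
    by (rule GDERIV_mult) (use g(1) \<open>\<And>p. GDERIV (\<lambda>p. p \<bullet> v) p :> v\<close> in blast)+
  moreover have "bump_class r (\<lambda>p. (p \<bullet> v) * (g p \<bullet> b) + (v \<bullet> b) * f p)" for b
    using g(2) times by (intro bump_class.intros) auto
  ultimately show ?case
    by (intro exI[of _ "\<lambda>p. (p \<bullet> v) *\<^sub>R g p + f p *\<^sub>R v"]) (simp add: inner_add_left mult.commute)
next
  case (scale f c)
  then obtain g where g: "\<forall>p. GDERIV f p :> g p" "\<forall>b. bump_class r (\<lambda>p. g p \<bullet> b)" by blast
  have "GDERIV (\<lambda>p. c * f p) p :> c *\<^sub>R g p" for p
    using GDERIV_mult[OF GDERIV_const[of c p], of f "g p"] g(1) by simp
  moreover have "bump_class r (\<lambda>p. c * (g p \<bullet> b))" for b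
    using g(2) by (intro bump_class.intros) auto
  ultimately show ?case by (intro exI[of _ "\<lambda>p. c *\<^sub>R g p"]) simp
next
  case (add f g)
  then obtain f' g' where "\<forall>p. GDERIV f p :> f' p" "\<forall>b. bump_class r (\<lambda>p. f' p \<bullet> b)"
    "\<forall>p. GDERIV g p :> g' p" "\<forall>b. bump_class r (\<lambda>p. g' p \<bullet> b)" by blast
  then show ?case
    by (intro exI[of _ "\<lambda>p. f' p + g' p"]) (auto simp: inner_add_left intro!: GDERIV_add bump_class.add)
qed

lemma bump_class_continuous: "bump_class r f \<Longrightarrow> continuous_on UNIV f"
  using bump_class_GDERIV GDERIV_continuous by (metis continuous_at_imp_continuous_on)

lemma mollifier_exists:
  assumes "0 < e"
  obtains \<rho> :: "'b::euclidean_space \<Rightarrow> real" where "bump_class (e\<^sup>2) \<rho>" "\<And>p. 0 \<le> \<rho> p"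
    "integrable lborel \<rho>" "(LINT p|lborel. \<rho> p) = 1" "\<And>p. e < norm p \<Longrightarrow> \<rho> p = 0"
proof -
  define f where "f p = bump_profile 0 (e\<^sup>2 - p \<bullet> p)" for p :: 'b
  have fc: "bump_class (e\<^sup>2) f" unfolding f_def by (rule bump_class.base)
  have supp: "f p = 0" if "e < norm p" for p
  proof (rule bump_class_support[OF fc])
    show "e\<^sup>2 < p \<bullet> p" using that assms
      by (metis dot_square_norm less_imp_le power_strict_mono pos2)
  qed
  have int: "integrable lborel f"
    by (rule compact_support_integrable[of "cball 0 e"])
       (use supp bump_class_continuous[OF fc] in auto)
  have nn: "0 \<le> f p" for p by (simp add: f_def bump_profile_def)
  \<comment> \<open>A nonnegative function with zero integral vanishes almost everywhere, but
    \<open>f\<close> is positive on the ball of radius \<open>e\<close>, which has positive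
    measure.\<close>
  have "(LINT p|lborel. f p) \<noteq> 0"
  proof
    assume "(LINT p|lborel. f p) = 0"
    then have "AE p in lborel. f p = 0"
      using integral_nonneg_eq_0_iff_AE[OF int] nn by auto
    then have "AE p in lborel. p \<notin> ball (0::'b) e"
    proof eventually_elim
      case (elim p)
      show "p \<notin> ball 0 e"
      proof
        assume "p \<in> ball 0 e"
        then have "p \<bullet> p < e\<^sup>2" using assms
          by (simp add: dot_square_norm power_strict_mono)
        then show False using elim by (simp add: f_def bump_profile_def)
      qed
    qed
    then have "emeasure lborel (ball (0::'b) e) = 0"
      by (subst (asm) AE_iff_measurable[of "ball 0 e"]) auto
    moreover have "0 < emeasure lborel (ball (0::'b) e)"
      using content_ball_pos[OF assms, of "0::'b"] by (simp add: measure_def enn2real_positive_iff)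
    ultimately show False by simp
  qed
  moreover have "0 \<le> (LINT p|lborel. f p)" using nn by simp
  ultimately have pos: "0 < (LINT p|lborel. f p)" by simp
  show ?thesis
  proof (rule that[of "\<lambda>p. (1 / (LINT p|lborel. f p)) * f p"])
    show "bump_class (e\<^sup>2) (\<lambda>p. (1 / (LINT p|lborel. f p)) * f p)"
      using fc by (rule bump_class.scale)
  qed (use pos nn int supp in auto)
qed

text \<open>If two points are closer than 1 and one lies in \<open>K\<close>, both lie in a slightly
  larger ball, where compactness gives uniform continuity; if neither lies in \<open>K\<close>, both
  values are 0.\<close>

lemma uniformly_continuous_compact_support:
  fixes g :: "'b::euclidean_space \<Rightarrow> 'c::real_normed_vector"
  assumes K: "compact K" and c: "continuous_on UNIV g" and z: "\<And>p. p \<notin> K \<Longrightarrow> g p = 0" and "0 < e"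
  obtains d where "0 < d" "\<And>u v. norm (u - v) < d \<Longrightarrow> norm (g u - g v) < e"
proof -
  obtain R where R: "\<And>p. p \<in> K \<Longrightarrow> norm p \<le> R"
    using compact_imp_bounded[OF K] by (auto simp: bounded_iff)
  have "uniformly_continuous_on (cball 0 (R + 1)) g"
    by (intro compact_uniformly_continuous continuous_on_subset[OF c]) auto
  then obtain d where d: "d > 0"
    "\<And>u v. u \<in> cball 0 (R+1) \<Longrightarrow> v \<in> cball 0 (R+1) \<Longrightarrow> norm (u - v) < d \<Longrightarrow> norm (g u - g v) < e"
    using \<open>0 < e\<close> unfolding uniformly_continuous_on_def dist_norm by metis
  show ?thesis
  proof (rule that[of "min d 1"])
    fix u v :: 'b assume uv: "norm (u - v) < min d 1"
    show "norm (g u - g v) < e"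
    proof (cases "u \<in> K \<or> v \<in> K")
      case True
      have "norm u \<le> norm v + norm (u - v)" "norm v \<le> norm u + norm (u - v)"
        by (metis norm_triangle_sub) (metis norm_triangle_sub norm_minus_commute)
      with True R[of u] R[of v] uv show ?thesis by (intro d) auto
    qed (use z \<open>0 < e\<close> in auto)
  qed (use d in auto)
qed

text \<open>The derivative falls on the regular factor \<open>f\<close>, while \<open>k\<close> is
  merely integrable. Uniform continuity of \<open>g\<close> makes the first order remainder small
  uniformly in \<open>q\<close>, so the estimate survives integration against
  \<open>k\<close>.\<close>

lemma GDERIV_convolution:
  fixes f k :: "'b::euclidean_space \<Rightarrow> real"
  assumes d: "\<And>p. GDERIV f p :> g p" and c: "continuous_on UNIV g"
    and K: "compact K" and z: "\<And>p. p \<notin> K \<Longrightarrow> f p = 0" and k: "integrable lborel k"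
  shows "GDERIV (\<lambda>p. LINT q|lborel. k q * f (p - q)) p :> (LINT q|lborel. k q *\<^sub>R g (p - q))"
    "integrable lborel (\<lambda>q. k q *\<^sub>R g (p - q))"
proof -
  have gz: "p \<notin> K \<Longrightarrow> g p = 0" for p
    using GDERIV_zero_outside[OF compact_imp_closed[OF K] z d] .
  have fc: "continuous_on UNIV f"
    using d GDERIV_continuous by (auto simp: continuous_on_eq_continuous_at)
  have [measurable]: "f \<in> borel_measurable borel" "g \<in> borel_measurable borel"
    using fc c by (auto intro: borel_measurable_continuous_onI)
  have [measurable]: "k \<in> borel_measurable borel" using k by simp
  obtain B1 where B1: "\<And>p. norm (f p) \<le> B1" using compact_support_bounded[OF K fc z] by blast
  obtain B2 where B2: "\<And>p. norm (g p) \<le> B2" using compact_support_bounded[OF K c gz] by blast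
  have if': "integrable lborel (\<lambda>q. k q * f (p - q))" for p
  proof -
    have "integrable lborel (\<lambda>q. k q *\<^sub>R f (p - q))"
      by (rule integrable_scaleR_bounded[OF k _ B1]) measurable
    then show ?thesis by simp
  qed
  show ig: "integrable lborel (\<lambda>q. k q *\<^sub>R g (p - q))" for p
    by (rule integrable_scaleR_bounded[OF k _ B2]) measurable
  let ?F = "\<lambda>p. LINT q|lborel. k q * f (p - q)" and ?G = "LINT q|lborel. k q *\<^sub>R g (p - q)"
  show "GDERIV ?F p :> ?G"
    unfolding gderiv_def has_derivative_at_alt
  proof (intro conjI allI impI)
    show "bounded_linear (\<lambda>h. h \<bullet> ?G)" by (rule bounded_linear_inner_left)
    fix e :: real assume "0 < e"
    \<comment> \<open>The added 1 keeps the divisor positive when \<open>k\<close> vanishes almost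
      everywhere.\<close>
    define C where "C = (LINT q|lborel. \<bar>k q\<bar>) + 1"
    have C: "C > 0" unfolding C_def by (simp add: add_nonneg_pos)
    with \<open>0 < e\<close> have "0 < e / C" by simp
    then obtain d where d0: "0 < d" and dd: "\<And>u v. norm (u - v) < d \<Longrightarrow> norm (g u - g v) < e / C"
      using uniformly_continuous_compact_support[OF K c gz] by metis
    have "norm (?F y - ?F p - (y - p) \<bullet> ?G) \<le> e * norm (y - p)" if y: "norm (y - p) < d" for y
    proof -
      let ?v = "y - p"
      have pt: "\<bar>f (y - q) - f (p - q) - ?v \<bullet> g (p - q)\<bar> \<le> e / C * norm ?v" for q
      proof -
        obtain s where s: "s \<in> {0<..<1}" "f ((p - q) + ?v) - f (p - q) = g ((p - q) + s *\<^sub>R ?v) \<bullet> ?v"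
          using GDERIV_mvt[of f g, OF d] by blast
        have "norm (s *\<^sub>R ?v) \<le> 1 * norm ?v"
          unfolding norm_scaleR using s(1) by (intro mult_right_mono) auto
        then have "norm (g ((p - q) + s *\<^sub>R ?v) - g (p - q)) < e / C"
          using y by (intro dd) simp
        then have "\<bar>(g ((p - q) + s *\<^sub>R ?v) - g (p - q)) \<bullet> ?v\<bar> \<le> e / C * norm ?v"
          by (rule order_trans[OF Cauchy_Schwarz_ineq2 mult_right_mono[OF less_imp_le norm_ge_zero]])
        moreover have "f (y - q) - f (p - q) - ?v \<bullet> g (p - q)
            = (g ((p - q) + s *\<^sub>R ?v) - g (p - q)) \<bullet> ?v"
          using s(2) by (simp add: inner_diff_left inner_commute algebra_simps)
        ultimately show ?thesis by simp
      qed
      have "(y - p) \<bullet> ?G = (LINT q|lborel. k q * (?v \<bullet> g (p - q)))"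
        by (subst inner_commute, subst integral_inner_left[symmetric]) (use ig in \<open>auto simp: inner_commute\<close>)
      moreover have i3: "integrable lborel (\<lambda>q. k q * (?v \<bullet> g (p - q)))"
        using integrable_inner_left[of ?v, OF ig[of p]] by (simp add: inner_commute)
      ultimately have "?F y - ?F p - (y - p) \<bullet> ?G
          = (LINT q|lborel. k q * (f (y - q) - f (p - q) - ?v \<bullet> g (p - q)))"
        using if' by (simp add: right_diff_distrib)
      also have "norm \<dots> \<le> (LINT q|lborel. \<bar>k q\<bar> * (e / C * norm ?v))"
      proof (rule Bochner_Integration.integral_norm_bound_integral)
        show "integrable lborel (\<lambda>q. k q * (f (y - q) - f (p - q) - ?v \<bullet> g (p - q)))"
          unfolding right_diff_distrib by (intro Bochner_Integration.integrable_diff if' i3)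
        show "integrable lborel (\<lambda>q. \<bar>k q\<bar> * (e / C * norm ?v))"
          using k by (intro integrable_mult_left integrable_abs)
        show "norm (k q * (f (y - q) - f (p - q) - ?v \<bullet> g (p - q))) \<le> \<bar>k q\<bar> * (e / C * norm ?v)" for q
          unfolding real_norm_def abs_mult by (intro mult_left_mono pt) simp
      qed
      also have "\<dots> = (LINT q|lborel. \<bar>k q\<bar>) * (e / C * norm ?v)" by simp
      also have "\<dots> \<le> C * (e / C * norm ?v)"
        unfolding C_def[symmetric] using C \<open>0 < e\<close> by (intro mult_right_mono) (auto simp: C_def)
      also have "\<dots> = e * norm ?v" using C by simp
      finally show ?thesis .
    qed
    then show "\<exists>d>0. \<forall>y. norm (y - p) < d \<longrightarrow> norm (?F y - ?F p - (y - p) \<bullet> ?G) \<le> e * norm (y - p)"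
      using d0 by blast
  qed
qed

text \<open>Induction over all members of \<open>bump_class\<close> at once: a partial derivative of
  the convolution is the convolution with another member.\<close>

lemma Ck_on_convolution_bump:
  assumes "integrable lborel k"
  shows "bump_class r f \<Longrightarrow> Ck_on n UNIV (\<lambda>p. LINT q|lborel. k q * f (p - q))"
proof (induction n arbitrary: f)
  case (0 f)
  obtain g where g: "\<And>p. GDERIV f p :> g p" "\<And>b. bump_class r (\<lambda>p. g p \<bullet> b)"
    using bump_class_GDERIV[OF 0] by blast
  have "continuous_on UNIV g"
    unfolding continuous_on_componentwise[of UNIV g] using g(2) bump_class_continuous by blast
  then have "GDERIV (\<lambda>p. LINT q|lborel. k q * f (p - q)) p :> (LINT q|lborel. k q *\<^sub>R g (p - q))" for p
    by (intro GDERIV_convolution(1)[OF g(1) _ compact_cball[of 0 "sqrt r"] _ assms])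
       (auto intro!: bump_class_support[OF 0] simp: norm_eq_sqrt_inner)
  then show ?case using GDERIV_continuous by (auto simp: continuous_on_eq_continuous_at)
next
  case (Suc n f)
  obtain g where g: "\<And>p. GDERIV f p :> g p" "\<And>b. bump_class r (\<lambda>p. g p \<bullet> b)"
    using bump_class_GDERIV[OF Suc.prems] by blast
  have gc: "continuous_on UNIV g"
    unfolding continuous_on_componentwise[of UNIV g] using g(2) bump_class_continuous by blast
  have d: "GDERIV (\<lambda>p. LINT q|lborel. k q * f (p - q)) p :> (LINT q|lborel. k q *\<^sub>R g (p - q))"
    "integrable lborel (\<lambda>q. k q *\<^sub>R g (p - q))" for p
    by (rule GDERIV_convolution[OF g(1) gc compact_cball[of 0 "sqrt r"] _ assms];
        auto intro!: bump_class_support[OF Suc.prems] simp: norm_eq_sqrt_inner)+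
  show ?case
  proof (rule Ck_on_Suc_GDERIV[OF open_UNIV d(1)])
    fix b :: 'a
    have "(LINT q|lborel. k q *\<^sub>R g (p - q)) \<bullet> b = (LINT q|lborel. k q * (g (p - q) \<bullet> b))" for p
      by (subst integral_inner_left[symmetric]) (use d(2) in auto)
    then show "Ck_on n UNIV (\<lambda>p. (LINT q|lborel. k q *\<^sub>R g (p - q)) \<bullet> b)"
      using Suc.IH[OF g(2)[of b]] by simp
  qed
qed

text \<open>A mean with total weight 1 cannot deviate from \<open>a\<close> by more than the values
  averaged. With \<open>a = 0\<close> this bounds mollifications, with \<open>a = h p\<close> it
  gives their convergence.\<close>

lemma mollify_pointwise:
  fixes h :: "'b::euclidean_space \<Rightarrow> 'c::{banach, second_countable_topology}"
  assumes \<rho>: "\<And>p. 0 \<le> \<rho> p" "integrable lborel \<rho>" "(LINT p|lborel. \<rho> p) = 1" "\<And>p. e < norm p \<Longrightarrow> \<rho> p = 0"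
    and i: "integrable lborel (\<lambda>q. \<rho> q *\<^sub>R h (p - q))"
    and B: "\<And>q. norm q \<le> e \<Longrightarrow> norm (h (p - q) - a) \<le> B"
  shows "norm ((LINT q|lborel. \<rho> q *\<^sub>R h (p - q)) - a) \<le> B"
proof -
  have "(LINT q|lborel. \<rho> q *\<^sub>R h (p - q)) - a = (LINT q|lborel. \<rho> q *\<^sub>R (h (p - q) - a))"
    using i \<rho>(2,3) by (simp add: scaleR_diff_right)
  also have "norm \<dots> \<le> (LINT q|lborel. \<rho> q * B)"
  proof (rule Bochner_Integration.integral_norm_bound_integral[where f="\<lambda>q. \<rho> q *\<^sub>R (h (p - q) - a)" and g="\<lambda>q. \<rho> q * B"])
    show "norm (\<rho> q *\<^sub>R (h (p - q) - a)) \<le> \<rho> q * B" for q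
      using B[of q] \<rho>(1)[of q] \<rho>(4)[of q] by (cases "norm q \<le> e") (auto intro!: mult_left_mono)
  qed (use i \<rho>(2) in \<open>auto simp: scaleR_diff_right\<close>)
  finally show ?thesis using \<rho>(3) by simp
qed

text \<open>\<open>weak_gradient\<close> is defined by smooth test functions, while the later
  products of cutoffs with derivatives of extensions are only handled as \<open>C\<^sup>1\<close>
  functions. Mollifications of \<open>\<psi>\<close> are admissible; their values and gradients
  converge boundedly, and their supports stay in one compact subset of
  \<open>\<Omega>\<close>.\<close>

lemma weak_gradient_C1_test:
  fixes \<psi> :: "'b::euclidean_space \<Rightarrow> real"
  assumes w: "weak_gradient \<Omega> U G" and "open \<Omega>"
    and d: "\<And>p. GDERIV \<psi> p :> g p" and c: "continuous_on UNIV g"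
    and K: "compact K" "K \<subseteq> \<Omega>" and z: "\<And>p. p \<notin> K \<Longrightarrow> \<psi> p = 0" and b: "b \<in> Basis"
  shows "(LINT p:\<Omega>|lborel. U p * (g p \<bullet> b)) = - (LINT p:\<Omega>|lborel. (G p \<bullet> b) * \<psi> p)"
proof (cases "K = {}")
  case True
  then have "\<psi> p = 0" "g p = 0" for p
    using z GDERIV_zero_outside[OF compact_imp_closed[OF K(1)] z d] by auto
  then show ?thesis by simp
next
  case False
  have gz: "p \<notin> K \<Longrightarrow> g p = 0" for p
    using GDERIV_zero_outside[OF compact_imp_closed[OF K(1)] z d] .
  have pc: "continuous_on UNIV \<psi>"
    using d GDERIV_continuous by (auto simp: continuous_on_eq_continuous_at)
  have [measurable]: "\<psi> \<in> borel_measurable borel" "g \<in> borel_measurable borel"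
    using pc c by (auto intro: borel_measurable_continuous_onI)
  have pint: "integrable lborel \<psi>" by (rule compact_support_integrable[OF K(1) pc z])
  obtain B1 where B1: "B1 > 0" "\<And>p. norm (\<psi> p) \<le> B1" using compact_support_bounded[OF K(1) pc z] by blast
  obtain B2 where B2: "B2 > 0" "\<And>p. norm (g p) \<le> B2" using compact_support_bounded[OF K(1) c gz] by blast
  \<comment> \<open>\<open>e0\<close> is a distance by which \<open>K\<close> can be enlarged inside
    \<open>\<Omega>\<close>. The enlargement \<open>K'\<close> contains the supports of all
    mollifications, because their radii satisfy \<open>e n \<le> e0\<close>.\<close>
  obtain e0 where e0: "e0 > 0" "{x. infdist x K \<le> e0} \<subseteq> \<Omega>"
    using compact_in_open_separated[OF False K(1) \<open>open \<Omega>\<close> K(2)] by metis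
  define K' where "K' = {x. infdist x K \<le> e0}"
  have K': "compact K'" "K' \<subseteq> \<Omega>"
    unfolding K'_def using e0 compact_infdist_le[OF False K(1) e0(1)] by auto
  define e where "e n = e0 / real (Suc n)" for n
  have e: "0 < e n" "e n \<le> e0" for n
    using e0(1) by (auto simp: e_def field_simps)
  have elim: "e \<longlonglongrightarrow> 0"
    unfolding e_def using tendsto_mult_right[OF LIMSEQ_Suc[OF lim_1_over_n], of e0] by simp
  have "\<exists>\<rho>. \<forall>n. bump_class ((e n)\<^sup>2) (\<rho> n) \<and> (\<forall>p::'b. 0 \<le> \<rho> n p) \<and> integrable lborel (\<rho> n) \<and>
      (LINT p|lborel. \<rho> n p) = 1 \<and> (\<forall>p. e n < norm p \<longrightarrow> \<rho> n p = 0)"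
  proof (intro choice allI)
    fix n
    show "\<exists>\<rho>. bump_class ((e n)\<^sup>2) \<rho> \<and> (\<forall>p::'b. 0 \<le> \<rho> p) \<and> integrable lborel \<rho> \<and>
      (LINT p|lborel. \<rho> p) = 1 \<and> (\<forall>p. e n < norm p \<longrightarrow> \<rho> p = 0)"
      by (rule mollifier_exists[OF e(1)[of n]]) blast
  qed
  then obtain \<rho> where \<rho>: "\<And>n. bump_class ((e n)\<^sup>2) (\<rho> n)" "\<And>n p::'b. 0 \<le> \<rho> n p"
      "\<And>n. integrable lborel (\<rho> n)" "\<And>n. (LINT p|lborel. \<rho> n p) = 1" "\<And>n p. e n < norm p \<Longrightarrow> \<rho> n p = 0"
    by blast
  have [measurable]: "\<rho> n \<in> borel_measurable borel" for n using \<rho>(3)[of n] by simp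
  define P where "P n p = (LINT q|lborel. \<rho> n q * \<psi> (p - q))" for n p
  define Q where "Q n p = (LINT q|lborel. \<rho> n q *\<^sub>R g (p - q))" for n p
  have PQ: "GDERIV (P n) p :> Q n p" and Qi: "integrable lborel (\<lambda>q. \<rho> n q *\<^sub>R g (p - q))" for n p
    unfolding P_def Q_def by (rule GDERIV_convolution[OF d c K(1) z \<rho>(3)], assumption)+
  have Pi: "integrable lborel (\<lambda>q. \<rho> n q *\<^sub>R \<psi> (p - q))" for n p
    by (rule integrable_scaleR_bounded[OF \<rho>(3) _ B1(2)]) measurable
  \<comment> \<open>After a reflection the roles are exchanged: \<open>\<psi>\<close> becomes the
    integrable factor, and the smoothness is that of \<open>\<rho> n\<close>.\<close>
  have Pk: "Ck_on k UNIV (P n)" for k n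
  proof -
    have "P n p = (LINT q|lborel. \<psi> q * \<rho> n (p - q))" for p
      unfolding P_def using lborel_integral_reflect[of "\<lambda>q. \<rho> n q * \<psi> (p - q)" p]
      by (simp add: mult.commute)
    then have "P n = (\<lambda>p. LINT q|lborel. \<psi> q * \<rho> n (p - q))" by blast
    then show ?thesis using Ck_on_convolution_bump[OF pint \<rho>(1)] by simp
  qed
  have supp: "p - q \<notin> K" if "p \<notin> K'" "norm q \<le> e n" for p q n
  proof
    assume "p - q \<in> K"
    then have "infdist p K \<le> norm q" by (metis infdist_le dist_norm diff_diff_eq2 add_diff_cancel_left')
    then show False using that e(2)[of n] by (simp add: K'_def)
  qed
  have Pz: "P n p = 0" and Qz: "Q n p = 0" if "p \<notin> K'" for n p
  proof -
    have 0: "\<rho> n q * \<psi> (p - q) = 0" "\<rho> n q *\<^sub>R g (p - q) = 0" for q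
      using supp[OF that, of q n] z gz \<rho>(5)[of n q] by (cases "norm q \<le> e n"; force)+
    show "P n p = 0" "Q n p = 0" by (simp_all only: P_def Q_def 0 Bochner_Integration.integral_zero)
  qed
  have test: "test_function \<Omega> (P n)" for n
  proof -
    have "{p. P n p \<noteq> 0} \<subseteq> K'"
      using Pz by blast
    then have 1: "closure {p. P n p \<noteq> 0} \<subseteq> K'"
      using K'(1) by (intro closure_minimal compact_imp_closed)
    then have "K' \<inter> closure {p. P n p \<noteq> 0} = closure {p. P n p \<noteq> 0}" by blast
    then have "compact (closure {p. P n p \<noteq> 0})"
      using compact_Int_closed[OF K'(1) closed_closure] by metis
    then show ?thesis unfolding test_function_def
      using Pk 1 K'(2) by blast
  qed
  have PB: "norm (P n p) \<le> B1" for n p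
  proof -
    have "norm ((LINT q|lborel. \<rho> n q *\<^sub>R \<psi> (p - q)) - 0) \<le> B1"
      by (rule mollify_pointwise[OF \<rho>(2-5) Pi]) (assumption, subst diff_zero, rule B1(2))
    then show ?thesis by (simp add: P_def)
  qed
  have QB: "norm (Q n p) \<le> B2" for n p
  proof -
    have "norm ((LINT q|lborel. \<rho> n q *\<^sub>R g (p - q)) - 0) \<le> B2"
      by (rule mollify_pointwise[OF \<rho>(2-5) Qi]) (assumption, subst diff_zero, rule B2(2))
    then show ?thesis by (simp add: Q_def)
  qed
  have lim: "(\<lambda>n. LINT q|lborel. \<rho> n q *\<^sub>R h (p - q)) \<longlonglongrightarrow> h p"
    if h: "isCont h p" and i: "\<And>n. integrable lborel (\<lambda>q. \<rho> n q *\<^sub>R h (p - q))"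
    for h :: "'b \<Rightarrow> 'c::{banach, second_countable_topology}" and p
  proof (rule LIMSEQ_I)
    fix r :: real assume "0 < r"
    then obtain s where s: "s > 0" "\<And>x. norm (x - p) < s \<Longrightarrow> norm (h x - h p) < r / 2"
      using h unfolding continuous_at_eps_delta dist_norm by (metis half_gt_zero)
    obtain N where N: "\<And>n. n \<ge> N \<Longrightarrow> e n < s"
      using order_tendstoD(2)[OF elim s(1)] by (auto simp: eventually_sequentially)
    have "norm ((LINT q|lborel. \<rho> n q *\<^sub>R h (p - q)) - h p) \<le> r / 2" if "n \<ge> N" for n
    proof (rule mollify_pointwise[OF \<rho>(2-5) i])
      fix q :: 'b assume "norm q \<le> e n"
      then show "norm (h (p - q) - h p) \<le> r / 2" using N[OF that] by (intro less_imp_le s(2)) simp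
    qed
    then show "\<exists>no. \<forall>n\<ge>no. norm ((LINT q|lborel. \<rho> n q *\<^sub>R h (p - q)) - h p) < r"
      using \<open>0 < r\<close> by (intro exI[of _ N]) force
  qed
  have Plim: "(\<lambda>n. P n p) \<longlonglongrightarrow> \<psi> p" for p
    unfolding P_def real_scaleR_def[symmetric]
    by (rule lim[OF GDERIV_continuous[OF d]]) (use Pi in simp)
  have Qlim: "(\<lambda>n. Q n p) \<longlonglongrightarrow> g p" for p
    unfolding Q_def using c by (intro lim Qi) (auto simp: continuous_on_eq_continuous_at)
  have UK: "integrable lborel (\<lambda>p. indicator K' p *\<^sub>R U p)" "integrable lborel (\<lambda>p. indicator K' p *\<^sub>R G p)"
    using w K' unfolding weak_gradient_def locally_integrable_def set_integrable_def by auto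
  have eq: "(LINT p:\<Omega>|lborel. U p * (Q n p \<bullet> b)) = - (LINT p:\<Omega>|lborel. (G p \<bullet> b) * P n p)" for n
  proof -
    have "partial_deriv b (P n) = (\<lambda>p. Q n p \<bullet> b)" using GDERIV_partial_deriv[OF PQ] by blast
    then show ?thesis using w test[of n] b unfolding weak_gradient_def by metis
  qed
  \<comment> \<open>The test factors vanish off \<open>K'\<close>, so \<open>\<Omega>\<close> may be
    replaced by \<open>K'\<close> under the integrals. This yields integrable majorants although
    \<open>U\<close> and \<open>G\<close> are only locally integrable.\<close>
  have KO: "indicator \<Omega> p *\<^sub>R (x * y) = (indicator K' p *\<^sub>R x) * y" if "p \<notin> K' \<Longrightarrow> y = 0" for p and x y :: real
    using that K'(2) by (auto simp: indicator_def)
  have KK: "K \<subseteq> K'" unfolding K'_def using e0(1) by auto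
  have Pc: "P n \<in> borel_measurable borel" for n
    using GDERIV_continuous[OF PQ] by (auto intro!: borel_measurable_continuous_onI simp: continuous_on_eq_continuous_at)
  have Qc: "(\<lambda>p. Q n p \<bullet> b) \<in> borel_measurable borel" for n
  proof -
    have "Ck_on 1 UNIV (P n)" by (rule Pk)
    then have "continuous_on UNIV (partial_deriv b (P n))" using b by simp
    moreover have "partial_deriv b (P n) = (\<lambda>p. Q n p \<bullet> b)" using GDERIV_partial_deriv[OF PQ] by blast
    ultimately show ?thesis by (auto intro!: borel_measurable_continuous_onI)
  qed
  have nb: "norm b = 1" using b by simp
  have L1: "(\<lambda>n. LINT p:\<Omega>|lborel. U p * (Q n p \<bullet> b)) \<longlonglongrightarrow> (LINT p:\<Omega>|lborel. U p * (g p \<bullet> b))"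
    unfolding set_lebesgue_integral_def
  proof (rule integral_dominated_convergence[where w="\<lambda>p. norm (indicator K' p *\<^sub>R U p) * B2"])
    have 1: "indicator \<Omega> p *\<^sub>R (U p * (g p \<bullet> b)) = (indicator K' p *\<^sub>R U p) * (g p \<bullet> b)" for p
      using gz KK by (intro KO) (metis inner_zero_left subsetD)
    have 2: "indicator \<Omega> p *\<^sub>R (U p * (Q n p \<bullet> b)) = (indicator K' p *\<^sub>R U p) * (Q n p \<bullet> b)" for n p
      using Qz by (intro KO) auto
    show "(\<lambda>p. indicator \<Omega> p *\<^sub>R (U p * (g p \<bullet> b))) \<in> borel_measurable lborel"
      unfolding 1 using UK(1)[THEN borel_measurable_integrable] by measurable
    show "(\<lambda>p. indicator \<Omega> p *\<^sub>R (U p * (Q n p \<bullet> b))) \<in> borel_measurable lborel" for n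
      unfolding 2 using UK(1)[THEN borel_measurable_integrable] Qc by measurable
    show "integrable lborel (\<lambda>p. norm (indicator K' p *\<^sub>R U p) * B2)" using UK(1) by simp
    show "AE p in lborel. (\<lambda>n. indicator \<Omega> p *\<^sub>R (U p * (Q n p \<bullet> b))) \<longlonglongrightarrow> indicator \<Omega> p *\<^sub>R (U p * (g p \<bullet> b))"
      using Qlim by (intro AE_I2 tendsto_intros)
    show "AE p in lborel. norm (indicator \<Omega> p *\<^sub>R (U p * (Q n p \<bullet> b))) \<le> norm (indicator K' p *\<^sub>R U p) * B2" for n
      unfolding 2 norm_mult
    proof (intro AE_I2 mult_left_mono)
      show "norm (Q n p \<bullet> b) \<le> B2" for p
        using order_trans[OF Cauchy_Schwarz_ineq2[of "Q n p" b]] QB[of n p] nb by simp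
    qed auto
  qed
  have L2: "(\<lambda>n. LINT p:\<Omega>|lborel. (G p \<bullet> b) * P n p) \<longlonglongrightarrow> (LINT p:\<Omega>|lborel. (G p \<bullet> b) * \<psi> p)"
    unfolding set_lebesgue_integral_def
  proof (rule integral_dominated_convergence[where w="\<lambda>p. norm (indicator K' p *\<^sub>R (G p \<bullet> b)) * B1"])
    have G: "integrable lborel (\<lambda>p. indicator K' p *\<^sub>R (G p \<bullet> b))"
      using integrable_inner_left[of b, OF UK(2)] by simp
    have 1: "indicator \<Omega> p *\<^sub>R ((G p \<bullet> b) * \<psi> p) = (indicator K' p *\<^sub>R (G p \<bullet> b)) * \<psi> p" for p
      using z KK by (intro KO) blast
    have 2: "indicator \<Omega> p *\<^sub>R ((G p \<bullet> b) * P n p) = (indicator K' p *\<^sub>R (G p \<bullet> b)) * P n p" for n p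
      using Pz by (intro KO) auto
    show "(\<lambda>p. indicator \<Omega> p *\<^sub>R ((G p \<bullet> b) * \<psi> p)) \<in> borel_measurable lborel"
      unfolding 1 using G[THEN borel_measurable_integrable] by measurable
    show "(\<lambda>p. indicator \<Omega> p *\<^sub>R ((G p \<bullet> b) * P n p)) \<in> borel_measurable lborel" for n
      unfolding 2 using G[THEN borel_measurable_integrable] Pc by measurable
    show "integrable lborel (\<lambda>p. norm (indicator K' p *\<^sub>R (G p \<bullet> b)) * B1)" using G by simp
    show "AE p in lborel. (\<lambda>n. indicator \<Omega> p *\<^sub>R ((G p \<bullet> b) * P n p)) \<longlonglongrightarrow> indicator \<Omega> p *\<^sub>R ((G p \<bullet> b) * \<psi> p)"
      using Plim by (intro AE_I2 tendsto_intros)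
    show "AE p in lborel. norm (indicator \<Omega> p *\<^sub>R ((G p \<bullet> b) * P n p)) \<le> norm (indicator K' p *\<^sub>R (G p \<bullet> b)) * B1" for n
      unfolding 2 norm_mult[of "indicator K' _ *\<^sub>R (G _ \<bullet> b)"]
      using PB by (intro AE_I2 mult_left_mono) auto
  qed
  have "(\<lambda>n. - (LINT p:\<Omega>|lborel. (G p \<bullet> b) * P n p)) \<longlonglongrightarrow> (LINT p:\<Omega>|lborel. U p * (g p \<bullet> b))"
    using L1 unfolding eq .
  then show ?thesis using tendsto_minus[OF L2] LIMSEQ_unique by blast
qed

section \<open>Translation in \<open>L\<^sup>2\<close> and convolution\<close>

lemma integrable_shift:
  fixes f :: "'a::euclidean_space \<Rightarrow> real"
  assumes "integrable lborel f"
  shows "integrable lborel (\<lambda>x. f (x + t))"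
  using assms lborel_integrable_affine_iff[of f 1 t] by (simp add: add.commute)

text \<open>Points of an open set stay in it under small shifts, so the positive part of the
  difference tends to 0 by domination. Both indicators have the same integral, so the negative part
  has the same integral as the positive one.\<close>

lemma open_translation_tendsto:
  fixes z :: "nat \<Rightarrow> 'a::euclidean_space"
  assumes U: "open U" "emeasure lborel U < \<infinity>" and z: "z \<longlonglongrightarrow> 0"
  shows "(\<lambda>n. LINT x|lborel. \<bar>indicator U (x + z n) - indicator U x :: real\<bar>) \<longlonglongrightarrow> 0"
proof -
  have [measurable]: "U \<in> sets borel" using U(1) by simp
  have iU: "integrable lborel (indicator U :: 'a \<Rightarrow> real)" using U by simp
  have iz: "integrable lborel (\<lambda>x. indicator U (x + z n) :: real)" for n
    by (rule integrable_shift[OF iU])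
  let ?p = "\<lambda>n x. max 0 (indicator U x - indicator U (x + z n)) :: real"
  have "(\<lambda>n. LINT x|lborel. ?p n x) \<longlonglongrightarrow> (LINT x|(lborel :: 'a measure). (0::real))"
  proof (rule integral_dominated_convergence[where w="indicator U"])
    show "AE x in lborel. (\<lambda>n. ?p n x) \<longlonglongrightarrow> 0"
    proof (rule AE_I2)
      fix x
      show "(\<lambda>n. ?p n x) \<longlonglongrightarrow> 0"
      proof (cases "x \<in> U")
        case True
        have "(\<lambda>n. x + z n) \<longlonglongrightarrow> x + 0" by (intro tendsto_intros z)
        then have "\<forall>\<^sub>F n in sequentially. x + z n \<in> U"
          using U(1) True by (auto dest: topological_tendstoD)
        then have "\<forall>\<^sub>F n in sequentially. ?p n x = 0"
          by eventually_elim (use True in simp)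
        then show ?thesis by (rule tendsto_eventually)
      next
        case False
        then have "?p n x = 0" for n by (simp add: indicator_def)
        then show ?thesis by (simp only: tendsto_const)
      qed
    qed
    show "AE x in lborel. norm (?p n x) \<le> indicator U x" for n
      by (rule AE_I2) (auto simp: indicator_def)
  qed (use iU in measurable)
  then have 1: "(\<lambda>n. 2 * (LINT x|lborel. ?p n x)) \<longlonglongrightarrow> 0"
    using tendsto_mult_left[of _ 0 sequentially 2] by simp
  have "(LINT x|lborel. \<bar>indicator U (x + z n) - indicator U x :: real\<bar>) = 2 * (LINT x|lborel. ?p n x)" for n
  proof -
    have e: "\<bar>indicator U (x + z n) - indicator U x :: real\<bar> = 2 * ?p n x - (indicator U x - indicator U (x + z n))" for x
      by (auto simp: indicator_def)
    have ip: "integrable lborel (?p n)" using iU iz by (intro integrable_max) auto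
    have "(LINT x|lborel. indicator U (x + z n) :: real) = (LINT x|lborel. indicator U x)"
      by (rule lborel_integral_shift) simp
    then show ?thesis unfolding e
      using ip iU iz[of n] by simp
  qed
  with 1 show ?thesis by simp
qed

text \<open>For indicators, outer regularity replaces a Borel set by an open one up to small
  measure. Sums and dominated limits then follow by the induction rule for integrable functions,
  because translations preserve the \<open>L\<^sup>1\<close> norm.\<close>

lemma L1_translation_tendsto:
  fixes f :: "'a::euclidean_space \<Rightarrow> real"
  assumes f: "integrable lborel f" and z: "z \<longlonglongrightarrow> 0"
  shows "(\<lambda>n. LINT x|lborel. \<bar>f (x + z n) - f x\<bar>) \<longlonglongrightarrow> 0"
  using f
proof (induction rule: integrable_induct)
  case (base A c)
  have [measurable]: "A \<in> sets borel" using base by simp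
  have "(\<lambda>n. LINT x|lborel. \<bar>indicator A (x + z n) - indicator A x :: real\<bar>) \<longlonglongrightarrow> 0"
  proof (rule LIMSEQ_I)
    fix r :: real assume "0 < r"
    \<comment> \<open>The error \<open>r / 4\<close> enters twice, shifted and unshifted, and leaves
      \<open>r / 2\<close> for the open set.\<close>
    then obtain U where U: "open U" "A \<subseteq> U" "emeasure lborel (U - A) < ennreal (r / 4)"
      using outer_regular_lborel[of A "r / 4"] base by auto
    have [measurable]: "U \<in> sets borel" using U(1) by simp
    have "emeasure lborel U = emeasure lborel A + emeasure lborel (U - A)"
      using U(2) by (subst plus_emeasure) (auto simp: Un_absorb1)
    also have "\<dots> < \<infinity>" using base U(3) by (auto simp: less_top[symmetric] ennreal_add_eq_top)
    finally have fU: "emeasure lborel U < \<infinity>" .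
    have iA: "integrable lborel (indicator A :: 'a \<Rightarrow> real)" using base by simp
    have iU: "integrable lborel (indicator U :: 'a \<Rightarrow> real)" using fU by simp
    have fD: "emeasure lborel (U - A) < \<infinity>" using U(3) by (rule less_trans) simp
    have iD: "integrable lborel (indicator (U - A) :: 'a \<Rightarrow> real)" using fD by simp
    have mD: "(LINT x|lborel. indicator (U - A) x :: real) < r / 4"
    proof -
      have "ennreal (measure lborel (U - A)) < ennreal (r / 4)"
        using U(3) fD by (simp add: emeasure_eq_ennreal_measure less_top[symmetric])
      then show ?thesis by (simp add: ennreal_less_iff)
    qed
    obtain N where N: "\<And>n. n \<ge> N \<Longrightarrow> norm ((LINT x|lborel. \<bar>indicator U (x + z n) - indicator U x :: real\<bar>) - 0) < r / 2"
      using LIMSEQ_D[OF open_translation_tendsto[OF U(1) fU z], of "r / 2"] \<open>0 < r\<close> by auto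
    have "norm ((LINT x|lborel. \<bar>indicator A (x + z n) - indicator A x :: real\<bar>) - 0) < r" if "n \<ge> N" for n
    proof -
      have "(LINT x|lborel. \<bar>indicator A (x + z n) - indicator A x :: real\<bar>)
        \<le> (LINT x|lborel. \<bar>indicator U (x + z n) - indicator U x\<bar> + indicator (U - A) (x + z n) + indicator (U - A) x)"
      proof (rule integral_mono)
        show "integrable lborel (\<lambda>x. \<bar>indicator A (x + z n) - indicator A x :: real\<bar>)"
          by (intro integrable_abs Bochner_Integration.integrable_diff integrable_shift iA)
        show "integrable lborel (\<lambda>x. \<bar>indicator U (x + z n) - indicator U x\<bar> + indicator (U - A) (x + z n) + indicator (U - A) x :: real)"
          by (intro integrable_abs Bochner_Integration.integrable_diff Bochner_Integration.integrable_add integrable_shift iU iD)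
        show "\<bar>indicator A (x + z n) - indicator A x :: real\<bar> \<le> \<bar>indicator U (x + z n) - indicator U x\<bar> + indicator (U - A) (x + z n) + indicator (U - A) x" for x
          using U(2) by (auto simp: indicator_def)
      qed
      also have "\<dots> = (LINT x|lborel. \<bar>indicator U (x + z n) - indicator U x :: real\<bar>) + (LINT x|lborel. indicator (U - A) (x + z n)) + (LINT x|lborel. indicator (U - A) x)"
        by (subst Bochner_Integration.integral_add Bochner_Integration.integral_add,
            (intro integrable_abs Bochner_Integration.integrable_diff Bochner_Integration.integrable_add integrable_shift iU iD)+)+ simp
      also have "(LINT x|lborel. indicator (U - A) (x + z n) :: real) = (LINT x|lborel. indicator (U - A) x)"
        by (rule lborel_integral_shift) simp
      finally show ?thesis using N[OF that] mD by simp
    qed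
    then show "\<exists>no. \<forall>n\<ge>no. norm ((LINT x|lborel. \<bar>indicator A (x + z n) - indicator A x :: real\<bar>) - 0) < r" by blast
  qed
  then have "(\<lambda>n. (LINT x|lborel. \<bar>indicator A (x + z n) - indicator A x :: real\<bar>) * \<bar>c\<bar>) \<longlonglongrightarrow> 0"
    by (rule tendsto_mult_left_zero)
  moreover have "\<bar>indicator A (x + z n) *\<^sub>R c - indicator A x *\<^sub>R c\<bar> = \<bar>indicator A (x + z n) - indicator A x\<bar> * \<bar>c\<bar>" for x n
    by (simp add: left_diff_distrib[symmetric] abs_mult)
  ultimately show ?case by simp
next
  case (add f g)
  show ?case
  proof (rule tendsto_sandwich[OF _ _ tendsto_const])
    have "(LINT x|lborel. \<bar>(f (x + z n) + g (x + z n)) - (f x + g x)\<bar>)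
        \<le> (LINT x|lborel. \<bar>f (x + z n) - f x\<bar>) + (LINT x|lborel. \<bar>g (x + z n) - g x\<bar>)" for n
    proof -
      have i: "integrable lborel (\<lambda>x. f (x + z n) - f x)" "integrable lborel (\<lambda>x. g (x + z n) - g x)"
        by (intro Bochner_Integration.integrable_diff integrable_shift add)+
      have "(LINT x|lborel. \<bar>(f (x + z n) + g (x + z n)) - (f x + g x)\<bar>)
          \<le> (LINT x|lborel. \<bar>f (x + z n) - f x\<bar> + \<bar>g (x + z n) - g x\<bar>)"
      proof (rule integral_mono)
        have "integrable lborel (\<lambda>x. \<bar>(f (x + z n) - f x) + (g (x + z n) - g x)\<bar>)"
          using i by (intro integrable_abs Bochner_Integration.integrable_add)
        then show "integrable lborel (\<lambda>x. \<bar>(f (x + z n) + g (x + z n)) - (f x + g x)\<bar>)"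
          by (simp add: algebra_simps)
      qed (use i in auto)
      then show ?thesis using i by simp
    qed
    then show "\<forall>\<^sub>F n in sequentially. (LINT x|lborel. \<bar>(f (x + z n) + g (x + z n)) - (f x + g x)\<bar>)
        \<le> (LINT x|lborel. \<bar>f (x + z n) - f x\<bar>) + (LINT x|lborel. \<bar>g (x + z n) - g x\<bar>)" by simp
    show "(\<lambda>n. (LINT x|lborel. \<bar>f (x + z n) - f x\<bar>) + (LINT x|lborel. \<bar>g (x + z n) - g x\<bar>)) \<longlonglongrightarrow> 0"
      using tendsto_add[OF add(3,4)] by simp
  qed simp
next
  case (lim f s)
  have [measurable]: "f \<in> borel_measurable borel" "\<And>i. s i \<in> borel_measurable borel"
    using lim.hyps(1)[THEN borel_measurable_integrable] lim.hyps(4)[THEN borel_measurable_integrable] by auto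
  have "(\<lambda>i. LINT x|lborel. \<bar>s i x - f x\<bar>) \<longlonglongrightarrow> (LINT x|(lborel :: 'a measure). (0::real))"
  proof (rule integral_dominated_convergence[where w="\<lambda>x. 3 * \<bar>f x\<bar>"])
    show "AE x in lborel. (\<lambda>i. \<bar>s i x - f x\<bar>) \<longlonglongrightarrow> 0"
      using lim.hyps(2) by (intro AE_I2 tendsto_rabs_zero) (simp add: LIM_zero)
    show "AE x in lborel. norm \<bar>s i x - f x\<bar> \<le> 3 * \<bar>f x\<bar>" for i
    proof (rule AE_I2)
      fix x
      show "norm \<bar>s i x - f x\<bar> \<le> 3 * \<bar>f x\<bar>" using lim.hyps(3)[of x i] by simp
    qed
  qed (use lim in auto)
  then have c: "(\<lambda>i. LINT x|lborel. \<bar>s i x - f x\<bar>) \<longlonglongrightarrow> 0" by simp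
  show ?case
  proof (rule LIMSEQ_I)
    fix r :: real assume "0 < r"
    obtain i where i: "norm ((LINT x|lborel. \<bar>s i x - f x\<bar>) - 0) < r / 4"
      using LIMSEQ_D[OF c, of "r / 4"] \<open>0 < r\<close> by auto
    obtain N where N: "\<And>n. n \<ge> N \<Longrightarrow> norm ((LINT x|lborel. \<bar>s i (x + z n) - s i x\<bar>) - 0) < r / 2"
      using LIMSEQ_D[OF lim.IH[of i], of "r / 2"] \<open>0 < r\<close> by auto
    have id: "integrable lborel (\<lambda>x. \<bar>s i x - f x\<bar>)" using lim by simp
    have "norm ((LINT x|lborel. \<bar>f (x + z n) - f x\<bar>) - 0) < r" if "n \<ge> N" for n
    proof -
      have i2: "integrable lborel (\<lambda>x. \<bar>s i (x + z n) - f (x + z n)\<bar>)"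
        by (rule integrable_shift[OF id])
      have i3: "integrable lborel (\<lambda>x. \<bar>s i (x + z n) - s i x\<bar>)" "integrable lborel (\<lambda>x. \<bar>f (x + z n) - f x\<bar>)"
        by (intro integrable_abs Bochner_Integration.integrable_diff integrable_shift lim.hyps)+
      have "(LINT x|lborel. \<bar>f (x + z n) - f x\<bar>)
        \<le> (LINT x|lborel. \<bar>s i (x + z n) - f (x + z n)\<bar> + \<bar>s i (x + z n) - s i x\<bar> + \<bar>s i x - f x\<bar>)"
        by (rule integral_mono) (use i2 i3 id in auto)
      also have "\<dots> = (LINT x|lborel. \<bar>s i (x + z n) - f (x + z n)\<bar>) + (LINT x|lborel. \<bar>s i (x + z n) - s i x\<bar>) + (LINT x|lborel. \<bar>s i x - f x\<bar>)"
        using i2 i3 id by simp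
      also have "(LINT x|lborel. \<bar>s i (x + z n) - f (x + z n)\<bar>) = (LINT x|lborel. \<bar>s i x - f x\<bar>)"
        by (rule lborel_integral_shift) simp
      finally show ?thesis using N[OF that] i by simp
    qed
    then show "\<exists>no. \<forall>n\<ge>no. norm ((LINT x|lborel. \<bar>f (x + z n) - f x\<bar>) - 0) < r" by blast
  qed
qed

lemma sq_integrable_real:
  fixes f :: "'a::euclidean_space \<Rightarrow> real"
  shows "sq_integrable f \<longleftrightarrow> f \<in> borel_measurable lborel \<and> integrable lborel (\<lambda>x. (f x)\<^sup>2)"
  by (simp add: sq_integrable_def)

lemma nn_integral_sq_finite:
  fixes f :: "'a::euclidean_space \<Rightarrow> real"
  assumes "sq_integrable f"
  shows "(\<integral>\<^sup>+x. ennreal ((f x)\<^sup>2) \<partial>lborel) < \<infinity>"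
  using assms by (simp add: sq_integrable_real nn_integral_eq_integral)

text \<open>Reduces to \<open>L\<^sup>1\<close> by \<open>(a - b)\<^sup>2 \<le> 2 \<bar>a\<bar>a\<bar> - b\<bar>b\<bar>\<bar>\<close>.\<close>
lemma L2_translation_tendsto:
  fixes f :: "'a::euclidean_space \<Rightarrow> real"
  assumes f: "sq_integrable f" and z: "z \<longlonglongrightarrow> 0"
  shows "(\<lambda>n. \<integral>\<^sup>+x. ennreal ((f (x + z n) - f x)\<^sup>2) \<partial>lborel) \<longlonglongrightarrow> 0"
proof -
  have [measurable]: "f \<in> borel_measurable borel" using f by (simp add: sq_integrable_def)
  define g where "g x = f x * \<bar>f x\<bar>" for x
  have [measurable]: "g \<in> borel_measurable borel" unfolding g_def by measurable
  have gi: "integrable lborel g"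
    by (rule Bochner_Integration.integrable_bound[of _ "\<lambda>x. (f x)\<^sup>2"])
       (use f in \<open>auto simp: sq_integrable_real g_def abs_mult power2_eq_square\<close>)
  have key: "(a - b)\<^sup>2 \<le> 2 * \<bar>a * \<bar>a\<bar> - b * \<bar>b\<bar>\<bar>" for a b :: real
  proof -
    \<comment> \<open>Up to exchanging \<open>a\<close> and \<open>b\<close> and changing both
      signs, \<open>a\<close> is nonnegative and the larger number. For b >= 0 the bound comes from
      (a - b)^2 <= 2 (a - b) (a + b), for b < 0 from (a - b)^2 <= 2 (a^2 + b^2).\<close>
    have *: "(a - b)\<^sup>2 \<le> 2 * \<bar>a * \<bar>a\<bar> - b * \<bar>b\<bar>\<bar>" if "0 \<le> a" "b \<le> a" for a b :: real
    proof (cases "0 \<le> b")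
      case True
      have "(a - b) * (a - b) \<le> (a - b) * (2 * (a + b))"
        using that True by (intro mult_left_mono) auto
      moreover have "b * b \<le> a * a" using that True by (intro mult_mono) auto
      ultimately show ?thesis using that True by (simp add: power2_eq_square algebra_simps)
    next
      case False
      have "0 \<le> (a + b)\<^sup>2" by simp
      then have "(a - b)\<^sup>2 \<le> 2 * (a * a + b * b)" by (simp add: power2_eq_square algebra_simps)
      moreover have "0 \<le> a * a + b * b" by simp
      ultimately show ?thesis using that False by simp
    qed
    consider "0 \<le> a" "b \<le> a" | "0 \<le> b" "a \<le> b" | "a \<le> 0" "a \<le> b" "b \<le> 0" | "b \<le> 0" "b \<le> a" "a \<le> 0" by linarith
    then show ?thesis
    proof cases
      case 2 then show ?thesis using *[of b a] by (simp add: power2_commute abs_minus_commute)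
    next
      case 3 then show ?thesis using *[of "-a" "-b"] by (simp add: power2_commute abs_minus_commute)
    next
      case 4 then show ?thesis using *[of "-b" "-a"] by (simp add: power2_commute abs_minus_commute)
    qed (rule *)
  qed
  have "(\<lambda>n. ennreal (2 * (LINT x|lborel. \<bar>g (x + z n) - g x\<bar>))) \<longlonglongrightarrow> ennreal (2 * 0)"
    by (intro tendsto_ennrealI tendsto_mult_left L1_translation_tendsto gi z)
  then have lim: "(\<lambda>n. ennreal (2 * (LINT x|lborel. \<bar>g (x + z n) - g x\<bar>))) \<longlonglongrightarrow> 0" by simp
  have le: "(\<integral>\<^sup>+x. ennreal ((f (x + z n) - f x)\<^sup>2) \<partial>lborel) \<le> ennreal (2 * (LINT x|lborel. \<bar>g (x + z n) - g x\<bar>))" for n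
  proof -
    have i: "integrable lborel (\<lambda>x. 2 * \<bar>g (x + z n) - g x\<bar>)"
      using gi integrable_shift[OF gi] by auto
    have "(\<integral>\<^sup>+x. ennreal ((f (x + z n) - f x)\<^sup>2) \<partial>lborel) \<le> (\<integral>\<^sup>+x. ennreal (2 * \<bar>g (x + z n) - g x\<bar>) \<partial>lborel)"
      unfolding g_def by (intro nn_integral_mono ennreal_leI key)
    also have "\<dots> = ennreal (2 * (LINT x|lborel. \<bar>g (x + z n) - g x\<bar>))"
      by (subst nn_integral_eq_integral[OF i]) simp_all
    finally show ?thesis .
  qed
  show ?thesis
    by (rule tendsto_sandwich[OF eventuallyI eventuallyI tendsto_const lim]) (simp_all add: le)
qed

section \<open>Cauchy-Schwarz with a weight, and Young's inequality\<close>

lemma nn_integral_weighted_Cauchy_Schwarz: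
  fixes k :: "'x \<Rightarrow> real"
  assumes [measurable]: "k \<in> borel_measurable M" "g \<in> borel_measurable M" and k: "\<And>x. 0 \<le> k x"
  shows "(\<integral>\<^sup>+x. ennreal (k x) * g x \<partial>M)\<^sup>2 \<le> (\<integral>\<^sup>+x. ennreal (k x) \<partial>M) * (\<integral>\<^sup>+x. ennreal (k x) * (g x)\<^sup>2 \<partial>M)"
proof -
  have e: "ennreal (sqrt (k x)) * ennreal (sqrt (k x)) = ennreal (k x)" for x
    using k[of x] by (simp add: ennreal_mult[symmetric])
  have "ennreal (sqrt (k x)) * (ennreal (sqrt (k x)) * g x) = ennreal (k x) * g x"
    "(ennreal (sqrt (k x)))\<^sup>2 = ennreal (k x)" "(ennreal (sqrt (k x)) * g x)\<^sup>2 = ennreal (k x) * (g x)\<^sup>2" for x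
    using e[of x] by (simp_all add: power2_eq_square mult_ac)
  then show ?thesis
    using Cauchy_Schwarz_nn_integral[of "\<lambda>x. ennreal (sqrt (k x))" M "\<lambda>x. ennreal (sqrt (k x)) * g x"] by simp
qed

text \<open>Cauchy-Schwarz in \<open>z\<close> with the kernel as weight, followed by Tonelli.
  Working in \<open>ennreal\<close> makes the bound available before any integrability is
  known.\<close>

lemma Young_L1_L2:
  fixes k :: "'a::euclidean_space \<Rightarrow> real" and f :: "'a \<Rightarrow> ennreal"
  assumes [measurable]: "k \<in> borel_measurable borel" "f \<in> borel_measurable borel" and k: "\<And>x. 0 \<le> k x"
  shows "(\<integral>\<^sup>+x. (\<integral>\<^sup>+z. ennreal (k (x - z)) * f z \<partial>lborel)\<^sup>2 \<partial>lborel)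
    \<le> (\<integral>\<^sup>+x. ennreal (k x) \<partial>lborel)\<^sup>2 * (\<integral>\<^sup>+x. (f x)\<^sup>2 \<partial>lborel)"
proof -
  let ?K = "\<integral>\<^sup>+x. ennreal (k x) \<partial>lborel"
  have "(\<integral>\<^sup>+z. ennreal (k (x - z)) * f z \<partial>lborel)\<^sup>2 \<le> ?K * (\<integral>\<^sup>+z. ennreal (k (x - z)) * (f z)\<^sup>2 \<partial>lborel)" for x
    using nn_integral_weighted_Cauchy_Schwarz[of "\<lambda>z. k (x - z)" lborel f] k
      nn_integral_reflect[of "\<lambda>z. ennreal (k z)" x] by simp
  then have "(\<integral>\<^sup>+x. (\<integral>\<^sup>+z. ennreal (k (x - z)) * f z \<partial>lborel)\<^sup>2 \<partial>lborel)
      \<le> (\<integral>\<^sup>+x. ?K * (\<integral>\<^sup>+z. ennreal (k (x - z)) * (f z)\<^sup>2 \<partial>lborel) \<partial>lborel)"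
    by (rule nn_integral_mono)
  also have "\<dots> = ?K * (\<integral>\<^sup>+x. (\<integral>\<^sup>+z. ennreal (k (x - z)) * (f z)\<^sup>2 \<partial>lborel) \<partial>lborel)"
    by (rule nn_integral_cmult) measurable
  also have "(\<integral>\<^sup>+x. (\<integral>\<^sup>+z. ennreal (k (x - z)) * (f z)\<^sup>2 \<partial>lborel) \<partial>lborel)
      = (\<integral>\<^sup>+z. (\<integral>\<^sup>+x. ennreal (k (x - z)) * (f z)\<^sup>2 \<partial>lborel) \<partial>lborel)"
    by (rule lborel_pair.Fubini') measurable
  also have "\<dots> = (\<integral>\<^sup>+z. ?K * (f z)\<^sup>2 \<partial>lborel)"
    using nn_integral_shift[of "\<lambda>z. ennreal (k z)" "- _"]
    by (intro nn_integral_cong) (subst nn_integral_multc, auto)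
  also have "\<dots> = ?K * (\<integral>\<^sup>+z. (f z)\<^sup>2 \<partial>lborel)"
    by (rule nn_integral_cmult) measurable
  finally show ?thesis by (simp add: power2_eq_square mult.assoc)
qed

section \<open>The kernel of the massive Poisson semigroup\<close>

lemma integral_prod_Basis:
  fixes f :: "'b::euclidean_space \<Rightarrow> real \<Rightarrow> complex"
  assumes "\<And>b. b \<in> Basis \<Longrightarrow> integrable lborel (f b)"
  shows "integrable lborel (\<lambda>x::'b. \<Prod>b\<in>Basis. f b (x \<bullet> b))"
    "(LINT x|lborel. (\<Prod>b\<in>Basis. f b ((x::'b) \<bullet> b))) = (\<Prod>b\<in>Basis. LINT t|lborel. f b t)"
proof -
  interpret product_sigma_finite "\<lambda>_::'b. lborel :: real measure" ..
  have m: "f b \<in> borel_measurable borel" if "b \<in> Basis" for b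
    using assms[OF that] by simp
  have m': "(\<lambda>x::'b. \<Prod>b\<in>Basis. f b (x \<bullet> b)) \<in> borel_measurable borel"
    by (intro borel_measurable_prod measurable_compose[OF _ m]) auto
  have e: "(\<Prod>b\<in>Basis. f b ((\<Sum>b'\<in>Basis. x b' *\<^sub>R b') \<bullet> b)) = (\<Prod>b\<in>Basis. f b (x b))" for x
    by (intro prod.cong refl) (simp add: inner_sum_left inner_Basis if_distrib cong: if_cong)
  show "integrable lborel (\<lambda>x::'b. \<Prod>b\<in>Basis. f b (x \<bullet> b))"
    using product_integrable_prod[of Basis f] assms
    by (subst lborel_eq, subst integrable_distr_eq) (auto simp: m' e)
  show "(LINT x|lborel. (\<Prod>b\<in>Basis. f b ((x::'b) \<bullet> b))) = (\<Prod>b\<in>Basis. LINT t|lborel. f b t)"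
    using product_integral_prod[of Basis f] assms
    by (subst lborel_eq, subst integral_distr) (auto simp: m' e)
qed

text \<open>Rescaling the variable by \<open>1 / (sqrt 2 * k)\<close> turns the integrand into a
  multiple of the standard normal density times a character, so the value is read off from the
  characteristic function of the normal distribution.\<close>

lemma gaussian_fourier_real:
  fixes k x :: real
  assumes "0 < k"
  shows "integrable lborel (\<lambda>t. exp (complex_of_real (- (k\<^sup>2 * t\<^sup>2)) - \<i> * complex_of_real (x * t)))"
    "(LINT t|lborel. exp (complex_of_real (- (k\<^sup>2 * t\<^sup>2)) - \<i> * complex_of_real (x * t)))
       = complex_of_real (sqrt pi / k * exp (- x\<^sup>2 / (4 * k\<^sup>2)))"
proof -
  let ?c = "1 / (sqrt 2 * k)"
  have c: "?c \<noteq> 0" using assms by simp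
  let ?f = "\<lambda>t. exp (complex_of_real (- (k\<^sup>2 * t\<^sup>2)) - \<i> * complex_of_real (x * t))"
  let ?s = "- (x * ?c)"
  have f: "?f (0 + ?c * t) = complex_of_real (sqrt (2 * pi)) * (std_normal_density t *\<^sub>R iexp (?s * t))" for t
  proof -
    have "?f (0 + ?c * t) = exp (complex_of_real (- (t\<^sup>2 / 2))) * iexp (?s * t)"
      using assms by (simp add: power_mult_distrib power_divide exp_add[symmetric] algebra_simps)
    also have "exp (complex_of_real (- (t\<^sup>2 / 2))) = complex_of_real (sqrt (2 * pi) * std_normal_density t)"
      unfolding exp_of_real by (simp add: std_normal_density_def)
    finally show ?thesis by (simp add: scaleR_conv_of_real)
  qed
  have i1: "integrable lborel (\<lambda>t. std_normal_density t *\<^sub>R iexp (?s * t))"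
  proof (rule Bochner_Integration.integrable_bound[of _ "std_normal_density"])
    show "integrable lborel std_normal_density" by (rule integrable_normal_density) simp
  qed auto
  show "integrable lborel ?f"
    by (subst lborel_integrable_real_affine_iff[OF c, of ?f 0, symmetric], subst f)
       (rule integrable_mult_right[OF i1])
  have "char std_normal_distribution ?s = (LINT t|lborel. std_normal_density t *\<^sub>R iexp (?s * t))"
    unfolding char_def by (subst integral_density) auto
  then have ch: "(LINT t|lborel. std_normal_density t *\<^sub>R iexp (?s * t)) = complex_of_real (exp (- ?s\<^sup>2 / 2))"
    by (simp add: char_std_normal_distribution)
  have "(LINT t|lborel. ?f t) = \<bar>?c\<bar> *\<^sub>R (LINT t|lborel. ?f (0 + ?c * t))"
    by (rule lborel_integral_real_affine[OF c])
  also have "\<dots> = ?c *\<^sub>R (complex_of_real (sqrt (2 * pi)) * complex_of_real (exp (- ?s\<^sup>2 / 2)))"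
    unfolding f integral_mult_right_zero ch using assms by simp
  also have "\<dots> = complex_of_real (sqrt pi / k * exp (- x\<^sup>2 / (4 * k\<^sup>2)))"
    using assms by (simp add: scaleR_conv_of_real real_sqrt_mult power_divide power_mult_distrib field_simps)
  finally show "(LINT t|lborel. ?f t) = complex_of_real (sqrt pi / k * exp (- x\<^sup>2 / (4 * k\<^sup>2)))" .
qed

text \<open>Both the Gaussian and the character split over the coordinates, so the integral is a
  product of one-dimensional ones.\<close>

lemma gaussian_fourier:
  fixes x :: "'b::euclidean_space"
  assumes "0 < k"
  shows "integrable lborel (\<lambda>\<xi>. cis (- (x \<bullet> \<xi>)) * complex_of_real (exp (- (k\<^sup>2 * (norm \<xi>)\<^sup>2))))"
    "(LINT \<xi>|lborel. cis (- (x \<bullet> \<xi>)) * complex_of_real (exp (- (k\<^sup>2 * (norm \<xi>)\<^sup>2))))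
       = complex_of_real ((sqrt pi / k) ^ DIM('b) * exp (- (norm x)\<^sup>2 / (4 * k\<^sup>2)))"
proof -
  let ?f = "\<lambda>b t. exp (complex_of_real (- (k\<^sup>2 * t\<^sup>2)) - \<i> * complex_of_real ((x \<bullet> b) * t))"
  have n: "(norm z)\<^sup>2 = (\<Sum>b\<in>Basis. (z \<bullet> b)\<^sup>2)" for z :: 'b
    unfolding power2_norm_eq_inner by (subst euclidean_inner) (simp add: power2_eq_square)
  have e: "cis (- (x \<bullet> \<xi>)) * complex_of_real (exp (- (k\<^sup>2 * (norm \<xi>)\<^sup>2))) = (\<Prod>b\<in>Basis. ?f b (\<xi> \<bullet> b))" for \<xi>
    unfolding exp_sum[OF finite_Basis, symmetric]
    by (simp add: cis_conv_exp exp_of_real[symmetric] exp_add[symmetric] n euclidean_inner[of x \<xi>]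
        sum_distrib_left sum_subtractf sum_negf) (simp add: algebra_simps minus_diff_commute)
  show "integrable lborel (\<lambda>\<xi>. cis (- (x \<bullet> \<xi>)) * complex_of_real (exp (- (k\<^sup>2 * (norm \<xi>)\<^sup>2))))"
    unfolding e by (rule integral_prod_Basis) (rule gaussian_fourier_real[OF assms])
  have "(\<Prod>b\<in>Basis. sqrt pi / k * exp (- (x \<bullet> b)\<^sup>2 / (4 * k\<^sup>2))) = (sqrt pi / k) ^ DIM('b) * exp (- (norm x)\<^sup>2 / (4 * k\<^sup>2))"
    by (simp only: prod.distrib prod_constant exp_sum[OF finite_Basis, symmetric] n sum_divide_distrib[symmetric] sum_negf)
  then show "(LINT \<xi>|lborel. cis (- (x \<bullet> \<xi>)) * complex_of_real (exp (- (k\<^sup>2 * (norm \<xi>)\<^sup>2))))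
       = complex_of_real ((sqrt pi / k) ^ DIM('b) * exp (- (norm x)\<^sup>2 / (4 * k\<^sup>2)))"
    unfolding e by (subst integral_prod_Basis(2)) (simp_all only: gaussian_fourier_real[OF assms] of_real_prod[symmetric])
qed

lemma gaussian_integral:
  assumes "0 < k"
  shows "integrable lborel (\<lambda>\<xi>::'b::euclidean_space. exp (- (k\<^sup>2 * (norm \<xi>)\<^sup>2)))"
    "(LINT \<xi>|lborel. exp (- (k\<^sup>2 * (norm (\<xi>::'b))\<^sup>2))) = (sqrt pi / k) ^ DIM('b)"
  using gaussian_fourier[OF assms, of "0::'b"]
  by (simp_all only: inner_zero_left minus_zero cis_zero mult_1 complex_of_real_integrable_eq integral_complex_of_real
      of_real_eq_iff norm_zero) simp_all

section \<open>Gaussian moments and the subordination integral\<close>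

lemma gaussian_moment_integrable:
  "integrable lborel (\<lambda>u::real. indicator {0<..} u * (u ^ n * exp (- u\<^sup>2)))"
proof -
  have "integrable lborel (\<lambda>u::real. indicator {0..} u *\<^sub>R (exp (- u\<^sup>2) * u ^ n))"
  proof (cases "even n")
    case True
    then obtain k where "n = 2 * k" by auto
    then show ?thesis using gaussian_moment_even_pos[of k] by (auto simp: has_bochner_integral_iff)
  next
    case False
    then obtain k where "n = 2 * k + 1" using oddE by blast
    then show ?thesis using gaussian_moment_odd_pos[of k] by (auto simp: has_bochner_integral_iff)
  qed
  then show ?thesis
    by (rule Bochner_Integration.integrable_bound) (auto simp: indicator_def)
qed

text \<open>The primitive is a combination of two Gaussian error functions.\<close>
lemma subordination_integral:
  fixes b :: real
  assumes "0 \<le> b"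
  shows "integrable lborel (\<lambda>u. indicator {0<..} u * exp (- u\<^sup>2 - b\<^sup>2 / u\<^sup>2))"
    "(LINT u|lborel. indicator {0<..} u * exp (- u\<^sup>2 - b\<^sup>2 / u\<^sup>2)) = sqrt pi / 2 * exp (- 2 * b)"
proof -
  show i: "integrable lborel (\<lambda>u. indicator {0<..} u * exp (- u\<^sup>2 - b\<^sup>2 / u\<^sup>2))"
    by (rule Bochner_Integration.integrable_bound[OF gaussian_moment_integrable[of 0]])
       (auto simp: indicator_def)
  show "(LINT u|lborel. indicator {0<..} u * exp (- u\<^sup>2 - b\<^sup>2 / u\<^sup>2)) = sqrt pi / 2 * exp (- 2 * b)"
  \<comment> \<open>For \<open>b = 0\<close> the arguments \<open>u + b / u\<close> and
    \<open>u - b / u\<close> of the primitive have no infinite limits at 0, so this case is treated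
    as a plain Gaussian integral.\<close>
  proof (cases "b = 0")
    case True
    have "(LINT u|lborel. indicator {0<..} u * exp (- u\<^sup>2)) = (LINT u|lborel. indicator {0..} u *\<^sub>R exp (- u\<^sup>2 :: real))"
      using AE_lborel_singleton[of "0::real"] by (intro integral_cong_AE) (auto simp: indicator_def elim!: eventually_mono)
    then show ?thesis using gaussian_moment_0 True by (simp add: has_bochner_integral_iff)
  next
    case False
    then have b: "0 < b" using assms by simp
    define N where "N x = (LBINT v=ereal 0..ereal x. exp (- v\<^sup>2))" for x :: real
    have dN: "(N has_real_derivative exp (- x\<^sup>2)) (at x)" for x
      unfolding N_def[abs_def] by (intro has_real_derivative_antiderivative continuous_intros)
    have Npos: "N x = (LINT v|lborel. indicator {..x} v *\<^sub>R (indicator {0..} v *\<^sub>R exp (- v\<^sup>2)))" if "0 \<le> x" for x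
      using that unfolding N_def
      by (simp add: interval_integral_Icc set_lebesgue_integral_def)
         (intro Bochner_Integration.integral_cong, auto simp: indicator_def)
    have g0: "has_bochner_integral lborel (\<lambda>x. indicator {0..} x *\<^sub>R exp (- x\<^sup>2)) (sqrt pi / 2)"
      by (rule gaussian_moment_0)
    have Ntop: "(N \<longlongrightarrow> sqrt pi / 2) at_top"
    proof -
      have "((\<lambda>x. LINT v|lborel. indicator {..x} v *\<^sub>R (indicator {0..} v *\<^sub>R exp (- v\<^sup>2))) \<longlongrightarrow> (LINT v|lborel. indicator {0..} v *\<^sub>R exp (- v\<^sup>2 :: real))) at_top"
        using g0 by (intro tendsto_integral_at_top) (auto simp: has_bochner_integral_iff)
      moreover have "\<forall>\<^sub>F x in at_top. N x = (LINT v|lborel. indicator {..x} v *\<^sub>R (indicator {0..} v *\<^sub>R exp (- v\<^sup>2)))"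
        using Npos by (auto simp: eventually_at_top_linorder)
      ultimately show ?thesis
        unfolding has_bochner_integral_integral_eq[OF g0] by (subst tendsto_cong)
    qed
    have Nodd: "N (- x) = - N x" for x
    proof -
      have "((\<lambda>x. N (- x) + N x) has_real_derivative 0) (at z)" for z
      proof -
        have "((\<lambda>x. N (- x)) has_real_derivative exp (- (- z)\<^sup>2) * (- 1)) (at z)"
          by (rule DERIV_chain2[OF dN]) (auto intro!: derivative_eq_intros)
        from DERIV_add[OF this dN[of z]] show ?thesis by simp
      qed
      then have "N (- x) + N x = N (- 0) + N 0"
        using DERIV_isconst_all[of "\<lambda>x. N (- x) + N x"] by blast
      then show ?thesis by (simp add: N_def)
    qed
    have Nbot: "(N \<longlongrightarrow> - (sqrt pi / 2)) at_bot"
    proof -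
      have "((\<lambda>x. - N (- x)) \<longlongrightarrow> - (sqrt pi / 2)) at_bot"
        by (intro tendsto_minus filterlim_compose[OF Ntop] filterlim_uminus_at_top_at_bot)
      then show ?thesis by (simp add: Nodd)
    qed
    \<comment> \<open>The squares of \<open>u + b / u\<close> and \<open>u - b / u\<close> differ
      from \<open>u\<^sup>2 + b\<^sup>2 / u\<^sup>2\<close> by \<open>2 * b\<close> with opposite
      signs, which the two exponential factors compensate. The derivatives of the arguments are
      \<open>1 - b / u\<^sup>2\<close> and \<open>1 + b / u\<^sup>2\<close>, with sum 2.\<close>
    define A where "A u = (exp (2 * b) * N (u + b / u) + exp (- 2 * b) * N (u - b / u)) / 2" for u
    have dA: "(A has_real_derivative exp (- u\<^sup>2 - b\<^sup>2 / u\<^sup>2)) (at u)" if "0 < u" for u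
    proof -
      have 1: "((\<lambda>u. N (u + b / u)) has_real_derivative exp (- (u + b / u)\<^sup>2) * (1 - b / u\<^sup>2)) (at u)"
        using that by (intro DERIV_chain2[OF dN]) (auto intro!: derivative_eq_intros simp: power2_eq_square)
      have 2: "((\<lambda>u. N (u - b / u)) has_real_derivative exp (- (u - b / u)\<^sup>2) * (1 + b / u\<^sup>2)) (at u)"
        using that by (intro DERIV_chain2[OF dN]) (auto intro!: derivative_eq_intros simp: power2_eq_square)
      have e1: "exp (2 * b) * exp (- (u + b / u)\<^sup>2) = exp (- u\<^sup>2 - b\<^sup>2 / u\<^sup>2)"
        "exp (- 2 * b) * exp (- (u - b / u)\<^sup>2) = exp (- u\<^sup>2 - b\<^sup>2 / u\<^sup>2)"
        using that unfolding exp_add[symmetric] by (auto simp: power2_eq_square field_simps)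
      have "(A has_real_derivative (exp (2 * b) * (exp (- (u + b / u)\<^sup>2) * (1 - b / u\<^sup>2))
            + exp (- 2 * b) * (exp (- (u - b / u)\<^sup>2) * (1 + b / u\<^sup>2))) / 2) (at u)"
        unfolding A_def by (intro DERIV_cdivide DERIV_add DERIV_cmult 1 2)
      then show ?thesis by (simp only: mult.assoc[symmetric] e1) (simp add: algebra_simps)
    qed
    have "(LBINT u=0..\<infinity>. exp (- u\<^sup>2 - b\<^sup>2 / u\<^sup>2)) =
        (exp (2 * b) * (sqrt pi / 2) + exp (- 2 * b) * (sqrt pi / 2)) / 2
        - (exp (2 * b) * (sqrt pi / 2) + exp (- 2 * b) * (- (sqrt pi / 2))) / 2"
    proof (rule interval_integral_FTC_nonneg(2))
      show "(0::ereal) < \<infinity>" by simp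
      show "DERIV A u :> exp (- u\<^sup>2 - b\<^sup>2 / u\<^sup>2)" if "0 < ereal u" for u
        using that by (intro dA) simp
      show "isCont (\<lambda>u. exp (- u\<^sup>2 - b\<^sup>2 / u\<^sup>2)) u" if "0 < ereal u" for u
        using that by (intro continuous_intros) auto
      \<comment> \<open>At 0 the two arguments tend to opposite infinities, at infinity to the same
        one. Hence the terms with \<open>exp (2 * b)\<close> cancel between the endpoints and those
        with \<open>exp (- 2 * b)\<close> add up.\<close>
      have l1: "filterlim (\<lambda>u. u + b / u) at_top (at_right 0)" "filterlim (\<lambda>u. u - b / u) at_bot (at_right 0)"
        "filterlim (\<lambda>u. u + b / u) at_top at_top" "filterlim (\<lambda>u. u - b / u) at_top at_top"
        using b by real_asymp+
      have "(A \<longlongrightarrow> (exp (2 * b) * (sqrt pi / 2) + exp (- 2 * b) * (- (sqrt pi / 2))) / 2) (at_right 0)"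
        unfolding A_def by (intro tendsto_intros filterlim_compose[OF Ntop] filterlim_compose[OF Nbot] l1) auto
      then show "((A \<circ> real_of_ereal) \<longlongrightarrow> (exp (2 * b) * (sqrt pi / 2) + exp (- 2 * b) * (- (sqrt pi / 2))) / 2) (at_right 0)"
        unfolding zero_ereal_def ereal_tendsto_simps .
      have "(A \<longlongrightarrow> (exp (2 * b) * (sqrt pi / 2) + exp (- 2 * b) * (sqrt pi / 2)) / 2) at_top"
        unfolding A_def by (intro tendsto_intros filterlim_compose[OF Ntop] l1) auto
      then show "((A \<circ> real_of_ereal) \<longlongrightarrow> (exp (2 * b) * (sqrt pi / 2) + exp (- 2 * b) * (sqrt pi / 2)) / 2) (at_left \<infinity>)"
        unfolding ereal_tendsto_simps .
    qed simp
    then show ?thesis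
      by (simp add: interval_lebesgue_integral_0_infty set_lebesgue_integral_def field_simps)
  qed
qed

text \<open>
  The kernel of \<open>exp (- y A\<^sub>m)\<close>, written through the subordination formula as a superposition of
  Gaussians, with the factor \<open>u\<^sup>d\<close> kept polynomial by parametrising the heat time as \<open>y\<^sup>2 / (4 u\<^sup>2)\<close>.
\<close>
definition massive_kernel :: "real \<Rightarrow> real \<Rightarrow> 'a::euclidean_space \<Rightarrow> real" where
  "massive_kernel m y z = 2 / sqrt pi * (LINT u|lborel. indicator {0<..} u *
     ((u / (sqrt pi * y)) ^ DIM('a) * exp (- u\<^sup>2 * (1 + (norm z)\<^sup>2 / y\<^sup>2) - (m * y / 2)\<^sup>2 / u\<^sup>2)))"

abbreviation massive_symbol :: "real \<Rightarrow> 'a::euclidean_space \<Rightarrow> real" where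
  "massive_symbol m \<xi> \<equiv> sqrt ((norm \<xi>)\<^sup>2 + m\<^sup>2)"

lemma massive_kernel_integrand_integrable:
  assumes "0 < y"
  shows "integrable lborel (\<lambda>u. indicator {0<..} u *
     ((u / (sqrt pi * y)) ^ n * exp (- u\<^sup>2 * (1 + (norm (z::'a::euclidean_space))\<^sup>2 / y\<^sup>2) - (m * y / 2)\<^sup>2 / u\<^sup>2)))"
proof (rule Bochner_Integration.integrable_bound)
  show "integrable lborel (\<lambda>u. (1 / (sqrt pi * y)) ^ n * (indicator {0<..} u * (u ^ n * exp (- u\<^sup>2))))"
    by (intro integrable_mult_right gaussian_moment_integrable)
  have "norm (indicator {0<..} u * ((u / (sqrt pi * y)) ^ n * exp (- u\<^sup>2 * (1 + (norm z)\<^sup>2 / y\<^sup>2) - (m * y / 2)\<^sup>2 / u\<^sup>2)))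
      \<le> norm ((1 / (sqrt pi * y)) ^ n * (indicator {0<..} u * (u ^ n * exp (- u\<^sup>2))))" for u :: real
  proof (cases "0 < u")
    case True
    have "- u\<^sup>2 * (1 + (norm z)\<^sup>2 / y\<^sup>2) - (m * y / 2)\<^sup>2 / u\<^sup>2 \<le> - u\<^sup>2"
      using True order_trans[of "- (u\<^sup>2 * (norm z)\<^sup>2 / y\<^sup>2)" 0 "(m * y / 2)\<^sup>2 / u\<^sup>2"] by (simp add: distrib_left)
    then have "exp (- u\<^sup>2 * (1 + (norm z)\<^sup>2 / y\<^sup>2) - (m * y / 2)\<^sup>2 / u\<^sup>2) \<le> exp (- u\<^sup>2)"
      by simp
    then have "(u / (sqrt pi * y)) ^ n * exp (- u\<^sup>2 * (1 + (norm z)\<^sup>2 / y\<^sup>2) - (m * y / 2)\<^sup>2 / u\<^sup>2)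
        \<le> (u / (sqrt pi * y)) ^ n * exp (- u\<^sup>2)"
      using True assms by (intro mult_left_mono) auto
    then show ?thesis using True assms by (simp add: abs_mult power_divide)
  qed simp
  then show "AE u in lborel. norm (indicator {0<..} u * ((u / (sqrt pi * y)) ^ n * exp (- u\<^sup>2 * (1 + (norm z)\<^sup>2 / y\<^sup>2) - (m * y / 2)\<^sup>2 / u\<^sup>2)))
      \<le> norm ((1 / (sqrt pi * y)) ^ n * (indicator {0<..} u * (u ^ n * exp (- u\<^sup>2))))"
    by (rule AE_I2)
qed measurable

lemma subordination_symbol:
  assumes "0 < y"
  shows "(LINT u|lborel. indicator {0<..} u * exp (- u\<^sup>2 - (y * massive_symbol m \<xi> / 2)\<^sup>2 / u\<^sup>2))
      = sqrt pi / 2 * exp (- y * massive_symbol m \<xi>)"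
  using subordination_integral(2)[of "y * massive_symbol m \<xi> / 2"] assms by simp

text \<open>For fixed \<open>u\<close> in the subordination formula the integrand is a Gaussian in
  \<open>\<xi>\<close> with parameter \<open>y / (2 * u)\<close>, whose transform is explicit;
  exchanging the two integrations produces the kernel. The power of \<open>2 * pi\<close> reflects
  the unnormalised transform.\<close>

lemma massive_symbol_fourier:
  fixes z :: "'a::euclidean_space"
  assumes y: "0 < y"
  shows "integrable lborel (\<lambda>\<xi>::'a. cis (- (z \<bullet> \<xi>)) * complex_of_real (exp (- y * massive_symbol m \<xi>)))"
    "(LINT \<xi>|lborel. cis (- (z \<bullet> \<xi>)) * complex_of_real (exp (- y * massive_symbol m \<xi>)))
       = complex_of_real ((2 * pi) ^ DIM('a) * massive_kernel m y z)"
proof -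
  define H where "H u \<xi> = cis (- (z \<bullet> \<xi>)) *
      complex_of_real (indicator {0<..} u * exp (- u\<^sup>2 - (y * massive_symbol m \<xi> / 2)\<^sup>2 / u\<^sup>2))" for u \<xi>
  have cm: "(\<lambda>\<xi>::'a. cis (- (z \<bullet> \<xi>))) \<in> borel_measurable borel"
    by (intro borel_measurable_continuous_onI continuous_intros)
  have Hm: "case_prod H \<in> borel_measurable (lborel \<Otimes>\<^sub>M lborel)"
    unfolding H_def case_prod_unfold using measurable_compose[OF measurable_snd cm] by measurable
  have He: "H u \<xi> = complex_of_real (indicator {0<..} u * exp (- u\<^sup>2 - (m * y / 2)\<^sup>2 / u\<^sup>2)) *
      (cis (- (z \<bullet> \<xi>)) * complex_of_real (exp (- ((y / (2 * u))\<^sup>2 * (norm \<xi>)\<^sup>2))))" for u \<xi>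
  proof (cases "0 < u")
    case True
    have "- u\<^sup>2 - (y * massive_symbol m \<xi> / 2)\<^sup>2 / u\<^sup>2
        = (- u\<^sup>2 - (m * y / 2)\<^sup>2 / u\<^sup>2) + (- ((y / (2 * u))\<^sup>2 * (norm \<xi>)\<^sup>2))"
      using True by (simp add: power_divide power_mult_distrib field_simps)
    then show ?thesis by (simp only: H_def exp_add of_real_mult mult_ac)
  qed (simp add: H_def)
  have k: "0 < y / (2 * u)" if "0 < u" for u using that y by simp
  have Hi: "integrable lborel (H u)" for u
  proof (cases "0 < u")
    case True
    then show ?thesis unfolding He by (intro integrable_mult_right gaussian_fourier(1) k)
  qed (simp add: H_def[abs_def])
  have HI: "(LINT \<xi>|lborel. H u \<xi>) = complex_of_real ((2 * pi) ^ DIM('a) * (indicator {0<..} u *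
     ((u / (sqrt pi * y)) ^ DIM('a) * exp (- u\<^sup>2 * (1 + (norm z)\<^sup>2 / y\<^sup>2) - (m * y / 2)\<^sup>2 / u\<^sup>2))))" for u
  proof (cases "0 < u")
    case True
    have 1: "sqrt pi / (y / (2 * u)) = 2 * pi * (u / (sqrt pi * y))"
      using True y by (simp add: field_simps)
    have 2: "- (norm z)\<^sup>2 / (4 * (y / (2 * u))\<^sup>2) = - u\<^sup>2 * (norm z)\<^sup>2 / y\<^sup>2"
      using True y by (simp add: power_divide power_mult_distrib field_simps)
    have "(LINT \<xi>|lborel. H u \<xi>) = complex_of_real (exp (- u\<^sup>2 - (m * y / 2)\<^sup>2 / u\<^sup>2) *
        ((2 * pi * (u / (sqrt pi * y))) ^ DIM('a) * exp (- u\<^sup>2 * (norm z)\<^sup>2 / y\<^sup>2)))"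
      unfolding He integral_mult_right_zero gaussian_fourier(2)[OF k[OF True]] 1 2 using True by simp
    also have "exp (- u\<^sup>2 - (m * y / 2)\<^sup>2 / u\<^sup>2) * ((2 * pi * (u / (sqrt pi * y))) ^ DIM('a) * exp (- u\<^sup>2 * (norm z)\<^sup>2 / y\<^sup>2))
      = (2 * pi) ^ DIM('a) * ((u / (sqrt pi * y)) ^ DIM('a) * exp ((- u\<^sup>2 - (m * y / 2)\<^sup>2 / u\<^sup>2) + (- u\<^sup>2 * (norm z)\<^sup>2 / y\<^sup>2)))"
      unfolding exp_add power_mult_distrib by (simp only: mult_ac)
    also have "(- u\<^sup>2 - (m * y / 2)\<^sup>2 / u\<^sup>2) + (- u\<^sup>2 * (norm z)\<^sup>2 / y\<^sup>2) = - u\<^sup>2 * (1 + (norm z)\<^sup>2 / y\<^sup>2) - (m * y / 2)\<^sup>2 / u\<^sup>2"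
      by (simp add: algebra_simps)
    finally show ?thesis using True by simp
  qed (simp add: H_def)
  have n0: "norm (H u \<xi>) = exp (- ((y / (2 * u))\<^sup>2 * (norm \<xi>)\<^sup>2)) * (indicator {0<..} u * exp (- u\<^sup>2 - (m * y / 2)\<^sup>2 / u\<^sup>2))" for u \<xi>
    unfolding He norm_mult by (simp add: norm_mult)
  \<comment> \<open>Absolute integrability for Fubini: the Gaussian in \<open>\<xi>\<close> has mass
    proportional to \<open>u ^ DIM('a)\<close>, which a Gaussian moment in \<open>u\<close>
    absorbs.\<close>
  have HN: "(LINT \<xi>|lborel. norm (H u \<xi>)) = (2 * sqrt pi / y) ^ DIM('a) * (indicator {0<..} u * (u ^ DIM('a) * exp (- u\<^sup>2 - (m * y / 2)\<^sup>2 / u\<^sup>2)))" for u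
  proof (cases "0 < u")
    case True
    have 1: "sqrt pi / (y / (2 * u)) = (2 * sqrt pi / y) * u"
      using True y by (simp add: field_simps)
    show ?thesis
      unfolding n0 integral_mult_left_zero gaussian_integral(2)[OF k[OF True]] 1 power_mult_distrib using True by simp
  qed (simp add: H_def)
  have HH: "integrable (lborel \<Otimes>\<^sub>M lborel) (case_prod H)"
  proof (rule lborel_pair.Fubini_integrable[OF Hm])
    have "integrable lborel (\<lambda>u. (2 * sqrt pi / y) ^ DIM('a) * (indicator {0<..} u * (u ^ DIM('a) * exp (- u\<^sup>2 - (m * y / 2)\<^sup>2 / u\<^sup>2))))"
    proof (rule integrable_mult_right, rule Bochner_Integration.integrable_bound[OF gaussian_moment_integrable[of "DIM('a)"]])
      show "AE u in lborel. norm (indicator {0<..} u * (u ^ DIM('a) * exp (- u\<^sup>2 - (m * y / 2)\<^sup>2 / u\<^sup>2)))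
         \<le> norm (indicator {0<..} u * (u ^ DIM('a) * exp (- u\<^sup>2)))"
        by (rule AE_I2) (auto simp: indicator_def abs_mult intro!: mult_left_mono)
    qed measurable
    then show "integrable lborel (\<lambda>x. LINT y|lborel. norm (case_prod H (x, y)))"
      unfolding case_prod_conv HN .
  qed (use Hi in simp)
  have Hs: "(LINT u|lborel. H u \<xi>) = complex_of_real (sqrt pi / 2) * (cis (- (z \<bullet> \<xi>)) * complex_of_real (exp (- y * massive_symbol m \<xi>)))" for \<xi>
    unfolding H_def integral_mult_right_zero integral_complex_of_real subordination_symbol[OF y]
    by (simp only: of_real_mult mult_ac)
  have "integrable lborel (\<lambda>\<xi>. LINT u|lborel. H u \<xi>)"
    by (rule lborel_pair.integrable_snd[OF HH])
  then have i: "integrable lborel (\<lambda>\<xi>. complex_of_real (2 / sqrt pi) * (LINT u|lborel. H u \<xi>))"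
    by (rule integrable_mult_right)
  have "complex_of_real (2 / sqrt pi) * (complex_of_real (sqrt pi / 2) * x) = x" for x
    by simp
  with i show "integrable lborel (\<lambda>\<xi>::'a. cis (- (z \<bullet> \<xi>)) * complex_of_real (exp (- y * massive_symbol m \<xi>)))"
    unfolding Hs by (simp only:)
  have "(LINT \<xi>|lborel. LINT u|lborel. H u \<xi>) = (LINT u|lborel. LINT \<xi>|lborel. H u \<xi>)"
    by (rule lborel_pair.Fubini_integral[OF HH])
  then have "complex_of_real (sqrt pi / 2) * (LINT \<xi>|lborel. cis (- (z \<bullet> \<xi>)) * complex_of_real (exp (- y * massive_symbol m \<xi>)))
     = complex_of_real ((2 * pi) ^ DIM('a) * (sqrt pi / 2 * massive_kernel m y z))"
    unfolding Hs HI integral_mult_right_zero integral_complex_of_real massive_kernel_def by simp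
  then show "(LINT \<xi>|lborel. cis (- (z \<bullet> \<xi>)) * complex_of_real (exp (- y * massive_symbol m \<xi>)))
       = complex_of_real ((2 * pi) ^ DIM('a) * massive_kernel m y z)"
    by (simp add: field_simps)
qed

lemma massive_symbol_exp_integrable:
  assumes "0 < y"
  shows "integrable lborel (\<lambda>\<xi>::'a::euclidean_space. exp (- y * massive_symbol m \<xi>))"
  using massive_symbol_fourier(1)[OF assms, of "0::'a" m]
  by (simp only: inner_zero_left minus_zero cis_zero mult_1 complex_of_real_integrable_eq)

section \<open>Sign, size and mass of the kernel\<close>

lemma massive_kernel_measurable [measurable]:
  "(\<lambda>p. massive_kernel m (fst p) (snd p :: 'a::euclidean_space)) \<in> borel_measurable (borel \<Otimes>\<^sub>M borel)"
  unfolding massive_kernel_def by measurable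

lemma massive_kernel_pos:
  assumes "0 < y"
  shows "0 < massive_kernel m y (z::'a::euclidean_space)"
proof -
  let ?f = "\<lambda>u. indicator {0<..} u *
     ((u / (sqrt pi * y)) ^ DIM('a) * exp (- u\<^sup>2 * (1 + (norm z)\<^sup>2 / y\<^sup>2) - (m * y / 2)\<^sup>2 / u\<^sup>2))"
  have i: "integrable lborel ?f" by (rule massive_kernel_integrand_integrable[OF assms])
  have nn: "0 \<le> ?f u" for u using assms by (auto simp: indicator_def)
  have "(LINT u|lborel. ?f u) \<noteq> 0"
  proof
    assume "(LINT u|lborel. ?f u) = 0"
    then have "AE u in lborel. ?f u = 0"
      using integral_nonneg_eq_0_iff_AE[OF i] nn by blast
    then have "AE u in lborel. u \<notin> {0::real<..<1}"
      by eventually_elim (use assms in \<open>auto simp: indicator_def split: if_splits\<close>)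
    then have "emeasure lborel {0::real<..<1} = 0"
      by (subst (asm) AE_iff_measurable[of "{0<..<1}"]) auto
    then show False by simp
  qed
  moreover have "0 \<le> (LINT u|lborel. ?f u)" using nn by (rule Bochner_Integration.integral_nonneg)
  ultimately show ?thesis by (simp add: massive_kernel_def)
qed

lemma massive_kernel_le_zero:
  assumes "0 < y"
  shows "massive_kernel m y (z::'a::euclidean_space) \<le> massive_kernel m y (0::'a)"
  unfolding massive_kernel_def
proof (rule mult_left_mono, rule integral_mono[OF massive_kernel_integrand_integrable massive_kernel_integrand_integrable, OF assms assms])
  fix u :: real
  show "indicator {0<..} u * ((u / (sqrt pi * y)) ^ DIM('a) * exp (- u\<^sup>2 * (1 + (norm z)\<^sup>2 / y\<^sup>2) - (m * y / 2)\<^sup>2 / u\<^sup>2))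
     \<le> indicator {0<..} u * ((u / (sqrt pi * y)) ^ DIM('a) * exp (- u\<^sup>2 * (1 + (norm (0::'a))\<^sup>2 / y\<^sup>2) - (m * y / 2)\<^sup>2 / u\<^sup>2))"
    using assms by (auto simp: indicator_def intro!: mult_left_mono)
qed simp

text \<open>The mass term breaks exact scaling, but dropping it from the exponent bounds the kernel
  by a dilation of one fixed integrable profile, the massless kernel at height 1. After rescaling
  \<open>z\<close> by \<open>y\<close> the majorant no longer depends on \<open>y\<close>.\<close>

lemma massive_kernel_le_scaled:
  assumes "0 < y"
  shows "massive_kernel m y (z::'a::euclidean_space) \<le> (1 / y) ^ DIM('a) * massive_kernel 0 1 ((1 / y) *\<^sub>R z)"
proof -
  have "(LINT u|lborel. indicator {0<..} u *
     ((u / (sqrt pi * y)) ^ DIM('a) * exp (- u\<^sup>2 * (1 + (norm z)\<^sup>2 / y\<^sup>2) - (m * y / 2)\<^sup>2 / u\<^sup>2)))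
     \<le> (LINT u|lborel. (1 / y) ^ DIM('a) * (indicator {0<..} u *
     ((u / (sqrt pi * 1)) ^ DIM('a) * exp (- u\<^sup>2 * (1 + (norm ((1 / y) *\<^sub>R z))\<^sup>2 / 1\<^sup>2) - (0 * 1 / 2)\<^sup>2 / u\<^sup>2))))"
  proof (intro integral_mono integrable_mult_right massive_kernel_integrand_integrable assms)
    fix u :: real
    show "indicator {0<..} u *
     ((u / (sqrt pi * y)) ^ DIM('a) * exp (- u\<^sup>2 * (1 + (norm z)\<^sup>2 / y\<^sup>2) - (m * y / 2)\<^sup>2 / u\<^sup>2))
     \<le> (1 / y) ^ DIM('a) * (indicator {0<..} u *
     ((u / (sqrt pi * 1)) ^ DIM('a) * exp (- u\<^sup>2 * (1 + (norm ((1 / y) *\<^sub>R z))\<^sup>2 / 1\<^sup>2) - (0 * 1 / 2)\<^sup>2 / u\<^sup>2)))"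
    proof (cases "0 < u")
      case True
      have "u / (sqrt pi * y) = (1 / y) * (u / (sqrt pi * 1))" by simp
      then have 1: "(u / (sqrt pi * y)) ^ DIM('a) = (1 / y) ^ DIM('a) * (u / (sqrt pi * 1)) ^ DIM('a)"
        by (simp only: power_mult_distrib)
      have "exp (- u\<^sup>2 * (1 + (norm z)\<^sup>2 / y\<^sup>2) - (m * y / 2)\<^sup>2 / u\<^sup>2)
          \<le> exp (- u\<^sup>2 * (1 + (norm ((1 / y) *\<^sub>R z))\<^sup>2 / 1\<^sup>2) - (0 * 1 / 2)\<^sup>2 / u\<^sup>2)"
        by (simp add: power_divide)
      then show ?thesis using True assms unfolding 1 mult.assoc
        by (auto intro!: mult_left_mono simp del: exp_le_cancel_iff)
    qed simp
  qed simp
  then have "2 / sqrt pi * (LINT u|lborel. indicator {0<..} u *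
     ((u / (sqrt pi * y)) ^ DIM('a) * exp (- u\<^sup>2 * (1 + (norm z)\<^sup>2 / y\<^sup>2) - (m * y / 2)\<^sup>2 / u\<^sup>2)))
     \<le> 2 / sqrt pi * (LINT u|lborel. (1 / y) ^ DIM('a) * (indicator {0<..} u *
     ((u / (sqrt pi * 1)) ^ DIM('a) * exp (- u\<^sup>2 * (1 + (norm ((1 / y) *\<^sub>R z))\<^sup>2 / 1\<^sup>2) - (0 * 1 / 2)\<^sup>2 / u\<^sup>2))))"
    by (rule mult_left_mono) simp
  then show ?thesis unfolding massive_kernel_def integral_mult_right_zero by (simp only: mult.left_commute)
qed

text \<open>Integrated first in \<open>z\<close>, the Gaussian cancels the power of \<open>u\<close>
  exactly, and the subordination integral with \<open>b = m * y / 2\<close> remains. The mass is the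
  value of \<open>exp (- y * massive_symbol m \<xi>)\<close> at \<open>\<xi> = 0\<close>.\<close>

lemma massive_kernel_integral:
  assumes y: "0 < y" and m: "0 \<le> m"
  shows "integrable lborel (massive_kernel m y :: 'a::euclidean_space \<Rightarrow> real)"
    "(LINT z|lborel. massive_kernel m y (z::'a)) = exp (- m * y)"
proof -
  define J where "J u z = indicator {0<..} u *
     ((u / (sqrt pi * y)) ^ DIM('a) * exp (- u\<^sup>2 * (1 + (norm (z::'a))\<^sup>2 / y\<^sup>2) - (m * y / 2)\<^sup>2 / u\<^sup>2))" for u z
  have Jm: "case_prod J \<in> borel_measurable (lborel \<Otimes>\<^sub>M lborel)"
    unfolding J_def case_prod_unfold by measurable
  have Je: "J u z = (indicator {0<..} u * (u / (sqrt pi * y)) ^ DIM('a) * exp (- u\<^sup>2 - (m * y / 2)\<^sup>2 / u\<^sup>2)) * exp (- ((u / y)\<^sup>2 * (norm z)\<^sup>2))" for u z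
  proof -
    have "- u\<^sup>2 * (1 + (norm z)\<^sup>2 / y\<^sup>2) - (m * y / 2)\<^sup>2 / u\<^sup>2 = (- u\<^sup>2 - (m * y / 2)\<^sup>2 / u\<^sup>2) + (- ((u / y)\<^sup>2 * (norm z)\<^sup>2))"
      by (simp add: power_divide algebra_simps)
    then show ?thesis by (simp only: J_def exp_add mult.assoc)
  qed
  have Ji: "integrable lborel (J u)" for u
  proof (cases "0 < u")
    case True
    then show ?thesis unfolding Je using y by (intro integrable_mult_right gaussian_integral(1)) simp
  qed (simp add: J_def[abs_def])
  have JI: "(LINT z|lborel. J u z) = indicator {0<..} u * exp (- u\<^sup>2 - (m * y / 2)\<^sup>2 / u\<^sup>2)" for u
  proof (cases "0 < u")
    case True
    then have uy: "0 < u / y" using y by simp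
    have "(u / (sqrt pi * y)) * (sqrt pi / (u / y)) = 1" using True y by simp
    then have "(u / (sqrt pi * y)) ^ DIM('a) * (sqrt pi / (u / y)) ^ DIM('a) = 1"
      by (simp only: power_mult_distrib[symmetric] power_one)
    then have "(1 * (u / (sqrt pi * y)) ^ DIM('a) * e) * (sqrt pi / (u / y)) ^ DIM('a) = 1 * e" for e :: real
      by (metis mult.assoc mult.commute mult_1)
    note 1 = this[of "exp (- u\<^sup>2 - (m * y / 2)\<^sup>2 / u\<^sup>2)"]
    show ?thesis
      unfolding Je integral_mult_right_zero gaussian_integral(2)[OF uy] indicator_simps(1)[OF iffD2[OF greaterThan_iff True]]
      by (rule 1)
  qed (simp add: J_def)
  have nn: "0 \<le> J u z" for u z using y by (auto simp: J_def indicator_def)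
  have HJ: "integrable (lborel \<Otimes>\<^sub>M lborel) (case_prod J)"
  proof (rule lborel_pair.Fubini_integrable[OF Jm])
    show "integrable lborel (\<lambda>u. LINT z|lborel. norm (case_prod J (u, z)))"
      using nn JI subordination_integral(1)[of "m * y / 2"] m y by simp
  qed (use Ji in simp)
  have K: "massive_kernel m y z = 2 / sqrt pi * (LINT u|lborel. J u z)" for z :: 'a
    by (simp only: massive_kernel_def J_def)
  show "integrable lborel (massive_kernel m y :: 'a \<Rightarrow> real)"
    unfolding K[abs_def] by (intro integrable_mult_right lborel_pair.integrable_snd[OF HJ])
  show "(LINT z|lborel. massive_kernel m y (z::'a)) = exp (- m * y)"
    unfolding K integral_mult_right_zero lborel_pair.Fubini_integral[OF HJ] JI
    using subordination_integral(2)[of "m * y / 2"] m y by (simp add: field_simps)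
qed

section \<open>The massive Poisson extension\<close>

definition massive_poisson :: "real \<Rightarrow> real \<Rightarrow> ('a::euclidean_space \<Rightarrow> real) \<Rightarrow> 'a \<Rightarrow> real" where
  "massive_poisson m y f x = (LINT z|lborel. massive_kernel m y (x - z) * f z)"

lemma massive_kernel_measurable' [measurable]:
  "massive_kernel m y \<in> borel_measurable (borel :: 'a::euclidean_space measure)"
  unfolding massive_kernel_def by measurable

lemma massive_kernel_minus: "massive_kernel m y (- z) = massive_kernel m y z"
  by (simp add: massive_kernel_def)

lemma nn_integral_massive_kernel:
  assumes "0 < y" "0 \<le> m"
  shows "(\<integral>\<^sup>+z. ennreal (massive_kernel m y (z::'a::euclidean_space)) \<partial>lborel) = ennreal (exp (- m * y))"
  by (subst nn_integral_eq_integral)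
     (auto simp: massive_kernel_integral[OF assms] less_imp_le[OF massive_kernel_pos[OF assms(1)]])

text \<open>The kernel is integrable and bounded by its value at 0, hence square integrable; a
  product of two square integrable functions is integrable.\<close>

lemma massive_kernel_times_integrable:
  fixes f :: "'a::euclidean_space \<Rightarrow> 'b::euclidean_space"
  assumes y: "0 < y" and m: "0 \<le> m" and f: "sq_integrable f"
  shows "integrable lborel (\<lambda>z. massive_kernel m y (x - z) *\<^sub>R f z)"
proof -
  have [measurable]: "f \<in> borel_measurable borel" using f by (simp add: sq_integrable_def)
  let ?k = "\<lambda>z. massive_kernel m y (x - z)"
  have pos: "0 \<le> massive_kernel m y z" for z :: 'a using massive_kernel_pos[OF y, of m z] by simp
  have ik: "integrable lborel ?k"
  proof -
    have "integrable lborel (\<lambda>z. massive_kernel m y (x + (-1) *\<^sub>R z))"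
      by (subst lborel_integrable_affine_iff) (use massive_kernel_integral(1)[OF y m] in auto)
    then show ?thesis by simp
  qed
  show ?thesis
  proof (rule Bochner_Integration.integrable_bound)
    show "integrable lborel (\<lambda>z. massive_kernel m y (0::'a) * ?k z + (norm (f z))\<^sup>2)"
      using ik f by (intro Bochner_Integration.integrable_add integrable_mult_right) (auto simp: sq_integrable_def)
    have "norm (?k z *\<^sub>R f z) \<le> norm (massive_kernel m y (0::'a) * ?k z + (norm (f z))\<^sup>2)" for z
    proof -
      have "?k z * norm (f z) \<le> (?k z)\<^sup>2 + (norm (f z))\<^sup>2"
        using sum_squares_bound[of "?k z" "norm (f z)"] pos[of "x - z"]
          mult_nonneg_nonneg[OF pos[of "x - z"] norm_ge_zero[of "f z"]] by linarith
      also have "(?k z)\<^sup>2 \<le> massive_kernel m y (0::'a) * ?k z"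
        unfolding power2_eq_square by (intro mult_right_mono massive_kernel_le_zero y pos)
      finally show ?thesis using pos by simp
    qed
    then show "AE z in lborel. norm (?k z *\<^sub>R f z) \<le> norm (massive_kernel m y (0::'a) * ?k z + (norm (f z))\<^sup>2)"
      by (rule AE_I2)
  qed measurable
qed

lemma massive_kernel_shift_integral:
  assumes "0 < y" "0 \<le> m"
  shows "integrable lborel (\<lambda>z. massive_kernel m y (x - z :: 'a::euclidean_space))"
    "(LINT z|lborel. massive_kernel m y (x - z :: 'a)) = exp (- m * y)"
proof -
  have "integrable lborel (\<lambda>z. massive_kernel m y (x + (-1) *\<^sub>R z))"
    by (subst lborel_integrable_affine_iff) (use massive_kernel_integral(1)[OF assms] in auto)
  then show "integrable lborel (\<lambda>z. massive_kernel m y (x - z))" by simp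
  show "(LINT z|lborel. massive_kernel m y (x - z :: 'a)) = exp (- m * y)"
    by (subst lborel_integral_reflect) (simp_all add: massive_kernel_integral(2)[OF assms])
qed

lemma massive_poisson_measurable:
  fixes f :: "'a::euclidean_space \<Rightarrow> real"
  assumes [measurable]: "f \<in> borel_measurable borel"
  shows "(\<lambda>p. massive_poisson m (snd p) f (fst p)) \<in> borel_measurable (borel \<Otimes>\<^sub>M borel)"
proof -
  have 1: "(\<lambda>q. massive_kernel m (snd (fst q)) (fst (fst q) - snd q :: 'a))
      \<in> borel_measurable ((borel \<Otimes>\<^sub>M borel) \<Otimes>\<^sub>M lborel)"
    using measurable_compose[of "\<lambda>q. (snd (fst q), fst (fst q) - snd q)" "(borel \<Otimes>\<^sub>M borel) \<Otimes>\<^sub>M lborel"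
        "borel \<Otimes>\<^sub>M borel", OF _ massive_kernel_measurable[of m]] by simp
  show ?thesis unfolding massive_poisson_def
    by (rule lborel.borel_measurable_lebesgue_integral) (use 1 in \<open>simp add: case_prod_unfold\<close>)
qed

lemma massive_poisson_bound:
  fixes f :: "'a::euclidean_space \<Rightarrow> real"
  assumes y: "0 < y" and m: "0 \<le> m" and f: "sq_integrable f" and M: "AE x in lborel. \<bar>f x\<bar> \<le> M" and "0 \<le> M"
  shows "\<bar>massive_poisson m y f x\<bar> \<le> M"
proof -
  have i: "integrable lborel (\<lambda>z. massive_kernel m y (x - z) * f z)"
    using massive_kernel_times_integrable[OF y m f, of x] by simp
  have "\<bar>massive_poisson m y f x\<bar> \<le> (LINT z|lborel. \<bar>massive_kernel m y (x - z) * f z\<bar>)"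
    unfolding massive_poisson_def by (rule integral_abs_bound)
  also have "\<dots> \<le> (LINT z|lborel. massive_kernel m y (x - z) * M)"
  proof (rule integral_mono_AE)
    show "AE z in lborel. \<bar>massive_kernel m y (x - z) * f z\<bar> \<le> massive_kernel m y (x - z) * M"
      using M by eventually_elim
        (simp add: abs_mult abs_of_pos massive_kernel_pos[OF y] less_imp_le[OF massive_kernel_pos[OF y]] mult_left_mono)
  qed (use i massive_kernel_shift_integral(1)[OF y m] in auto)
  also have "\<dots> = exp (- m * y) * M"
    using massive_kernel_shift_integral(2)[OF y m, of x] by simp
  also have "\<dots> \<le> 1 * M" using y m \<open>0 \<le> M\<close> by (intro mult_right_mono) auto
  finally show ?thesis by simp
qed

text \<open>The kernel is positive at every point, so positivity of \<open>f\<close> almost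
  everywhere becomes strict positivity at each interior point.\<close>

lemma massive_poisson_pos:
  fixes f :: "'a::euclidean_space \<Rightarrow> real"
  assumes y: "0 < y" and m: "0 \<le> m" and f: "sq_integrable f" and pos: "AE x in lborel. 0 < f x"
  shows "0 < massive_poisson m y f x"
proof -
  let ?g = "\<lambda>z. massive_kernel m y (x - z) * f z"
  have i: "integrable lborel ?g"
    using massive_kernel_times_integrable[OF y m f, of x] by simp
  have gp: "AE z in lborel. 0 < ?g z"
    using pos by eventually_elim (simp add: massive_kernel_pos[OF y])
  have nn: "AE z in lborel. 0 \<le> ?g z" using gp by eventually_elim simp
  have "(LINT z|lborel. ?g z) \<noteq> 0"
  proof
    assume "(LINT z|lborel. ?g z) = 0"
    then have "AE z in lborel. ?g z = 0"
      using integral_nonneg_eq_0_iff_AE[OF i nn] by blast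
    with gp have "AE z in (lborel :: 'a measure). False" by eventually_elim simp
    then have "emeasure lborel (UNIV :: 'a set) = 0" by (subst (asm) AE_iff_measurable[of UNIV]) auto
    then show False by simp
  qed
  moreover have "0 \<le> (LINT z|lborel. ?g z)" using nn by (rule integral_nonneg_AE)
  ultimately show ?thesis unfolding massive_poisson_def by simp
qed

section \<open>\<open>L\<^sup>2\<close> bounds for the Poisson extension and its limit at the
  boundary\<close>

lemma massive_poisson_le_nn:
  fixes f :: "'a::euclidean_space \<Rightarrow> real"
  assumes y: "0 < y" and m: "0 \<le> m" and f: "sq_integrable f"
  shows "ennreal \<bar>massive_poisson m y f x\<bar> \<le> (\<integral>\<^sup>+z. ennreal (massive_kernel m y (x - z)) * ennreal \<bar>f z\<bar> \<partial>lborel)"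
proof -
  have i: "integrable lborel (\<lambda>z. massive_kernel m y (x - z) * f z)"
    using massive_kernel_times_integrable[OF y m f, of x] by simp
  have "ennreal \<bar>massive_poisson m y f x\<bar> \<le> (\<integral>\<^sup>+z. ennreal (norm (massive_kernel m y (x - z) * f z)) \<partial>lborel)"
    unfolding massive_poisson_def using integral_norm_bound_ennreal[OF i] by simp
  also have "\<dots> = (\<integral>\<^sup>+z. ennreal (massive_kernel m y (x - z)) * ennreal \<bar>f z\<bar> \<partial>lborel)"
  proof (rule nn_integral_cong)
    fix z
    have "0 \<le> massive_kernel m y (x - z)" using massive_kernel_pos[OF y, of m "x - z"] by simp
    then show "ennreal (norm (massive_kernel m y (x - z) * f z)) = ennreal (massive_kernel m y (x - z)) * ennreal \<bar>f z\<bar>"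
      by (simp add: abs_mult ennreal_mult)
  qed
  finally show ?thesis .
qed

text \<open>Young's inequality with the squared kernel mass. The exponential decay in
  \<open>y\<close> is what later gives square integrability over the half-space.\<close>

lemma massive_poisson_L2:
  fixes f :: "'a::euclidean_space \<Rightarrow> real"
  assumes y: "0 < y" and m: "0 \<le> m" and f: "sq_integrable f"
  shows "(\<integral>\<^sup>+x. ennreal ((massive_poisson m y f x)\<^sup>2) \<partial>lborel) \<le> ennreal (exp (- (2 * m * y))) * (\<integral>\<^sup>+x. ennreal ((f x)\<^sup>2) \<partial>lborel)"
proof -
  have [measurable]: "f \<in> borel_measurable borel" using f by (simp add: sq_integrable_def)
  have "(\<integral>\<^sup>+x. ennreal ((massive_poisson m y f x)\<^sup>2) \<partial>lborel)
      \<le> (\<integral>\<^sup>+x. (\<integral>\<^sup>+z. ennreal (massive_kernel m y (x - z)) * ennreal \<bar>f z\<bar> \<partial>lborel)\<^sup>2 \<partial>lborel)"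
  proof (rule nn_integral_mono)
    fix x
    have "ennreal ((massive_poisson m y f x)\<^sup>2) = (ennreal \<bar>massive_poisson m y f x\<bar>)\<^sup>2"
      by (simp add: ennreal_power)
    then show "ennreal ((massive_poisson m y f x)\<^sup>2) \<le> (\<integral>\<^sup>+z. ennreal (massive_kernel m y (x - z)) * ennreal \<bar>f z\<bar> \<partial>lborel)\<^sup>2"
      by (simp only:) (intro power_mono massive_poisson_le_nn assms, simp)
  qed
  also have "\<dots> \<le> (\<integral>\<^sup>+x. ennreal (massive_kernel m y (x::'a)) \<partial>lborel)\<^sup>2 * (\<integral>\<^sup>+x. (ennreal \<bar>f x\<bar>)\<^sup>2 \<partial>lborel)"
    by (rule Young_L1_L2) (use less_imp_le[OF massive_kernel_pos[OF y]] in auto)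
  also have "\<dots> = ennreal (exp (- (2 * m * y))) * (\<integral>\<^sup>+x. ennreal ((f x)\<^sup>2) \<partial>lborel)"
    by (simp add: nn_integral_massive_kernel[OF y m] ennreal_power exp_double[symmetric] mult.assoc)
  finally show ?thesis .
qed

text \<open>The kernel has mass \<open>exp (- m * y)\<close> instead of 1, so the error splits into
  a mean of \<open>f z - f x\<close> and the term \<open>(1 - exp (- m * y)) * f x\<close>. The
  first is controlled by the kernel mean of the squared \<open>L\<^sup>2\<close> modulus of
  continuity \<open>w\<close>, which tends to 0 by domination after rescaling.\<close>

lemma massive_poisson_tendsto_L2:
  fixes f :: "'a::euclidean_space \<Rightarrow> real"
  assumes m: "0 \<le> m" and f: "sq_integrable f" and y: "\<And>n. 0 < y n" "y \<longlonglongrightarrow> 0"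
  shows "(\<lambda>n. \<integral>\<^sup>+x. ennreal ((massive_poisson m (y n) f x - f x)\<^sup>2) \<partial>lborel) \<longlonglongrightarrow> 0"
proof -
  have [measurable]: "f \<in> borel_measurable borel" using f by (simp add: sq_integrable_def)
  define N where "N = (\<integral>\<^sup>+x. ennreal ((f x)\<^sup>2) \<partial>lborel)"
  have N: "N < \<infinity>" unfolding N_def by (rule nn_integral_sq_finite[OF f])
  define w where "w z = (\<integral>\<^sup>+x. ennreal ((f (x - z) - f x)\<^sup>2) \<partial>lborel)" for z
  have [measurable]: "w \<in> borel_measurable borel" unfolding w_def by measurable
  have w4: "w z \<le> 4 * N" for z
  proof -
    have "w z \<le> (\<integral>\<^sup>+x. 2 * ennreal ((f (x - z))\<^sup>2) + 2 * ennreal ((f x)\<^sup>2) \<partial>lborel)"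
      unfolding w_def
    proof (rule nn_integral_mono)
      fix x
      have "(f (x - z) - f x)\<^sup>2 \<le> 2 * (f (x - z))\<^sup>2 + 2 * (f x)\<^sup>2"
        using zero_le_power2[of "f (x - z) + f x"] by (simp add: power2_eq_square algebra_simps)
      then have "ennreal ((f (x - z) - f x)\<^sup>2) \<le> ennreal (2 * (f (x - z))\<^sup>2 + 2 * (f x)\<^sup>2)" by (rule ennreal_leI)
      then show "ennreal ((f (x - z) - f x)\<^sup>2) \<le> 2 * ennreal ((f (x - z))\<^sup>2) + 2 * ennreal ((f x)\<^sup>2)"
        by (simp add: ennreal_mult)
    qed
    also have "\<dots> = 2 * (\<integral>\<^sup>+x. ennreal ((f (x - z))\<^sup>2) \<partial>lborel) + 2 * N"
      by (simp add: nn_integral_add nn_integral_cmult N_def)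
    also have "(\<integral>\<^sup>+x. ennreal ((f (x - z))\<^sup>2) \<partial>lborel) = N"
      using nn_integral_shift[of "\<lambda>x. ennreal ((f x)\<^sup>2)" "- z"] by (simp add: N_def)
    finally show ?thesis by (simp add: mult_2[symmetric] distrib_right[symmetric] flip: mult.assoc)
  qed
  have wlim: "(\<lambda>n. w (y n *\<^sub>R v)) \<longlonglongrightarrow> 0" for v
  proof -
    have "(\<lambda>n. - (y n *\<^sub>R v)) \<longlonglongrightarrow> - (0 *\<^sub>R v)" by (intro tendsto_intros y)
    then show ?thesis using L2_translation_tendsto[OF f, of "\<lambda>n. - (y n *\<^sub>R v)"] by (simp add: w_def)
  qed
  let ?p = "massive_kernel 0 1 :: 'a \<Rightarrow> real"
  have lim1: "(\<lambda>n. \<integral>\<^sup>+v. ennreal (?p v) * w (y n *\<^sub>R v) \<partial>lborel) \<longlonglongrightarrow> (\<integral>\<^sup>+v. 0 \<partial>(lborel :: 'a measure))"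
  proof (rule nn_integral_dominated_convergence[where w="\<lambda>v. ennreal (?p v) * (4 * N)"])
    have "(\<integral>\<^sup>+v. ennreal (?p v) * (4 * N) \<partial>lborel) = ennreal (exp (- 0 * 1)) * (4 * N)"
      by (subst nn_integral_multc) (simp_all add: nn_integral_massive_kernel)
    then show "(\<integral>\<^sup>+v. ennreal (?p v) * (4 * N) \<partial>lborel) < \<infinity>"
      using N by (simp add: ennreal_mult_less_top)
    show "AE v in lborel. ennreal (?p v) * w (y n *\<^sub>R v) \<le> ennreal (?p v) * (4 * N)" for n
      by (intro AE_I2 mult_left_mono w4) simp
    show "AE v in lborel. (\<lambda>n. ennreal (?p v) * w (y n *\<^sub>R v)) \<longlonglongrightarrow> 0"
      using ennreal_tendsto_cmult[OF _ wlim] by (intro AE_I2) simp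
  qed measurable
  \<comment> \<open>The dilation factor \<open>(1 / y n) ^ DIM('a)\<close> of the scaled profile
    cancels against the Jacobian of the substitution \<open>z = y n *\<^sub>R v\<close>.\<close>
  have 1: "(\<integral>\<^sup>+z. ennreal (massive_kernel m (y n) z) * w z \<partial>lborel) \<le> (\<integral>\<^sup>+v. ennreal (?p v) * w (y n *\<^sub>R v) \<partial>lborel)" for n
  proof -
    have yn: "0 < y n" by (rule y)
    have "(\<integral>\<^sup>+z. ennreal (massive_kernel m (y n) z) * w z \<partial>lborel)
        \<le> (\<integral>\<^sup>+z. ennreal ((1 / y n) ^ DIM('a)) * (ennreal (?p ((1 / y n) *\<^sub>R z)) * w z) \<partial>lborel)"
    proof (rule nn_integral_mono)
      fix z :: 'a
      have "ennreal (massive_kernel m (y n) z) \<le> ennreal ((1 / y n) ^ DIM('a) * ?p ((1 / y n) *\<^sub>R z))"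
        by (intro ennreal_leI massive_kernel_le_scaled yn)
      also have "\<dots> = ennreal ((1 / y n) ^ DIM('a)) * ennreal (?p ((1 / y n) *\<^sub>R z))"
        using yn less_imp_le[OF massive_kernel_pos[of 1 0 "(1 / y n) *\<^sub>R z"]] by (intro ennreal_mult) auto
      finally show "ennreal (massive_kernel m (y n) z) * w z \<le> ennreal ((1 / y n) ^ DIM('a)) * (ennreal (?p ((1 / y n) *\<^sub>R z)) * w z)"
        unfolding mult.assoc[symmetric] by (rule mult_right_mono) simp
    qed
    also have "\<dots> = ennreal ((1 / y n) ^ DIM('a)) * (\<integral>\<^sup>+z. ennreal (?p ((1 / y n) *\<^sub>R z)) * w z \<partial>lborel)"
      by (rule nn_integral_cmult) measurable
    also have "(\<integral>\<^sup>+z. ennreal (?p ((1 / y n) *\<^sub>R z)) * w z \<partial>lborel)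
        = ennreal (\<bar>y n\<bar> ^ DIM('a)) * (\<integral>\<^sup>+v. ennreal (?p v) * w (y n *\<^sub>R v) \<partial>lborel)"
      using nn_integral_lborel_affine[of "\<lambda>z. ennreal (?p ((1 / y n) *\<^sub>R z)) * w z" "y n" 0] yn by simp
    also have "ennreal ((1 / y n) ^ DIM('a)) * (ennreal (\<bar>y n\<bar> ^ DIM('a)) * X) = X" for X
    proof -
      have "(1 / y n) ^ DIM('a) * \<bar>y n\<bar> ^ DIM('a) = 1" using yn by (simp add: power_mult_distrib[symmetric])
      then show ?thesis using yn by (simp add: mult.assoc[symmetric] ennreal_mult[symmetric])
    qed
    finally show ?thesis .
  qed
  have main: "(\<integral>\<^sup>+x. ennreal ((massive_poisson m (y n) f x - f x)\<^sup>2) \<partial>lborel)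
      \<le> 2 * (\<integral>\<^sup>+v. ennreal (?p v) * w (y n *\<^sub>R v) \<partial>lborel) + ennreal (2 * (1 - exp (- m * y n))\<^sup>2) * N" for n
  proof -
    have yn: "0 < y n" by (rule y)
    let ?k = "massive_kernel m (y n) :: 'a \<Rightarrow> real"
    have kp: "0 \<le> ?k z" for z using massive_kernel_pos[OF yn, of m z] by simp
    let ?D = "\<lambda>x. \<integral>\<^sup>+z. ennreal (?k z) * ennreal \<bar>f (x - z) - f x\<bar> \<partial>lborel"
    have pt: "ennreal ((massive_poisson m (y n) f x - f x)\<^sup>2)
        \<le> 2 * (?D x)\<^sup>2 + ennreal (2 * (1 - exp (- m * y n))\<^sup>2) * ennreal ((f x)\<^sup>2)" for x
    proof -
      have i: "integrable lborel (\<lambda>z. ?k (x - z) * f z)"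
        using massive_kernel_times_integrable[OF yn m f, of x] by simp
      have ik: "integrable lborel (\<lambda>z. ?k (x - z))" by (rule massive_kernel_shift_integral[OF yn m])
      have id: "integrable lborel (\<lambda>z. ?k (x - z) * (f z - f x))"
        using i ik by (simp add: right_diff_distrib)
      have e: "massive_poisson m (y n) f x - f x
          = (LINT z|lborel. ?k (x - z) * (f z - f x)) - (1 - exp (- m * y n)) * f x"
        using i ik massive_kernel_shift_integral(2)[OF yn m, of x]
        by (simp add: massive_poisson_def right_diff_distrib algebra_simps)
      let ?I = "LINT z|lborel. ?k (x - z) * (f z - f x)"
      have "ennreal \<bar>?I\<bar> \<le> (\<integral>\<^sup>+z. ennreal (norm (?k (x - z) * (f z - f x))) \<partial>lborel)"
        using integral_norm_bound_ennreal[OF id] by simp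
      also have "\<dots> = (\<integral>\<^sup>+z. ennreal (?k z) * ennreal \<bar>f (x - z) - f x\<bar> \<partial>lborel)"
        using nn_integral_reflect[of "\<lambda>z. ennreal (?k z) * ennreal \<bar>f (x - z) - f x\<bar>" x] kp
        by (simp add: abs_mult ennreal_mult)
      finally have I: "ennreal \<bar>?I\<bar> \<le> ?D x" .
      have "(massive_poisson m (y n) f x - f x)\<^sup>2 \<le> 2 * ?I\<^sup>2 + 2 * (1 - exp (- m * y n))\<^sup>2 * (f x)\<^sup>2"
        unfolding e using zero_le_power2[of "?I + (1 - exp (- m * y n)) * f x"]
        by (simp add: power2_eq_square algebra_simps)
      then have "ennreal ((massive_poisson m (y n) f x - f x)\<^sup>2) \<le> ennreal (2 * ?I\<^sup>2 + 2 * (1 - exp (- m * y n))\<^sup>2 * (f x)\<^sup>2)"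
        by (rule ennreal_leI)
      also have "\<dots> = 2 * (ennreal \<bar>?I\<bar>)\<^sup>2 + ennreal (2 * (1 - exp (- m * y n))\<^sup>2) * ennreal ((f x)\<^sup>2)"
        by (simp add: ennreal_power ennreal_mult)
      also have "\<dots> \<le> 2 * (?D x)\<^sup>2 + ennreal (2 * (1 - exp (- m * y n))\<^sup>2) * ennreal ((f x)\<^sup>2)"
        by (intro add_mono mult_left_mono power_mono I) auto
      finally show ?thesis .
    qed
    \<comment> \<open>Cauchy-Schwarz against the kernel, whose mass is at most 1.\<close>
    have D: "(?D x)\<^sup>2 \<le> (\<integral>\<^sup>+z. ennreal (?k z) * ennreal ((f (x - z) - f x)\<^sup>2) \<partial>lborel)" for x
    proof -
      have "(?D x)\<^sup>2 \<le> (\<integral>\<^sup>+z. ennreal (?k z) \<partial>lborel) * (\<integral>\<^sup>+z. ennreal (?k z) * (ennreal \<bar>f (x - z) - f x\<bar>)\<^sup>2 \<partial>lborel)"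
        by (rule nn_integral_weighted_Cauchy_Schwarz) (use kp in auto)
      also have "\<dots> \<le> 1 * (\<integral>\<^sup>+z. ennreal (?k z) * (ennreal \<bar>f (x - z) - f x\<bar>)\<^sup>2 \<partial>lborel)"
        using yn m by (intro mult_right_mono) (auto simp: nn_integral_massive_kernel[OF yn m] simp del: ennreal_1 simp flip: ennreal_1 intro!: ennreal_leI)
      finally show ?thesis by (simp add: ennreal_power)
    qed
    have "(\<integral>\<^sup>+x. ennreal ((massive_poisson m (y n) f x - f x)\<^sup>2) \<partial>lborel)
      \<le> (\<integral>\<^sup>+x. 2 * (\<integral>\<^sup>+z. ennreal (?k z) * ennreal ((f (x - z) - f x)\<^sup>2) \<partial>lborel)
           + ennreal (2 * (1 - exp (- m * y n))\<^sup>2) * ennreal ((f x)\<^sup>2) \<partial>lborel)"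
      by (intro nn_integral_mono order_trans[OF pt] add_mono mult_left_mono D) auto
    also have "\<dots> = 2 * (\<integral>\<^sup>+x. (\<integral>\<^sup>+z. ennreal (?k z) * ennreal ((f (x - z) - f x)\<^sup>2) \<partial>lborel) \<partial>lborel)
        + ennreal (2 * (1 - exp (- m * y n))\<^sup>2) * N"
      by (simp add: nn_integral_add nn_integral_cmult N_def)
    also have "(\<integral>\<^sup>+x. (\<integral>\<^sup>+z. ennreal (?k z) * ennreal ((f (x - z) - f x)\<^sup>2) \<partial>lborel) \<partial>lborel)
       = (\<integral>\<^sup>+z. (\<integral>\<^sup>+x. ennreal (?k z) * ennreal ((f (x - z) - f x)\<^sup>2) \<partial>lborel) \<partial>lborel)"
      by (rule lborel_pair.Fubini') measurable
    also have "\<dots> = (\<integral>\<^sup>+z. ennreal (?k z) * w z \<partial>lborel)"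
      unfolding w_def by (intro nn_integral_cong nn_integral_cmult) measurable
    also have "2 * \<dots> + ennreal (2 * (1 - exp (- m * y n))\<^sup>2) * N
       \<le> 2 * (\<integral>\<^sup>+v. ennreal (?p v) * w (y n *\<^sub>R v) \<partial>lborel) + ennreal (2 * (1 - exp (- m * y n))\<^sup>2) * N"
      by (intro add_mono mult_left_mono 1) auto
    finally show ?thesis .
  qed
  have "(\<lambda>n. 2 * (1 - exp (- m * y n))\<^sup>2) \<longlonglongrightarrow> 2 * (1 - exp (- m * 0))\<^sup>2"
    by (intro tendsto_intros y)
  then have l2: "(\<lambda>n. ennreal (2 * (1 - exp (- m * y n))\<^sup>2)) \<longlonglongrightarrow> 0"
    using tendsto_ennrealI by fastforce
  have l3: "(\<lambda>n. ennreal (2 * (1 - exp (- m * y n))\<^sup>2) * N) \<longlonglongrightarrow> 0"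
    using ennreal_tendsto_cmult[OF _ l2, of N] N by (simp add: mult.commute)
  have l4: "(\<lambda>n. 2 * (\<integral>\<^sup>+v. ennreal (?p v) * w (y n *\<^sub>R v) \<partial>lborel)) \<longlonglongrightarrow> 0"
    using ennreal_tendsto_cmult[of 2, OF _ lim1] by simp
  have "(\<lambda>n. 2 * (\<integral>\<^sup>+v. ennreal (?p v) * w (y n *\<^sub>R v) \<partial>lborel) + ennreal (2 * (1 - exp (- m * y n))\<^sup>2) * N) \<longlonglongrightarrow> 0 + 0"
    by (rule tendsto_add[OF l4 l3])
  then have l5: "(\<lambda>n. 2 * (\<integral>\<^sup>+v. ennreal (?p v) * w (y n *\<^sub>R v) \<partial>lborel) + ennreal (2 * (1 - exp (- m * y n))\<^sup>2) * N) \<longlonglongrightarrow> 0"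
    by simp
  show ?thesis
    by (rule tendsto_sandwich[OF eventuallyI eventuallyI tendsto_const l5]) (simp, rule main)
qed

lemma massive_poisson_has_trace:
  fixes f :: "'a::euclidean_space \<Rightarrow> real"
  assumes m: "0 \<le> m" and f: "sq_integrable f"
  shows "has_trace (\<lambda>p. massive_poisson m (snd p) f (fst p)) f"
  unfolding has_trace_def fst_conv snd_conv
proof (intro conjI allI impI)
  show "f \<in> borel_measurable lborel" using f by (simp add: sq_integrable_def)
  fix e :: real assume "0 < e"
  let ?I = "\<lambda>y. \<integral>\<^sup>+x. ennreal ((massive_poisson m y f x - f x)\<^sup>2) \<partial>lborel"
  have "(?I \<longlongrightarrow> 0) (at_right 0)"
    by (rule tendsto_at_right_sequentially[of 0 1])
       (auto intro!: massive_poisson_tendsto_L2[OF m f])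
  then have "\<forall>\<^sub>F y in at_right 0. ?I y < ennreal e"
    using \<open>0 < e\<close> by (intro order_tendstoD(2)) auto
  then obtain d where "d > 0" "\<And>y. 0 < y \<Longrightarrow> y < d \<Longrightarrow> ?I y < ennreal e"
    unfolding eventually_at_right_field by auto
  then show "\<exists>d>0. AE y in lborel. 0 < y \<and> y < d \<longrightarrow> ?I y < ennreal e"
    by (intro exI[of _ d]) auto
qed

section \<open>Fourier representation of the extension\<close>

text \<open>Real linear in \<open>p\<close>. Differentiating
  \<open>exp (massive_phase m \<xi> p)\<close> in direction \<open>q\<close> multiplies it by
  \<open>massive_phase m \<xi> q\<close>, so every derivative of a \<open>fourier_extension\<close>
  is again one, with a new density.\<close>

definition massive_phase :: "real \<Rightarrow> 'a::euclidean_space \<Rightarrow> 'a \<times> real \<Rightarrow> complex" where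
  "massive_phase m \<xi> p = Complex (- snd p * massive_symbol m \<xi>) (fst p \<bullet> \<xi>)"

definition fourier_extension :: "real \<Rightarrow> ('a::euclidean_space \<Rightarrow> complex) \<Rightarrow> 'a \<times> real \<Rightarrow> complex" where
  "fourier_extension m a p = (LINT \<xi>|lborel. a \<xi> * exp (massive_phase m \<xi> p))"

text \<open>Multiplication by the symbol can destroy square integrability. This larger class is
  stable under it, because every positive height leaves some decay to spend.\<close>

definition decaying_density :: "real \<Rightarrow> ('a::euclidean_space \<Rightarrow> complex) \<Rightarrow> bool" where
  "decaying_density m a \<longleftrightarrow> a \<in> borel_measurable borel \<and>
     (\<forall>y>0. integrable lborel (\<lambda>\<xi>. norm (a \<xi>) * exp (- y * massive_symbol m \<xi>)))"

lemma massive_phase_measurable [measurable]: "(\<lambda>\<xi>. massive_phase m \<xi> p) \<in> borel_measurable borel"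
proof -
  have "massive_phase m \<xi> p = complex_of_real (- snd p * massive_symbol m \<xi>) + \<i> * complex_of_real (fst p \<bullet> \<xi>)" for \<xi>
    by (simp add: massive_phase_def complex_eq_iff)
  then show ?thesis by simp
qed

lemma massive_phase_add: "massive_phase m \<xi> (p + q) = massive_phase m \<xi> p + massive_phase m \<xi> q"
  by (simp add: massive_phase_def complex_eq_iff algebra_simps inner_add_left)

lemma massive_phase_scaleR: "massive_phase m \<xi> (c *\<^sub>R p) = c *\<^sub>R massive_phase m \<xi> p"
  by (simp add: massive_phase_def complex_eq_iff)

lemma norm_le_massive_symbol: "norm \<xi> \<le> massive_symbol m \<xi>"
  by (rule real_le_rsqrt) simp

lemma norm_fst_snd_le: "norm (fst p) \<le> norm p" "norm (snd p) \<le> norm p"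
  by (metis norm_fst_le prod.collapse, metis norm_snd_le prod.collapse)

lemma norm_massive_phase: "norm (massive_phase m \<xi> p) \<le> 2 * massive_symbol m \<xi> * norm p"
proof -
  have "norm (massive_phase m \<xi> p) \<le> \<bar>- snd p * massive_symbol m \<xi>\<bar> + \<bar>fst p \<bullet> \<xi>\<bar>"
    using cmod_le[of "massive_phase m \<xi> p"] by (simp add: massive_phase_def)
  also have "\<bar>- snd p * massive_symbol m \<xi>\<bar> \<le> norm p * massive_symbol m \<xi>"
    using norm_fst_snd_le(2)[of p] by (simp add: abs_mult mult_right_mono)
  also have "\<bar>fst p \<bullet> \<xi>\<bar> \<le> norm p * massive_symbol m \<xi>"
    by (rule order_trans[OF Cauchy_Schwarz_ineq2 mult_mono[OF norm_fst_snd_le(1) norm_le_massive_symbol]]) simp_all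
  finally show ?thesis by (simp add: mult.commute mult.left_commute)
qed

lemma norm_exp_massive_phase: "norm (exp (massive_phase m \<xi> p)) = exp (- snd p * massive_symbol m \<xi>)"
  by (simp add: massive_phase_def)

text \<open>The series from order 2 on is compared termwise with the full series, since factorials
  increase.\<close>

lemma norm_exp_diff_quadratic: "norm (exp z - 1 - z) \<le> (norm z)\<^sup>2 * exp (norm z)" for z :: complex
proof -
  have s: "summable (\<lambda>n. inverse (fact n) *\<^sub>R (norm z) ^ n)" by (rule summable_exp_generic)
  have b: "norm (inverse (fact (n + 2)) *\<^sub>R z ^ (n + 2)) \<le> (norm z)\<^sup>2 * (inverse (fact n) *\<^sub>R (norm z) ^ n)" for n
  proof -
    have "(fact n :: real) \<le> fact (n + 2)" by (rule fact_mono) simp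
    then have "inverse (fact (n + 2)) \<le> (inverse (fact n) :: real)" by (rule le_imp_inverse_le) simp
    then have "inverse (fact (n + 2)) * (norm z ^ n * (norm z)\<^sup>2) \<le> inverse (fact n) * (norm z ^ n * (norm z)\<^sup>2)"
      by (rule mult_right_mono) simp
    then show ?thesis by (simp only: norm_scaleR norm_mult norm_power power_add abs_of_nonneg inverse_nonnegative_iff_nonnegative fact_ge_zero real_scaleR_def mult_ac)
  qed
  have "exp z - 1 - z = (\<Sum>n. inverse (fact (n + 2)) *\<^sub>R z ^ (n + 2))"
    unfolding exp_first_two_terms[of z] by simp
  also have "norm \<dots> \<le> (\<Sum>n. (norm z)\<^sup>2 * (inverse (fact n) *\<^sub>R (norm z) ^ n))"
    using b summable_mult[OF s] by (rule norm_suminf_le)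
  also have "\<dots> = (norm z)\<^sup>2 * exp (norm z)" unfolding exp_def by (rule suminf_mult[OF s])
  finally show ?thesis .
qed

lemma decaying_densityD:
  "decaying_density m a \<Longrightarrow> 0 < y \<Longrightarrow> integrable lborel (\<lambda>\<xi>. norm (a \<xi>) * exp (- y * massive_symbol m \<xi>))"
  by (simp add: decaying_density_def)

lemma decaying_density_integrable:
  assumes "decaying_density m a" "0 < snd p"
  shows "integrable lborel (\<lambda>\<xi>. a \<xi> * exp (massive_phase m \<xi> p))"
proof (rule Bochner_Integration.integrable_bound)
  have [measurable]: "a \<in> borel_measurable borel" using assms by (simp add: decaying_density_def)
  show "integrable lborel (\<lambda>\<xi>. norm (a \<xi>) * exp (- snd p * massive_symbol m \<xi>))"
    using assms by (simp add: decaying_density_def)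
  show "(\<lambda>\<xi>. a \<xi> * exp (massive_phase m \<xi> p)) \<in> borel_measurable lborel" by measurable
  show "AE \<xi> in lborel. norm (a \<xi> * exp (massive_phase m \<xi> p)) \<le> norm (norm (a \<xi>) * exp (- snd p * massive_symbol m \<xi>))"
    unfolding norm_mult norm_exp_massive_phase by simp
qed

text \<open>One factor \<open>s\<close> of the symbol costs half of the height:
  \<open>s \<le> 2 / y * exp (y / 2 * s)\<close>.\<close>

lemma decaying_density_bound:
  assumes "decaying_density m a" "b \<in> borel_measurable borel" "0 \<le> C"
    and "\<And>\<xi>. norm (b \<xi>) \<le> C * massive_symbol m \<xi> * norm (a \<xi>)"
  shows "decaying_density m b"
  unfolding decaying_density_def
proof (intro conjI allI impI)
  fix y :: real assume y: "0 < y"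
  have [measurable]: "b \<in> borel_measurable borel" by fact
  show "integrable lborel (\<lambda>\<xi>. norm (b \<xi>) * exp (- y * massive_symbol m \<xi>))"
  proof (rule Bochner_Integration.integrable_bound)
    show "integrable lborel (\<lambda>\<xi>. (2 * C / y) * (norm (a \<xi>) * exp (- (y / 2) * massive_symbol m \<xi>)))"
      using y by (intro integrable_mult_right decaying_densityD[OF assms(1)]) simp
    have "norm (b \<xi>) * exp (- y * massive_symbol m \<xi>) \<le> (2 * C / y) * (norm (a \<xi>) * exp (- (y / 2) * massive_symbol m \<xi>))" for \<xi>
    proof -
      let ?s = "massive_symbol m \<xi>"
      have "y / 2 * ?s \<le> exp (y / 2 * ?s)" using exp_ge_add_one_self[of "y / 2 * ?s"] by linarith
      then have "?s \<le> 2 / y * exp (y / 2 * ?s)" using y by (simp add: field_simps)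
      then have 1: "C * ?s * norm (a \<xi>) \<le> C * (2 / y * exp (y / 2 * ?s)) * norm (a \<xi>)"
        using assms(3) by (intro mult_right_mono mult_left_mono) auto
      have "norm (b \<xi>) * exp (- y * ?s) \<le> C * (2 / y * exp (y / 2 * ?s)) * norm (a \<xi>) * exp (- y * ?s)"
        by (intro mult_right_mono order_trans[OF assms(4) 1]) simp
      also have "\<dots> = (2 * C / y) * (norm (a \<xi>) * (exp (y / 2 * ?s) * exp (- y * ?s)))" by simp
      also have "exp (y / 2 * ?s) * exp (- y * ?s) = exp (- (y / 2) * ?s)"
        unfolding exp_add[symmetric] by (simp add: field_simps)
      finally show ?thesis .
    qed
    then show "AE \<xi> in lborel. norm (norm (b \<xi>) * exp (- y * massive_symbol m \<xi>)) \<le> norm ((2 * C / y) * (norm (a \<xi>) * exp (- (y / 2) * massive_symbol m \<xi>)))"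
      by (intro AE_I2) (smt (verit) exp_gt_zero mult_nonneg_nonneg norm_ge_zero real_norm_def)
  qed measurable
qed fact

lemma decaying_density_times_phase:
  assumes "decaying_density m a"
  shows "decaying_density m (\<lambda>\<xi>. a \<xi> * massive_phase m \<xi> q)"
proof (rule decaying_density_bound[OF assms, of _ "2 * norm q"])
  have [measurable]: "a \<in> borel_measurable borel" using assms by (simp add: decaying_density_def)
  show "(\<lambda>\<xi>. a \<xi> * massive_phase m \<xi> q) \<in> borel_measurable borel" by measurable
  show "norm (a \<xi> * massive_phase m \<xi> q) \<le> 2 * norm q * massive_symbol m \<xi> * norm (a \<xi>)" for \<xi>
    using mult_right_mono[OF norm_massive_phase[of m \<xi> q] norm_ge_zero[of "a \<xi>"]]
    by (simp add: norm_mult mult_ac)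
qed simp

text \<open>Taylor expansion of the exponential under the integral. For
  \<open>norm q \<le> snd p / 8\<close> the phase of \<open>q\<close> has norm at most
  \<open>snd p / 4\<close> times the symbol, and the squared symbol is at most
  \<open>32 / (snd p)\<^sup>2\<close> times an exponential of the same rate. The two exponentials
  use up half of the decay; the constant is \<open>128 = 4 * 32\<close>.\<close>

lemma fourier_extension_quadratic:
  fixes p :: "'a::euclidean_space \<times> real"
  assumes a: "decaying_density m a" and p: "0 < snd p"
  obtains C where "0 \<le> C" "\<And>q. norm q \<le> snd p / 8 \<Longrightarrow>
    norm (fourier_extension m a (p + q) - fourier_extension m a p
       - fourier_extension m (\<lambda>\<xi>. a \<xi> * massive_phase m \<xi> q) p) \<le> C * (norm q)\<^sup>2"
proof -
  let ?y = "snd p"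
  have [measurable]: "a \<in> borel_measurable borel" using a by (simp add: decaying_density_def)
  define C where "C = (LINT \<xi>|lborel. 128 / ?y\<^sup>2 * (norm (a \<xi>) * exp (- (?y / 2) * massive_symbol m \<xi>)))"
  have Ci: "integrable lborel (\<lambda>\<xi>. 128 / ?y\<^sup>2 * (norm (a \<xi>) * exp (- (?y / 2) * massive_symbol m \<xi>)))"
    using p by (intro integrable_mult_right decaying_densityD[OF a]) simp
  show ?thesis
  proof (rule that[of C])
    show "0 \<le> C" unfolding C_def by (intro Bochner_Integration.integral_nonneg) simp
    fix q :: "'a \<times> real" assume q: "norm q \<le> ?y / 8"
    have "\<bar>snd q\<bar> \<le> norm q" using norm_fst_snd_le(2)[of q] by simp
    then have pq: "0 < snd (p + q)" using q p by simp
    have i: "integrable lborel (\<lambda>\<xi>. a \<xi> * exp (massive_phase m \<xi> (p + q)))"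
        "integrable lborel (\<lambda>\<xi>. a \<xi> * exp (massive_phase m \<xi> p))"
        "integrable lborel (\<lambda>\<xi>. a \<xi> * massive_phase m \<xi> q * exp (massive_phase m \<xi> p))"
      using decaying_density_integrable[OF a pq] decaying_density_integrable[OF a p]
        decaying_density_integrable[OF decaying_density_times_phase[OF a] p] by auto
    let ?d = "\<lambda>\<xi>. a \<xi> * exp (massive_phase m \<xi> (p + q)) - a \<xi> * exp (massive_phase m \<xi> p)
        - a \<xi> * massive_phase m \<xi> q * exp (massive_phase m \<xi> p)"
    have "fourier_extension m a (p + q) - fourier_extension m a p
       - fourier_extension m (\<lambda>\<xi>. a \<xi> * massive_phase m \<xi> q) p = (LINT \<xi>|lborel. ?d \<xi>)"
      unfolding fourier_extension_def using i by simp
    also have "norm \<dots> \<le> (LINT \<xi>|lborel. (norm q)\<^sup>2 * (128 / ?y\<^sup>2 * (norm (a \<xi>) * exp (- (?y / 2) * massive_symbol m \<xi>))))"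
    proof (rule Bochner_Integration.integral_norm_bound_integral)
      show "integrable lborel ?d" using i by (intro Bochner_Integration.integrable_diff)
      show "integrable lborel (\<lambda>\<xi>. (norm q)\<^sup>2 * (128 / ?y\<^sup>2 * (norm (a \<xi>) * exp (- (?y / 2) * massive_symbol m \<xi>))))"
        using Ci by (rule integrable_mult_right)
      fix \<xi>
      let ?s = "massive_symbol m \<xi>" and ?z = "massive_phase m \<xi> q"
      have s: "0 \<le> ?s" by simp
      have zn: "norm ?z \<le> 2 * ?s * norm q" by (rule norm_massive_phase)
      also have "\<dots> \<le> 2 * ?s * (?y / 8)" using q s by (intro mult_left_mono) auto
      finally have z1: "norm ?z \<le> ?y / 4 * ?s" by simp
      have z2: "(norm ?z)\<^sup>2 \<le> 4 * ?s\<^sup>2 * (norm q)\<^sup>2"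
        using power_mono[OF zn, of 2] by (simp add: power_mult_distrib)
      have "(?y / 4 * ?s)\<^sup>2 / 2 \<le> exp (?y / 4 * ?s)"
      proof -
        have "1 + ?y / 4 * ?s + (?y / 4 * ?s)\<^sup>2 / 2 \<le> exp (?y / 4 * ?s)"
          using p s by (intro exp_lower_Taylor_quadratic) auto
        moreover have "0 \<le> ?y / 4 * ?s" using p s by simp
        ultimately show ?thesis by linarith
      qed
      then have s2: "?s\<^sup>2 \<le> 32 / ?y\<^sup>2 * exp (?y / 4 * ?s)"
        using p by (simp add: power_mult_distrib power_divide field_simps)
      have "?d \<xi> = a \<xi> * exp (massive_phase m \<xi> p) * (exp ?z - 1 - ?z)"
        by (simp add: massive_phase_add exp_add algebra_simps)
      then have "norm (?d \<xi>) = norm (a \<xi>) * exp (- ?y * ?s) * norm (exp ?z - 1 - ?z)"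
        by (simp only: norm_mult norm_exp_massive_phase)
      also have "\<dots> \<le> norm (a \<xi>) * exp (- ?y * ?s) * ((norm ?z)\<^sup>2 * exp (norm ?z))"
        by (intro mult_left_mono norm_exp_diff_quadratic) simp
      also have "\<dots> \<le> norm (a \<xi>) * exp (- ?y * ?s) * ((4 * (32 / ?y\<^sup>2 * exp (?y / 4 * ?s)) * (norm q)\<^sup>2) * exp (?y / 4 * ?s))"
        by (intro mult_left_mono mult_mono order_trans[OF z2] mult_right_mono s2) (use z1 in auto)
      also have "\<dots> = (norm q)\<^sup>2 * (128 / ?y\<^sup>2 * (norm (a \<xi>) * (exp (- ?y * ?s) * (exp (?y / 4 * ?s) * exp (?y / 4 * ?s)))))"
        by simp
      also have "exp (- ?y * ?s) * (exp (?y / 4 * ?s) * exp (?y / 4 * ?s)) = exp (- (?y / 2) * ?s)"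
        unfolding exp_add[symmetric] by (simp add: field_simps)
      finally show "norm (?d \<xi>) \<le> (norm q)\<^sup>2 * (128 / ?y\<^sup>2 * (norm (a \<xi>) * exp (- (?y / 2) * ?s)))" .
    qed
    also have "\<dots> = C * (norm q)\<^sup>2" unfolding integral_mult_right_zero[of _ "(norm q)\<^sup>2"] C_def by simp
    finally show "norm (fourier_extension m a (p + q) - fourier_extension m a p
       - fourier_extension m (\<lambda>\<xi>. a \<xi> * massive_phase m \<xi> q) p) \<le> C * (norm q)\<^sup>2" .
  qed
qed

lemma fourier_extension_GDERIV:
  assumes a: "decaying_density m a" and p: "p \<in> half_space"
  shows "GDERIV (\<lambda>p. Re (fourier_extension m a p)) p :>
    (\<Sum>b\<in>Basis. Re (fourier_extension m (\<lambda>\<xi>. a \<xi> * massive_phase m \<xi> b) p) *\<^sub>R b)"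
proof -
  have p: "0 < snd p" using p by (simp add: half_space_def)
  let ?G = "\<Sum>b\<in>Basis. Re (fourier_extension m (\<lambda>\<xi>. a \<xi> * massive_phase m \<xi> b) p) *\<^sub>R b"
  have G: "h \<bullet> ?G = Re (fourier_extension m (\<lambda>\<xi>. a \<xi> * massive_phase m \<xi> h) p)" for h
  proof -
    have i: "integrable lborel (\<lambda>\<xi>. (h \<bullet> b) *\<^sub>R (a \<xi> * massive_phase m \<xi> b * exp (massive_phase m \<xi> p)))" for b
      by (intro integrable_scaleR_right decaying_density_integrable decaying_density_times_phase a p)
    have ph: "massive_phase m \<xi> h = (\<Sum>b\<in>Basis. (h \<bullet> b) *\<^sub>R massive_phase m \<xi> b)" for \<xi>
    proof -
      have "massive_phase m \<xi> (\<Sum>b\<in>B. (h \<bullet> b) *\<^sub>R b) = (\<Sum>b\<in>B. (h \<bullet> b) *\<^sub>R massive_phase m \<xi> b)" if "finite B" for B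
        using that by (induction B rule: finite_induct)
          (auto simp: massive_phase_add massive_phase_scaleR, simp add: massive_phase_def zero_complex.code)
      from this[OF finite_Basis] show ?thesis by (simp add: euclidean_representation)
    qed
    have "fourier_extension m (\<lambda>\<xi>. a \<xi> * massive_phase m \<xi> h) p
      = (LINT \<xi>|lborel. (\<Sum>b\<in>Basis. (h \<bullet> b) *\<^sub>R (a \<xi> * massive_phase m \<xi> b * exp (massive_phase m \<xi> p))))"
      unfolding fourier_extension_def ph by (simp add: sum_distrib_left sum_distrib_right)
    also have "\<dots> = (\<Sum>b\<in>Basis. (h \<bullet> b) *\<^sub>R fourier_extension m (\<lambda>\<xi>. a \<xi> * massive_phase m \<xi> b) p)"
      unfolding fourier_extension_def by (subst Bochner_Integration.integral_sum[OF i]) simp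
    finally show ?thesis by (simp add: inner_sum_right mult.commute)
  qed
  obtain C where C: "0 \<le> C" "\<And>q. norm q \<le> snd p / 8 \<Longrightarrow>
    norm (fourier_extension m a (p + q) - fourier_extension m a p
       - fourier_extension m (\<lambda>\<xi>. a \<xi> * massive_phase m \<xi> q) p) \<le> C * (norm q)\<^sup>2"
    using fourier_extension_quadratic[OF a p] by blast
  show ?thesis
    unfolding gderiv_def has_derivative_at_alt
  proof (intro conjI allI impI)
    show "bounded_linear (\<lambda>h. h \<bullet> ?G)" by (rule bounded_linear_inner_left)
    fix e :: real assume "0 < e"
    have "norm (Re (fourier_extension m a z) - Re (fourier_extension m a p) - (z - p) \<bullet> ?G) \<le> e * norm (z - p)"
      if z: "norm (z - p) < min (snd p / 8) (e / (C + 1))" for z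
    proof -
      have "Re (fourier_extension m a z) - Re (fourier_extension m a p) - (z - p) \<bullet> ?G
        = Re (fourier_extension m a (p + (z - p)) - fourier_extension m a p
           - fourier_extension m (\<lambda>\<xi>. a \<xi> * massive_phase m \<xi> (z - p)) p)"
        unfolding G by simp
      also have "norm \<dots> \<le> C * (norm (z - p))\<^sup>2"
        unfolding real_norm_def by (rule order_trans[OF abs_Re_le_cmod C(2)]) (use z in simp)
      also have "\<dots> = (C * norm (z - p)) * norm (z - p)" by (simp add: power2_eq_square)
      also have "\<dots> \<le> e * norm (z - p)"
      proof (rule mult_right_mono)
        have "C * norm (z - p) \<le> (C + 1) * (e / (C + 1))" using z C(1) by (intro mult_mono) auto
        then show "C * norm (z - p) \<le> e" using C(1) by simp
      qed simp
      finally show ?thesis .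
    qed
    then show "\<exists>d>0. \<forall>z. norm (z - p) < d \<longrightarrow>
        norm (Re (fourier_extension m a z) - Re (fourier_extension m a p) - (z - p) \<bullet> ?G) \<le> e * norm (z - p)"
      using p \<open>0 < e\<close> C(1) by (intro exI[of _ "min (snd p / 8) (e / (C + 1))"]) auto
  qed
qed

lemma open_half_space: "open (half_space :: ('a::euclidean_space \<times> real) set)"
  unfolding half_space_def by (intro open_Collect_less continuous_intros)

lemma fourier_extension_partial_deriv:
  assumes "decaying_density m a" "p \<in> half_space" "b \<in> Basis"
  shows "partial_deriv b (\<lambda>p. Re (fourier_extension m a p)) p
    = Re (fourier_extension m (\<lambda>\<xi>. a \<xi> * massive_phase m \<xi> b) p)"
  using GDERIV_partial_deriv[OF fourier_extension_GDERIV[OF assms(1,2)], of b] assms(3)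
  by (simp add: inner_sum_left inner_Basis if_distrib cong: if_cong)

lemma fourier_extension_Ck: "decaying_density m a \<Longrightarrow> Ck_on k half_space (\<lambda>p. Re (fourier_extension m a p))"
proof (induction k arbitrary: a)
  case 0
  then show ?case
    using GDERIV_continuous[OF fourier_extension_GDERIV[OF 0]]
    by (auto intro: continuous_at_imp_continuous_on)
next
  case (Suc k)
  show ?case
  proof (rule Ck_on_Suc_GDERIV[OF open_half_space fourier_extension_GDERIV[OF Suc.prems]])
    fix b :: "'a \<times> real" assume b: "b \<in> Basis"
    have "Ck_on k half_space (\<lambda>p. Re (fourier_extension m (\<lambda>\<xi>. a \<xi> * massive_phase m \<xi> b) p))"
      by (rule Suc.IH[OF decaying_density_times_phase[OF Suc.prems]])
    then show "Ck_on k half_space (\<lambda>p. (\<Sum>b\<in>Basis. Re (fourier_extension m (\<lambda>\<xi>. a \<xi> * massive_phase m \<xi> b) p) *\<^sub>R b) \<bullet> b)"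
      using b by (simp add: inner_sum_left inner_Basis if_distrib cong: if_cong)
  qed
qed

text \<open>The tangential directions contribute \<open>- (norm \<xi>)\<^sup>2\<close> and the
  normal one \<open>(norm \<xi>)\<^sup>2 + m\<^sup>2\<close>. This identity is the differential
  equation on the Fourier side.\<close>

lemma massive_phase_sum_squares:
  "(\<Sum>b\<in>Basis. (massive_phase m \<xi> b)\<^sup>2) = complex_of_real (m\<^sup>2)"
proof -
  have "(\<Sum>b\<in>Basis. (massive_phase m \<xi> (b, 0))\<^sup>2) = (\<Sum>b\<in>Basis. complex_of_real (- (\<xi> \<bullet> b)\<^sup>2))"
    by (intro sum.cong refl) (simp add: massive_phase_def complex_eq_iff power2_eq_square inner_commute)
  also have "\<dots> = complex_of_real (- (norm \<xi>)\<^sup>2)"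
    unfolding power2_norm_eq_inner euclidean_inner[of \<xi> \<xi>] by (simp add: sum_negf power2_eq_square)
  finally have 1: "(\<Sum>b\<in>Basis. (massive_phase m \<xi> (b, 0))\<^sup>2) = complex_of_real (- (norm \<xi>)\<^sup>2)" .
  have "(massive_phase m \<xi> (0, 1))\<^sup>2 = complex_of_real ((norm \<xi>)\<^sup>2 + m\<^sup>2)"
    by (simp add: massive_phase_def complex_eq_iff power2_eq_square)
  moreover have "(\<Sum>b\<in>Basis. (massive_phase m \<xi> b)\<^sup>2)
      = (\<Sum>b\<in>(\<lambda>u. (u, 0)) ` Basis. (massive_phase m \<xi> b)\<^sup>2) + (\<Sum>b\<in>Pair 0 ` Basis. (massive_phase m \<xi> b)\<^sup>2)"
    unfolding Basis_prod_def by (rule sum.union_disjoint) (auto simp: image_iff)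
  moreover have "(\<Sum>b\<in>(\<lambda>u. (u, 0)) ` Basis. (massive_phase m \<xi> b)\<^sup>2) = (\<Sum>b\<in>Basis. (massive_phase m \<xi> (b, 0))\<^sup>2)"
    by (subst sum.reindex) (auto simp: inj_on_def)
  ultimately show ?thesis using 1 by simp
qed

lemma fourier_extension_laplacian:
  assumes a: "decaying_density m a" and p: "p \<in> half_space"
  shows "laplacian (\<lambda>p. Re (fourier_extension m a p)) p = m\<^sup>2 * Re (fourier_extension m a p)"
proof -
  have "partial_deriv b (partial_deriv b (\<lambda>p. Re (fourier_extension m a p))) p
      = Re (fourier_extension m (\<lambda>\<xi>. a \<xi> * massive_phase m \<xi> b * massive_phase m \<xi> b) p)" if b: "b \<in> Basis" for b
  proof -
    have "GDERIV (partial_deriv b (\<lambda>p. Re (fourier_extension m a p))) p :>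
      gradient (\<lambda>p. Re (fourier_extension m (\<lambda>\<xi>. a \<xi> * massive_phase m \<xi> b) p)) p"
    proof (rule GDERIV_transform_open[OF _ open_half_space p])
      show "GDERIV (\<lambda>p. Re (fourier_extension m (\<lambda>\<xi>. a \<xi> * massive_phase m \<xi> b) p)) p :>
         gradient (\<lambda>p. Re (fourier_extension m (\<lambda>\<xi>. a \<xi> * massive_phase m \<xi> b) p)) p"
        using fourier_extension_GDERIV[OF decaying_density_times_phase[OF a] p, of b]
        unfolding GDERIV_gradient[OF fourier_extension_GDERIV[OF decaying_density_times_phase[OF a] p, of b]] .
      show "Re (fourier_extension m (\<lambda>\<xi>. a \<xi> * massive_phase m \<xi> b) q) =
          partial_deriv b (\<lambda>p. Re (fourier_extension m a p)) q" if "q \<in> half_space" for q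
        by (rule fourier_extension_partial_deriv[OF a that b, symmetric])
    qed
    then have "partial_deriv b (partial_deriv b (\<lambda>p. Re (fourier_extension m a p))) p
       = partial_deriv b (\<lambda>p. Re (fourier_extension m (\<lambda>\<xi>. a \<xi> * massive_phase m \<xi> b) p)) p"
      using b by (simp add: GDERIV_partial_deriv gradient_inner_Basis)
    then show ?thesis
      using fourier_extension_partial_deriv[OF decaying_density_times_phase[OF a] p b] by simp
  qed
  then have "laplacian (\<lambda>p. Re (fourier_extension m a p)) p
      = Re (\<Sum>b\<in>Basis. fourier_extension m (\<lambda>\<xi>. a \<xi> * massive_phase m \<xi> b * massive_phase m \<xi> b) p)"
    by (simp add: laplacian_def)
  also have "(\<Sum>b\<in>Basis. fourier_extension m (\<lambda>\<xi>. a \<xi> * massive_phase m \<xi> b * massive_phase m \<xi> b) p)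
      = (LINT \<xi>|lborel. (\<Sum>b\<in>Basis. a \<xi> * massive_phase m \<xi> b * massive_phase m \<xi> b * exp (massive_phase m \<xi> p)))"
    unfolding fourier_extension_def using p
    by (subst Bochner_Integration.integral_sum)
       (auto simp: half_space_def intro!: decaying_density_integrable decaying_density_times_phase a)
  also have "\<dots> = (LINT \<xi>|lborel. complex_of_real (m\<^sup>2) * (a \<xi> * exp (massive_phase m \<xi> p)))"
  proof (rule Bochner_Integration.integral_cong[OF refl])
    fix \<xi> :: 'a
    have "(\<Sum>b\<in>Basis. a \<xi> * massive_phase m \<xi> b * massive_phase m \<xi> b * exp (massive_phase m \<xi> p))
      = (\<Sum>b\<in>Basis. (massive_phase m \<xi> b)\<^sup>2) * (a \<xi> * exp (massive_phase m \<xi> p))"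
      unfolding sum_distrib_right by (intro sum.cong refl) (simp add: power2_eq_square)
    then show "(\<Sum>b\<in>Basis. a \<xi> * massive_phase m \<xi> b * massive_phase m \<xi> b * exp (massive_phase m \<xi> p))
      = complex_of_real (m\<^sup>2) * (a \<xi> * exp (massive_phase m \<xi> p))"
      by (simp only: massive_phase_sum_squares)
  qed
  also have "\<dots> = complex_of_real (m\<^sup>2) * fourier_extension m a p"
    unfolding fourier_extension_def by (rule integral_mult_right_zero)
  finally show ?thesis by simp
qed

section \<open>Square integrable densities, and the link between Fourier integral and kernel\<close>

lemma sq_integrable_decaying:
  assumes "sq_integrable a"
  shows "decaying_density m a"
  unfolding decaying_density_def
proof (intro conjI allI impI)
  show am[measurable]: "a \<in> borel_measurable borel" using assms by (simp add: sq_integrable_def)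
  fix y :: real assume y: "0 < y"
  show "integrable lborel (\<lambda>\<xi>. norm (a \<xi>) * exp (- y * massive_symbol m \<xi>))"
  proof (rule Bochner_Integration.integrable_bound)
    show "integrable lborel (\<lambda>\<xi>. (norm (a \<xi>))\<^sup>2 + exp (- (2 * y) * massive_symbol m \<xi>))"
      using assms y massive_symbol_exp_integrable[of "2 * y" m]
      by (intro Bochner_Integration.integrable_add) (auto simp: sq_integrable_def)
    have "norm (norm (a \<xi>) * exp (- y * massive_symbol m \<xi>)) \<le> norm ((norm (a \<xi>))\<^sup>2 + exp (- (2 * y) * massive_symbol m \<xi>))" for \<xi>
    proof -
      have "norm (a \<xi>) * exp (- y * massive_symbol m \<xi>) \<le> (norm (a \<xi>))\<^sup>2 + (exp (- y * massive_symbol m \<xi>))\<^sup>2"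
      proof -
        have "0 \<le> norm (a \<xi>) * exp (- y * massive_symbol m \<xi>)" by simp
        then show ?thesis
          using sum_squares_bound[of "norm (a \<xi>)" "exp (- y * massive_symbol m \<xi>)"] by linarith
      qed
      then show ?thesis by (simp add: exp_double[symmetric] mult.assoc)
    qed
    then show "AE \<xi> in lborel. norm (norm (a \<xi>) * exp (- y * massive_symbol m \<xi>)) \<le> norm ((norm (a \<xi>))\<^sup>2 + exp (- (2 * y) * massive_symbol m \<xi>))"
      by (rule AE_I2)
  qed measurable
qed

text \<open>
  The multiplication formula: the integral of f times the transform of g equals that of g times the
  transform of f, for \<open>g(\<xi>) = exp (i x\<cdot>\<xi> - y \<sigma>(\<xi>))\<close>.
\<close>
lemma L2_fourier_kernel:
  fixes f :: "'a::euclidean_space \<Rightarrow> complex"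
  assumes F: "L2_fourier f fh" and y: "0 < y" and m: "0 \<le> m"
  shows "(LINT z|lborel. massive_kernel m y (x - z) *\<^sub>R f z)
    = fourier_extension m fh (x, y) / complex_of_real ((2 * pi) ^ DIM('a))"
proof -
  have f: "sq_integrable f" and fh: "sq_integrable fh" using F by (auto simp: L2_fourier_def)
  have [measurable]: "f \<in> borel_measurable borel" "fh \<in> borel_measurable borel"
    using f fh by (auto simp: sq_integrable_def)
  \<comment> \<open>These are the truncations in \<open>L2_fourier\<close>. They are integrable, so
    Fubini proves the formula for each \<open>n\<close>, and both sides then pass to the
    limit.\<close>
  define fn where "fn n z = indicator (cball 0 (real n)) z * f z" for n z
  define Fn where "Fn n = fourier_integral (fn n)" for n
  define g where "g \<xi> = exp (massive_phase m \<xi> (x, y))" for \<xi>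
  have lim0: "(\<lambda>n. \<integral>\<^sup>+\<xi>. ennreal ((cmod (Fn n \<xi> - fh \<xi>))\<^sup>2) \<partial>lborel) \<longlonglongrightarrow> 0"
    using F unfolding L2_fourier_def Fn_def fn_def by simp
  have ng: "norm (g \<xi>) = exp (- y * massive_symbol m \<xi>)" for \<xi>
    unfolding g_def norm_exp_massive_phase by simp
  have [measurable]: "g \<in> borel_measurable borel" unfolding g_def by measurable
  have ig: "integrable lborel g"
    by (rule integrableI_bounded) (use massive_symbol_exp_integrable[OF y, of m, where 'a='a] in
      \<open>auto simp: ng integrable_iff_bounded\<close>)
  have gc: "cis (- (z \<bullet> \<xi>)) * g \<xi> = cis (- ((z - x) \<bullet> \<xi>)) * complex_of_real (exp (- y * massive_symbol m \<xi>))" for z \<xi>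
    by (simp add: g_def massive_phase_def exp_eq_polar cis_mult inner_diff_left)
  have [measurable]: "cball (0::'a) (real n) \<in> sets borel" for n by simp
  have [measurable]: "fn n \<in> borel_measurable borel" for n
    unfolding fn_def by (intro borel_measurable_times borel_measurable_indicator) measurable
  \<comment> \<open>A square integrable function is integrable on bounded sets, through
    \<open>norm (f z) \<le> 1 + (norm (f z))\<^sup>2\<close>.\<close>
  have ifn: "integrable lborel (fn n)" for n
  proof (rule Bochner_Integration.integrable_bound)
    have "integrable lborel (\<lambda>z::'a. indicator (cball 0 (real n)) z :: real)"
      using emeasure_lborel_cball_finite[of "0::'a" "real n"] by simp
    then show "integrable lborel (\<lambda>z::'a. indicator (cball 0 (real n)) z + (norm (f z))\<^sup>2)"
      using f by (intro Bochner_Integration.integrable_add) (auto simp: sq_integrable_def)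
    have "norm (f z) \<le> 1 + (norm (f z))\<^sup>2" for z
      using sum_squares_bound[of 1 "norm (f z)"] norm_ge_zero[of "f z"]
      unfolding power_one mult_1_right by linarith
    then show "AE z in lborel. norm (fn n z) \<le> norm (indicator (cball 0 (real n)) z + (norm (f z))\<^sup>2)"
      by (intro AE_I2) (auto simp: fn_def indicator_def)
  qed measurable
  have cm: "(\<lambda>q::'a \<times> 'a. cis (- (fst q \<bullet> snd q))) \<in> borel_measurable borel"
    by (intro borel_measurable_continuous_onI continuous_intros)
  define H where "H n z \<xi> = cis (- (z \<bullet> \<xi>)) * fn n z * g \<xi>" for n z \<xi>
  have Hm: "case_prod (H n) \<in> borel_measurable (lborel \<Otimes>\<^sub>M lborel)" for n
    unfolding H_def case_prod_unfold using cm by (simp add: borel_prod[symmetric])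
  have nH: "norm (H n z \<xi>) = norm (fn n z) * norm (g \<xi>)" for n z \<xi> by (simp add: H_def norm_mult)
  have iH: "integrable (lborel \<Otimes>\<^sub>M lborel) (case_prod (H n))" for n
  proof (rule lborel_pair.Fubini_integrable[OF Hm])
    show "integrable lborel (\<lambda>z. LINT \<xi>|lborel. norm (case_prod (H n) (z, \<xi>)))"
      using ifn[of n] ig by (simp add: nH)
    have "integrable lborel (H n z)" for z
    proof (rule Bochner_Integration.integrable_bound)
      show "integrable lborel (\<lambda>\<xi>. norm (fn n z) * norm (g \<xi>))" using ig by simp
      show "H n z \<in> borel_measurable lborel" using measurable_Pair2[OF Hm[of n], of z] by simp
    qed (simp add: nH)
    then show "AE z in lborel. integrable lborel (\<lambda>\<xi>. case_prod (H n) (z, \<xi>))" by simp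
  qed
  have H1: "(LINT z|lborel. H n z \<xi>) = Fn n \<xi> * g \<xi>" for n \<xi>
    by (simp add: H_def Fn_def fourier_integral_def)
  have H2: "(LINT \<xi>|lborel. H n z \<xi>) = complex_of_real ((2 * pi) ^ DIM('a)) * (massive_kernel m y (x - z) *\<^sub>R fn n z)" for n z
  proof -
    have "H n z \<xi> = fn n z * (cis (- ((z - x) \<bullet> \<xi>)) * complex_of_real (exp (- y * massive_symbol m \<xi>)))" for \<xi>
      unfolding gc[symmetric] H_def by (simp only: mult_ac)
    then have "(LINT \<xi>|lborel. H n z \<xi>) = fn n z * complex_of_real ((2 * pi) ^ DIM('a) * massive_kernel m y (z - x))"
      by (simp only: integral_mult_right_zero massive_symbol_fourier(2)[OF y])
    then show ?thesis
      using massive_kernel_minus[of m y "x - z"] by (simp add: scaleR_conv_of_real mult_ac)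
  qed
  have iFg: "integrable lborel (\<lambda>\<xi>. Fn n \<xi> * g \<xi>)" for n
    using lborel_pair.integrable_snd[OF iH[of n]] by (simp add: H1)
  have eq: "(LINT \<xi>|lborel. Fn n \<xi> * g \<xi>) = complex_of_real ((2 * pi) ^ DIM('a)) * (LINT z|lborel. massive_kernel m y (x - z) *\<^sub>R fn n z)" for n
    using lborel_pair.Fubini_integral[OF iH[of n]] unfolding H1 H2 integral_mult_right_zero .
  have ifg: "integrable lborel (\<lambda>\<xi>. fh \<xi> * g \<xi>)"
    unfolding g_def by (rule decaying_density_integrable[OF sq_integrable_decaying[OF fh]]) (use y in simp)
  \<comment> \<open>\<open>g\<close> is square integrable at positive height, so Cauchy-Schwarz
    turns the \<open>L\<^sup>2\<close> convergence of the transforms into convergence of these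
    integrals.\<close>
  have L1: "(\<lambda>n. LINT \<xi>|lborel. Fn n \<xi> * g \<xi>) \<longlonglongrightarrow> (LINT \<xi>|lborel. fh \<xi> * g \<xi>)"
  proof -
    define A where "A = (\<integral>\<^sup>+\<xi>. ennreal ((norm (g \<xi>))\<^sup>2) \<partial>lborel)"
    have "A = (\<integral>\<^sup>+\<xi>. ennreal (exp (- (2 * y) * massive_symbol m (\<xi>::'a))) \<partial>lborel)"
      unfolding A_def ng by (simp add: exp_double[symmetric] mult.assoc)
    then have A: "A < \<infinity>" using massive_symbol_exp_integrable[of "2 * y" m, where 'a='a] y
      by (simp add: integrable_iff_bounded)
    define d where "d n = norm ((LINT \<xi>|lborel. Fn n \<xi> * g \<xi>) - (LINT \<xi>|lborel. fh \<xi> * g \<xi>))" for n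
    have le: "(ennreal (d n))\<^sup>2 \<le> (\<integral>\<^sup>+\<xi>. ennreal ((cmod (Fn n \<xi> - fh \<xi>))\<^sup>2) \<partial>lborel) * A" for n
    proof -
      have [measurable]: "Fn n \<in> borel_measurable borel"
      proof -
        have "(\<lambda>q::'a \<times> 'a. cis (- (snd q \<bullet> fst q))) \<in> borel_measurable borel"
          by (intro borel_measurable_continuous_onI continuous_intros)
        then have "(\<lambda>q. cis (- (snd q \<bullet> fst q)) * fn n (snd q)) \<in> borel_measurable (borel \<Otimes>\<^sub>M lborel)"
          by (simp add: borel_prod[symmetric])
        then show ?thesis unfolding Fn_def fourier_integral_def[abs_def]
          by (intro lborel.borel_measurable_lebesgue_integral) (simp add: case_prod_unfold)
      qed
      have "d n = norm (LINT \<xi>|lborel. (Fn n \<xi> - fh \<xi>) * g \<xi>)"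
        unfolding d_def using iFg ifg by (simp add: left_diff_distrib)
      then have "ennreal (d n) \<le> (\<integral>\<^sup>+\<xi>. ennreal (norm ((Fn n \<xi> - fh \<xi>) * g \<xi>)) \<partial>lborel)"
        using integral_norm_bound_ennreal[of lborel "\<lambda>\<xi>. (Fn n \<xi> - fh \<xi>) * g \<xi>"] iFg ifg
        by (simp add: left_diff_distrib)
      also have "\<dots> = (\<integral>\<^sup>+\<xi>. ennreal (norm (Fn n \<xi> - fh \<xi>)) * ennreal (norm (g \<xi>)) \<partial>lborel)"
        by (simp add: norm_mult ennreal_mult)
      finally have "(ennreal (d n))\<^sup>2 \<le> (\<integral>\<^sup>+\<xi>. ennreal (norm (Fn n \<xi> - fh \<xi>)) * ennreal (norm (g \<xi>)) \<partial>lborel)\<^sup>2"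
        by (intro power_mono) auto
      also have "\<dots> \<le> (\<integral>\<^sup>+\<xi>. (ennreal (norm (Fn n \<xi> - fh \<xi>)))\<^sup>2 \<partial>lborel) * (\<integral>\<^sup>+\<xi>. (ennreal (norm (g \<xi>)))\<^sup>2 \<partial>lborel)"
        by (rule Cauchy_Schwarz_nn_integral) measurable
      finally show ?thesis by (simp add: A_def ennreal_power)
    qed
    have "(\<lambda>n. (\<integral>\<^sup>+\<xi>. ennreal ((cmod (Fn n \<xi> - fh \<xi>))\<^sup>2) \<partial>lborel) * A) \<longlonglongrightarrow> 0"
      using ennreal_tendsto_cmult[OF _ lim0, of A] A by (simp add: mult.commute)
    then have "(\<lambda>n. (ennreal (d n))\<^sup>2) \<longlonglongrightarrow> 0"
      by (rule tendsto_sandwich[OF eventuallyI eventuallyI tendsto_const, rotated 2]) (rule zero_le, rule le)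
    then have "(\<lambda>n. ennreal ((d n)\<^sup>2)) \<longlonglongrightarrow> ennreal 0"
      by (simp add: d_def ennreal_power)
    then have "(\<lambda>n. (d n)\<^sup>2) \<longlonglongrightarrow> 0"
      by (subst (asm) tendsto_ennreal_iff) auto
    then have "(\<lambda>n. sqrt ((d n)\<^sup>2)) \<longlonglongrightarrow> sqrt 0" by (rule tendsto_real_sqrt)
    then have "d \<longlonglongrightarrow> 0" by (simp add: d_def[abs_def])
    then show ?thesis unfolding d_def by (simp add: tendsto_norm_zero_iff LIM_zero_iff)
  qed
  have ik: "integrable lborel (\<lambda>z. massive_kernel m y (x - z) *\<^sub>R f z)"
    by (rule massive_kernel_times_integrable[OF y m f])
  have L2: "(\<lambda>n. LINT z|lborel. massive_kernel m y (x - z) *\<^sub>R fn n z) \<longlonglongrightarrow> (LINT z|lborel. massive_kernel m y (x - z) *\<^sub>R f z)"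
  proof (rule integral_dominated_convergence[where w="\<lambda>z. norm (massive_kernel m y (x - z) *\<^sub>R f z)"])
    show "AE z in lborel. (\<lambda>n. massive_kernel m y (x - z) *\<^sub>R fn n z) \<longlonglongrightarrow> massive_kernel m y (x - z) *\<^sub>R f z"
    proof (rule AE_I2)
      fix z :: 'a
      obtain k where "norm z \<le> real k" using real_arch_simple by blast
      then have "\<forall>\<^sub>F n in sequentially. massive_kernel m y (x - z) *\<^sub>R fn n z = massive_kernel m y (x - z) *\<^sub>R f z"
        by (auto simp: eventually_sequentially fn_def indicator_def intro!: exI[of _ k])
      then show "(\<lambda>n. massive_kernel m y (x - z) *\<^sub>R fn n z) \<longlonglongrightarrow> massive_kernel m y (x - z) *\<^sub>R f z"
        by (rule tendsto_eventually)
    qed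
    show "AE z in lborel. norm (massive_kernel m y (x - z) *\<^sub>R fn n z) \<le> norm (massive_kernel m y (x - z) *\<^sub>R f z)" for n
      by (intro AE_I2) (auto simp: fn_def indicator_def)
    show "integrable lborel (\<lambda>z. norm (massive_kernel m y (x - z) *\<^sub>R f z))"
      using ik by (rule integrable_norm)
  qed measurable
  have "(LINT \<xi>|lborel. fh \<xi> * g \<xi>) = complex_of_real ((2 * pi) ^ DIM('a)) * (LINT z|lborel. massive_kernel m y (x - z) *\<^sub>R f z)"
    using LIMSEQ_unique[OF L1[unfolded eq] tendsto_mult_left[OF L2]] .
  then show ?thesis by (simp add: fourier_extension_def g_def)
qed

text \<open>The complex representative \<open>w\<close> agrees with the real function
  \<open>f\<close> only almost everywhere, which the kernel integral does not see. The constant of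
  the unnormalised transform is moved into the density.\<close>

lemma massive_poisson_eq_fourier_extension:
  fixes f :: "'a::euclidean_space \<Rightarrow> real"
  assumes F: "L2_fourier w wh" and w: "AE x in lborel. w x = complex_of_real (f x)"
    and f: "f \<in> borel_measurable borel" and p: "p \<in> half_space" and m: "0 \<le> m"
  shows "massive_poisson m (snd p) f (fst p)
    = Re (fourier_extension m (\<lambda>\<xi>. wh \<xi> / complex_of_real ((2 * pi) ^ DIM('a))) p)"
proof -
  have y: "0 < snd p" using p by (simp add: half_space_def)
  have [measurable]: "w \<in> borel_measurable borel" "f \<in> borel_measurable borel"
    using F f by (auto simp: L2_fourier_def sq_integrable_def)
  have "complex_of_real (massive_poisson m (snd p) f (fst p))
      = (LINT z|lborel. complex_of_real (massive_kernel m (snd p) (fst p - z) * f z))"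
    unfolding massive_poisson_def by (simp only: integral_complex_of_real)
  also have "\<dots> = (LINT z|lborel. massive_kernel m (snd p) (fst p - z) *\<^sub>R w z)"
  proof (rule integral_cong_AE)
    show "AE z in lborel. complex_of_real (massive_kernel m (snd p) (fst p - z) * f z) = massive_kernel m (snd p) (fst p - z) *\<^sub>R w z"
      using w by eventually_elim (simp add: scaleR_conv_of_real)
  qed measurable
  also have "\<dots> = fourier_extension m wh p / complex_of_real ((2 * pi) ^ DIM('a))"
    using L2_fourier_kernel[OF F y m, of "fst p"] by simp
  also have "\<dots> = fourier_extension m (\<lambda>\<xi>. wh \<xi> / complex_of_real ((2 * pi) ^ DIM('a))) p"
    by (simp add: fourier_extension_def)
  finally show ?thesis by (metis Re_complex_of_real)
qed

text \<open>The hypotheses encode \<open>A\<^sub>m f = g\<close>, with \<open>w\<close> the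
  representative attached to the transform. The last claim is the smoothing effect at positive
  height: the integral of the modulus bounds the Fourier integral uniformly in \<open>x\<close>,
  although \<open>f\<close> is only square integrable.\<close>

lemma massive_poisson_regular:
  fixes f g :: "'a::euclidean_space \<Rightarrow> real"
  assumes F: "L2_fourier (\<lambda>x. complex_of_real (f x)) fh"
    and W: "L2_fourier w (\<lambda>\<xi>. complex_of_real (massive_symbol m \<xi>) * fh \<xi>)"
    and w: "AE x in lborel. w x = complex_of_real (g x)"
    and f: "f \<in> borel_measurable borel" and g: "g \<in> borel_measurable borel" and m: "0 \<le> m"
  defines "V \<equiv> \<lambda>p. massive_poisson m (snd p) f (fst p)"
  shows "Ck_on k half_space V"
    "p \<in> half_space \<Longrightarrow> laplacian V p = m\<^sup>2 * V p"
    "p \<in> half_space \<Longrightarrow> partial_deriv (0, 1) V p = - massive_poisson m (snd p) g (fst p)"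
    "0 < y \<Longrightarrow> \<exists>M. \<forall>x. \<bar>V (x, y)\<bar> \<le> M"
proof -
  let ?c = "complex_of_real ((2 * pi) ^ DIM('a))"
  let ?a = "\<lambda>\<xi>. fh \<xi> / ?c"
  let ?E = "\<lambda>p. Re (fourier_extension m ?a p)"
  have fh: "sq_integrable fh" using F by (simp add: L2_fourier_def)
  have "decaying_density m fh" by (rule sq_integrable_decaying[OF fh])
  then have a: "decaying_density m ?a"
    by (auto simp: decaying_density_def norm_divide)
  have V: "V p = ?E p" if "p \<in> half_space" for p
    unfolding V_def by (rule massive_poisson_eq_fourier_extension[OF F _ f that m]) simp
  show "Ck_on k half_space V"
    using fourier_extension_Ck[OF a] by (subst Ck_on_cong[OF open_half_space V])
  have D: "partial_deriv b V p = partial_deriv b ?E p" if "p \<in> half_space" for b p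
  proof -
    have "GDERIV V p :> (\<Sum>b\<in>Basis. Re (fourier_extension m (\<lambda>\<xi>. ?a \<xi> * massive_phase m \<xi> b) p) *\<^sub>R b)"
      by (rule GDERIV_transform_open[OF fourier_extension_GDERIV[OF a that] open_half_space that]) (simp add: V)
    then show ?thesis using fourier_extension_GDERIV[OF a that] by (simp only: GDERIV_partial_deriv)
  qed
  have DD: "partial_deriv b (partial_deriv b V) p = partial_deriv b (partial_deriv b ?E) p" if "p \<in> half_space" "b \<in> Basis" for b p
  proof -
    have "Ck_on 1 half_space (partial_deriv b ?E)"
      using fourier_extension_Ck[OF a, of 2] that(2) by (simp add: numeral_2_eq_2)
    then have "GDERIV (partial_deriv b ?E) p :> gradient (partial_deriv b ?E) p"
      using Ck_on_Suc_imp(1)[OF open_half_space, of 0] that(1) by simp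
    moreover from this have "GDERIV (partial_deriv b V) p :> gradient (partial_deriv b ?E) p"
      by (rule GDERIV_transform_open[OF _ open_half_space that(1)]) (simp add: D)
    ultimately show ?thesis by (simp only: GDERIV_partial_deriv)
  qed
  show "laplacian V p = m\<^sup>2 * V p" if "p \<in> half_space" for p
    using fourier_extension_laplacian[OF a that] DD[OF that] V[OF that]
    by (simp add: laplacian_def)
  show "partial_deriv (0, 1) V p = - massive_poisson m (snd p) g (fst p)" if p: "p \<in> half_space" for p
  proof -
    have b: "(0, 1) \<in> (Basis :: ('a \<times> real) set)" by (simp add: Basis_prod_def)
    \<comment> \<open>The phase of the unit normal is minus the symbol, so the normal derivative
      acts on densities as \<open>- A\<^sub>m\<close>.\<close>
    have "(\<lambda>\<xi>. ?a \<xi> * massive_phase m \<xi> (0, 1)) = (\<lambda>\<xi>. - (complex_of_real (massive_symbol m \<xi>) * fh \<xi> / ?c))"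
      by (simp add: massive_phase_def fun_eq_iff complex_eq_iff)
    then have "partial_deriv (0, 1) V p = Re (fourier_extension m (\<lambda>\<xi>. - (complex_of_real (massive_symbol m \<xi>) * fh \<xi> / ?c)) p)"
      using D[OF p] fourier_extension_partial_deriv[OF a p b] by simp
    also have "\<dots> = - Re (fourier_extension m (\<lambda>\<xi>. complex_of_real (massive_symbol m \<xi>) * fh \<xi> / ?c) p)"
      by (simp add: fourier_extension_def)
    also have "\<dots> = - massive_poisson m (snd p) g (fst p)"
      by (simp only: massive_poisson_eq_fourier_extension[OF W w g p m])
    finally show ?thesis .
  qed
  show "\<exists>M. \<forall>x. \<bar>V (x, y)\<bar> \<le> M" if y: "0 < y"
  proof (intro exI allI)
    fix x
    have "\<bar>V (x, y)\<bar> \<le> norm (fourier_extension m ?a (x, y))"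
      using V[of "(x, y)"] y abs_Re_le_cmod by (simp add: half_space_def)
    also have "\<dots> \<le> (LINT \<xi>|lborel. norm (?a \<xi>) * exp (- y * massive_symbol m \<xi>))"
      unfolding fourier_extension_def
    proof (rule Bochner_Integration.integral_norm_bound_integral)
      show "integrable lborel (\<lambda>\<xi>. ?a \<xi> * exp (massive_phase m \<xi> (x, y)))"
        by (rule decaying_density_integrable[OF a]) (use y in simp)
      show "integrable lborel (\<lambda>\<xi>. norm (?a \<xi>) * exp (- y * massive_symbol m \<xi>))"
        by (rule decaying_densityD[OF a y])
      show "norm (?a \<xi> * exp (massive_phase m \<xi> (x, y))) \<le> norm (?a \<xi>) * exp (- y * massive_symbol m \<xi>)" for \<xi>
        unfolding norm_mult norm_exp_massive_phase by simp
    qed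
    finally show "\<bar>V (x, y)\<bar> \<le> (LINT \<xi>|lborel. norm (?a \<xi>) * exp (- y * massive_symbol m \<xi>))" .
  qed
qed

section \<open>Cutoff functions and Green identities\<close>

text \<open>The parabola \<open>6 * s * (1 - s)\<close> has integral 1 over the unit interval.
  Integrating it twice yields a convex \<open>C\<^sup>2\<close> ramp; convexity fixes the sign of
  the second derivative in the cutoff estimates.\<close>

definition step_density :: "real \<Rightarrow> real" where "step_density s = max 0 (6 * s * (1 - s))"
definition smooth_step :: "real \<Rightarrow> real" where "smooth_step s = (LBINT v=ereal 0..ereal s. step_density v)"
definition smooth_ramp :: "real \<Rightarrow> real" where "smooth_ramp s = (LBINT v=ereal 0..ereal s. smooth_step v)"

lemma step_density_continuous: "continuous_on UNIV step_density"
  unfolding step_density_def by (intro continuous_intros)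

lemma step_density_measurable [measurable]: "step_density \<in> borel_measurable borel"
  by (rule borel_measurable_continuous_onI[OF step_density_continuous])

lemma step_density_outside: "s \<le> 0 \<or> 1 \<le> s \<Longrightarrow> step_density s = 0"
  unfolding step_density_def by (auto simp: max_def mult_nonneg_nonpos mult_le_0_iff zero_le_mult_iff not_le)

lemma step_density_nonneg: "0 \<le> step_density s"
  by (simp add: step_density_def)

lemma step_density_le: "step_density s \<le> 3 / 2"
proof -
  have "0 \<le> (2 * s - 1)\<^sup>2" by simp
  then show ?thesis unfolding step_density_def by (simp add: max_def power2_eq_square algebra_simps)
qed

lemma smooth_step_deriv: "(smooth_step has_real_derivative step_density s) (at s)"
  using has_real_derivative_antiderivative[OF step_density_continuous] unfolding smooth_step_def[abs_def] .

lemma smooth_step_continuous: "continuous_on UNIV smooth_step"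
  using smooth_step_deriv by (auto intro: continuous_at_imp_continuous_on DERIV_isCont)

lemma smooth_ramp_deriv: "(smooth_ramp has_real_derivative smooth_step s) (at s)"
  using has_real_derivative_antiderivative[OF smooth_step_continuous] unfolding smooth_ramp_def[abs_def] .

lemma smooth_step_mono: "s \<le> t \<Longrightarrow> smooth_step s \<le> smooth_step t"
  by (rule DERIV_nonneg_imp_nondecreasing) (use smooth_step_deriv step_density_nonneg in blast)+

lemma smooth_step_0: "s \<le> 0 \<Longrightarrow> smooth_step s = 0"
proof -
  assume s: "s \<le> 0"
  show ?thesis
  proof (cases "s = 0")
    case False
    then have "\<exists>z. s < z \<and> z < 0 \<and> smooth_step 0 - smooth_step s = (0 - s) * step_density z"
      using s by (intro MVT2) (auto intro: smooth_step_deriv)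
    then show ?thesis using step_density_outside by (auto simp: smooth_step_def)
  qed (simp add: smooth_step_def)
qed

lemma smooth_step_1: "1 \<le> s \<Longrightarrow> smooth_step s = 1"
proof -
  assume s: "1 \<le> s"
  have 1: "smooth_step 1 = 1"
  proof -
    have d: "((\<lambda>x. smooth_step x - (3 * x\<^sup>2 - 2 * x ^ 3)) has_real_derivative 0) (at x)" if "0 < x" "x < 1" for x
      using that by (auto intro!: derivative_eq_intros smooth_step_deriv
        simp: step_density_def power2_eq_square max_def algebra_simps zero_le_mult_iff not_le mult_less_0_iff)
    have "smooth_step 1 - (3 * 1\<^sup>2 - 2 * 1 ^ 3) = smooth_step 0 - (3 * 0\<^sup>2 - 2 * 0 ^ 3)"
      by (rule DERIV_isconst_end[of 0 1 "\<lambda>x. smooth_step x - (3 * x\<^sup>2 - 2 * x ^ 3)"])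
         (auto intro!: d continuous_intros continuous_on_subset[OF smooth_step_continuous])
    then show ?thesis by (simp add: smooth_step_0)
  qed
  show ?thesis
  proof (cases "s = 1")
    case False
    then have "\<exists>z. 1 < z \<and> z < s \<and> smooth_step s - smooth_step 1 = (s - 1) * step_density z"
      using s by (intro MVT2) (auto intro: smooth_step_deriv)
    then show ?thesis using step_density_outside 1 by auto
  qed (simp add: 1)
qed

lemma smooth_step_bounds: "0 \<le> smooth_step s" "smooth_step s \<le> 1"
  using smooth_step_mono[of "min s 0" s] smooth_step_mono[of s "max s 1"] smooth_step_0[of "min s 0"] smooth_step_1[of "max s 1"]
  by auto

lemma smooth_ramp_0: "s \<le> 0 \<Longrightarrow> smooth_ramp s = 0"
proof -
  assume s: "s \<le> 0"
  show ?thesis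
  proof (cases "s = 0")
    case False
    then have "\<exists>z. s < z \<and> z < 0 \<and> smooth_ramp 0 - smooth_ramp s = (0 - s) * smooth_step z"
      using s by (intro MVT2) (auto intro: smooth_ramp_deriv)
    then show ?thesis using smooth_step_0 by (auto simp: smooth_ramp_def)
  qed (simp add: smooth_ramp_def)
qed

lemma smooth_ramp_bounds: "0 \<le> smooth_ramp s" "smooth_ramp s \<le> max 0 s" "s - 1 \<le> smooth_ramp s"
proof -
  have z: "smooth_ramp 0 = 0" by (simp add: smooth_ramp_0)
  have *: "0 \<le> smooth_ramp s \<and> smooth_ramp s \<le> s" if pos: "0 < s" for s
  proof -
    obtain z where "smooth_ramp s - smooth_ramp 0 = (s - 0) * smooth_step z"
      using MVT2[OF pos, of smooth_ramp smooth_step] smooth_ramp_deriv by auto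
    then show ?thesis using z smooth_step_bounds[of z] pos by (simp add: mult_left_le)
  qed
  show "0 \<le> smooth_ramp s" "smooth_ramp s \<le> max 0 s"
    using *[of s] smooth_ramp_0[of s] by (cases "0 < s"; simp)+
  show "s - 1 \<le> smooth_ramp s"
  proof (cases "1 < s")
    case True
    obtain z where "1 < z" "smooth_ramp s - smooth_ramp 1 = (s - 1) * smooth_step z"
      using MVT2[OF True, of smooth_ramp smooth_step] smooth_ramp_deriv by auto
    then show ?thesis using smooth_step_1[of z] *[of 1] by simp
  next
    case False
    then show ?thesis using \<open>0 \<le> smooth_ramp s\<close> by simp
  qed
qed

lemma max_power_deriv:
  "((\<lambda>s::real. max 0 s ^ (n + 2)) has_real_derivative real (n + 2) * max 0 s ^ (n + 1)) (at s)"
proof -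
  consider "s > 0" | "s < 0" | "s = 0" by linarith
  then show ?thesis
  proof cases
    case 1
    have "((\<lambda>s. s ^ (n + 2)) has_real_derivative real (n + 2) * s ^ (n + 1)) (at s)"
      using DERIV_pow[of "n + 2" s] by simp
    then have "((\<lambda>s. max 0 s ^ (n + 2)) has_real_derivative real (n + 2) * s ^ (n + 1)) (at s)"
      by (rule has_field_derivative_transform_within_open[of _ _ _ "{0<..}"]) (use 1 in auto)
    then show ?thesis using 1 by simp
  next
    case 2
    have "((\<lambda>s. 0) has_real_derivative 0) (at s)" by simp
    then have "((\<lambda>s. max 0 s ^ (n + 2)) has_real_derivative 0) (at s)"
      by (rule has_field_derivative_transform_within_open[of _ _ _ "{..<0}"]) (use 2 in auto)
    then show ?thesis using 2 by simp
  next
    case 3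
    have "((\<lambda>h::real. max 0 h ^ (n + 2) / h) \<longlongrightarrow> 0) (at 0)"
    proof (rule Lim_null_comparison[of _ "\<lambda>h. \<bar>h\<bar> ^ (n + 1)"])
      show "\<forall>\<^sub>F h in at 0. norm (max 0 h ^ (n + 2) / h) \<le> \<bar>h\<bar> ^ (n + 1)"
        by (auto simp: eventually_at max_def intro!: exI[of _ 1] mult_nonpos_nonneg)
      have "((\<lambda>h::real. \<bar>h\<bar> ^ (n + 1)) \<longlongrightarrow> \<bar>0\<bar> ^ (n + 1)) (at 0)" by (intro tendsto_intros)
      then show "((\<lambda>h::real. \<bar>h\<bar> ^ (n + 1)) \<longlongrightarrow> 0) (at 0)" by simp
    qed
    then show ?thesis using 3 by (simp add: has_field_derivative_iff)
  qed
qed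

text \<open>Its square is \<open>C\<^sup>1\<close> and its cube \<open>C\<^sup>2\<close>, with
  polynomial derivatives inside the ball. The factor \<open>1 / R\<^sup>2\<close> in the gradient
  makes the errors of the cutoff small for large \<open>R\<close>.\<close>

definition ball_profile :: "real \<Rightarrow> 'b::euclidean_space \<Rightarrow> real" where
  "ball_profile R p = max 0 (1 - (p \<bullet> p) / R\<^sup>2)"

lemma GDERIV_ball_profile_power:
  "GDERIV (\<lambda>p. ball_profile R p ^ (n + 2)) p :> (real (n + 2) * ball_profile R p ^ (n + 1)) *\<^sub>R (- (2 / R\<^sup>2) *\<^sub>R p)"
proof -
  have "GDERIV (\<lambda>p. 1 - (p \<bullet> p) / R\<^sup>2) p :> - (2 / R\<^sup>2) *\<^sub>R p"
  proof -
    have "GDERIV (\<lambda>p. p \<bullet> p) p :> 2 *\<^sub>R p"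
      unfolding gderiv_def by (auto intro!: derivative_eq_intros simp: inner_commute fun_eq_iff)
    moreover have "((\<lambda>t. 1 - t / R\<^sup>2) has_real_derivative (0 - 1 / R\<^sup>2)) (at (p \<bullet> p))"
      by (intro DERIV_diff DERIV_const DERIV_cdivide DERIV_ident)
    ultimately show ?thesis using GDERIV_DERIV_compose by fastforce
  qed
  from GDERIV_DERIV_compose[OF this max_power_deriv]
  show ?thesis unfolding ball_profile_def .
qed

lemma ball_profile_bounds: "0 \<le> ball_profile R p" "ball_profile R p \<le> 1"
  by (auto simp: ball_profile_def)

lemma ball_profile_outside: "0 < R \<Longrightarrow> R \<le> norm p \<Longrightarrow> ball_profile R p = 0"
proof -
  assume "0 < R" "R \<le> norm p"
  then have "R\<^sup>2 \<le> p \<bullet> p" unfolding power2_norm_eq_inner[symmetric] by (intro power_mono) auto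
  then show ?thesis using \<open>0 < R\<close> by (simp add: ball_profile_def)
qed

lemma ball_profile_continuous: "continuous_on UNIV (ball_profile R)"
  unfolding ball_profile_def divide_inverse by (intro continuous_intros)

lemma ball_profile_ge: "0 < R \<Longrightarrow> norm p \<le> R / 2 \<Longrightarrow> 3 / 4 \<le> ball_profile R p"
proof -
  assume R: "0 < R" "norm p \<le> R / 2"
  then have "p \<bullet> p \<le> (R / 2)\<^sup>2" unfolding power2_norm_eq_inner[symmetric] by (intro power_mono) auto
  then have "3 / 4 \<le> 1 - (p \<bullet> p) / R\<^sup>2" using R by (simp add: power_divide field_simps)
  then show ?thesis unfolding ball_profile_def by (rule max.coboundedI2)
qed

section \<open>Green's identity on an open set\<close>

lemma integral_derivative_open:
  fixes f :: "'b::euclidean_space \<Rightarrow> real"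
  assumes "open \<Omega>" and d: "\<And>p. p \<in> \<Omega> \<Longrightarrow> GDERIV f p :> g p" and c: "continuous_on \<Omega> g"
    and K: "compact K" "K \<subseteq> \<Omega>" and z: "\<And>p. p \<notin> K \<Longrightarrow> f p = 0"
  shows "set_integrable lborel \<Omega> (\<lambda>p. g p \<bullet> v)" "(LINT p:\<Omega>|lborel. g p \<bullet> v) = 0"
proof -
  define g' where "g' p = (if p \<in> \<Omega> then g p else 0)" for p
  have d': "GDERIV f p :> g' p" for p
    using GDERIV_zero_extension[OF \<open>open \<Omega>\<close> d K z] by (simp add: g'_def)
  have c': "continuous_on UNIV g'"
    unfolding g'_def by (rule continuous_on_zero_extension[OF \<open>open \<Omega>\<close> d c K z])
  have e: "indicator \<Omega> p *\<^sub>R (g p \<bullet> v) = g' p \<bullet> v" for p by (simp add: g'_def indicator_def)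
  show "set_integrable lborel \<Omega> (\<lambda>p. g p \<bullet> v)" "(LINT p:\<Omega>|lborel. g p \<bullet> v) = 0"
    unfolding set_integrable_def set_lebesgue_integral_def e
    using integral_derivative_compact_support[OF d' c' K(1) z] by blast+
qed

lemma laplacian_eq_sum:
  "laplacian D p = (\<Sum>b\<in>Basis. gradient (\<lambda>q. gradient D q \<bullet> b) p \<bullet> b)"
  by (simp add: laplacian_def gradient_inner_Basis)

lemma GDERIV_cmult_const: "GDERIV f p :> D \<Longrightarrow> GDERIV (\<lambda>p. c * f p) p :> c *\<^sub>R D" for c :: real
  using GDERIV_mult[OF GDERIV_const[of c p], of f D] by simp

lemma Ck_on_2_gradient:
  assumes S: "open S" and D: "Ck_on 2 S D" and p: "p \<in> S"
  shows "GDERIV D p :> gradient D p" "continuous_on S D" "continuous_on S (gradient D)"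
    "b \<in> Basis \<Longrightarrow> GDERIV (\<lambda>q. gradient D q \<bullet> b) p :> gradient (\<lambda>q. gradient D q \<bullet> b) p"
    "b \<in> Basis \<Longrightarrow> continuous_on S (gradient (\<lambda>q. gradient D q \<bullet> b))"
proof -
  have D': "Ck_on (Suc 1) S D" using D by (simp add: numeral_2_eq_2)
  note 1 = Ck_on_Suc_imp[OF S D']
  show "GDERIV D p :> gradient D p" "continuous_on S (gradient D)" using 1(1,2) p by auto
  show "continuous_on S D" by (rule Ck_on_continuous[OF D])
  have 2: "Ck_on (Suc 0) S (\<lambda>q. gradient D q \<bullet> b)" if "b \<in> Basis" using 1(3)[OF that] by simp
  show "b \<in> Basis \<Longrightarrow> GDERIV (\<lambda>q. gradient D q \<bullet> b) p :> gradient (\<lambda>q. gradient D q \<bullet> b) p"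
    "b \<in> Basis \<Longrightarrow> continuous_on S (gradient (\<lambda>q. gradient D q \<bullet> b))"
    using Ck_on_Suc_imp(1,2)[OF S 2] p by auto
qed

text \<open>Green's identity for \<open>D\<^sup>2\<close> and \<open>\<eta>\<close>, after inserting \<open>\<Delta>(D\<^sup>2) = 2\<bar>\<nabla>D\<bar>\<^sup>2 + 2m\<^sup>2D\<^sup>2\<close>.\<close>
lemma Green_square:
  fixes D :: "'b::euclidean_space \<Rightarrow> real"
  assumes S: "open S" and D: "Ck_on 2 S D" and pde: "\<And>p. p \<in> S \<Longrightarrow> laplacian D p = m\<^sup>2 * D p"
    and e1: "\<And>p. GDERIV \<eta> p :> e1 p" and e2: "\<And>b p. b \<in> Basis \<Longrightarrow> GDERIV (\<lambda>p. e1 p \<bullet> b) p :> e2 b p"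
    and c2: "\<And>b. b \<in> Basis \<Longrightarrow> continuous_on UNIV (e2 b)"
    and K: "compact K" "K \<subseteq> S" and z: "\<And>p. p \<notin> K \<Longrightarrow> \<eta> p = 0"
  shows "set_integrable lborel S (\<lambda>p. \<eta> p * (2 * (norm (gradient D p))\<^sup>2 + 2 * m\<^sup>2 * (D p)\<^sup>2) - (D p)\<^sup>2 * (\<Sum>b\<in>Basis. e2 b p \<bullet> b))"
    "(LINT p:S|lborel. \<eta> p * (2 * (norm (gradient D p))\<^sup>2 + 2 * m\<^sup>2 * (D p)\<^sup>2) - (D p)\<^sup>2 * (\<Sum>b\<in>Basis. e2 b p \<bullet> b)) = 0"
proof -
  define g where "g = gradient D"
  define h where "h b = gradient (\<lambda>q. g q \<bullet> b)" for b
  \<comment> \<open>\<open>X\<close> lists the components of the field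
    \<open>\<eta> \<nabla>(D\<^sup>2) - D\<^sup>2 \<nabla>\<eta>\<close>, and \<open>Y b\<close> is
    the gradient of its component \<open>b\<close>. In the divergence, the sum of
    \<open>Y b p \<bullet> b\<close>, the mixed terms cancel.\<close>
  define X where "X b p = \<eta> p * (2 * (D p * (g p \<bullet> b))) - D p * D p * (e1 p \<bullet> b)" for b p
  define Y where "Y b p = (\<eta> p *\<^sub>R (2 *\<^sub>R (D p *\<^sub>R h b p + (g p \<bullet> b) *\<^sub>R g p)) + (2 * (D p * (g p \<bullet> b))) *\<^sub>R e1 p)
      - ((D p * D p) *\<^sub>R e2 b p + (e1 p \<bullet> b) *\<^sub>R (D p *\<^sub>R g p + D p *\<^sub>R g p))" for b p
  have ez: "e1 p = 0" if "p \<notin> K" for p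
    using GDERIV_zero_outside[OF compact_imp_closed[OF K(1)] z e1 that] .
  have Xd: "GDERIV (X b) p :> Y b p" if "p \<in> S" "b \<in> Basis" for b p
    unfolding X_def Y_def
    by (intro GDERIV_diff GDERIV_mult GDERIV_cmult_const e1 e2 that Ck_on_2_gradient(1,4)[OF S D that(1), folded g_def, folded h_def])
  have ec: "continuous_on UNIV \<eta>" using GDERIV_continuous[OF e1] by (simp add: continuous_at_imp_continuous_on)
  have e1c: "continuous_on UNIV e1"
    unfolding continuous_on_componentwise[of UNIV e1]
    using GDERIV_continuous[OF e2] by (auto intro: continuous_at_imp_continuous_on)
  note cS = continuous_on_subset[OF _ subset_UNIV]
  have Yc: "continuous_on S (Y b)" if "b \<in> Basis" for b
  proof (cases "S = {}")
    case False
    then obtain p0 where p0: "p0 \<in> S" by blast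
    note C = Ck_on_2_gradient[OF S D p0, folded g_def, folded h_def]
    show ?thesis unfolding Y_def
      by (intro continuous_intros C(2,3,5) that cS[OF ec] cS[OF e1c] cS[OF c2])
  qed simp
  have Xz: "X b p = 0" if "p \<notin> K" for b p using z[OF that] ez[OF that] by (simp add: X_def)
  have I: "set_integrable lborel S (\<lambda>p. Y b p \<bullet> b)" "(LINT p:S|lborel. Y b p \<bullet> b) = 0" if "b \<in> Basis" for b
    using integral_derivative_open[OF S Xd[OF _ that] Yc[OF that] K Xz] by auto
  have sum: "indicator S p *\<^sub>R (\<eta> p * (2 * (norm (gradient D p))\<^sup>2 + 2 * m\<^sup>2 * (D p)\<^sup>2) - (D p)\<^sup>2 * (\<Sum>b\<in>Basis. e2 b p \<bullet> b))
     = (\<Sum>b\<in>Basis. indicator S p *\<^sub>R (Y b p \<bullet> b))" for p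
  proof (cases "p \<in> S")
    case True
    have Yb: "Y b p \<bullet> b = \<eta> p * (2 * (D p * (h b p \<bullet> b) + (g p \<bullet> b)\<^sup>2)) - (D p)\<^sup>2 * (e2 b p \<bullet> b)" for b
      by (simp add: Y_def inner_diff_left inner_add_left power2_eq_square algebra_simps)
    have lap: "(\<Sum>b\<in>Basis. h b p \<bullet> b) = m\<^sup>2 * D p"
      using pde[OF True] laplacian_eq_sum[of D p] by (simp add: h_def g_def)
    have nrm: "(\<Sum>b\<in>Basis. (g p \<bullet> b)\<^sup>2) = (norm (g p))\<^sup>2"
      unfolding power2_norm_eq_inner by (subst euclidean_inner) (simp add: power2_eq_square)
    have "(\<Sum>b\<in>Basis. Y b p \<bullet> b) = \<eta> p * (2 * (D p * (\<Sum>b\<in>Basis. h b p \<bullet> b) + (\<Sum>b\<in>Basis. (g p \<bullet> b)\<^sup>2)))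
        - (D p)\<^sup>2 * (\<Sum>b\<in>Basis. e2 b p \<bullet> b)"
      unfolding Yb by (simp add: sum_subtractf sum_distrib_left sum.distrib distrib_left)
    then show ?thesis using True lap nrm by (simp add: g_def power2_eq_square algebra_simps)
  qed simp
  show "set_integrable lborel S (\<lambda>p. \<eta> p * (2 * (norm (gradient D p))\<^sup>2 + 2 * m\<^sup>2 * (D p)\<^sup>2) - (D p)\<^sup>2 * (\<Sum>b\<in>Basis. e2 b p \<bullet> b))"
    unfolding set_integrable_def sum
    using I(1) by (intro Bochner_Integration.integrable_sum) (simp add: set_integrable_def)
  show "(LINT p:S|lborel. \<eta> p * (2 * (norm (gradient D p))\<^sup>2 + 2 * m\<^sup>2 * (D p)\<^sup>2) - (D p)\<^sup>2 * (\<Sum>b\<in>Basis. e2 b p \<bullet> b)) = 0"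
    unfolding set_lebesgue_integral_def sum
    using I by (subst Bochner_Integration.integral_sum) (auto simp: set_integrable_def set_lebesgue_integral_def)
qed

section \<open>Uniqueness of the finite-energy extension\<close>

text \<open>A probability density in \<open>y\<close> carried by the layer between
  \<open>\<delta>\<close> and \<open>2 * \<delta>\<close>, hence away from the boundary itself,
  where extensions need not be differentiable. It is the normal derivative of
  \<open>layer_step\<close>.\<close>

definition layer_density :: "real \<Rightarrow> real \<Rightarrow> real" where
  "layer_density \<delta> y = step_density ((y - \<delta>) / \<delta>) / \<delta>"

definition layer_step :: "real \<Rightarrow> 'a::euclidean_space \<times> real \<Rightarrow> real" where
  "layer_step \<delta> p = smooth_step ((snd p - \<delta>) / \<delta>)"

lemma layer_density_bounds:
  assumes "0 < \<delta>"
  shows "0 \<le> layer_density \<delta> y" "layer_density \<delta> y \<le> 3 / (2 * \<delta>)"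
    "y \<notin> {\<delta><..<2 * \<delta>} \<Longrightarrow> layer_density \<delta> y = 0"
proof -
  show "0 \<le> layer_density \<delta> y" using assms step_density_nonneg by (simp add: layer_density_def)
  show "layer_density \<delta> y \<le> 3 / (2 * \<delta>)"
    using divide_right_mono[OF step_density_le, of \<delta> "(y - \<delta>) / \<delta>"] assms by (simp add: layer_density_def)
  show "y \<notin> {\<delta><..<2 * \<delta>} \<Longrightarrow> layer_density \<delta> y = 0"
    using assms step_density_outside[of "(y - \<delta>) / \<delta>"] by (auto simp: layer_density_def field_simps not_less)
qed

lemma layer_density_measurable [measurable]: "layer_density \<delta> \<in> borel_measurable borel"
  unfolding layer_density_def by measurable

lemma layer_density_snd_measurable:
  "(\<lambda>p::'a::euclidean_space \<times> real. layer_density \<delta> (snd p)) \<in> borel_measurable borel"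
  unfolding borel_prod[symmetric] by measurable

lemma GDERIV_snd: "GDERIV (\<lambda>p::'a::euclidean_space \<times> real. snd p) p :> (0, 1)"
  unfolding gderiv_def by (auto intro!: derivative_eq_intros simp: inner_prod_def)

lemma GDERIV_layer:
  assumes "0 < \<delta>"
  shows "GDERIV (\<lambda>p. \<delta> * smooth_ramp ((snd p - \<delta>) / \<delta>)) p :> layer_step \<delta> p *\<^sub>R (0, 1)"
    "GDERIV (layer_step \<delta>) p :> layer_density \<delta> (snd p) *\<^sub>R (0, 1)"
proof -
  have d: "((\<lambda>y. (y - \<delta>) / \<delta>) has_real_derivative 1 / \<delta>) (at y)" for y
    using assms by (auto intro!: derivative_eq_intros)
  have "((\<lambda>y. \<delta> * smooth_ramp ((y - \<delta>) / \<delta>)) has_real_derivative \<delta> * (smooth_step ((y - \<delta>) / \<delta>) * (1 / \<delta>))) (at y)" for y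
    by (intro DERIV_cmult DERIV_chain2[OF smooth_ramp_deriv d])
  then have 1: "((\<lambda>y. \<delta> * smooth_ramp ((y - \<delta>) / \<delta>)) has_real_derivative smooth_step ((y - \<delta>) / \<delta>)) (at y)" for y
    using assms by simp
  show "GDERIV (\<lambda>p. \<delta> * smooth_ramp ((snd p - \<delta>) / \<delta>)) p :> layer_step \<delta> p *\<^sub>R (0, 1)"
    unfolding layer_step_def by (rule GDERIV_DERIV_compose[OF GDERIV_snd 1])
  have 2: "((\<lambda>y. smooth_step ((y - \<delta>) / \<delta>)) has_real_derivative layer_density \<delta> y) (at y)" for y
    using DERIV_chain2[OF smooth_step_deriv d, of y] by (simp add: layer_density_def)
  show "GDERIV (layer_step \<delta>) p :> layer_density \<delta> (snd p) *\<^sub>R (0, 1)"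
    unfolding layer_step_def[abs_def] by (rule GDERIV_DERIV_compose[OF GDERIV_snd 2])
qed

text \<open>The cutoff grows like \<open>snd p\<close> instead of becoming constant. Its second
  normal derivative is then governed by the layer density, of order \<open>1 / \<delta>\<close> on a
  layer of width \<open>\<delta>\<close>, which a vanishing \<open>L\<^sup>2\<close> trace can
  absorb; a bounded cutoff would give order \<open>1 / \<delta>\<^sup>2\<close>. The Laplacian is
  bounded from above only, because it will multiply a square.\<close>

lemma half_space_cutoff:
  fixes \<delta> R :: real
  assumes \<delta>: "0 < \<delta>" and R: "0 < R"
  obtains \<eta> :: "'a::euclidean_space \<times> real \<Rightarrow> real" and e1 e2 where
    "\<And>p. GDERIV \<eta> p :> e1 p" "\<And>b p. b \<in> Basis \<Longrightarrow> GDERIV (\<lambda>p. e1 p \<bullet> b) p :> e2 b p"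
    "\<And>b. b \<in> Basis \<Longrightarrow> continuous_on UNIV (e2 b)"
    "\<And>p. p \<notin> cball 0 R \<inter> {p. \<delta> \<le> snd p} \<Longrightarrow> \<eta> p = 0" "\<And>p. 0 \<le> \<eta> p" "\<And>p. \<eta> p \<le> R"
    "\<And>p. (\<Sum>b\<in>Basis. e2 b p \<bullet> b) \<le> layer_density \<delta> (snd p) + 24 / R"
    "\<And>p. norm p \<le> R / 2 \<Longrightarrow> 2 * \<delta> \<le> snd p \<Longrightarrow> (snd p - 2 * \<delta>) / 4 \<le> \<eta> p"
proof -
  define Z :: "'a \<times> real \<Rightarrow> real" where "Z p = \<delta> * smooth_ramp ((snd p - \<delta>) / \<delta>)" for p
  define T :: "'a \<times> real \<Rightarrow> real" where "T = layer_step \<delta>"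
  define K :: "'a \<times> real \<Rightarrow> real" where "K p = layer_density \<delta> (snd p)" for p
  define e :: "'a \<times> real" where "e = (0, 1)"
  define B where "B = (ball_profile R :: 'a \<times> real \<Rightarrow> real)"
  define c where "c = - (2 / R\<^sup>2)"
  define \<eta> where "\<eta> p = Z p * B p ^ 3" for p
  define e1 where "e1 p = Z p *\<^sub>R ((3 * B p ^ 2) *\<^sub>R (c *\<^sub>R p)) + B p ^ 3 *\<^sub>R (T p *\<^sub>R e)" for p
  define e2 where "e2 b p = (Z p *\<^sub>R ((3 * c) *\<^sub>R ((B p ^ 2) *\<^sub>R b + (p \<bullet> b) *\<^sub>R ((2 * B p) *\<^sub>R (c *\<^sub>R p)))) + (3 * c * (B p ^ 2 * (p \<bullet> b))) *\<^sub>R (T p *\<^sub>R e))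
     + (B p ^ 3 *\<^sub>R ((e \<bullet> b) *\<^sub>R (K p *\<^sub>R e)) + ((e \<bullet> b) * T p) *\<^sub>R ((3 * B p ^ 2) *\<^sub>R (c *\<^sub>R p)))" for b p
  have Zd: "GDERIV Z p :> T p *\<^sub>R e" and Td: "GDERIV T p :> K p *\<^sub>R e" for p
    unfolding Z_def[abs_def] T_def K_def e_def by (rule GDERIV_layer[OF \<delta>])+
  have B3: "GDERIV (\<lambda>p. B p ^ 3) p :> (3 * B p ^ 2) *\<^sub>R (c *\<^sub>R p)" for p
    using GDERIV_ball_profile_power[of R 1 p] by (simp add: B_def c_def eval_nat_numeral)
  have B2: "GDERIV (\<lambda>p. B p ^ 2) p :> (2 * B p) *\<^sub>R (c *\<^sub>R p)" for p
    using GDERIV_ball_profile_power[of R 0 p] by (simp add: B_def c_def eval_nat_numeral)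
  have pb: "GDERIV (\<lambda>p. p \<bullet> b) p :> b" for p b :: "'a \<times> real"
    unfolding gderiv_def by (auto intro!: derivative_eq_intros)
  have Bb: "0 \<le> B p" "B p \<le> 1" for p unfolding B_def by (rule ball_profile_bounds)+
  have Zb: "0 \<le> Z p" for p unfolding Z_def using \<delta> smooth_ramp_bounds(1) by simp
  have Zle: "Z p \<le> max 0 (snd p - \<delta>)" for p
  proof -
    have "Z p \<le> \<delta> * max 0 ((snd p - \<delta>) / \<delta>)"
      unfolding Z_def using \<delta> smooth_ramp_bounds(2) by (intro mult_left_mono) auto
    also have "\<dots> = max 0 (snd p - \<delta>)" using \<delta> by (simp add: max_def field_simps)
    finally show ?thesis .
  qed
  have Zge: "snd p - 2 * \<delta> \<le> Z p" for p
  proof -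
    have "\<delta> * ((snd p - \<delta>) / \<delta> - 1) \<le> Z p"
      unfolding Z_def using \<delta> smooth_ramp_bounds(3) by (intro mult_left_mono) auto
    moreover have "\<delta> * ((snd p - \<delta>) / \<delta> - 1) = snd p - 2 * \<delta>" using \<delta> by (simp add: field_simps)
    ultimately show ?thesis by simp
  qed
  have Tb: "0 \<le> T p" for p unfolding T_def layer_step_def by (rule smooth_step_bounds)
  have Kb: "0 \<le> K p" for p unfolding K_def by (rule layer_density_bounds[OF \<delta>])
  have sR: "snd p \<le> norm p" for p :: "'a \<times> real" using norm_fst_snd_le(2)[of p] by simp
  \<comment> \<open>The layer step vanishes below the layer, so this product has a sign; it makes
    the mixed term of the Laplacian nonpositive.\<close>
  have Tsnd: "0 \<le> T p * snd p" for p
  proof (cases "snd p \<le> 0")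
    case True
    have "(snd p - \<delta>) / \<delta> \<le> 0" using True \<delta> by (intro divide_nonpos_pos) auto
    then have "T p = 0" unfolding T_def layer_step_def by (rule smooth_step_0)
    then show ?thesis by simp
  qed (use Tb in simp)
  have ZB: "Z p * B p \<le> R" for p
  proof (cases "norm p < R")
    case True
    have "Z p * B p \<le> Z p * 1" by (intro mult_left_mono Bb Zb)
    also have "\<dots> \<le> max 0 (snd p - \<delta>)" using Zle by simp
    also have "\<dots> \<le> R" using sR[of p] True R \<delta> by auto
    finally show ?thesis .
  next
    case False
    then show ?thesis using ball_profile_outside[OF R, of p] R by (simp add: B_def)
  qed
  have Bp: "B p * (p \<bullet> p) \<le> R\<^sup>2 * B p" for p
  proof (cases "norm p < R")
    case True
    then have "p \<bullet> p \<le> R\<^sup>2" unfolding power2_norm_eq_inner[symmetric] by (intro power_mono) auto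
    then have "B p * (p \<bullet> p) \<le> B p * R\<^sup>2" by (intro mult_left_mono Bb)
    then show ?thesis by (simp add: mult.commute)
  next
    case False
    then show ?thesis using ball_profile_outside[OF R, of p] by (simp add: B_def)
  qed
  show ?thesis
  proof (rule that[of \<eta> e1 e2])
    show "GDERIV \<eta> p :> e1 p" for p
      unfolding \<eta>_def e1_def by (intro GDERIV_mult Zd B3)
    show "GDERIV (\<lambda>p. e1 p \<bullet> b) p :> e2 b p" for b p
    proof -
      have "e1 p \<bullet> b = Z p * (3 * c * (B p ^ 2 * (p \<bullet> b))) + B p ^ 3 * ((e \<bullet> b) * T p)" for p
        by (simp add: e1_def inner_add_left)
      then have "(\<lambda>p. e1 p \<bullet> b) = (\<lambda>p. Z p * (3 * c * (B p ^ 2 * (p \<bullet> b))) + B p ^ 3 * ((e \<bullet> b) * T p))" by blast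
      then show ?thesis unfolding e2_def
        by (simp only:) (intro GDERIV_add GDERIV_mult GDERIV_cmult_const Zd Td B2 B3 pb)
    qed
    have cZ: "continuous_on UNIV Z" using GDERIV_continuous[OF Zd] by (simp add: continuous_at_imp_continuous_on)
    have cT: "continuous_on UNIV T" using GDERIV_continuous[OF Td] by (simp add: continuous_at_imp_continuous_on)
    have cB: "continuous_on UNIV B" unfolding B_def by (rule ball_profile_continuous)
    have cK: "continuous_on UNIV K" unfolding K_def layer_density_def divide_inverse
      by (intro continuous_intros continuous_on_compose2[OF step_density_continuous]) auto
    show "continuous_on UNIV (e2 b)" for b
      unfolding e2_def by (intro continuous_intros cZ cT cB cK)
    show "\<eta> p = 0" if np: "p \<notin> cball 0 R \<inter> {p. \<delta> \<le> snd p}" for p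
    proof -
      consider "R \<le> norm p" | "snd p < \<delta>" using np unfolding Int_iff mem_cball_0 mem_Collect_eq by linarith
      then show ?thesis
      proof cases
        case 1 then show ?thesis using ball_profile_outside[OF R, of p] by (simp add: \<eta>_def B_def)
      next
        case 2
        then have "(snd p - \<delta>) / \<delta> \<le> 0" using \<delta> by (intro divide_nonpos_pos) auto
        then show ?thesis by (simp add: \<eta>_def Z_def smooth_ramp_0)
      qed
    qed
    show "0 \<le> \<eta> p" for p unfolding \<eta>_def using Zb Bb by simp
    show "\<eta> p \<le> R" for p
    proof -
      have "B p * B p \<le> 1" using Bb by (intro mult_le_one) auto
      then have "(Z p * B p) * (B p * B p) \<le> R * 1" using ZB Zb Bb R by (intro mult_mono) auto
      then show ?thesis by (simp add: \<eta>_def power3_eq_cube mult_ac)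
    qed
    show "(\<Sum>b\<in>Basis. e2 b p \<bullet> b) \<le> layer_density \<delta> (snd p) + 24 / R" for p
    proof -
      have c0: "c \<le> 0" using R by (simp add: c_def)
      have pe: "p \<bullet> e = snd p" and ee: "e \<bullet> e = 1" by (simp_all add: e_def inner_prod_def)
      have e2b: "e2 b p \<bullet> b = (3 * c * Z p * (B p)\<^sup>2) * (b \<bullet> b) + (6 * c\<^sup>2 * Z p * B p) * ((p \<bullet> b) * (p \<bullet> b))
          + (6 * c * (B p)\<^sup>2 * T p) * ((p \<bullet> b) * (e \<bullet> b)) + (B p ^ 3 * K p) * ((e \<bullet> b) * (e \<bullet> b))" for b
        by (simp add: e2_def inner_add_left power2_eq_square algebra_simps)
      have "(\<Sum>b\<in>Basis. e2 b p \<bullet> b) = (3 * c * Z p * (B p)\<^sup>2) * (\<Sum>b\<in>(Basis::('a\<times>real) set). b \<bullet> b) + (6 * c\<^sup>2 * Z p * B p) * (p \<bullet> p)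
          + (6 * c * (B p)\<^sup>2 * T p) * (p \<bullet> e) + (B p ^ 3 * K p) * (e \<bullet> e)"
        unfolding e2b euclidean_inner[of p p] euclidean_inner[of p e] euclidean_inner[of e e]
        by (simp only: sum.distrib sum_distrib_left)
      \<comment> \<open>As \<open>c = - (2 / R\<^sup>2)\<close> is negative, the trace term and the
        mixed term are nonpositive. The second term is at most
        \<open>6 * c\<^sup>2 * R\<^sup>2 * R = 24 / R\<close>, using
        \<open>Z p * B p \<le> R\<close>; the last is at most the layer density, since
        \<open>B p \<le> 1\<close>.\<close>
      also have "\<dots> \<le> 0 + 24 / R + 0 + K p"
      proof (intro add_mono)
        show "(3 * c * Z p * (B p)\<^sup>2) * (\<Sum>b\<in>(Basis::('a\<times>real) set). b \<bullet> b) \<le> 0"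
        proof (rule mult_nonpos_nonneg)
          have "c * (3 * Z p * (B p)\<^sup>2) \<le> 0" using c0 Zb[of p] by (intro mult_nonpos_nonneg) auto
          then show "3 * c * Z p * (B p)\<^sup>2 \<le> 0" by (simp only: mult_ac)
        qed (simp add: sum_nonneg)
        have "(6 * c\<^sup>2 * Z p * B p) * (p \<bullet> p) = (6 * c\<^sup>2 * Z p) * (B p * (p \<bullet> p))" by simp
        also have "\<dots> \<le> (6 * c\<^sup>2 * Z p) * (R\<^sup>2 * B p)" using Zb by (intro mult_left_mono Bp) simp
        also have "\<dots> = (6 * c\<^sup>2 * R\<^sup>2) * (Z p * B p)" by simp
        also have "\<dots> \<le> (6 * c\<^sup>2 * R\<^sup>2) * R" by (intro mult_left_mono ZB) simp
        also have "\<dots> = 24 / R" using R by (simp add: c_def power2_eq_square field_simps)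
        finally show "(6 * c\<^sup>2 * Z p * B p) * (p \<bullet> p) \<le> 24 / R" .
        have "c * (6 * (B p)\<^sup>2 * (T p * snd p)) \<le> 0"
          using c0 Tsnd[of p] by (intro mult_nonpos_nonneg) auto
        then show "(6 * c * (B p)\<^sup>2 * T p) * (p \<bullet> e) \<le> 0" unfolding pe by (simp only: mult_ac)
        have "B p ^ 3 * K p \<le> 1 * K p" using Bb Kb by (intro mult_right_mono power_le_one) auto
        then show "(B p ^ 3 * K p) * (e \<bullet> e) \<le> K p" by (simp add: ee)
      qed
      finally show ?thesis by (simp add: K_def)
    qed
    show "(snd p - 2 * \<delta>) / 4 \<le> \<eta> p" if "norm p \<le> R / 2" "2 * \<delta> \<le> snd p" for p
    proof -
      have "3 / 4 \<le> B p" unfolding B_def by (rule ball_profile_ge[OF R that(1)])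
      then have "(3 / 4) ^ 3 \<le> B p ^ 3" by (intro power_mono) auto
      then have "1 / 4 \<le> B p ^ 3" by (simp add: power3_eq_cube)
      then have "(snd p - 2 * \<delta>) * (1 / 4) \<le> Z p * B p ^ 3"
        using Zge[of p] Zb[of p] that by (intro mult_mono) auto
      then show ?thesis by (simp add: \<eta>_def)
    qed
  qed
qed

lemma compact_half_space_part:
  assumes "0 < \<delta>"
  shows "compact (cball 0 R \<inter> {p :: 'a::euclidean_space \<times> real. \<delta> \<le> snd p})"
    "cball 0 R \<inter> {p :: 'a \<times> real. \<delta> \<le> snd p} \<subseteq> half_space"
  using assms by (auto simp: half_space_def intro!: compact_Int_closed closed_Collect_le continuous_intros)

text \<open>The density is at most \<open>3 / (2 * \<delta>)\<close> on a layer of width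
  \<open>\<delta>\<close>, whence a constant independent of \<open>\<delta>\<close>. Bounds at
  almost every height suffice, which is all that \<open>has_trace\<close> provides.\<close>

lemma nn_integral_layer_le:
  fixes G :: "'a::euclidean_space \<times> real \<Rightarrow> ennreal"
  assumes [measurable]: "G \<in> borel_measurable borel" and \<delta>: "0 < \<delta>" "2 * \<delta> \<le> d"
    and ae: "AE y in lborel. 0 < y \<and> y < d \<longrightarrow> (\<integral>\<^sup>+x. G (x, y) \<partial>lborel) \<le> e"
  shows "(\<integral>\<^sup>+p. ennreal (layer_density \<delta> (snd p)) * G p \<partial>lborel) \<le> ennreal (3 / 2) * e"
proof -
  have [measurable]: "G \<in> borel_measurable (borel \<Otimes>\<^sub>M borel)" by (simp add: borel_prod)
  have "(\<integral>\<^sup>+p. ennreal (layer_density \<delta> (snd p)) * G p \<partial>lborel)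
      = (\<integral>\<^sup>+p. ennreal (layer_density \<delta> (snd p)) * G p \<partial>(lborel \<Otimes>\<^sub>M lborel))"
    by (simp add: lborel_prod)
  also have "\<dots> = (\<integral>\<^sup>+y. (\<integral>\<^sup>+x. ennreal (layer_density \<delta> y) * G (x, y) \<partial>lborel) \<partial>lborel)"
    by (subst lborel_pair.nn_integral_snd[symmetric]) auto
  also have "\<dots> \<le> (\<integral>\<^sup>+y. ennreal (3 / (2 * \<delta>)) * e * indicator {\<delta><..<2 * \<delta>} y \<partial>lborel)"
  proof (rule nn_integral_mono_AE)
    show "AE y in lborel. (\<integral>\<^sup>+x. ennreal (layer_density \<delta> y) * G (x, y) \<partial>lborel) \<le> ennreal (3 / (2 * \<delta>)) * e * indicator {\<delta><..<2 * \<delta>} y"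
      using ae
    proof eventually_elim
      case (elim y)
      have "(\<integral>\<^sup>+x. ennreal (layer_density \<delta> y) * G (x, y) \<partial>lborel) = ennreal (layer_density \<delta> y) * (\<integral>\<^sup>+x. G (x, y) \<partial>lborel)"
        by (rule nn_integral_cmult) simp
      also have "\<dots> \<le> ennreal (3 / (2 * \<delta>)) * e * indicator {\<delta><..<2 * \<delta>} y"
      proof (cases "y \<in> {\<delta><..<2 * \<delta>}")
        case True
        then have "(\<integral>\<^sup>+x. G (x, y) \<partial>lborel) \<le> e" using elim \<delta> by auto
        then have "ennreal (layer_density \<delta> y) * (\<integral>\<^sup>+x. G (x, y) \<partial>lborel) \<le> ennreal (3 / (2 * \<delta>)) * e"
          by (intro mult_mono ennreal_leI layer_density_bounds \<delta>) auto
        then show ?thesis using True by simp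
      next
        case False
        then show ?thesis using layer_density_bounds(3)[OF \<delta>(1)] by simp
      qed
      finally show ?case .
    qed
  qed
  also have "\<dots> = ennreal (3 / (2 * \<delta>)) * e * ennreal \<delta>"
    using \<delta> by (subst nn_integral_cmult_indicator) auto
  also have "\<dots> = ennreal (3 / 2) * e"
  proof -
    have "ennreal (3 / (2 * \<delta>)) * ennreal \<delta> = ennreal (3 / 2)" using \<delta> by (simp add: ennreal_mult[symmetric])
    then show ?thesis by (metis mult.assoc mult.commute)
  qed
  finally show ?thesis .
qed

lemma half_space_measurable [measurable]: "half_space \<in> sets (borel :: ('a::euclidean_space \<times> real) measure)"
  using open_half_space by (rule borel_open)

text \<open>By Green's identity, \<open>2 * m\<^sup>2\<close> times the integral of
  \<open>D\<^sup>2\<close> against the cutoff is at most its integral against the Laplacian of the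
  cutoff. There the layer part becomes small by the zero trace and the part \<open>24 / R\<close> by
  square integrability, while near a point with \<open>D p0 \<noteq> 0\<close> the left side stays
  above a fixed positive number.\<close>

lemma massive_harmonic_zero_trace:
  fixes D :: "'a::euclidean_space \<times> real \<Rightarrow> real"
  assumes m: "0 < m" and D: "Ck_on 2 half_space D"
    and pde: "\<And>p. p \<in> half_space \<Longrightarrow> laplacian D p = m\<^sup>2 * D p"
    and int: "set_integrable lborel half_space (\<lambda>p. (D p)\<^sup>2)"
    and tr: "has_trace D (\<lambda>_. 0)" and p0: "p0 \<in> half_space"
  shows "D p0 = 0"
proof (rule ccontr)
  assume nz: "D p0 \<noteq> 0"
  let ?H = "half_space :: ('a \<times> real) set"
  define t where "t = snd p0 / 2"
  have t: "0 < t" using p0 by (simp add: t_def half_space_def)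
  have Dc: "continuous_on ?H D" by (rule Ck_on_continuous[OF D])
  have Dm: "(\<lambda>p. indicator ?H p * D p) \<in> borel_measurable borel"
    using borel_measurable_continuous_on_indicator[OF half_space_measurable Dc] by simp
  define J where "J = (LINT p:?H|lborel. (D p)\<^sup>2)"
  have J: "0 \<le> J" unfolding J_def set_lebesgue_integral_def by (intro Bochner_Integration.integral_nonneg) simp
  have "isCont D p0" using Dc p0 continuous_on_eq_continuous_at[OF open_half_space, of D] by blast
  then obtain r0 where r0: "0 < r0" "\<And>p. norm (p - p0) < r0 \<Longrightarrow> norm (D p - D p0) < \<bar>D p0\<bar> / 2"
    using nz unfolding continuous_at_eps_delta dist_norm by (metis half_gt_zero zero_less_abs_iff)
  define r where "r = min r0 t"
  have r: "0 < r" "r \<le> r0" "r \<le> t" using r0 t by (auto simp: r_def)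
  define U where "U = ball p0 r"
  have Us: "t \<le> snd p" "norm p \<le> norm p0 + t" "(\<bar>D p0\<bar> / 2)\<^sup>2 \<le> (D p)\<^sup>2" "p \<in> ?H" if "p \<in> U" for p
  proof -
    have n: "norm (p - p0) < r" using that by (simp add: U_def dist_norm norm_minus_commute)
    have "\<bar>snd p - snd p0\<bar> < r" using norm_fst_snd_le(2)[of "p - p0"] n by simp
    then show "t \<le> snd p" using r by (auto simp: t_def)
    then show "p \<in> ?H" using t by (simp add: half_space_def)
    have "norm p \<le> norm p0 + norm (p - p0)" by (metis norm_triangle_sub)
    then show "norm p \<le> norm p0 + t" using n r by simp
    have "\<bar>D p - D p0\<bar> < \<bar>D p0\<bar> / 2" using r0(2)[of p] n r by simp
    then have "\<bar>D p0\<bar> / 2 \<le> \<bar>D p\<bar>" by linarith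
    then show "(\<bar>D p0\<bar> / 2)\<^sup>2 \<le> (D p)\<^sup>2" using power_mono[of "\<bar>D p0\<bar> / 2" "\<bar>D p\<bar>" 2] by simp
  qed
  define vol where "vol = measure lborel U"
  have vol: "0 < vol" unfolding vol_def U_def using content_ball_pos[OF r(1), of p0] by simp
  \<comment> \<open>\<open>t / 8\<close> bounds the cutoff from below on the ball \<open>U\<close>:
    there \<open>snd p \<ge> t\<close>, and \<open>4 * \<delta> \<le> t\<close> gives
    \<open>(t - 2 * \<delta>) / 4 \<ge> t / 8\<close>.\<close>
  define A where "A = t / 8 * (\<bar>D p0\<bar> / 2)\<^sup>2 * vol"
  have A: "0 < A" unfolding A_def using t nz vol by simp
  \<comment> \<open>The factor 3 here and the factor 48 in \<open>R\<close> leave at most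
    \<open>m\<^sup>2 * A / 2\<close> for each of the two error terms, together half of the lower
    bound \<open>2 * m\<^sup>2 * A\<close>.\<close>
  define \<epsilon> where "\<epsilon> = m\<^sup>2 * A / 3"
  have \<epsilon>: "0 < \<epsilon>" using m A by (simp add: \<epsilon>_def)
  obtain d where d: "0 < d" "AE y in lborel. 0 < y \<and> y < d \<longrightarrow> (\<integral>\<^sup>+x. ennreal ((D (x, y) - 0)\<^sup>2) \<partial>lborel) < ennreal \<epsilon>"
    using tr[unfolded has_trace_def, THEN conjunct2, rule_format, OF \<epsilon>] by blast
  define \<delta> where "\<delta> = min (d / 2) (t / 4)"
  have \<delta>: "0 < \<delta>" "2 * \<delta> \<le> d" "4 * \<delta> \<le> t" using d t by (auto simp: \<delta>_def)
  define R where "R = max (2 * (norm p0 + t)) (48 * (J + 1) / (m\<^sup>2 * A))"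
  have R: "0 < R" "norm p0 + t \<le> R / 2" using t norm_ge_zero[of p0] by (auto simp: R_def less_max_iff_disj simp del: norm_ge_zero)
  have RJ: "24 / R * J \<le> m\<^sup>2 * A / 2"
  proof -
    have "48 * (J + 1) / (m\<^sup>2 * A) \<le> R" by (simp add: R_def)
    then have "48 * (J + 1) \<le> R * (m\<^sup>2 * A)" using m A by (simp add: pos_divide_le_eq)
    then show ?thesis using R(1) by (simp add: field_simps)
  qed
  obtain \<eta> :: "'a \<times> real \<Rightarrow> real" and e1 e2 where \<eta>:
    "\<And>p. GDERIV \<eta> p :> e1 p" "\<And>b p. b \<in> Basis \<Longrightarrow> GDERIV (\<lambda>p. e1 p \<bullet> b) p :> e2 b p"
    "\<And>b. b \<in> Basis \<Longrightarrow> continuous_on UNIV (e2 b)"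
    "\<And>p. p \<notin> cball 0 R \<inter> {p. \<delta> \<le> snd p} \<Longrightarrow> \<eta> p = 0" "\<And>p. 0 \<le> \<eta> p" "\<And>p. \<eta> p \<le> R"
    "\<And>p. (\<Sum>b\<in>Basis. e2 b p \<bullet> b) \<le> layer_density \<delta> (snd p) + 24 / R"
    "\<And>p. norm p \<le> R / 2 \<Longrightarrow> 2 * \<delta> \<le> snd p \<Longrightarrow> (snd p - 2 * \<delta>) / 4 \<le> \<eta> p"
    using half_space_cutoff[OF \<delta>(1) R(1), where 'a='a] by blast
  note G = Green_square[OF open_half_space D pde \<eta>(1-3) compact_half_space_part[OF \<delta>(1), of R] \<eta>(4)]
  have [measurable]: "\<eta> \<in> borel_measurable borel"
    using GDERIV_continuous[OF \<eta>(1)] by (intro borel_measurable_continuous_onI) (simp add: continuous_at_imp_continuous_on)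
  let ?D2 = "\<lambda>p. indicator ?H p * (D p)\<^sup>2"
  have iD: "integrable lborel ?D2" using int by (simp add: set_integrable_def)
  have ieta: "integrable lborel (\<lambda>p. \<eta> p * ?D2 p)"
  proof (rule Bochner_Integration.integrable_bound)
    show "integrable lborel (\<lambda>p. R * ?D2 p)" using iD by (rule integrable_mult_right)
    have "norm (\<eta> p * ?D2 p) \<le> norm (R * ?D2 p)" for p
      using \<eta>(5,6)[of p] R by (simp add: abs_mult mult_right_mono)
    then show "AE p in lborel. norm (\<eta> p * ?D2 p) \<le> norm (R * ?D2 p)" by (rule AE_I2)
  qed (use iD in measurable)
  let ?k = "\<lambda>p::'a \<times> real. layer_density \<delta> (snd p)"
  have ik: "integrable lborel (\<lambda>p. ?k p * ?D2 p)"
  proof (rule Bochner_Integration.integrable_bound)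
    show "integrable lborel (\<lambda>p. 3 / (2 * \<delta>) * ?D2 p)" using iD by (rule integrable_mult_right)
    have "norm (?k p * ?D2 p) \<le> norm (3 / (2 * \<delta>) * ?D2 p)" for p
    proof -
      have "?k p * ?D2 p \<le> 3 / (2 * \<delta>) * ?D2 p"
        by (intro mult_right_mono layer_density_bounds(2)[OF \<delta>(1)]) simp
      moreover have "0 \<le> ?k p * ?D2 p" using layer_density_bounds(1)[OF \<delta>(1), of "snd p"] by simp
      ultimately show ?thesis unfolding real_norm_def by linarith
    qed
    then show "AE p in lborel. norm (?k p * ?D2 p) \<le> norm (3 / (2 * \<delta>) * ?D2 p)" by (rule AE_I2)
    have [measurable]: "?k \<in> borel_measurable borel" "?D2 \<in> borel_measurable borel"
      using iD by (simp_all add: layer_density_snd_measurable)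
    show "(\<lambda>p. ?k p * ?D2 p) \<in> borel_measurable lborel" by measurable
  qed
  have "(LINT p|lborel. 2 * m\<^sup>2 * (\<eta> p * ?D2 p) - (?k p * ?D2 p + 24 / R * ?D2 p))
      \<le> (LINT p:?H|lborel. \<eta> p * (2 * (norm (gradient D p))\<^sup>2 + 2 * m\<^sup>2 * (D p)\<^sup>2) - (D p)\<^sup>2 * (\<Sum>b\<in>Basis. e2 b p \<bullet> b))"
    unfolding set_lebesgue_integral_def
  proof (rule integral_mono)
    show "integrable lborel (\<lambda>p. 2 * m\<^sup>2 * (\<eta> p * ?D2 p) - (?k p * ?D2 p + 24 / R * ?D2 p))"
      by (intro Bochner_Integration.integrable_diff Bochner_Integration.integrable_add integrable_mult_right ieta ik iD)
    show "integrable lborel (\<lambda>p. indicator ?H p *\<^sub>R (\<eta> p * (2 * (norm (gradient D p))\<^sup>2 + 2 * m\<^sup>2 * (D p)\<^sup>2) - (D p)\<^sup>2 * (\<Sum>b\<in>Basis. e2 b p \<bullet> b)))"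
      using G(1) by (simp add: set_integrable_def)
    fix p
    have "(D p)\<^sup>2 * (\<Sum>b\<in>Basis. e2 b p \<bullet> b) \<le> (D p)\<^sup>2 * (?k p + 24 / R)" by (intro mult_left_mono \<eta>(7)) simp
    moreover have "0 \<le> \<eta> p * (2 * (norm (gradient D p))\<^sup>2)" using \<eta>(5) by simp
    ultimately show "2 * m\<^sup>2 * (\<eta> p * ?D2 p) - (?k p * ?D2 p + 24 / R * ?D2 p)
       \<le> indicator ?H p *\<^sub>R (\<eta> p * (2 * (norm (gradient D p))\<^sup>2 + 2 * m\<^sup>2 * (D p)\<^sup>2) - (D p)\<^sup>2 * (\<Sum>b\<in>Basis. e2 b p \<bullet> b))"
      by (cases "p \<in> ?H") (simp_all add: algebra_simps)
  qed
  also have "\<dots> = 0" by (rule G(2))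
  finally have main: "2 * m\<^sup>2 * (LINT p|lborel. \<eta> p * ?D2 p) \<le> (LINT p|lborel. ?k p * ?D2 p) + 24 / R * J"
    using ieta ik iD by (simp add: J_def set_lebesgue_integral_def)
  have "A \<le> (LINT p|lborel. \<eta> p * ?D2 p)"
  proof -
    have "A = (LINT p|lborel. (t / 8 * (\<bar>D p0\<bar> / 2)\<^sup>2) * indicator U p)"
      by (simp add: A_def vol_def)
    also have "\<dots> \<le> (LINT p|lborel. \<eta> p * ?D2 p)"
    proof (rule integral_mono[OF _ ieta])
      show "integrable lborel (\<lambda>p. (t / 8 * (\<bar>D p0\<bar> / 2)\<^sup>2) * indicator U p)"
        using emeasure_lborel_ball_finite[of p0 r] by (intro integrable_mult_right) (simp add: U_def)
      fix p
      show "(t / 8 * (\<bar>D p0\<bar> / 2)\<^sup>2) * indicator U p \<le> \<eta> p * ?D2 p"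
      proof (cases "p \<in> U")
        case True
        note u = Us[OF True]
        have "t / 8 \<le> (snd p - 2 * \<delta>) / 4" using u(1) \<delta> by simp
        also have "\<dots> \<le> \<eta> p" using u(1,2) R \<delta> by (intro \<eta>(8)) auto
        finally have "t / 8 * (\<bar>D p0\<bar> / 2)\<^sup>2 \<le> \<eta> p * (D p)\<^sup>2"
          using u(3) t \<eta>(5)[of p] by (intro mult_mono) auto
        then show ?thesis using True u(4) by simp
      qed (use \<eta>(5)[of p] in simp)
    qed
    finally show ?thesis .
  qed
  then have l: "2 * m\<^sup>2 * A \<le> 2 * m\<^sup>2 * (LINT p|lborel. \<eta> p * ?D2 p)" by (intro mult_left_mono) auto
  have "ennreal (LINT p|lborel. ?k p * ?D2 p) \<le> ennreal (3 / 2) * ennreal \<epsilon>"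
  proof -
    have "ennreal (LINT p|lborel. ?k p * ?D2 p) = (\<integral>\<^sup>+p. ennreal (?k p) * ennreal (?D2 p) \<partial>lborel)"
      using layer_density_bounds(1)[OF \<delta>(1)]
      by (subst nn_integral_eq_integral[OF ik, symmetric]) (auto simp: ennreal_mult)
    also have "\<dots> \<le> ennreal (3 / 2) * ennreal \<epsilon>"
    proof (rule nn_integral_layer_le[OF _ \<delta>(1,2)])
      show "(\<lambda>p. ennreal (?D2 p)) \<in> borel_measurable borel" using iD by measurable
      show "AE y in lborel. 0 < y \<and> y < d \<longrightarrow> (\<integral>\<^sup>+x. ennreal (?D2 (x, y)) \<partial>lborel) \<le> ennreal \<epsilon>"
        using d(2) by eventually_elim (simp add: half_space_def less_imp_le)
    qed
    finally show ?thesis .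
  qed
  then have "(LINT p|lborel. ?k p * ?D2 p) \<le> 3 / 2 * \<epsilon>"
    using \<epsilon> by (simp add: ennreal_mult[symmetric])
  with main l RJ have "2 * m\<^sup>2 * A \<le> m\<^sup>2 * A / 2 + m\<^sup>2 * A / 2"
    unfolding \<epsilon>_def by linarith
  moreover have "0 < m\<^sup>2 * A" using m A by simp
  ultimately show False by linarith
qed

section \<open>Traces and the weak Green formula\<close>

text \<open>Local integrability speaks about compact subsets only; an exhaustion of the half-space
  by compact sets makes the zero extension Borel measurable.\<close>

lemma locally_integrable_half_space_measurable:
  fixes f :: "'a::euclidean_space \<times> real \<Rightarrow> 'c::euclidean_space"
  assumes "locally_integrable half_space f"
  shows "(\<lambda>p. indicator half_space p *\<^sub>R f p) \<in> borel_measurable borel"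
proof (rule borel_measurable_LIMSEQ_metric)
  define K where "K n = cball 0 (real n) \<inter> {p :: 'a \<times> real. 1 / real (Suc n) \<le> snd p}" for n
  have K: "compact (K n)" "K n \<subseteq> half_space" for n
    unfolding K_def by (rule compact_half_space_part; simp)+
  show "(\<lambda>p. indicator (K n) p *\<^sub>R f p) \<in> borel_measurable borel" for n
    using assms K[of n] borel_measurable_integrable[of lborel "\<lambda>p. indicator (K n) p *\<^sub>R f p"]
    unfolding locally_integrable_def set_integrable_def by simp
  fix p :: "'a \<times> real"
  show "(\<lambda>n. indicator (K n) p *\<^sub>R f p) \<longlonglongrightarrow> indicator half_space p *\<^sub>R f p"
  proof (cases "p \<in> half_space")
    case True
    then have "0 < snd p" by (simp add: half_space_def)
    then obtain n1 where n1: "1 / real (Suc n1) < snd p" using nat_approx_posE by blast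
    obtain n2 where n2: "norm p \<le> real n2" using real_arch_simple by blast
    have "p \<in> K n" if "n \<ge> max n1 n2" for n
    proof -
      have "1 / real (Suc n) \<le> 1 / real (Suc n1)" using that by (intro divide_left_mono) auto
      then show ?thesis using n1 n2 that by (simp add: K_def)
    qed
    then have "\<forall>\<^sub>F n in sequentially. indicator (K n) p *\<^sub>R f p = indicator half_space p *\<^sub>R f p"
      using True unfolding eventually_sequentially by (intro exI[of _ "max n1 n2"]) simp
    then show ?thesis by (rule tendsto_eventually)
  next
    case False
    then have "p \<notin> K n" for n using K(2)[of n] by blast
    then have "indicator (K n) p *\<^sub>R f p = indicator half_space p *\<^sub>R f p" for n using False by simp
    then show ?thesis by (simp only: tendsto_const)
  qed
qed

section \<open>Traces of combinations and products\<close>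

lemma has_traceD:
  assumes "has_trace U U0" "0 < e"
  shows "\<exists>d>0. AE y in lborel. 0 < y \<and> y < d \<longrightarrow> (\<integral>\<^sup>+x. ennreal ((U (x, y) - U0 x)\<^sup>2) \<partial>lborel) < ennreal e"
  using assms(1)[unfolded has_trace_def, THEN conjunct2, rule_format, OF assms(2)] .

lemma has_trace_dominated:
  fixes A B U :: "'a::euclidean_space \<times> real \<Rightarrow> real"
  assumes A: "has_trace A A0" and B: "has_trace B B0" and U0: "U0 \<in> borel_measurable borel"
    and m: "\<And>y. 0 < y \<Longrightarrow> (\<lambda>x. A (x, y)) \<in> borel_measurable borel" "\<And>y. 0 < y \<Longrightarrow> (\<lambda>x. B (x, y)) \<in> borel_measurable borel"
    and c: "0 \<le> c"
    and le: "\<And>y. 0 < y \<Longrightarrow> AE x in lborel. (U (x, y) - U0 x)\<^sup>2 \<le> c * ((A (x, y) - A0 x)\<^sup>2 + (B (x, y) - B0 x)\<^sup>2)"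
  shows "has_trace U U0"
  unfolding has_trace_def
proof (intro conjI allI impI)
  show "U0 \<in> borel_measurable lborel" using U0 by simp
  have [measurable]: "A0 \<in> borel_measurable borel" "B0 \<in> borel_measurable borel"
    using A B by (auto simp: has_trace_def)
  fix e :: real assume e: "0 < e"
  \<comment> \<open>The total error is \<open>c * (e' + e') = e * (c / (c + 1))\<close>, which is
    less than \<open>e\<close>; the added 1 also covers \<open>c = 0\<close>.\<close>
  define e' where "e' = e / (c + 1) / 2"
  have e': "0 < e'" using e c by (simp add: e'_def)
  obtain d1 d2 where d: "d1 > 0" "AE y in lborel. 0 < y \<and> y < d1 \<longrightarrow> (\<integral>\<^sup>+x. ennreal ((A (x, y) - A0 x)\<^sup>2) \<partial>lborel) < ennreal e'"
    "d2 > 0" "AE y in lborel. 0 < y \<and> y < d2 \<longrightarrow> (\<integral>\<^sup>+x. ennreal ((B (x, y) - B0 x)\<^sup>2) \<partial>lborel) < ennreal e'"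
    using has_traceD[OF A e'] has_traceD[OF B e'] by blast
  have "AE y in lborel. 0 < y \<and> y < min d1 d2 \<longrightarrow> (\<integral>\<^sup>+x. ennreal ((U (x, y) - U0 x)\<^sup>2) \<partial>lborel) < ennreal e"
    using d(2,4)
  proof eventually_elim
    case (elim y)
    show ?case
    proof
      assume y: "0 < y \<and> y < min d1 d2"
      have [measurable]: "(\<lambda>x. A (x, y)) \<in> borel_measurable borel" "(\<lambda>x. B (x, y)) \<in> borel_measurable borel"
        using m y by auto
      have "(\<integral>\<^sup>+x. ennreal ((U (x, y) - U0 x)\<^sup>2) \<partial>lborel)
          \<le> (\<integral>\<^sup>+x. ennreal c * (ennreal ((A (x, y) - A0 x)\<^sup>2) + ennreal ((B (x, y) - B0 x)\<^sup>2)) \<partial>lborel)"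
      proof (rule nn_integral_mono_AE)
        show "AE x in lborel. ennreal ((U (x, y) - U0 x)\<^sup>2) \<le> ennreal c * (ennreal ((A (x, y) - A0 x)\<^sup>2) + ennreal ((B (x, y) - B0 x)\<^sup>2))"
          using le[of y] y c by (auto elim!: eventually_mono simp: ennreal_mult[symmetric] ennreal_plus[symmetric] simp del: ennreal_plus intro!: ennreal_leI)
      qed
      also have "\<dots> = ennreal c * ((\<integral>\<^sup>+x. ennreal ((A (x, y) - A0 x)\<^sup>2) \<partial>lborel) + (\<integral>\<^sup>+x. ennreal ((B (x, y) - B0 x)\<^sup>2) \<partial>lborel))"
        by (simp add: nn_integral_cmult nn_integral_add)
      also have "\<dots> \<le> ennreal c * (ennreal e' + ennreal e')"
        using elim y by (intro mult_left_mono add_mono) auto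
      also have "\<dots> = ennreal (c * (e' + e'))" using c e' by (simp add: ennreal_mult[symmetric] ennreal_plus[symmetric] del: ennreal_plus)
      also have "\<dots> < ennreal e"
      proof (rule ennreal_lessI[OF e])
        have "c * (e' + e') = e * (c / (c + 1))" 
          unfolding e'_def field_sum_of_halves by simp
        also have "\<dots> < e * 1" using e c by (intro mult_strict_left_mono) (auto simp: divide_less_eq)
        finally show "c * (e' + e') < e" by simp
      qed
      finally show "(\<integral>\<^sup>+x. ennreal ((U (x, y) - U0 x)\<^sup>2) \<partial>lborel) < ennreal e" .
    qed
  qed
  then show "\<exists>\<delta>>0. AE y in lborel. 0 < y \<and> y < \<delta> \<longrightarrow> (\<integral>\<^sup>+x. ennreal ((U (x, y) - U0 x)\<^sup>2) \<partial>lborel) < ennreal e"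
    using d(1,3) by (intro exI[of _ "min d1 d2"]) auto
qed

text \<open>Without sup bounds, a product of two functions with \<open>L\<^sup>2\<close> traces
  converges in \<open>L\<^sup>1\<close> only. That is enough for the boundary pairing of a field
  with an arbitrary energy function.\<close>

lemma has_trace_product_L1:
  fixes A B :: "'a::euclidean_space \<times> real \<Rightarrow> real"
  assumes A: "has_trace A A0" and B: "has_trace B B0" and A0: "sq_integrable A0" and B0: "sq_integrable B0"
    and m: "\<And>y. 0 < y \<Longrightarrow> (\<lambda>x. A (x, y)) \<in> borel_measurable borel" "\<And>y. 0 < y \<Longrightarrow> (\<lambda>x. B (x, y)) \<in> borel_measurable borel"
    and e: "0 < e"
  shows "\<exists>d>0. AE y in lborel. 0 < y \<and> y < d \<longrightarrow> (\<integral>\<^sup>+x. ennreal \<bar>A (x, y) * B (x, y) - A0 x * B0 x\<bar> \<partial>lborel) \<le> ennreal e"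
proof -
  have [measurable]: "A0 \<in> borel_measurable borel" "B0 \<in> borel_measurable borel"
    using A0 B0 by (auto simp: sq_integrable_def)
  define N where "N = (LINT x|lborel. (A0 x)\<^sup>2 + (B0 x)\<^sup>2)"
  have iN: "integrable lborel (\<lambda>x. (A0 x)\<^sup>2 + (B0 x)\<^sup>2)"
    using A0 B0 by (simp add: sq_integrable_real)
  have N: "0 \<le> N" unfolding N_def by simp
  have nN: "(\<integral>\<^sup>+x. ennreal ((A0 x)\<^sup>2 + (B0 x)\<^sup>2) \<partial>lborel) = ennreal N"
    unfolding N_def by (rule nn_integral_eq_integral[OF iN]) simp
  \<comment> \<open>The weight \<open>k\<close> in Young's inequality charges at most
    \<open>e / 2\<close> to the fixed functions \<open>A0\<close> and \<open>B0\<close>. The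
    coefficients of the two trace errors are collected in \<open>c\<close>, and \<open>e'\<close>
    makes their share another \<open>e / 2\<close>.\<close>
  define k where "k = e / (N + 1)"
  have k: "0 < k" using e N by (simp add: k_def)
  define c where "c = 1 / 2 + 1 / (2 * k)"
  have c: "0 < c" using k by (simp add: c_def add_pos_pos)
  define e' where "e' = e / (4 * c)"
  have e': "0 < e'" using e c by (simp add: e'_def)
  obtain d1 d2 where d: "d1 > 0" "AE y in lborel. 0 < y \<and> y < d1 \<longrightarrow> (\<integral>\<^sup>+x. ennreal ((A (x, y) - A0 x)\<^sup>2) \<partial>lborel) < ennreal e'"
    "d2 > 0" "AE y in lborel. 0 < y \<and> y < d2 \<longrightarrow> (\<integral>\<^sup>+x. ennreal ((B (x, y) - B0 x)\<^sup>2) \<partial>lborel) < ennreal e'"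
    using has_traceD[OF A e'] has_traceD[OF B e'] by blast
  have key: "\<bar>a * b - a0 * b0\<bar> \<le> c * ((a - a0)\<^sup>2 + (b - b0)\<^sup>2) + k / 2 * (a0\<^sup>2 + b0\<^sup>2)" for a b a0 b0 :: real
  proof -
    have y: "\<bar>u * v\<bar> \<le> k / 2 * u\<^sup>2 + 1 / (2 * k) * v\<^sup>2" for u v :: real
    proof -
      have "0 \<le> (k * \<bar>u\<bar> - \<bar>v\<bar>)\<^sup>2 / (2 * k)" using k by simp
      also have "\<dots> = k / 2 * u\<^sup>2 + 1 / (2 * k) * v\<^sup>2 - \<bar>u * v\<bar>"
        using k by (simp add: power2_eq_square abs_mult field_simps)
      finally show ?thesis by simp
    qed
    have y1: "\<bar>u * v\<bar> \<le> 1 / 2 * u\<^sup>2 + 1 / 2 * v\<^sup>2" for u v :: real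
    proof -
      have "0 \<le> (\<bar>u\<bar> - \<bar>v\<bar>)\<^sup>2" by simp
      then show ?thesis by (simp add: power2_eq_square abs_mult algebra_simps)
    qed
    have "a * b - a0 * b0 = (a - a0) * (b - b0) + a0 * (b - b0) + b0 * (a - a0)" by (simp add: algebra_simps)
    then have "\<bar>a * b - a0 * b0\<bar> \<le> \<bar>(a - a0) * (b - b0)\<bar> + \<bar>a0 * (b - b0)\<bar> + \<bar>b0 * (a - a0)\<bar>" by linarith
    also have "\<dots> \<le> (1 / 2 * (a - a0)\<^sup>2 + 1 / 2 * (b - b0)\<^sup>2) + (k / 2 * a0\<^sup>2 + 1 / (2 * k) * (b - b0)\<^sup>2) + (k / 2 * b0\<^sup>2 + 1 / (2 * k) * (a - a0)\<^sup>2)"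
      by (intro add_mono y y1)
    also have "\<dots> = c * ((a - a0)\<^sup>2 + (b - b0)\<^sup>2) + k / 2 * (a0\<^sup>2 + b0\<^sup>2)"
      unfolding c_def by (simp add: algebra_simps)
    finally show ?thesis .
  qed
  have "AE y in lborel. 0 < y \<and> y < min d1 d2 \<longrightarrow> (\<integral>\<^sup>+x. ennreal \<bar>A (x, y) * B (x, y) - A0 x * B0 x\<bar> \<partial>lborel) \<le> ennreal e"
    using d(2,4)
  proof eventually_elim
    case (elim y)
    show ?case
    proof
      assume y: "0 < y \<and> y < min d1 d2"
      have [measurable]: "(\<lambda>x. A (x, y)) \<in> borel_measurable borel" "(\<lambda>x. B (x, y)) \<in> borel_measurable borel"
        using m y by auto
      have "(\<integral>\<^sup>+x. ennreal \<bar>A (x, y) * B (x, y) - A0 x * B0 x\<bar> \<partial>lborel)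
          \<le> (\<integral>\<^sup>+x. ennreal c * (ennreal ((A (x, y) - A0 x)\<^sup>2) + ennreal ((B (x, y) - B0 x)\<^sup>2)) + ennreal (k / 2) * ennreal ((A0 x)\<^sup>2 + (B0 x)\<^sup>2) \<partial>lborel)"
      proof (rule nn_integral_mono)
        fix x
        have "ennreal \<bar>A (x, y) * B (x, y) - A0 x * B0 x\<bar> \<le> ennreal (c * ((A (x, y) - A0 x)\<^sup>2 + (B (x, y) - B0 x)\<^sup>2) + k / 2 * ((A0 x)\<^sup>2 + (B0 x)\<^sup>2))"
          by (rule ennreal_leI[OF key])
        also have "\<dots> = ennreal c * (ennreal ((A (x, y) - A0 x)\<^sup>2) + ennreal ((B (x, y) - B0 x)\<^sup>2)) + ennreal (k / 2) * ennreal ((A0 x)\<^sup>2 + (B0 x)\<^sup>2)"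
          using c k by (simp add: ennreal_mult[symmetric] ennreal_plus[symmetric] del: ennreal_plus)
        finally show "ennreal \<bar>A (x, y) * B (x, y) - A0 x * B0 x\<bar> \<le> ennreal c * (ennreal ((A (x, y) - A0 x)\<^sup>2) + ennreal ((B (x, y) - B0 x)\<^sup>2)) + ennreal (k / 2) * ennreal ((A0 x)\<^sup>2 + (B0 x)\<^sup>2)" .
      qed
      also have "\<dots> = ennreal c * ((\<integral>\<^sup>+x. ennreal ((A (x, y) - A0 x)\<^sup>2) \<partial>lborel) + (\<integral>\<^sup>+x. ennreal ((B (x, y) - B0 x)\<^sup>2) \<partial>lborel)) + ennreal (k / 2) * ennreal N"
        unfolding nN[symmetric] by (subst nn_integral_add) (auto simp: nn_integral_cmult nn_integral_add)
      also have "\<dots> \<le> ennreal c * (ennreal e' + ennreal e') + ennreal (k / 2) * ennreal N"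
        using elim y by (intro add_mono mult_left_mono) auto
      also have "\<dots> = ennreal (c * (e' + e') + k / 2 * N)"
        using c e' k N by (simp add: ennreal_mult[symmetric] ennreal_plus[symmetric] del: ennreal_plus)
      also have "\<dots> \<le> ennreal e"
      proof (rule ennreal_leI)
        have 1: "c * (e' + e') = e / 2" using c by (simp add: e'_def)
        have "k * N \<le> k * (N + 1)" using k by simp
        also have "\<dots> = e" using N by (simp add: k_def)
        finally show "c * (e' + e') + k / 2 * N \<le> e" using 1 by simp
      qed
      finally show "(\<integral>\<^sup>+x. ennreal \<bar>A (x, y) * B (x, y) - A0 x * B0 x\<bar> \<partial>lborel) \<le> ennreal e" .
    qed
  qed
  then show ?thesis using d(1,3) by (intro exI[of _ "min d1 d2"]) auto
qed

section \<open>Unit mass of the averaging layer, and products of square integrable functions\<close>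

lemma step_density_integral: "integrable lborel step_density" "(LINT s|lborel. step_density s) = 1"
proof -
  show "integrable lborel step_density"
  proof (rule compact_support_integrable[OF compact_Icc step_density_continuous])
    show "step_density s = 0" if "s \<notin> {0..1}" for s using that by (intro step_density_outside) auto
  qed
  have "smooth_step 1 = (LINT s|lborel. step_density s)"
  proof -
    have "indicator {0..1} s *\<^sub>R step_density s = step_density s" for s
      using step_density_outside[of s] by (cases "s \<in> {0..1}") auto
    then have "(LINT s|lborel. indicator {0..1} s *\<^sub>R step_density s) = (LINT s|lborel. step_density s)"
      by (simp only:)
    then show ?thesis
      unfolding smooth_step_def by (simp add: interval_integral_Icc set_lebesgue_integral_def)
  qed
  then show "(LINT s|lborel. step_density s) = 1" by (simp add: smooth_step_1)
qed

lemma layer_density_integral: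
  assumes "0 < \<delta>"
  shows "integrable lborel (layer_density \<delta>)" "(LINT s|lborel. layer_density \<delta> s) = 1"
proof -
  have e: "layer_density \<delta> (\<delta> + \<delta> * s) = step_density s / \<delta>" for s
    using assms by (simp add: layer_density_def)
  show "integrable lborel (layer_density \<delta>)"
    using lborel_integrable_real_affine_iff[of \<delta> "layer_density \<delta>" \<delta>] assms step_density_integral(1)
    by (simp add: e)
  show "(LINT s|lborel. layer_density \<delta> s) = 1"
    using lborel_integral_real_affine[of \<delta> "layer_density \<delta>" \<delta>] assms step_density_integral(2)
    by (simp add: e)
qed

lemma layer_density_product_integral:
  fixes h :: "'a::euclidean_space \<Rightarrow> real"
  assumes \<delta>: "0 < \<delta>" and h: "integrable lborel h"
  shows "integrable lborel (\<lambda>p. layer_density \<delta> (snd p) * h (fst p))"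
    "(LINT p|lborel. layer_density \<delta> (snd p) * h (fst p)) = (LINT x|lborel. h x)"
proof -
  have [measurable]: "h \<in> borel_measurable borel" using h by simp
  let ?f = "\<lambda>(x, y). layer_density \<delta> y * h x"
  have i: "integrable (lborel \<Otimes>\<^sub>M lborel) ?f"
  proof (rule lborel_pair.Fubini_integrable)
    show "integrable lborel (\<lambda>x. LINT y|lborel. norm (?f (x, y)))"
      using h layer_density_integral[OF \<delta>] layer_density_bounds(1)[OF \<delta>] by (simp add: abs_mult)
    show "AE x in lborel. integrable lborel (\<lambda>y. ?f (x, y))"
      using layer_density_integral(1)[OF \<delta>] by simp
  qed measurable
  show "integrable lborel (\<lambda>p. layer_density \<delta> (snd p) * h (fst p))"
    using i by (simp add: lborel_prod case_prod_unfold)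
  have "(LINT x|lborel. LINT y|lborel. ?f (x, y)) = (LINT p|(lborel \<Otimes>\<^sub>M lborel). ?f p)"
    by (rule lborel_pair.integral_fst'[OF i])
  then show "(LINT p|lborel. layer_density \<delta> (snd p) * h (fst p)) = (LINT x|lborel. h x)"
    using layer_density_integral(2)[OF \<delta>] by (simp add: lborel_prod case_prod_unfold)
qed

lemma ball_profile_tendsto: "(\<lambda>n. ball_profile (real (Suc n)) p) \<longlonglongrightarrow> 1"
proof -
  have "(\<lambda>n. max 0 (1 - (p \<bullet> p) * (1 / real (Suc n)) ^ 2)) \<longlonglongrightarrow> max 0 (1 - (p \<bullet> p) * 0 ^ 2)"
    by (intro tendsto_intros LIMSEQ_Suc[OF lim_1_over_n])
  then show ?thesis by (simp add: ball_profile_def power_divide)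
qed

lemma set_integrable_product_L2:
  fixes F G :: "'b::euclidean_space \<Rightarrow> 'c::euclidean_space"
  assumes [measurable]: "(\<lambda>p. indicator S p *\<^sub>R F p) \<in> borel_measurable borel" "(\<lambda>p. indicator S p *\<^sub>R G p) \<in> borel_measurable borel"
    and F: "set_integrable lborel S (\<lambda>p. (norm (F p))\<^sup>2)" and G: "set_integrable lborel S (\<lambda>p. (norm (G p))\<^sup>2)"
  shows "set_integrable lborel S (\<lambda>p. F p \<bullet> G p)"
  unfolding set_integrable_def
proof (rule Bochner_Integration.integrable_bound)
  show "integrable lborel (\<lambda>p. indicator S p *\<^sub>R (norm (F p))\<^sup>2 + indicator S p *\<^sub>R (norm (G p))\<^sup>2)"
    using F G by (simp add: set_integrable_def)
  have "indicator S p *\<^sub>R (F p \<bullet> G p) = (indicator S p *\<^sub>R F p) \<bullet> (indicator S p *\<^sub>R G p)" for p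
    by (simp add: indicator_def)
  then show "(\<lambda>p. indicator S p *\<^sub>R (F p \<bullet> G p)) \<in> borel_measurable lborel" by (simp only:) measurable
  have "\<bar>F p \<bullet> G p\<bar> \<le> (norm (F p))\<^sup>2 + (norm (G p))\<^sup>2" for p
  proof -
    have "2 * norm (F p) * norm (G p) \<le> (norm (F p))\<^sup>2 + (norm (G p))\<^sup>2" by (rule sum_squares_bound)
    moreover have "0 \<le> norm (F p) * norm (G p)" by simp
    ultimately show ?thesis using Cauchy_Schwarz_ineq2[of "F p" "G p"] by linarith
  qed
  then show "AE p in lborel. norm (indicator S p *\<^sub>R (F p \<bullet> G p)) \<le> norm (indicator S p *\<^sub>R (norm (F p))\<^sup>2 + indicator S p *\<^sub>R (norm (G p))\<^sup>2)"
    by (intro AE_I2) (auto simp: indicator_def)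
qed


lemma has_trace_cong:
  assumes "has_trace U U0" "\<And>x y. 0 < y \<Longrightarrow> V (x, y) = U (x, y)"
  shows "has_trace V U0"
  unfolding has_trace_def
proof (intro conjI allI impI)
  show "U0 \<in> borel_measurable lborel" using assms(1) by (simp add: has_trace_def)
  fix e :: real assume "0 < e"
  from has_traceD[OF assms(1) this] obtain d where d: "d > 0"
    "AE y in lborel. 0 < y \<and> y < d \<longrightarrow> (\<integral>\<^sup>+x. ennreal ((U (x, y) - U0 x)\<^sup>2) \<partial>lborel) < ennreal e" by blast
  have "AE y in lborel. 0 < y \<and> y < d \<longrightarrow> (\<integral>\<^sup>+x. ennreal ((V (x, y) - U0 x)\<^sup>2) \<partial>lborel) < ennreal e"
    using d(2) by eventually_elim (simp add: assms(2))
  with d(1) show "\<exists>\<delta>>0. AE y in lborel. 0 < y \<and> y < \<delta> \<longrightarrow> (\<integral>\<^sup>+x. ennreal ((V (x, y) - U0 x)\<^sup>2) \<partial>lborel) < ennreal e"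
    by blast
qed

text \<open>Testing with a function differentiable on \<open>\<Omega>\<close> only, through its zero
  extension. The uniform bound on the gradient supplies integrability against the merely locally
  integrable \<open>U\<close>.\<close>

lemma weak_gradient_open_test:
  fixes f :: "'b::euclidean_space \<Rightarrow> real"
  assumes w: "weak_gradient \<Omega> U G" and \<Omega>: "open \<Omega>"
    and d: "\<And>p. p \<in> \<Omega> \<Longrightarrow> GDERIV f p :> g p" and c: "continuous_on \<Omega> g"
    and K: "compact K" "K \<subseteq> \<Omega>" and z: "\<And>p. p \<notin> K \<Longrightarrow> f p = 0" and b: "b \<in> Basis"
  shows "(LINT p:\<Omega>|lborel. U p * (g p \<bullet> b)) = - (LINT p:\<Omega>|lborel. (G p \<bullet> b) * f p)"
    "\<exists>B. \<forall>p\<in>\<Omega>. norm (g p) \<le> B"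
proof -
  define g' where "g' p = (if p \<in> \<Omega> then g p else 0)" for p
  have d': "GDERIV f p :> g' p" for p
    using GDERIV_zero_extension[OF \<Omega> d K z] by (simp add: g'_def)
  have c': "continuous_on UNIV g'"
    unfolding g'_def by (rule continuous_on_zero_extension[OF \<Omega> d c K z])
  have e: "indicator \<Omega> p *\<^sub>R (U p * (g p \<bullet> b)) = indicator \<Omega> p *\<^sub>R (U p * (g' p \<bullet> b))" for p
    by (simp add: g'_def indicator_def)
  show "(LINT p:\<Omega>|lborel. U p * (g p \<bullet> b)) = - (LINT p:\<Omega>|lborel. (G p \<bullet> b) * f p)"
    using weak_gradient_C1_test[OF w \<Omega> d' c' K z b] unfolding set_lebesgue_integral_def e .
  have gz: "g' p = 0" if "p \<notin> K" for p
    using GDERIV_zero_outside[OF compact_imp_closed[OF K(1)] z d' that] .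
  obtain B where "\<And>p. norm (g' p) \<le> B" using compact_support_bounded[OF K(1) c' gz] by blast
  then show "\<exists>B. \<forall>p\<in>\<Omega>. norm (g p) \<le> B" by (metis g'_def)
qed

text \<open>The weak gradient is tested with a cutoff times each component of \<open>F\<close>, and
  the results are summed; as the divergence of \<open>F\<close> vanishes, only
  \<open>F \<bullet> G\<close> and the flux of \<open>U F\<close> through the gradient of the cutoff
  remain. The ball is sent to infinity first, which leaves a normal gradient, and then the layer
  shrinks to the boundary. The sign is that of the outer normal \<open>(0, -1)\<close>.\<close>

lemma weak_green:
  fixes F :: "'a::euclidean_space \<times> real \<Rightarrow> 'a \<times> real"
  assumes dF: "\<And>b p. b \<in> Basis \<Longrightarrow> p \<in> half_space \<Longrightarrow> GDERIV (\<lambda>p. F p \<bullet> b) p :> dF b p"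
    and cF: "\<And>b. b \<in> Basis \<Longrightarrow> continuous_on half_space (dF b)"
    and div: "\<And>p. p \<in> half_space \<Longrightarrow> (\<Sum>b\<in>Basis. dF b p \<bullet> b) = 0"
    and F2: "set_integrable lborel half_space (\<lambda>p. (norm (F p))\<^sup>2)"
    and w: "weak_gradient half_space U G"
    and G2: "set_integrable lborel half_space (\<lambda>p. (norm (G p))\<^sup>2)"
    and U2: "set_integrable lborel half_space (\<lambda>p. (U p)\<^sup>2)"
    and tU: "has_trace U U0" and sU: "sq_integrable U0"
    and tF: "has_trace (\<lambda>p. F p \<bullet> (0, 1)) f0" and sf: "sq_integrable f0"
  shows "set_integrable lborel half_space (\<lambda>p. F p \<bullet> G p)"
    "(LINT p:half_space|lborel. F p \<bullet> G p) = - (LINT x|lborel. f0 x * U0 x)"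
proof -
  let ?H = "half_space :: ('a \<times> real) set"
  define e :: "'a \<times> real" where "e = (0, 1)"
  have Fbc: "continuous_on ?H (\<lambda>p. F p \<bullet> b)" if "b \<in> Basis" for b
    using GDERIV_continuous[OF dF[OF that]] by (auto intro: continuous_at_imp_continuous_on)
  then have Fc: "continuous_on ?H F" unfolding continuous_on_componentwise[of ?H F] by blast
  have Fm[measurable]: "(\<lambda>p. indicator ?H p *\<^sub>R F p) \<in> borel_measurable borel"
    by (rule borel_measurable_continuous_on_indicator[OF half_space_measurable Fc])
  have Gm[measurable]: "(\<lambda>p. indicator ?H p *\<^sub>R G p) \<in> borel_measurable borel"
    and Um[measurable]: "(\<lambda>p. indicator ?H p *\<^sub>R U p) \<in> borel_measurable borel"
    using w locally_integrable_half_space_measurable[of G] locally_integrable_half_space_measurable[of U]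
    unfolding weak_gradient_def by blast+
  show FG: "set_integrable lborel half_space (\<lambda>p. F p \<bullet> G p)"
    by (rule set_integrable_product_L2[OF Fm Gm F2 G2])
  define Q where "Q p = indicator ?H p * ((norm (F p))\<^sup>2 + (norm (G p))\<^sup>2 + (U p)\<^sup>2)" for p
  have Qi: "integrable lborel Q"
    using F2 G2 U2 unfolding Q_def set_integrable_def
    by (simp add: distrib_left)
  define f where "f p = indicator ?H p * (F p \<bullet> G p)" for p
  define h where "h v p = indicator ?H p * (U p * (F p \<bullet> v))" for v p
  have Uv: "\<bar>U p * (F p \<bullet> v)\<bar> \<le> norm v * ((norm (F p))\<^sup>2 + (U p)\<^sup>2)" for p v
  proof -
    have "\<bar>F p \<bullet> v\<bar> \<le> norm (F p) * norm v" by (rule Cauchy_Schwarz_ineq2)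
    then have "\<bar>U p\<bar> * \<bar>F p \<bullet> v\<bar> \<le> \<bar>U p\<bar> * (norm (F p) * norm v)" by (rule mult_left_mono) simp
    also have "\<dots> = norm v * (\<bar>U p\<bar> * norm (F p))" by simp
    also have "\<bar>U p\<bar> * norm (F p) \<le> (norm (F p))\<^sup>2 + (U p)\<^sup>2"
    proof -
      have "2 * \<bar>U p\<bar> * norm (F p) \<le> \<bar>U p\<bar>\<^sup>2 + (norm (F p))\<^sup>2" by (rule sum_squares_bound)
      moreover have "0 \<le> \<bar>U p\<bar> * norm (F p)" by simp
      ultimately show ?thesis unfolding power2_abs by linarith
    qed
    finally show ?thesis by (simp add: abs_mult mult_left_mono)
  qed
  have hQ: "\<bar>h v p\<bar> \<le> norm v * Q p" for v p
  proof (cases "p \<in> ?H")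
    case True
    have "norm v * ((norm (F p))\<^sup>2 + (U p)\<^sup>2) \<le> norm v * ((norm (F p))\<^sup>2 + (norm (G p))\<^sup>2 + (U p)\<^sup>2)"
      by (intro mult_left_mono) auto
    then show ?thesis using True Uv[of p v] by (simp add: h_def Q_def)
  qed (simp add: h_def Q_def)
  have fQ: "\<bar>f p\<bar> \<le> Q p" for p
  proof -
    have "2 * norm (F p) * norm (G p) \<le> (norm (F p))\<^sup>2 + (norm (G p))\<^sup>2" by (rule sum_squares_bound)
    moreover have "0 \<le> norm (F p) * norm (G p)" "0 \<le> (U p)\<^sup>2" by simp_all
    ultimately have "\<bar>F p \<bullet> G p\<bar> \<le> (norm (F p))\<^sup>2 + (norm (G p))\<^sup>2 + (U p)\<^sup>2"
      using Cauchy_Schwarz_ineq2[of "F p" "G p"] by linarith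
    then show ?thesis by (simp add: f_def Q_def indicator_def)
  qed
  have fm[measurable]: "f \<in> borel_measurable borel"
    using FG by (auto simp: set_integrable_def f_def[abs_def])
  have hm': "(\<lambda>p. h (v p) p) \<in> borel_measurable borel" if [measurable]: "v \<in> borel_measurable borel" for v
  proof -
    have "h (v p) p = (indicator ?H p *\<^sub>R U p) * ((indicator ?H p *\<^sub>R F p) \<bullet> v p)" for p
      by (simp add: h_def indicator_def)
    then show ?thesis by (simp only:) measurable
  qed
  have step: "(LINT p|lborel. layer_step \<delta> p * f p) = - (LINT p|lborel. layer_density \<delta> (snd p) * h e p)" if \<delta>: "0 < \<delta>" for \<delta>
  proof -
    define T where "T = (layer_step \<delta> :: 'a \<times> real \<Rightarrow> real)"
    define k where "k p = layer_density \<delta> (snd p)" for p :: "'a \<times> real"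
    have Td: "GDERIV T p :> k p *\<^sub>R e" for p unfolding T_def k_def e_def by (rule GDERIV_layer[OF \<delta>])
    have Tb: "0 \<le> T p" "T p \<le> 1" for p unfolding T_def layer_step_def by (rule smooth_step_bounds)+
    have kb: "0 \<le> k p" "k p \<le> 3 / (2 * \<delta>)" for p unfolding k_def by (rule layer_density_bounds[OF \<delta>])+
    have Tc: "continuous_on UNIV T" using GDERIV_continuous[OF Td] by (simp add: continuous_at_imp_continuous_on)
    have [measurable]: "T \<in> borel_measurable borel" by (rule borel_measurable_continuous_onI[OF Tc])
    have kc: "continuous_on UNIV k" unfolding k_def layer_density_def divide_inverse
      by (intro continuous_intros continuous_on_compose2[OF step_density_continuous]) auto
    have [measurable]: "k \<in> borel_measurable borel" by (rule borel_measurable_continuous_onI[OF kc])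
    define B where "B n = (ball_profile (real (Suc n)) :: 'a \<times> real \<Rightarrow> real)" for n
    define c where "c n = - (2 / (real (Suc n))\<^sup>2)" for n
    have Bb: "0 \<le> B n p" "B n p \<le> 1" for n p unfolding B_def by (rule ball_profile_bounds)+
    have Bc: "continuous_on UNIV (B n)" for n unfolding B_def by (rule ball_profile_continuous)
    have [measurable]: "B n \<in> borel_measurable borel" for n by (rule borel_measurable_continuous_onI[OF Bc])
    have Bd: "GDERIV (\<lambda>p. (B n p)\<^sup>2) p :> (2 * B n p) *\<^sub>R (c n *\<^sub>R p)" for n p
      using GDERIV_ball_profile_power[of "real (Suc n)" 0 p] by (simp add: B_def c_def eval_nat_numeral)
    \<comment> \<open>The square of the profile is smooth enough, as this cutoff is differentiated
      only once.\<close>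
    define \<eta> where "\<eta> n p = T p * (B n p)\<^sup>2" for n p
    define v where "v n p = T p *\<^sub>R ((2 * B n p) *\<^sub>R (c n *\<^sub>R p)) + (B n p)\<^sup>2 *\<^sub>R (k p *\<^sub>R e)" for n p
    have \<eta>d: "GDERIV (\<eta> n) p :> v n p" for n p
      unfolding \<eta>_def[abs_def] v_def by (intro GDERIV_mult Td Bd)
    have \<eta>c: "continuous_on UNIV (\<eta> n)" for n unfolding \<eta>_def by (intro continuous_intros Tc Bc)
    have vc: "continuous_on UNIV (v n)" for n unfolding v_def by (intro continuous_intros Tc Bc kc)
    have [measurable]: "\<eta> n \<in> borel_measurable borel" "v n \<in> borel_measurable borel" for n
      using \<eta>c vc by (auto intro: borel_measurable_continuous_onI)
    define K where "K n = cball 0 (real (Suc n)) \<inter> {p :: 'a \<times> real. \<delta> \<le> snd p}" for n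
    have K: "compact (K n)" "K n \<subseteq> ?H" for n unfolding K_def by (rule compact_half_space_part[OF \<delta>])+
    have \<eta>z: "\<eta> n p = 0" if np: "p \<notin> K n" for n p
    proof -
      consider "real (Suc n) \<le> norm p" | "snd p \<le> \<delta>"
        using np unfolding K_def Int_iff mem_cball_0 mem_Collect_eq by linarith
      then show ?thesis
      proof cases
        case 1 then show ?thesis using ball_profile_outside[of "real (Suc n)" p] by (simp add: \<eta>_def B_def)
      next
        case 2
        then have "(snd p - \<delta>) / \<delta> \<le> 0" using \<delta> by (intro divide_nonpos_pos) auto
        then show ?thesis by (simp add: \<eta>_def T_def layer_step_def smooth_step_0)
      qed
    qed
    \<comment> \<open>Uniform in \<open>n\<close>: on its ball the gradient of the squared profile
      is at most \<open>4 / real (Suc n)\<close>, and the layer contributes at most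
      \<open>3 / (2 * \<delta>)\<close>.\<close>
    have vB: "norm (v n p) \<le> 4 + 3 / (2 * \<delta>)" for n p
    proof -
      have "norm (T p *\<^sub>R ((2 * B n p) *\<^sub>R (c n *\<^sub>R p))) \<le> 4"
      proof (cases "norm p < real (Suc n)")
        case True
        have "norm (T p *\<^sub>R ((2 * B n p) *\<^sub>R (c n *\<^sub>R p))) = T p * (2 * B n p * (2 / (real (Suc n))\<^sup>2 * norm p))"
          using Tb[of p] Bb[of n p] by (simp add: c_def)
        also have "\<dots> \<le> 1 * (2 * 1 * (2 / (real (Suc n))\<^sup>2 * real (Suc n)))"
          using Tb[of p] Bb[of n p] True by (intro mult_mono) auto
        also have "\<dots> = 4 / real (Suc n)" by (simp add: power2_eq_square del: of_nat_Suc)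
        also have "\<dots> \<le> 4" by (simp add: field_simps)
        finally show ?thesis .
      next
        case False
        then show ?thesis using ball_profile_outside[of "real (Suc n)" p] by (simp add: B_def)
      qed
      moreover have "norm ((B n p)\<^sup>2 *\<^sub>R (k p *\<^sub>R e)) \<le> 3 / (2 * \<delta>)"
      proof -
        have "norm ((B n p)\<^sup>2 *\<^sub>R (k p *\<^sub>R e)) = (B n p)\<^sup>2 * k p" using kb[of p] by (simp add: e_def norm_prod_def)
        also have "\<dots> \<le> 1 * (3 / (2 * \<delta>))" using kb[of p] Bb[of n p] by (intro mult_mono power_le_one) auto
        finally show ?thesis by simp
      qed
      ultimately show ?thesis unfolding v_def by (metis add_mono norm_triangle_le)
    qed
    have zero: "(LINT p|lborel. \<eta> n p * f p + h (v n p) p) = 0" for n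
    proof -
      define g where "g b p = \<eta> n p *\<^sub>R dF b p + (F p \<bullet> b) *\<^sub>R v n p" for b p
      have gd: "GDERIV (\<lambda>p. \<eta> n p * (F p \<bullet> b)) p :> g b p" if "p \<in> ?H" "b \<in> Basis" for b p
        unfolding g_def by (intro GDERIV_mult \<eta>d dF that)
      have gc: "continuous_on ?H (g b)" if "b \<in> Basis" for b
        unfolding g_def by (intro continuous_intros cF[OF that] Fbc[OF that] continuous_on_subset[OF \<eta>c subset_UNIV] continuous_on_subset[OF vc subset_UNIV])
      have z: "\<eta> n p * (F p \<bullet> b) = 0" if "p \<notin> K n" for b p using \<eta>z[OF that] by simp
      have W1: "(LINT p:?H|lborel. U p * (g b p \<bullet> b)) = - (LINT p:?H|lborel. (G p \<bullet> b) * (\<eta> n p * (F p \<bullet> b)))"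
        and W2: "\<exists>B. \<forall>p\<in>?H. norm (g b p) \<le> B" if "b \<in> Basis" for b
        by (rule weak_gradient_open_test[OF w open_half_space gd[OF _ that] gc[OF that] K[of n] z that], assumption+)+
      \<comment> \<open>Both integrals of the weak formulation must exist separately before the sum
        over the basis can be moved inside. In the first, \<open>g b\<close> is bounded and vanishes
        on the half-space off the compact set \<open>K n\<close>, where \<open>U\<close> is
        integrable; in the second, \<open>Q\<close> dominates.\<close>
      have Ui: "integrable lborel (\<lambda>p. indicator ?H p *\<^sub>R (U p * (g b p \<bullet> b)))"
        and Gi: "integrable lborel (\<lambda>p. indicator ?H p *\<^sub>R ((G p \<bullet> b) * (\<eta> n p * (F p \<bullet> b))))" if b: "b \<in> Basis" for b
      proof -
        obtain C where C: "\<And>p. p \<in> ?H \<Longrightarrow> norm (g b p) \<le> C" using W2[OF b] by blast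
        have gz: "g b p = 0" if "p \<in> ?H" "p \<notin> K n" for p
        proof -
          have "GDERIV (\<lambda>p. \<eta> n p * (F p \<bullet> b)) p :> g b p" by (rule gd[OF that(1) b])
          from GDERIV_zero_outside[OF compact_imp_closed[OF K(1)[of n]] z this that(2)] show ?thesis .
        qed
        have gm: "(\<lambda>p. indicator ?H p *\<^sub>R g b p) \<in> borel_measurable borel"
          by (rule borel_measurable_continuous_on_indicator[OF half_space_measurable gc[OF b]])
        have UK: "integrable lborel (\<lambda>p. indicator (K n) p *\<^sub>R U p)"
          using w K[of n] unfolding weak_gradient_def locally_integrable_def set_integrable_def by blast
        show "integrable lborel (\<lambda>p. indicator ?H p *\<^sub>R (U p * (g b p \<bullet> b)))"
        proof (rule Bochner_Integration.integrable_bound)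
          show "integrable lborel (\<lambda>p. C * (indicator (K n) p *\<^sub>R U p))" using UK by (rule integrable_mult_right)
          have "indicator ?H p *\<^sub>R (U p * (g b p \<bullet> b)) = (indicator ?H p *\<^sub>R U p) * ((indicator ?H p *\<^sub>R g b p) \<bullet> b)" for p
            by (simp add: indicator_def)
          moreover have "(\<lambda>p. (indicator ?H p *\<^sub>R U p) * ((indicator ?H p *\<^sub>R g b p) \<bullet> b)) \<in> borel_measurable borel"
            by (rule borel_measurable_times[OF Um borel_measurable_inner[OF gm borel_measurable_const]])
          ultimately show "(\<lambda>p. indicator ?H p *\<^sub>R (U p * (g b p \<bullet> b))) \<in> borel_measurable lborel"
            by (simp only:) simp
          have "norm (indicator ?H p *\<^sub>R (U p * (g b p \<bullet> b))) \<le> norm (C * (indicator (K n) p *\<^sub>R U p))" for p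
          proof (cases "p \<in> K n")
            case True
            then have p: "p \<in> ?H" using K(2) by blast
            have "\<bar>g b p \<bullet> b\<bar> \<le> C"
              using Cauchy_Schwarz_ineq2[of "g b p" b] C[OF p] b by simp
            then have "\<bar>U p\<bar> * \<bar>g b p \<bullet> b\<bar> \<le> \<bar>U p\<bar> * \<bar>C\<bar>" by (intro mult_left_mono) auto
            then show ?thesis using True p by (simp add: abs_mult mult.commute)
          next
            case False
            then show ?thesis using gz[of p] by (cases "p \<in> ?H") auto
          qed
          then show "AE p in lborel. norm (indicator ?H p *\<^sub>R (U p * (g b p \<bullet> b))) \<le> norm (C * (indicator (K n) p *\<^sub>R U p))" by (rule AE_I2)
        qed
        show "integrable lborel (\<lambda>p. indicator ?H p *\<^sub>R ((G p \<bullet> b) * (\<eta> n p * (F p \<bullet> b))))"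
        proof (rule Bochner_Integration.integrable_bound[OF Qi])
          have "indicator ?H p *\<^sub>R ((G p \<bullet> b) * (\<eta> n p * (F p \<bullet> b))) = ((indicator ?H p *\<^sub>R G p) \<bullet> b) * (\<eta> n p * ((indicator ?H p *\<^sub>R F p) \<bullet> b))" for p
            by (simp add: indicator_def)
          then show "(\<lambda>p. indicator ?H p *\<^sub>R ((G p \<bullet> b) * (\<eta> n p * (F p \<bullet> b)))) \<in> borel_measurable lborel"
            by (simp only:) measurable
          have "\<bar>(G p \<bullet> b) * (\<eta> n p * (F p \<bullet> b))\<bar> \<le> (norm (F p))\<^sup>2 + (norm (G p))\<^sup>2 + (U p)\<^sup>2" for p
          proof -
            have e1: "\<bar>\<eta> n p\<bar> \<le> 1" using Tb[of p] Bb[of n p] by (simp add: \<eta>_def abs_mult mult_le_one power_le_one)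
            have gb: "\<bar>G p \<bullet> b\<bar> \<le> norm (G p)" "\<bar>F p \<bullet> b\<bar> \<le> norm (F p)"
              using Cauchy_Schwarz_ineq2[of "G p" b] Cauchy_Schwarz_ineq2[of "F p" b] b by auto
            have "\<bar>(G p \<bullet> b) * (\<eta> n p * (F p \<bullet> b))\<bar> \<le> norm (G p) * (1 * norm (F p))"
              unfolding abs_mult by (intro mult_mono gb e1) auto
            moreover have "2 * norm (F p) * norm (G p) \<le> (norm (F p))\<^sup>2 + (norm (G p))\<^sup>2" by (rule sum_squares_bound)
            moreover have "0 \<le> norm (F p) * norm (G p)" "0 \<le> (U p)\<^sup>2" by simp_all
            ultimately show ?thesis by (simp only: mult_1 mult.commute[of "norm (G p)"])
          qed
          then show "AE p in lborel. norm (indicator ?H p *\<^sub>R ((G p \<bullet> b) * (\<eta> n p * (F p \<bullet> b)))) \<le> norm (Q p)"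
            by (intro AE_I2) (auto simp: Q_def indicator_def)
        qed
      qed
      have "\<eta> n p * f p + h (v n p) p = (\<Sum>b\<in>Basis. indicator ?H p *\<^sub>R (U p * (g b p \<bullet> b)) + indicator ?H p *\<^sub>R ((G p \<bullet> b) * (\<eta> n p * (F p \<bullet> b))))" for p
      proof (cases "p \<in> ?H")
        case True
        have "(\<Sum>b\<in>Basis. U p * (g b p \<bullet> b) + (G p \<bullet> b) * (\<eta> n p * (F p \<bullet> b)))
          = U p * (\<eta> n p * (\<Sum>b\<in>Basis. dF b p \<bullet> b) + (\<Sum>b\<in>Basis. (F p \<bullet> b) * (v n p \<bullet> b))) + \<eta> n p * (\<Sum>b\<in>Basis. (F p \<bullet> b) * (G p \<bullet> b))"
          by (simp add: g_def inner_add_left sum.distrib sum_distrib_left distrib_left mult_ac)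
        also have "\<dots> = U p * (F p \<bullet> v n p) + \<eta> n p * (F p \<bullet> G p)"
          by (simp only: div[OF True] euclidean_inner[of "F p" "v n p", symmetric]
              euclidean_inner[of "F p" "G p", symmetric] mult_zero_right add_0)
        finally show ?thesis using True by (simp add: f_def h_def)
      qed (simp add: f_def h_def)
      then have "(LINT p|lborel. \<eta> n p * f p + h (v n p) p)
        = (\<Sum>b\<in>Basis. (LINT p|lborel. indicator ?H p *\<^sub>R (U p * (g b p \<bullet> b))) + (LINT p|lborel. indicator ?H p *\<^sub>R ((G p \<bullet> b) * (\<eta> n p * (F p \<bullet> b)))))"
        using Ui Gi
        by (simp only: Bochner_Integration.integral_sum Bochner_Integration.integrable_add)
           (intro sum.cong refl Bochner_Integration.integral_add Ui Gi)
      also have "\<dots> = 0"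
        using W1 unfolding set_lebesgue_integral_def by (intro sum.neutral ballI) simp
      finally show ?thesis .
    qed
    \<comment> \<open>As the ball exhausts the space, \<open>\<eta> n\<close> tends to
      \<open>T\<close> and its gradient to \<open>k p *\<^sub>R e\<close>, so only the normal
      component of \<open>F\<close> is left in the flux.\<close>
    have lim: "(\<lambda>n. LINT p|lborel. \<eta> n p * f p + h (v n p) p) \<longlonglongrightarrow> (LINT p|lborel. T p * f p + k p * h e p)"
    proof (rule integral_dominated_convergence[where w="\<lambda>p. (5 + 3 / (2 * \<delta>)) * Q p"])
      show "integrable lborel (\<lambda>p. (5 + 3 / (2 * \<delta>)) * Q p)" using Qi by (rule integrable_mult_right)
      have [measurable]: "h e \<in> borel_measurable borel" using hm'[of "\<lambda>_. e"] by simp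
      show "(\<lambda>p. T p * f p + k p * h e p) \<in> borel_measurable lborel" by measurable
      show "(\<lambda>p. \<eta> n p * f p + h (v n p) p) \<in> borel_measurable lborel" for n
        using hm'[of "v n"] by measurable
      show "AE p in lborel. (\<lambda>n. \<eta> n p * f p + h (v n p) p) \<longlonglongrightarrow> T p * f p + k p * h e p"
      proof (rule AE_I2)
        fix p :: "'a \<times> real"
        have B1: "(\<lambda>n. B n p) \<longlonglongrightarrow> 1" unfolding B_def by (rule ball_profile_tendsto)
        have "(\<lambda>n. - (2 * (1 / real (Suc n)) ^ 2)) \<longlonglongrightarrow> - (2 * 0 ^ 2)"
          by (intro tendsto_intros LIMSEQ_Suc[OF lim_1_over_n])
        then have c1: "c \<longlonglongrightarrow> 0" by (simp add: c_def[abs_def] power_divide)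
        have "(\<lambda>n. v n p) \<longlonglongrightarrow> T p *\<^sub>R ((2 * 1) *\<^sub>R (0 *\<^sub>R p)) + 1\<^sup>2 *\<^sub>R (k p *\<^sub>R e)"
          unfolding v_def by (intro tendsto_intros B1 c1)
        then have "(\<lambda>n. \<eta> n p * f p + indicator ?H p * (U p * (F p \<bullet> v n p))) \<longlonglongrightarrow> (T p * 1\<^sup>2) * f p + indicator ?H p * (U p * (F p \<bullet> (T p *\<^sub>R ((2 * 1) *\<^sub>R (0 *\<^sub>R p)) + 1\<^sup>2 *\<^sub>R (k p *\<^sub>R e))))"
          unfolding \<eta>_def by (intro tendsto_intros B1)
        then show "(\<lambda>n. \<eta> n p * f p + h (v n p) p) \<longlonglongrightarrow> T p * f p + k p * h e p"
          by (simp add: h_def mult_ac)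
      qed
      show "AE p in lborel. norm (\<eta> n p * f p + h (v n p) p) \<le> (5 + 3 / (2 * \<delta>)) * Q p" for n
      proof (rule AE_I2)
        fix p
        have Q0: "0 \<le> Q p" by (simp add: Q_def)
        have "\<bar>\<eta> n p * f p\<bar> \<le> 1 * Q p" unfolding abs_mult
          using Tb[of p] Bb[of n p] fQ[of p] Q0 by (intro mult_mono) (auto simp: \<eta>_def abs_mult mult_le_one power_le_one)
        moreover have "\<bar>h (v n p) p\<bar> \<le> (4 + 3 / (2 * \<delta>)) * Q p"
          by (rule order_trans[OF hQ mult_right_mono[OF vB Q0]])
        ultimately show "norm (\<eta> n p * f p + h (v n p) p) \<le> (5 + 3 / (2 * \<delta>)) * Q p"
          unfolding real_norm_def by (simp add: distrib_right)
      qed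
    qed
    have "(LINT p|lborel. T p * f p + k p * h e p) = 0"
      using lim unfolding zero by (simp add: LIMSEQ_const_iff)
    moreover have "integrable lborel (\<lambda>p. T p * f p)"
    proof (rule Bochner_Integration.integrable_bound[OF Qi])
      have "\<bar>T p * f p\<bar> \<le> 1 * \<bar>f p\<bar>" for p unfolding abs_mult using Tb[of p] by (intro mult_right_mono) auto
      then show "AE p in lborel. norm (T p * f p) \<le> norm (Q p)"
        using fQ by (intro AE_I2) (metis abs_ge_self mult_1 order_trans real_norm_def)
    qed measurable
    moreover have "integrable lborel (\<lambda>p. k p * h e p)"
    proof (rule Bochner_Integration.integrable_bound)
      show "integrable lborel (\<lambda>p. (3 / (2 * \<delta>)) * Q p)" using Qi by (rule integrable_mult_right)
      have [measurable]: "h e \<in> borel_measurable borel" using hm'[of "\<lambda>_. e"] by simp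
      show "(\<lambda>p. k p * h e p) \<in> borel_measurable lborel" by measurable
      have "\<bar>k p * h e p\<bar> \<le> (3 / (2 * \<delta>)) * Q p" for p unfolding abs_mult
        using kb[of p] hQ[of e p] \<delta> by (intro mult_mono) (auto simp: e_def norm_prod_def)
      then show "AE p in lborel. norm (k p * h e p) \<le> norm ((3 / (2 * \<delta>)) * Q p)"
        by (intro AE_I2) (metis abs_ge_self order_trans real_norm_def)
    qed
    ultimately show ?thesis by (simp add: T_def k_def)
  qed
  have [measurable]: "U0 \<in> borel_measurable borel" "f0 \<in> borel_measurable borel"
    using sU sf by (auto simp: sq_integrable_def)
  have hem[measurable]: "h e \<in> borel_measurable borel" using hm'[of "\<lambda>_. e"] by simp
  have ifU: "integrable lborel (\<lambda>x. f0 x * U0 x)"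
  proof (rule Bochner_Integration.integrable_bound)
    show "integrable lborel (\<lambda>x. (f0 x)\<^sup>2 + (U0 x)\<^sup>2)" using sU sf by (simp add: sq_integrable_real)
    have "\<bar>a * b\<bar> \<le> a\<^sup>2 + b\<^sup>2" for a b :: real
      using sum_squares_bound[of "\<bar>a\<bar>" "\<bar>b\<bar>"] mult_nonneg_nonneg[OF abs_ge_zero[of a] abs_ge_zero[of b]]
      unfolding power2_abs abs_mult by linarith
    then show "AE x in lborel. norm (f0 x * U0 x) \<le> norm ((f0 x)\<^sup>2 + (U0 x)\<^sup>2)" by (intro AE_I2) simp
  qed measurable
  define dl where "dl n = 1 / real (Suc n)" for n
  have dl: "0 < dl n" for n by (simp add: dl_def)
  have dl0: "dl \<longlonglongrightarrow> 0" unfolding dl_def[abs_def] by (rule LIMSEQ_Suc[OF lim_1_over_n])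
  \<comment> \<open>At each point of the half-space the layer step equals 1 as soon as
    \<open>2 * dl n \<le> snd p\<close>.\<close>
  have lim1: "(\<lambda>n. LINT p|lborel. layer_step (dl n) p * f p) \<longlonglongrightarrow> (LINT p|lborel. f p)"
  proof (rule integral_dominated_convergence[where w=Q])
    have "layer_step \<delta> \<in> borel_measurable borel" if "0 < \<delta>" for \<delta>
      using GDERIV_continuous[OF GDERIV_layer(2)[OF that]]
      by (intro borel_measurable_continuous_onI continuous_at_imp_continuous_on) blast
    then show "(\<lambda>p. layer_step (dl n) p * f p) \<in> borel_measurable lborel" for n
      using dl by measurable
    show "AE p in lborel. (\<lambda>n. layer_step (dl n) p * f p) \<longlonglongrightarrow> f p"
    proof (rule AE_I2)
      fix p
      show "(\<lambda>n. layer_step (dl n) p * f p) \<longlonglongrightarrow> f p"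
      proof (cases "p \<in> ?H")
        case True
        then have "\<forall>\<^sub>F n in sequentially. dl n < snd p / 2"
          using dl0 by (intro order_tendstoD(2)[of _ 0]) (auto simp: half_space_def)
        then have "\<forall>\<^sub>F n in sequentially. layer_step (dl n) p * f p = f p"
        proof eventually_elim
          case (elim n)
          then have "1 \<le> (snd p - dl n) / dl n" using dl[of n] by (simp add: pos_le_divide_eq)
          then show ?case by (simp add: layer_step_def smooth_step_1)
        qed
        then show ?thesis by (rule tendsto_eventually)
      qed (simp add: f_def)
    qed
    show "AE p in lborel. norm (layer_step (dl n) p * f p) \<le> Q p" for n
    proof (rule AE_I2)
      fix p
      have "\<bar>layer_step (dl n) p\<bar> * \<bar>f p\<bar> \<le> 1 * Q p"
        using fQ[of p] smooth_step_bounds unfolding layer_step_def by (intro mult_mono) auto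
      then show "norm (layer_step (dl n) p * f p) \<le> Q p" by (simp add: abs_mult)
    qed
  qed (use Qi in auto)
  have lim2: "(\<lambda>n. LINT p|lborel. layer_density (dl n) (snd p) * h e p) \<longlonglongrightarrow> (LINT x|lborel. f0 x * U0 x)"
  proof (rule LIMSEQ_I)
    fix r :: real assume r: "0 < r"
    \<comment> \<open>\<open>F\<close> and \<open>U\<close> are arbitrary outside the half-space.
      The zero extensions have Borel slices and the same traces.\<close>
    define A where "A p = (indicator ?H p *\<^sub>R F p) \<bullet> e" for p
    define V where "V p = indicator ?H p *\<^sub>R U p" for p
    have Am: "A \<in> borel_measurable borel" and Vm: "V \<in> borel_measurable borel"
      unfolding A_def[abs_def] V_def[abs_def] by measurable
    have slice: "(\<lambda>x. S (x, y)) \<in> borel_measurable borel" if "S \<in> borel_measurable borel" for S :: "'a \<times> real \<Rightarrow> real" and y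
    proof -
      have "S \<in> borel_measurable (borel \<Otimes>\<^sub>M borel)" using that by (simp add: borel_prod)
      then show ?thesis by measurable
    qed
    have in_H: "(x, y) \<in> ?H" if "0 < y" for x y using that by (simp add: half_space_def)
    have tA: "has_trace A f0"
      by (rule has_trace_cong[OF tF]) (simp add: A_def e_def in_H)
    have tV: "has_trace V U0"
      by (rule has_trace_cong[OF tU]) (simp add: V_def in_H)
    obtain d where d: "0 < d" "AE y in lborel. 0 < y \<and> y < d \<longrightarrow> (\<integral>\<^sup>+x. ennreal \<bar>A (x, y) * V (x, y) - f0 x * U0 x\<bar> \<partial>lborel) \<le> ennreal (r / 3)"
      using has_trace_product_L1[OF tA tV sf sU slice[OF Am] slice[OF Vm], of "r / 3"] r by auto
    obtain N where N: "\<And>n. n \<ge> N \<Longrightarrow> dl n < d / 2"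
      using order_tendstoD(2)[OF dl0, of "d / 2"] d(1) by (auto simp: eventually_sequentially)
    have "norm ((LINT p|lborel. layer_density (dl n) (snd p) * h e p) - (LINT x|lborel. f0 x * U0 x)) < r" if n: "n \<ge> N" for n
    proof -
      let ?k = "\<lambda>p::'a \<times> real. layer_density (dl n) (snd p)"
      have kb: "0 \<le> ?k p" "?k p \<le> 3 / (2 * dl n)" for p by (rule layer_density_bounds[OF dl])+
      have hA: "h e p = A p * V p" for p by (simp add: h_def A_def V_def indicator_def)
      have i1: "integrable lborel (\<lambda>p. ?k p * h e p)"
      proof (rule Bochner_Integration.integrable_bound)
        show "integrable lborel (\<lambda>p. (3 / (2 * dl n)) * Q p)" using Qi by (rule integrable_mult_right)
        show "(\<lambda>p. ?k p * h e p) \<in> borel_measurable lborel"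
          using layer_density_snd_measurable by measurable
        have "\<bar>?k p * h e p\<bar> \<le> (3 / (2 * dl n)) * Q p" for p unfolding abs_mult
          using kb[of p] hQ[of e p] dl[of n] by (intro mult_mono) (auto simp: e_def norm_prod_def)
        then show "AE p in lborel. norm (?k p * h e p) \<le> norm ((3 / (2 * dl n)) * Q p)"
          by (intro AE_I2) (metis abs_ge_self order_trans real_norm_def)
      qed
      \<comment> \<open>The layer has mass 1, so the boundary integral is itself a layer average and
        the difference can be estimated under one integral.\<close>
      note i2 = layer_density_product_integral[OF dl ifU, of n]
      have "(LINT p|lborel. ?k p * h e p) - (LINT x|lborel. f0 x * U0 x)
        = (LINT p|lborel. ?k p * h e p - ?k p * (f0 (fst p) * U0 (fst p)))"
        using i1 i2 by simp
      also have "ennreal (norm \<dots>) \<le> (\<integral>\<^sup>+p. ennreal (norm (?k p * h e p - ?k p * (f0 (fst p) * U0 (fst p)))) \<partial>lborel)"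
        using i1 i2(1) by (intro integral_norm_bound_ennreal Bochner_Integration.integrable_diff)
      also have "\<dots> = (\<integral>\<^sup>+p. ennreal (?k p) * ennreal \<bar>A p * V p - f0 (fst p) * U0 (fst p)\<bar> \<partial>lborel)"
      proof (rule nn_integral_cong)
        fix p
        have "norm (?k p * h e p - ?k p * (f0 (fst p) * U0 (fst p))) = ?k p * \<bar>A p * V p - f0 (fst p) * U0 (fst p)\<bar>"
          unfolding hA right_diff_distrib[symmetric] real_norm_def abs_mult using kb(1)[of p] by simp
        then show "ennreal (norm (?k p * h e p - ?k p * (f0 (fst p) * U0 (fst p)))) = ennreal (?k p) * ennreal \<bar>A p * V p - f0 (fst p) * U0 (fst p)\<bar>"
          using kb(1)[of p] by (simp add: ennreal_mult)
      qed
      also have "\<dots> \<le> ennreal (3 / 2) * ennreal (r / 3)"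
      proof (rule nn_integral_layer_le[OF _ dl, of _ n d])
        have "(\<lambda>p. f0 (fst p) * U0 (fst p)) \<in> borel_measurable (borel :: ('a \<times> real) measure)"
          unfolding borel_prod[symmetric] by measurable
        then show "(\<lambda>p. ennreal \<bar>A p * V p - f0 (fst p) * U0 (fst p)\<bar>) \<in> borel_measurable borel"
          using Am Vm by measurable
        show "2 * dl n \<le> d" using N[OF n] by simp
        show "AE y in lborel. 0 < y \<and> y < d \<longrightarrow> (\<integral>\<^sup>+x. ennreal \<bar>A (x, y) * V (x, y) - f0 (fst (x, y)) * U0 (fst (x, y))\<bar> \<partial>lborel) \<le> ennreal (r / 3)"
          using d(2) by simp
      qed
      also have "\<dots> = ennreal (r / 2)" using r by (simp add: ennreal_mult[symmetric])
      also have "\<dots> < ennreal r" using r by (intro ennreal_lessI) auto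
      finally show ?thesis using r by (simp add: ennreal_less_iff)
    qed
    then show "\<exists>no. \<forall>n\<ge>no. norm ((LINT p|lborel. layer_density (dl n) (snd p) * h e p) - (LINT x|lborel. f0 x * U0 x)) < r" by blast
  qed
  have "(LINT p|lborel. f p) = - (LINT x|lborel. f0 x * U0 x)"
    by (rule LIMSEQ_unique[OF lim1]) (use tendsto_minus[OF lim2] step[OF dl] in simp)
  then show "(LINT p:half_space|lborel. F p \<bullet> G p) = - (LINT x|lborel. f0 x * U0 x)"
    by (simp add: set_lebesgue_integral_def f_def)
qed

section \<open>Bounded eigenfunctions and identification of the extension\<close>

lemma Ck_on_diff:
  assumes S: "open S"
  shows "Ck_on k S f \<Longrightarrow> Ck_on k S g \<Longrightarrow> Ck_on k S (\<lambda>p. f p - g p)"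
proof (induction k arbitrary: f g)
  case 0
  then show ?case by (auto intro: continuous_intros)
next
  case (Suc k)
  note f = Ck_on_Suc_imp[OF S Suc.prems(1)] and g = Ck_on_Suc_imp[OF S Suc.prems(2)]
  show ?case
  proof (rule Ck_on_Suc_GDERIV[OF S])
    show "GDERIV (\<lambda>p. f p - g p) p :> gradient f p - gradient g p" if "p \<in> S" for p
      using f(1)[OF that] g(1)[OF that] by (rule GDERIV_diff)
    show "Ck_on k S (\<lambda>p. (gradient f p - gradient g p) \<bullet> b)" if "b \<in> Basis" for b
      unfolding inner_diff_left using f(3)[OF that] g(3)[OF that] by (rule Suc.IH)
  qed
qed

lemma laplacian_diff:
  assumes S: "open S" and f: "Ck_on 2 S f" and g: "Ck_on 2 S g" and p: "p \<in> S"
  shows "laplacian (\<lambda>p. f p - g p) p = laplacian f p - laplacian g p"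
proof -
  note F = Ck_on_2_gradient[OF S f] and G = Ck_on_2_gradient[OF S g]
  have "partial_deriv b (partial_deriv b (\<lambda>p. f p - g p)) p
      = partial_deriv b (partial_deriv b f) p - partial_deriv b (partial_deriv b g) p" if b: "b \<in> Basis" for b
  proof -
    have 1: "gradient f q \<bullet> b - gradient g q \<bullet> b = partial_deriv b (\<lambda>p. f p - g p) q" if "q \<in> S" for q
      using GDERIV_partial_deriv[OF GDERIV_diff[OF F(1)[OF that] G(1)[OF that]], of b] by (simp add: inner_diff_left)
    have "GDERIV (\<lambda>q. gradient f q \<bullet> b - gradient g q \<bullet> b) p :>
        gradient (\<lambda>q. gradient f q \<bullet> b) p - gradient (\<lambda>q. gradient g q \<bullet> b) p"
      by (intro GDERIV_diff F(4) G(4) p b)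
    from GDERIV_transform_open[OF this S p 1]
    show ?thesis using b by (simp add: GDERIV_partial_deriv inner_diff_left gradient_inner_Basis)
  qed
  then show ?thesis by (simp add: laplacian_def sum_subtractf)
qed

section \<open>Averages of the semigroup over short times\<close>

lemma massive_kernel_measurable2 [measurable (raw)]:
  fixes g :: "'x \<Rightarrow> 'a::euclidean_space"
  assumes "f \<in> borel_measurable M" "g \<in> borel_measurable M"
  shows "(\<lambda>x. massive_kernel m (f x) (g x)) \<in> borel_measurable M"
  using measurable_compose[OF measurable_Pair[OF assms] massive_kernel_measurable[of m]] by simp

text \<open>The integral of \<open>exp (- s A\<^sub>m) h\<close> over
  \<open>0 < s < \<epsilon>\<close>, taken in \<open>ennreal\<close> so that it is defined and
  monotone without integrability conditions.\<close>

definition poisson_average :: "real \<Rightarrow> real \<Rightarrow> ('a::euclidean_space \<Rightarrow> ennreal) \<Rightarrow> 'a \<Rightarrow> ennreal" where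
  "poisson_average m \<epsilon> h x = (\<integral>\<^sup>+s. ennreal (indicator {0<..<\<epsilon>} s) *
     (\<integral>\<^sup>+z. ennreal (massive_kernel m s (x - z)) * h z \<partial>lborel) \<partial>lborel)"

lemma poisson_average_measurable:
  fixes h :: "'a::euclidean_space \<Rightarrow> ennreal"
  assumes [measurable]: "h \<in> borel_measurable borel"
  shows "poisson_average m \<epsilon> h \<in> borel_measurable borel"
  unfolding poisson_average_def[abs_def] by measurable

text \<open>Cauchy-Schwarz in \<open>s\<close> gives one factor \<open>\<epsilon>\<close>, and
  integrating the contraction bound over \<open>s\<close> gives the other.\<close>

lemma poisson_average_L2:
  fixes h :: "'a::euclidean_space \<Rightarrow> ennreal"
  assumes [measurable]: "h \<in> borel_measurable borel" and m: "0 \<le> m" and \<epsilon>: "0 < \<epsilon>"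
  shows "(\<integral>\<^sup>+x. (poisson_average m \<epsilon> h x)\<^sup>2 \<partial>lborel) \<le> ennreal (\<epsilon>\<^sup>2) * (\<integral>\<^sup>+x. (h x)\<^sup>2 \<partial>lborel)"
proof -
  let ?i = "\<lambda>s. indicator {0<..<\<epsilon>} s :: real"
  let ?S = "\<lambda>s x. \<integral>\<^sup>+z. ennreal (massive_kernel m s (x - z)) * h z \<partial>lborel"
  have ii: "(\<integral>\<^sup>+s. ennreal (?i s) \<partial>lborel) = ennreal \<epsilon>"
    using \<epsilon> by (simp add: ennreal_indicator)
  have "(\<integral>\<^sup>+x. (poisson_average m \<epsilon> h x)\<^sup>2 \<partial>lborel)
      \<le> (\<integral>\<^sup>+x. ennreal \<epsilon> * (\<integral>\<^sup>+s. ennreal (?i s) * (?S s x)\<^sup>2 \<partial>lborel) \<partial>lborel)"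
  proof (rule nn_integral_mono)
    fix x
    show "(poisson_average m \<epsilon> h x)\<^sup>2 \<le> ennreal \<epsilon> * (\<integral>\<^sup>+s. ennreal (?i s) * (?S s x)\<^sup>2 \<partial>lborel)"
      unfolding poisson_average_def ii[symmetric]
      by (rule nn_integral_weighted_Cauchy_Schwarz) simp_all
  qed
  also have "\<dots> = ennreal \<epsilon> * (\<integral>\<^sup>+x. (\<integral>\<^sup>+s. ennreal (?i s) * (?S s x)\<^sup>2 \<partial>lborel) \<partial>lborel)"
    by (rule nn_integral_cmult) measurable
  also have "(\<integral>\<^sup>+x. (\<integral>\<^sup>+s. ennreal (?i s) * (?S s x)\<^sup>2 \<partial>lborel) \<partial>lborel)
      = (\<integral>\<^sup>+s. (\<integral>\<^sup>+x. ennreal (?i s) * (?S s x)\<^sup>2 \<partial>lborel) \<partial>lborel)"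
    by (rule lborel_pair.Fubini') measurable
  also have "\<dots> \<le> (\<integral>\<^sup>+s. ennreal (?i s) * (\<integral>\<^sup>+x. (h x)\<^sup>2 \<partial>lborel) \<partial>lborel)"
  proof (rule nn_integral_mono)
    fix s :: real
    show "(\<integral>\<^sup>+x. ennreal (?i s) * (?S s x)\<^sup>2 \<partial>lborel) \<le> ennreal (?i s) * (\<integral>\<^sup>+x. (h x)\<^sup>2 \<partial>lborel)"
    proof (cases "s \<in> {0<..<\<epsilon>}")
      case True
      then have s: "0 < s" by simp
      have "(\<integral>\<^sup>+x. (?S s x)\<^sup>2 \<partial>lborel) \<le> (\<integral>\<^sup>+x. ennreal (massive_kernel m s (x::'a)) \<partial>lborel)\<^sup>2 * (\<integral>\<^sup>+x. (h x)\<^sup>2 \<partial>lborel)"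
        by (rule Young_L1_L2) (use less_imp_le[OF massive_kernel_pos[OF s]] in auto)
      also have "\<dots> \<le> 1 * (\<integral>\<^sup>+x. (h x)\<^sup>2 \<partial>lborel)"
      proof (rule mult_right_mono)
        have "exp (- m * s) \<le> 1" using m s by simp
        then have "(exp (- m * s))\<^sup>2 \<le> 1" by (intro power_le_one) auto
        then show "(\<integral>\<^sup>+x. ennreal (massive_kernel m s (x::'a)) \<partial>lborel)\<^sup>2 \<le> 1"
          unfolding nn_integral_massive_kernel[OF s m] by (simp add: ennreal_power flip: ennreal_1)
      qed simp
      finally show ?thesis using True by simp
    qed simp
  qed
  also have "\<dots> = ennreal \<epsilon> * (\<integral>\<^sup>+x. (h x)\<^sup>2 \<partial>lborel)"
    by (subst nn_integral_multc) (simp_all add: ii)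
  finally have "(\<integral>\<^sup>+x. (poisson_average m \<epsilon> h x)\<^sup>2 \<partial>lborel) \<le> ennreal \<epsilon> * (ennreal \<epsilon> * (\<integral>\<^sup>+x. (h x)\<^sup>2 \<partial>lborel))"
    by (simp add: mult_left_mono)
  also have "\<dots> = ennreal (\<epsilon>\<^sup>2) * (\<integral>\<^sup>+x. (h x)\<^sup>2 \<partial>lborel)"
    using \<epsilon> by (simp add: power2_eq_square ennreal_mult mult.assoc)
  finally show ?thesis .
qed

lemma poisson_average_mono:
  assumes "AE z in lborel. h z \<le> k z"
  shows "poisson_average m \<epsilon> h x \<le> poisson_average m \<epsilon> k x"
  unfolding poisson_average_def
proof (rule nn_integral_mono, rule mult_left_mono, rule nn_integral_mono_AE)
  fix s :: real
  show "AE z in lborel. ennreal (massive_kernel m s (x - z)) * h z \<le> ennreal (massive_kernel m s (x - z)) * k z"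
    using assms by eventually_elim (simp add: mult_left_mono)
qed simp

text \<open>An inequality and not an identity, because the kernel mass \<open>exp (- m * s)\<close>
  is replaced by 1.\<close>

lemma poisson_average_cmult_add:
  fixes h :: "'a::euclidean_space \<Rightarrow> ennreal"
  assumes [measurable]: "h \<in> borel_measurable borel" and m: "0 \<le> m" and \<epsilon>: "0 < \<epsilon>"
  shows "poisson_average m \<epsilon> (\<lambda>z. c * (a + h z)) x \<le> c * (ennreal \<epsilon> * a + poisson_average m \<epsilon> h x)"
proof -
  let ?i = "\<lambda>s. indicator {0<..<\<epsilon>} s :: real"
  let ?S = "\<lambda>s. \<integral>\<^sup>+z. ennreal (massive_kernel m s (x - z)) * h z \<partial>lborel"
  have "poisson_average m \<epsilon> (\<lambda>z. c * (a + h z)) x \<le> (\<integral>\<^sup>+s. c * (a * ennreal (?i s) + ennreal (?i s) * ?S s) \<partial>lborel)"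
    unfolding poisson_average_def
  proof (rule nn_integral_mono)
    fix s :: real
    show "ennreal (?i s) * (\<integral>\<^sup>+z. ennreal (massive_kernel m s (x - z)) * (c * (a + h z)) \<partial>lborel)
      \<le> c * (a * ennreal (?i s) + ennreal (?i s) * ?S s)"
    proof (cases "s \<in> {0<..<\<epsilon>}")
      case True
      then have s: "0 < s" by simp
      have "(\<integral>\<^sup>+z. ennreal (massive_kernel m s (x - z)) * (c * (a + h z)) \<partial>lborel)
         = (\<integral>\<^sup>+z. c * (a * ennreal (massive_kernel m s (x - z)) + ennreal (massive_kernel m s (x - z)) * h z) \<partial>lborel)"
        by (intro nn_integral_cong) (simp add: distrib_left mult_ac)
      also have "\<dots> = c * (a * (\<integral>\<^sup>+z. ennreal (massive_kernel m s (x - z)) \<partial>lborel) + ?S s)"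
        by (simp add: nn_integral_cmult nn_integral_add)
      also have "(\<integral>\<^sup>+z. ennreal (massive_kernel m s (x - z)) \<partial>lborel) = ennreal (exp (- m * s))"
        using nn_integral_reflect[of "\<lambda>z. ennreal (massive_kernel m s z)" x] nn_integral_massive_kernel[OF s m, where 'a='a] by simp
      also have "c * (a * ennreal (exp (- m * s)) + ?S s) \<le> c * (a * 1 + ?S s)"
      proof -
        have "exp (- m * s) \<le> 1" using m s by simp
        then have "ennreal (exp (- m * s)) \<le> 1" by (simp flip: ennreal_1)
        then show ?thesis by (intro mult_left_mono add_right_mono) simp_all
      qed
      finally show ?thesis using True by simp
    qed simp
  qed
  also have "\<dots> = c * (a * (\<integral>\<^sup>+s. ennreal (?i s) \<partial>lborel) + poisson_average m \<epsilon> h x)"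
    unfolding poisson_average_def by (simp add: nn_integral_cmult nn_integral_add)
  also have "(\<integral>\<^sup>+s. ennreal (?i s) \<partial>lborel) = ennreal \<epsilon>"
    using \<epsilon> by (simp add: ennreal_indicator)
  finally show ?thesis by (simp add: mult.commute)
qed

text \<open>With \<open>A\<^sub>m \<phi> = g\<close> one has \<open>\<phi> = e\<^bsup>-\<epsilon>A\<^esup>\<phi> + \<integral>\<^sub>0\<^sup>\<epsilon> e\<^bsup>-sA\<^esup> g ds\<close>. The first term is bounded, and for
  small \<open>\<epsilon>\<close> the second is a contraction applied to \<open>\<bar>\<phi>\<bar>\<close>, which forces the part of \<open>\<bar>\<phi>\<bar>\<close> above
  twice that bound to vanish.\<close>
lemma eigenfunction_bounded:
  fixes \<phi> g :: "'a::euclidean_space \<Rightarrow> real"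
  assumes m: "0 \<le> m" and F: "L2_fourier (\<lambda>x. complex_of_real (\<phi> x)) fh"
    and W: "L2_fourier w (\<lambda>\<xi>. complex_of_real (massive_symbol m \<xi>) * fh \<xi>)"
    and w: "AE x in lborel. w x = complex_of_real (g x)"
    and s\<phi>: "sq_integrable \<phi>" and sg: "sq_integrable g"
    and C: "0 < C" and gC: "AE x in lborel. \<bar>g x\<bar> \<le> C * \<bar>\<phi> x\<bar>"
  shows "\<exists>M\<ge>0. AE x in lborel. \<bar>\<phi> x\<bar> \<le> M"
proof -
  have \<phi>m[measurable]: "\<phi> \<in> borel_measurable borel" and gm[measurable]: "g \<in> borel_measurable borel"
    using s\<phi> sg by (auto simp: sq_integrable_def)
  define V where "V p = massive_poisson m (snd p) \<phi> (fst p)" for p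
  note R = massive_poisson_regular[OF F W w \<phi>m gm m, folded V_def]
  \<comment> \<open>Then \<open>C * \<epsilon> = 1 / 2\<close>, which fixes both the threshold
    \<open>2 * M0\<close> and the factor \<open>1 / 4\<close> in the final contraction.\<close>
  define \<epsilon> where "\<epsilon> = 1 / (2 * C)"
  have \<epsilon>: "0 < \<epsilon>" using C by (simp add: \<epsilon>_def)
  obtain M0 where M0: "\<And>x. \<bar>V (x, \<epsilon>)\<bar> \<le> M0" using R(4)[OF \<epsilon>] by blast
  have M0n: "0 \<le> M0" using M0[of 0] by simp
  let ?N = "poisson_average m \<epsilon> :: ('a \<Rightarrow> ennreal) \<Rightarrow> 'a \<Rightarrow> ennreal"
  have V2: "Ck_on (Suc 1) half_space V" using R(1)[of 2] by (simp add: numeral_2_eq_2)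
  have pd: "((\<lambda>s. V (x, s)) has_real_derivative - massive_poisson m s g x) (at s)" if s: "0 < s" for x s
  proof -
    have p: "(x, s) \<in> half_space" using s by (simp add: half_space_def)
    have b: "(0, 1) \<in> (Basis :: ('a \<times> real) set)" by (simp add: Basis_prod_def)
    have "GDERIV V ((x, 0) + s *\<^sub>R (0, 1)) :> gradient V (x, s)"
      using Ck_on_Suc_imp(1)[OF open_half_space V2 p] by simp
    from GDERIV_along_line[OF this] show ?thesis
      using R(3)[OF p] gradient_inner_Basis[OF b, of V "(x, s)"] by simp
  qed
  have pc: "continuous_on {a..b} (\<lambda>s. - massive_poisson m s g x)" if "0 < a" for a b x
  proof -
    have b: "(0, 1) \<in> (Basis :: ('a \<times> real) set)" by (simp add: Basis_prod_def)
    have "continuous_on half_space (\<lambda>p. gradient V p \<bullet> (0, 1))"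
      using Ck_on_continuous[OF Ck_on_Suc_imp(3)[OF open_half_space V2 b]] .
    then have "continuous_on {a..b} (\<lambda>s. gradient V (x, s) \<bullet> (0, 1))"
      by (rule continuous_on_compose2) (use that in \<open>auto simp: half_space_def intro!: continuous_intros\<close>)
    then show ?thesis
    proof (rule continuous_on_eq)
      fix s assume "s \<in> {a..b}"
      then have p: "(x, s) \<in> half_space" using that by (simp add: half_space_def)
      show "gradient V (x, s) \<bullet> (0, 1) = - massive_poisson m s g x"
        using R(3)[OF p] gradient_inner_Basis[OF b, of V "(x, s)"] by simp
    qed
  qed
  \<comment> \<open>The fundamental theorem is applied between a positive height \<open>y\<close>
    and \<open>\<epsilon>\<close>, since nothing is known pointwise at height 0.\<close>
  have Vle: "ennreal \<bar>V (x, y)\<bar> \<le> ennreal M0 + ?N (\<lambda>z. ennreal \<bar>g z\<bar>) x" if y: "0 < y" "y < \<epsilon>" for x y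
  proof -
    let ?q = "\<lambda>s. indicator {y..\<epsilon>} s *\<^sub>R (- massive_poisson m s g x)"
    have int: "(LINT s|lborel. ?q s) = V (x, \<epsilon>) - V (x, y)"
    proof (rule integral_FTC_atLeastAtMost)
      show "((\<lambda>s. V (x, s)) has_vector_derivative - massive_poisson m s g x) (at s within {y..\<epsilon>})" if "y \<le> s" for s
        using pd[of s x] y that
        by (auto simp: has_real_derivative_iff_has_vector_derivative intro: has_vector_derivative_at_within)
    qed (use y pc in auto)
    have iq: "integrable lborel ?q"
      using borel_integrable_atLeastAtMost'[OF pc[OF y(1), of \<epsilon> x]] by (simp add: set_integrable_def)
    have "V (x, y) = V (x, \<epsilon>) - (LINT s|lborel. ?q s)" using int by simp
    then have "\<bar>V (x, y)\<bar> \<le> M0 + \<bar>LINT s|lborel. ?q s\<bar>" using M0[of x] by linarith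
    then have "ennreal \<bar>V (x, y)\<bar> \<le> ennreal (M0 + \<bar>LINT s|lborel. ?q s\<bar>)" by (rule ennreal_leI)
    also have "\<dots> = ennreal M0 + ennreal (norm (LINT s|lborel. ?q s))" using M0n by simp
    also have "\<dots> \<le> ennreal M0 + ?N (\<lambda>z. ennreal \<bar>g z\<bar>) x"
    proof (rule add_left_mono)
      have "ennreal (norm (LINT s|lborel. ?q s)) \<le> (\<integral>\<^sup>+s. ennreal (norm (?q s)) \<partial>lborel)"
        by (rule integral_norm_bound_ennreal[OF iq])
      also have "\<dots> \<le> ?N (\<lambda>z. ennreal \<bar>g z\<bar>) x"
        unfolding poisson_average_def
      proof (rule nn_integral_mono_AE)
        \<comment> \<open>The interval of integration is closed at \<open>\<epsilon>\<close>, the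
          one in \<open>poisson_average\<close> is open; the endpoint is a null set.\<close>
        have "AE s in lborel. s \<noteq> \<epsilon>" by (rule AE_lborel_singleton)
        then show "AE s in lborel. ennreal (norm (?q s)) \<le> ennreal (indicator {0<..<\<epsilon>} s) *
           (\<integral>\<^sup>+z. ennreal (massive_kernel m s (x - z)) * ennreal \<bar>g z\<bar> \<partial>lborel)"
        proof eventually_elim
          case (elim s)
          show ?case
          proof (cases "s \<in> {y..\<epsilon>}")
            case True
            then have s: "0 < s" "s < \<epsilon>" using y elim by auto
            then show ?thesis using True massive_poisson_le_nn[OF s(1) m sg, of x] by simp
          qed simp
        qed
      qed
      finally show "ennreal (norm (LINT s|lborel. ?q s)) \<le> ?N (\<lambda>z. ennreal \<bar>g z\<bar>) x" .
    qed
    finally show ?thesis .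
  qed
  have Nm[measurable]: "?N (\<lambda>z. ennreal \<bar>g z\<bar>) \<in> borel_measurable borel"
    by (rule poisson_average_measurable) measurable
  let ?b = "\<lambda>x. ennreal M0 + ?N (\<lambda>z. ennreal \<bar>g z\<bar>) x"
  have le1: "AE x in lborel. ennreal \<bar>\<phi> x\<bar> \<le> ?b x"
  proof -
    define y where "y n = \<epsilon> / real (n + 2)" for n
    have y: "0 < y n" "y n < \<epsilon>" for n using \<epsilon> by (auto simp: y_def divide_less_eq)
    have "(\<lambda>n. \<epsilon> * (1 / real (n + 2))) \<longlonglongrightarrow> \<epsilon> * 0"
      by (intro tendsto_intros LIMSEQ_ignore_initial_segment[OF lim_1_over_n])
    then have y0: "y \<longlonglongrightarrow> 0" by (simp add: y_def[abs_def])
    \<comment> \<open>The boundary values are attained in \<open>L\<^sup>2\<close> only. Truncated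
      subtraction in \<open>ennreal\<close> keeps just the excess of
      \<open>\<bar>\<phi> x\<bar>\<close> over the bound, and the \<open>L\<^sup>2\<close> norm of
      this excess is at most the distance from \<open>V\<close> at height \<open>y n\<close> to
      \<open>\<phi>\<close>.\<close>
    let ?D = "\<lambda>x. ennreal \<bar>\<phi> x\<bar> - ?b x"
    have "(\<integral>\<^sup>+x. (?D x)\<^sup>2 \<partial>lborel) \<le> (\<integral>\<^sup>+x. ennreal ((massive_poisson m (y n) \<phi> x - \<phi> x)\<^sup>2) \<partial>lborel)" for n
    proof (rule nn_integral_mono)
      fix x
      have "?D x \<le> ennreal \<bar>\<phi> x\<bar> - ennreal \<bar>V (x, y n)\<bar>"
        by (intro ennreal_minus_mono order_refl Vle y)
      also have "\<dots> = ennreal (\<bar>\<phi> x\<bar> - \<bar>V (x, y n)\<bar>)" by (simp add: ennreal_minus)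
      also have "\<dots> \<le> ennreal \<bar>massive_poisson m (y n) \<phi> x - \<phi> x\<bar>"
        unfolding V_def by (intro ennreal_leI) auto
      finally have "(?D x)\<^sup>2 \<le> (ennreal \<bar>massive_poisson m (y n) \<phi> x - \<phi> x\<bar>)\<^sup>2" by (rule power_mono) simp
      then show "(?D x)\<^sup>2 \<le> ennreal ((massive_poisson m (y n) \<phi> x - \<phi> x)\<^sup>2)" by (simp add: ennreal_power)
    qed
    then have "(\<integral>\<^sup>+x. (?D x)\<^sup>2 \<partial>lborel) \<le> 0"
      by (intro LIMSEQ_le_const[OF massive_poisson_tendsto_L2[OF m s\<phi> y(1) y0]]) blast
    then have "AE x in lborel. (?D x)\<^sup>2 = 0"
      by (subst (asm) le_zero_eq, subst (asm) nn_integral_0_iff_AE) measurable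
    then show ?thesis by eventually_elim (simp add: diff_eq_0_iff_ennreal)
  qed
  define \<psi> where "\<psi> x = ennreal (max 0 (\<bar>\<phi> x\<bar> - 2 * M0))" for x
  have [measurable]: "\<psi> \<in> borel_measurable borel" unfolding \<psi>_def[abs_def] by measurable
  \<comment> \<open>The threshold reproduces itself: the constant part \<open>2 * M0\<close>
    contributes \<open>C * (\<epsilon> * (2 * M0)) = M0\<close>, and the \<open>M0\<close> of the
    first term brings the sum back to \<open>2 * M0\<close>.\<close>
  have gN: "?N (\<lambda>z. ennreal \<bar>g z\<bar>) x \<le> ennreal M0 + ennreal C * ?N \<psi> x" for x
  proof -
    have "?N (\<lambda>z. ennreal \<bar>g z\<bar>) x \<le> ?N (\<lambda>z. ennreal C * (ennreal (2 * M0) + \<psi> z)) x"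
    proof (rule poisson_average_mono)
      show "AE z in lborel. ennreal \<bar>g z\<bar> \<le> ennreal C * (ennreal (2 * M0) + \<psi> z)"
        using gC
      proof eventually_elim
        case (elim z)
        have "C * \<bar>\<phi> z\<bar> \<le> C * (2 * M0 + max 0 (\<bar>\<phi> z\<bar> - 2 * M0))" using C by (intro mult_left_mono) auto
        with elim have "ennreal \<bar>g z\<bar> \<le> ennreal (C * (2 * M0 + max 0 (\<bar>\<phi> z\<bar> - 2 * M0)))" by (intro ennreal_leI) simp
        also have "\<dots> = ennreal C * (ennreal (2 * M0) + \<psi> z)" using C M0n by (simp add: \<psi>_def ennreal_mult)
        finally show ?case .
      qed
    qed
    also have "\<dots> \<le> ennreal C * (ennreal \<epsilon> * ennreal (2 * M0) + ?N \<psi> x)"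
      by (rule poisson_average_cmult_add[OF _ m \<epsilon>]) measurable
    also have "\<dots> = ennreal C * (ennreal \<epsilon> * ennreal (2 * M0)) + ennreal C * ?N \<psi> x" by (rule distrib_left)
    also have "ennreal C * (ennreal \<epsilon> * ennreal (2 * M0)) = ennreal (C * (\<epsilon> * (2 * M0)))"
      using C \<epsilon> M0n by (simp add: ennreal_mult)
    also have "C * (\<epsilon> * (2 * M0)) = M0" using C by (simp add: \<epsilon>_def)
    finally show ?thesis .
  qed
  have le2: "AE x in lborel. \<psi> x \<le> ennreal C * ?N \<psi> x"
    using le1
  proof eventually_elim
    case (elim x)
    have "ennreal \<bar>\<phi> x\<bar> \<le> ennreal M0 + (ennreal M0 + ennreal C * ?N \<psi> x)"
      by (rule order_trans[OF elim add_left_mono[OF gN]])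
    then have "ennreal \<bar>\<phi> x\<bar> \<le> ennreal (2 * M0) + ennreal C * ?N \<psi> x"
      unfolding mult_2 ennreal_plus[OF M0n M0n] add.assoc .
    then have "ennreal \<bar>\<phi> x\<bar> - ennreal (2 * M0) \<le> ennreal C * ?N \<psi> x"
      by (simp add: ennreal_minus_le_iff)
    moreover have "\<psi> x = ennreal \<bar>\<phi> x\<bar> - ennreal (2 * M0)"
      using M0n by (simp add: \<psi>_def ennreal_minus max_def ennreal_neg)
    ultimately show ?case by simp
  qed
  let ?I = "\<integral>\<^sup>+x. (\<psi> x)\<^sup>2 \<partial>lborel"
  have "?I \<le> (\<integral>\<^sup>+x. ennreal (C\<^sup>2) * (?N \<psi> x)\<^sup>2 \<partial>lborel)"
  proof (rule nn_integral_mono_AE)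
    show "AE x in lborel. (\<psi> x)\<^sup>2 \<le> ennreal (C\<^sup>2) * (?N \<psi> x)\<^sup>2"
      using le2
    proof eventually_elim
      case (elim x)
      have "(\<psi> x)\<^sup>2 \<le> (ennreal C * ?N \<psi> x)\<^sup>2" using elim by (rule power_mono) simp
      then show ?case using C by (simp add: power_mult_distrib ennreal_power)
    qed
  qed
  also have "\<dots> = ennreal (C\<^sup>2) * (\<integral>\<^sup>+x. (?N \<psi> x)\<^sup>2 \<partial>lborel)"
    by (rule nn_integral_cmult) (use poisson_average_measurable[of \<psi> m \<epsilon>] in measurable)
  also have "\<dots> \<le> ennreal (C\<^sup>2) * (ennreal (\<epsilon>\<^sup>2) * ?I)"
    by (intro mult_left_mono poisson_average_L2 m \<epsilon>) auto
  also have "\<dots> = ennreal (1 / 4) * ?I"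
  proof -
    have "C\<^sup>2 * \<epsilon>\<^sup>2 = 1 / 4" using C by (simp add: \<epsilon>_def power2_eq_square)
    then have "ennreal (C\<^sup>2) * ennreal (\<epsilon>\<^sup>2) = ennreal (1 / 4)" by (simp add: ennreal_mult[symmetric])
    then show ?thesis by (simp add: mult.assoc[symmetric])
  qed
  finally have I: "?I \<le> ennreal (1 / 4) * ?I" .
  \<comment> \<open>Finiteness of \<open>?I\<close> is what allows the contraction to be
    absorbed.\<close>
  have "?I \<le> (\<integral>\<^sup>+x. ennreal ((\<phi> x)\<^sup>2) \<partial>lborel)"
  proof (rule nn_integral_mono)
    fix x
    have "\<psi> x \<le> ennreal \<bar>\<phi> x\<bar>" unfolding \<psi>_def using M0n by (intro ennreal_leI) auto
    then have "(\<psi> x)\<^sup>2 \<le> (ennreal \<bar>\<phi> x\<bar>)\<^sup>2" by (rule power_mono) simp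
    then show "(\<psi> x)\<^sup>2 \<le> ennreal ((\<phi> x)\<^sup>2)" by (simp add: ennreal_power)
  qed
  then have "?I < \<infinity>" using nn_integral_sq_finite[OF s\<phi>] by (rule le_less_trans)
  then obtain r where r: "?I = ennreal r" "0 \<le> r" by (cases "?I") auto
  have "r \<le> 1 / 4 * r" using I r by (simp add: ennreal_mult[symmetric])
  then have "r = 0" using r(2) by simp
  then have "?I = 0" using r by simp
  then have "AE x in lborel. (\<psi> x)\<^sup>2 = 0"
    by (subst (asm) nn_integral_0_iff_AE) measurable
  then have "AE x in lborel. \<bar>\<phi> x\<bar> \<le> 2 * M0"
  proof eventually_elim
    case (elim x)
    then have "\<psi> x = 0" by simp
    then have "max 0 (\<bar>\<phi> x\<bar> - 2 * M0) \<le> 0" unfolding \<psi>_def by (simp only: ennreal_eq_0_iff)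
    then show ?case by simp
  qed
  then show ?thesis using M0n by (intro exI[of _ "2 * M0"]) simp
qed

section \<open>Data of the eigenfunctions and identification of their extensions\<close>

lemma radial_eigenfunction_data:
  fixes \<phi> W :: "'a::euclidean_space \<Rightarrow> real"
  assumes E: "radial_eigenfunction m W \<kappa> (\<lambda>x. complex_of_real (\<phi> x))"
    and Wm: "W \<in> borel_measurable borel" and Wb: "bounded (range W)"
  obtains fh w C where "L2_fourier (\<lambda>x. complex_of_real (\<phi> x)) fh"
    "L2_fourier w (\<lambda>\<xi>. complex_of_real (massive_symbol m \<xi>) * fh \<xi>)"
    "AE x in lborel. w x = complex_of_real ((\<kappa> - W x) * \<phi> x)"
    "sq_integrable \<phi>" "sq_integrable (\<lambda>x. (\<kappa> - W x) * \<phi> x)" "0 < C" "\<And>x. \<bar>\<kappa> - W x\<bar> \<le> C"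
proof -
  obtain fh w where F: "L2_fourier (\<lambda>x. complex_of_real (\<phi> x)) fh"
    "L2_fourier w (\<lambda>\<xi>. complex_of_real (massive_symbol m \<xi>) * fh \<xi>)"
    "AE x in lborel. complex_of_real \<kappa> * complex_of_real (\<phi> x) = w x + complex_of_real (W x) * complex_of_real (\<phi> x)"
    using E unfolding radial_eigenfunction_def schroedinger_op_def massive_op_def by blast
  have w: "AE x in lborel. w x = complex_of_real ((\<kappa> - W x) * \<phi> x)"
    using F(3) by eventually_elim (simp add: algebra_simps)
  have s: "sq_integrable (\<lambda>x. complex_of_real (\<phi> x))" using F(1) by (simp add: L2_fourier_def)
  then have "(\<lambda>x. complex_of_real (\<phi> x)) \<in> borel_measurable borel"
    by (simp add: sq_integrable_def)
  moreover have "Re \<in> borel_measurable borel"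
    by (intro borel_measurable_continuous_onI continuous_intros)
  ultimately have "(\<lambda>x. Re (complex_of_real (\<phi> x))) \<in> borel_measurable borel"
    by (rule measurable_compose)
  then have \<phi>m[measurable]: "\<phi> \<in> borel_measurable borel" by simp
  have \<phi>2: "integrable lborel (\<lambda>x. (\<phi> x)\<^sup>2)" using s by (simp add: sq_integrable_def)
  obtain B where B: "\<And>x. \<bar>W x\<bar> \<le> B" using Wb by (auto simp: bounded_iff)
  define C where "C = \<bar>\<kappa>\<bar> + B + 1"
  have "0 \<le> B" using B[of 0] by simp
  then have C: "0 < C" by (simp add: C_def)
  have CW: "\<bar>\<kappa> - W x\<bar> \<le> C" for x using B[of x] by (simp add: C_def)
  have "sq_integrable (\<lambda>x. (\<kappa> - W x) * \<phi> x)"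
    unfolding sq_integrable_real
  proof
    show gm: "(\<lambda>x. (\<kappa> - W x) * \<phi> x) \<in> borel_measurable lborel" using Wm by measurable
    show "integrable lborel (\<lambda>x. ((\<kappa> - W x) * \<phi> x)\<^sup>2)"
    proof (rule Bochner_Integration.integrable_bound)
      show "integrable lborel (\<lambda>x. C\<^sup>2 * (\<phi> x)\<^sup>2)" using \<phi>2 by simp
      show "(\<lambda>x. ((\<kappa> - W x) * \<phi> x)\<^sup>2) \<in> borel_measurable lborel" using gm by measurable
      have "(\<kappa> - W x)\<^sup>2 \<le> C\<^sup>2" for x using power_mono[OF CW[of x], of 2] by simp
      then show "AE x in lborel. norm (((\<kappa> - W x) * \<phi> x)\<^sup>2) \<le> norm (C\<^sup>2 * (\<phi> x)\<^sup>2)"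
        by (intro AE_I2) (simp add: power_mult_distrib mult_right_mono)
    qed
  qed
  moreover have "sq_integrable \<phi>" using \<phi>2 by (simp add: sq_integrable_real)
  ultimately show ?thesis using that[OF F(1,2) w _ _ C CW] by blast
qed

text \<open>The slices decay like \<open>exp (- (2 * m * y))\<close> in squared norm, which is
  integrable in \<open>y\<close> because \<open>m\<close> is positive.\<close>

lemma massive_poisson_sq_integrable:
  fixes f :: "'a::euclidean_space \<Rightarrow> real"
  assumes m: "0 < m" and f: "sq_integrable f"
  shows "set_integrable lborel half_space (\<lambda>p. (massive_poisson m (snd p) f (fst p))\<^sup>2)"
proof -
  have fm: "f \<in> borel_measurable borel" using f by (simp add: sq_integrable_def)
  have [measurable]: "(\<lambda>p. massive_poisson m (snd p) f (fst p)) \<in> borel_measurable (borel :: ('a \<times> real) measure)"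
    using massive_poisson_measurable[OF fm, of m] by (simp add: borel_prod)
  let ?V = "\<lambda>p. massive_poisson m (snd p) f (fst p)"
  let ?g = "\<lambda>p::'a \<times> real. indicator half_space p *\<^sub>R (?V p)\<^sup>2"
  have gm: "?g \<in> borel_measurable borel" by measurable
  have "(\<integral>\<^sup>+p. ennreal (?g p) \<partial>lborel) = (\<integral>\<^sup>+p. ennreal (?g p) \<partial>(lborel \<Otimes>\<^sub>M lborel))"
    by (simp add: lborel_prod)
  also have "\<dots> = (\<integral>\<^sup>+y. (\<integral>\<^sup>+x. ennreal (?g (x, y)) \<partial>lborel) \<partial>lborel)"
    by (rule lborel_pair.nn_integral_snd[symmetric]) (unfold lborel_prod, use gm in measurable)
  also have "\<dots> \<le> (\<integral>\<^sup>+y. (ennreal (exp (- (2 * m * y))) * indicator {0..} y) * (\<integral>\<^sup>+x. ennreal ((f x)\<^sup>2) \<partial>lborel) \<partial>lborel)"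
  proof (rule nn_integral_mono)
    fix y :: real
    show "(\<integral>\<^sup>+x. ennreal (?g (x, y)) \<partial>lborel) \<le> (ennreal (exp (- (2 * m * y))) * indicator {0..} y) * (\<integral>\<^sup>+x. ennreal ((f x)\<^sup>2) \<partial>lborel)"
    proof (cases "0 < y")
      case True
      then show ?thesis using massive_poisson_L2[OF True _ f, of m] m by (simp add: half_space_def)
    qed (simp add: half_space_def)
  qed
  also have "\<dots> = (\<integral>\<^sup>+y. ennreal (exp (- (2 * m * y))) * indicator {0..} y \<partial>lborel) * (\<integral>\<^sup>+x. ennreal ((f x)\<^sup>2) \<partial>lborel)"
    by (rule nn_integral_multc) measurable
  also have "(\<integral>\<^sup>+y. ennreal (exp (- (2 * m * y))) * indicator {0..} y \<partial>lborel) = ennreal (0 - (- exp (- (2 * m * 0)) / (2 * m)))"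
  proof (rule nn_integral_FTC_atLeast)
    show "((\<lambda>y. - exp (- (2 * m * y)) / (2 * m)) has_real_derivative exp (- (2 * m * y))) (at y)" for y
      using m by (auto intro!: derivative_eq_intros)
    show "((\<lambda>y. - exp (- (2 * m * y)) / (2 * m)) \<longlongrightarrow> 0) at_top"
      using m by real_asymp
  qed simp_all
  also have "\<dots> * (\<integral>\<^sup>+x. ennreal ((f x)\<^sup>2) \<partial>lborel) < \<infinity>"
    using nn_integral_sq_finite[OF f] by (simp add: ennreal_mult_less_top)
  finally have "(\<integral>\<^sup>+p. ennreal (?g p) \<partial>lborel) < \<infinity>" .
  then show ?thesis unfolding set_integrable_def using gm by (intro integrableI_bounded) simp_all
qed

lemma massive_poisson_slice_measurable:
  fixes f :: "'a::euclidean_space \<Rightarrow> real"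
  assumes [measurable]: "f \<in> borel_measurable borel"
  shows "massive_poisson m y f \<in> borel_measurable borel"
  unfolding massive_poisson_def[abs_def] by measurable


text \<open>Uniqueness applies because the difference is square integrable: \<open>\<Phi>\<close> by
  the term \<open>m\<^sup>2 * (\<Phi> p)\<^sup>2\<close> of its energy, the Poisson extension by its
  decay. The second claim expresses the normal derivative through boundary data, so that it too has
  a trace.\<close>

lemma massive_extension_eq_poisson:
  fixes \<phi> g :: "'a::euclidean_space \<Rightarrow> real"
  assumes m: "0 < m" and F: "L2_fourier (\<lambda>x. complex_of_real (\<phi> x)) fh"
    and W: "L2_fourier w (\<lambda>\<xi>. complex_of_real (massive_symbol m \<xi>) * fh \<xi>)"
    and w: "AE x in lborel. w x = complex_of_real (g x)"
    and s\<phi>: "sq_integrable \<phi>" and gm: "g \<in> borel_measurable borel"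
    and E: "massive_extension m \<phi> \<Phi>" and p: "p \<in> half_space"
  shows "\<Phi> p = massive_poisson m (snd p) \<phi> (fst p)"
    "partial_deriv (0, 1) \<Phi> p = - massive_poisson m (snd p) g (fst p)"
proof -
  have m0: "0 \<le> m" using m by simp
  have \<phi>m[measurable]: "\<phi> \<in> borel_measurable borel" using s\<phi> by (simp add: sq_integrable_def)
  define V where "V p = massive_poisson m (snd p) \<phi> (fst p)" for p
  note R = massive_poisson_regular[OF F W w \<phi>m gm m0, folded V_def]
  have \<Phi>2: "Ck_on 2 half_space \<Phi>" and pde: "\<And>p. p \<in> half_space \<Longrightarrow> laplacian \<Phi> p = m\<^sup>2 * \<Phi> p"
    and en: "set_integrable lborel half_space (\<lambda>p. (norm (gradient \<Phi> p))\<^sup>2 + m\<^sup>2 * (\<Phi> p)\<^sup>2)"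
    and tr: "has_trace \<Phi> \<phi>"
    using E by (auto simp: massive_extension_def)
  let ?H = "half_space :: ('a \<times> real) set"
  have \<Phi>m: "(\<lambda>p. indicator ?H p * \<Phi> p) \<in> borel_measurable borel"
    using borel_measurable_continuous_on_indicator[OF half_space_measurable Ck_on_continuous[OF \<Phi>2]] by simp
  have Vm: "V \<in> borel_measurable borel"
    unfolding V_def[abs_def] using massive_poisson_measurable[OF \<phi>m, of m] by (simp add: borel_prod)
  define D where "D p = \<Phi> p - V p" for p
  have "D q = 0" if q: "q \<in> half_space" for q
  proof (rule massive_harmonic_zero_trace[OF m _ _ _ _ q])
    show "Ck_on 2 half_space D" unfolding D_def[abs_def] by (rule Ck_on_diff[OF open_half_space \<Phi>2 R(1)])
    show "laplacian D p = m\<^sup>2 * D p" if "p \<in> half_space" for p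
      unfolding D_def[abs_def] laplacian_diff[OF open_half_space \<Phi>2 R(1) that] pde[OF that] R(2)[OF that]
      by (simp add: right_diff_distrib)
    show "set_integrable lborel half_space (\<lambda>p. (D p)\<^sup>2)"
      unfolding set_integrable_def
    proof (rule Bochner_Integration.integrable_bound)
      show "integrable lborel (\<lambda>p. (2 / m\<^sup>2) * (indicator ?H p *\<^sub>R ((norm (gradient \<Phi> p))\<^sup>2 + m\<^sup>2 * (\<Phi> p)\<^sup>2)) + 2 * (indicator ?H p *\<^sub>R (V p)\<^sup>2))"
        using en massive_poisson_sq_integrable[OF m s\<phi>, folded V_def]
        unfolding set_integrable_def by (intro Bochner_Integration.integrable_add integrable_mult_right)
      have "indicator ?H p *\<^sub>R (D p)\<^sup>2 = (indicator ?H p * \<Phi> p - indicator ?H p * V p)\<^sup>2" for p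
        by (simp add: D_def indicator_def)
      moreover have "(\<lambda>p. (indicator ?H p * \<Phi> p - indicator ?H p * V p)\<^sup>2) \<in> borel_measurable borel"
        by (intro borel_measurable_power borel_measurable_diff \<Phi>m borel_measurable_times
            borel_measurable_indicator half_space_measurable Vm)
      ultimately show "(\<lambda>p. indicator ?H p *\<^sub>R (D p)\<^sup>2) \<in> borel_measurable lborel"
        by (simp only:) simp
      have "(D p)\<^sup>2 \<le> (2 / m\<^sup>2) * ((norm (gradient \<Phi> p))\<^sup>2 + m\<^sup>2 * (\<Phi> p)\<^sup>2) + 2 * (V p)\<^sup>2" for p
      proof -
        have "(D p)\<^sup>2 \<le> 2 * (\<Phi> p)\<^sup>2 + 2 * (V p)\<^sup>2"
          unfolding D_def using zero_le_power2[of "\<Phi> p + V p"] by (simp add: power2_eq_square algebra_simps)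
        also have "2 * (\<Phi> p)\<^sup>2 \<le> (2 / m\<^sup>2) * ((norm (gradient \<Phi> p))\<^sup>2 + m\<^sup>2 * (\<Phi> p)\<^sup>2)"
          using m by (simp add: distrib_left)
        finally show ?thesis by simp
      qed
      then show "AE p in lborel. norm (indicator ?H p *\<^sub>R (D p)\<^sup>2) \<le> norm ((2 / m\<^sup>2) * (indicator ?H p *\<^sub>R ((norm (gradient \<Phi> p))\<^sup>2 + m\<^sup>2 * (\<Phi> p)\<^sup>2)) + 2 * (indicator ?H p *\<^sub>R (V p)\<^sup>2))"
        by (intro AE_I2) (auto simp: indicator_def)
    qed
    show "has_trace D (\<lambda>_. 0)"
    proof (rule has_trace_dominated[where c=2])
      \<comment> \<open>The indicator provides measurable slices, since \<open>\<Phi>\<close> is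
        arbitrary for negative \<open>y\<close>.\<close>
      show "has_trace (\<lambda>p. indicator ?H p * \<Phi> p) \<phi>"
        by (rule has_trace_cong[OF tr]) (simp add: half_space_def)
      show "has_trace V \<phi>" unfolding V_def[abs_def] by (rule massive_poisson_has_trace[OF m0 s\<phi>])
      have \<Phi>m': "(\<lambda>p. indicator ?H p * \<Phi> p) \<in> borel_measurable (borel \<Otimes>\<^sub>M borel)" and Vm': "V \<in> borel_measurable (borel \<Otimes>\<^sub>M borel)"
        using \<Phi>m Vm by (simp_all add: borel_prod)
      show "(\<lambda>x. indicator ?H (x, y) * \<Phi> (x, y)) \<in> borel_measurable borel" for y
        using measurable_compose[OF measurable_Pair2' \<Phi>m', of y] by simp
      show "(\<lambda>x. V (x, y)) \<in> borel_measurable borel" for y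
        using measurable_compose[OF measurable_Pair2' Vm', of y] by simp
      show "AE x in lborel. (D (x, y) - 0)\<^sup>2 \<le> 2 * ((indicator ?H (x, y) * \<Phi> (x, y) - \<phi> x)\<^sup>2 + (V (x, y) - \<phi> x)\<^sup>2)" if "0 < y" for y
      proof (rule AE_I2)
        fix x
        have "(a - b)\<^sup>2 \<le> 2 * ((a - c)\<^sup>2 + (b - c)\<^sup>2)" for a b c :: real
          using zero_le_power2[of "(a - c) + (b - c)"] by (simp add: power2_eq_square algebra_simps)
        then show "(D (x, y) - 0)\<^sup>2 \<le> 2 * ((indicator ?H (x, y) * \<Phi> (x, y) - \<phi> x)\<^sup>2 + (V (x, y) - \<phi> x)\<^sup>2)"
          using that by (simp add: D_def half_space_def)
      qed
    qed simp_all
  qed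
  then have eq: "\<Phi> q = V q" if "q \<in> half_space" for q using that by (simp add: D_def)
  show "\<Phi> p = massive_poisson m (snd p) \<phi> (fst p)" using eq[OF p] by (simp add: V_def)
  have "GDERIV V p :> gradient \<Phi> p"
    by (rule GDERIV_transform_open[OF Ck_on_2_gradient(1)[OF open_half_space \<Phi>2 p] open_half_space p eq])
  then have "partial_deriv (0, 1) V p = partial_deriv (0, 1) \<Phi> p"
    using Ck_on_2_gradient(1)[OF open_half_space \<Phi>2 p] by (simp add: GDERIV_partial_deriv)
  then show "partial_deriv (0, 1) \<Phi> p = - massive_poisson m (snd p) g (fst p)" using R(3)[OF p] by simp
qed

section \<open>The equation for the quotient\<close>

text \<open>With A B - A0 B0 = A (B - B0) + B0 (A - A0), a bound on \<open>A\<close> at all positive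
  heights and a bound on the boundary value \<open>B0\<close> keep the convergence in
  \<open>L\<^sup>2\<close>.\<close>

lemma has_trace_product:
  fixes A B :: "'a::euclidean_space \<times> real \<Rightarrow> real"
  assumes A: "has_trace A A0" and B: "has_trace B B0"
    and m: "\<And>y. 0 < y \<Longrightarrow> (\<lambda>x. A (x, y)) \<in> borel_measurable borel" "\<And>y. 0 < y \<Longrightarrow> (\<lambda>x. B (x, y)) \<in> borel_measurable borel"
    and M: "\<And>x y. 0 < y \<Longrightarrow> \<bar>A (x, y)\<bar> \<le> M" and K: "AE x in lborel. \<bar>B0 x\<bar> \<le> K"
  shows "has_trace (\<lambda>p. A p * B p) (\<lambda>x. A0 x * B0 x)"
proof (rule has_trace_dominated[OF A B _ m, where c="2 * (M\<^sup>2 + K\<^sup>2)"])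
  show "(\<lambda>x. A0 x * B0 x) \<in> borel_measurable borel"
    using A B by (auto simp: has_trace_def)
  show "AE x in lborel. (A (x, y) * B (x, y) - A0 x * B0 x)\<^sup>2
      \<le> 2 * (M\<^sup>2 + K\<^sup>2) * ((A (x, y) - A0 x)\<^sup>2 + (B (x, y) - B0 x)\<^sup>2)" if y: "0 < y" for y
    using K
  proof eventually_elim
    case (elim x)
    let ?p = "A (x, y)" and ?q = "B (x, y)" and ?r = "A0 x" and ?s = "B0 x"
    have M2: "?p\<^sup>2 \<le> M\<^sup>2" using power_mono[OF M[OF y, of x], of 2] by simp
    have K2: "?s\<^sup>2 \<le> K\<^sup>2" using power_mono[OF elim, of 2] by simp
    have "(?p * ?q - ?r * ?s)\<^sup>2 \<le> 2 * (?p\<^sup>2 * (?q - ?s)\<^sup>2) + 2 * (?s\<^sup>2 * (?p - ?r)\<^sup>2)"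
      using zero_le_power2[of "?p * (?q - ?s) - ?s * (?p - ?r)"] by (simp add: power2_eq_square algebra_simps)
    also have "\<dots> \<le> 2 * (M\<^sup>2 * (?q - ?s)\<^sup>2) + 2 * (K\<^sup>2 * (?p - ?r)\<^sup>2)"
      by (intro add_mono mult_left_mono mult_right_mono M2 K2) simp_all
    also have "\<dots> \<le> 2 * (M\<^sup>2 + K\<^sup>2) * ((?p - ?r)\<^sup>2 + (?q - ?s)\<^sup>2)"
      by (simp add: algebra_simps)
    finally show ?case .
  qed
qed (assumption | intro mult_nonneg_nonneg add_nonneg_nonneg | simp)+

lemma set_integrable_norm_gradient:
  fixes \<Phi> :: "'a::euclidean_space \<times> real \<Rightarrow> real"
  assumes \<Phi>: "Ck_on 2 half_space \<Phi>"
    and en: "set_integrable lborel half_space (\<lambda>p. (norm (gradient \<Phi> p))\<^sup>2 + m\<^sup>2 * (\<Phi> p)\<^sup>2)"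
  shows "set_integrable lborel half_space (\<lambda>p. (norm (gradient \<Phi> p))\<^sup>2)"
  unfolding set_integrable_def
proof (rule Bochner_Integration.integrable_bound)
  let ?H = "half_space :: ('a \<times> real) set"
  show "integrable lborel (\<lambda>p. indicator ?H p *\<^sub>R ((norm (gradient \<Phi> p))\<^sup>2 + m\<^sup>2 * (\<Phi> p)\<^sup>2))"
    using en by (simp add: set_integrable_def)
  have "Ck_on (Suc 1) ?H \<Phi>" using \<Phi> by (simp add: numeral_2_eq_2)
  then have "continuous_on ?H (\<lambda>p. (norm (gradient \<Phi> p))\<^sup>2)"
    by (intro continuous_intros Ck_on_Suc_imp(2)[OF open_half_space])
  then show "(\<lambda>p. indicator ?H p *\<^sub>R (norm (gradient \<Phi> p))\<^sup>2) \<in> borel_measurable lborel"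
    using borel_measurable_continuous_on_indicator[OF half_space_measurable, of "\<lambda>p. (norm (gradient \<Phi> p))\<^sup>2"] by simp
  show "AE p in lborel. norm (indicator ?H p *\<^sub>R (norm (gradient \<Phi> p))\<^sup>2)
      \<le> norm (indicator ?H p *\<^sub>R ((norm (gradient \<Phi> p))\<^sup>2 + m\<^sup>2 * (\<Phi> p)\<^sup>2))"
    by (intro AE_I2) (auto simp: indicator_def)
qed

text \<open>Both squares are dominated by the energy density, the second with the factor
  \<open>1 / m\<^sup>2\<close>; measurability comes from the local integrability contained in
  \<open>weak_gradient\<close>.\<close>

lemma H_rad_integrable:
  fixes U :: "'a::euclidean_space \<times> real \<Rightarrow> real"
  assumes H: "H_rad m W U G U0" and m: "0 < m"
  shows "weak_gradient half_space U G" "has_trace U U0" "sq_integrable U0"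
    "set_integrable lborel half_space (\<lambda>p. (norm (G p))\<^sup>2)" "set_integrable lborel half_space (\<lambda>p. (U p)\<^sup>2)"
proof -
  let ?H = "half_space :: ('a \<times> real) set"
  show w: "weak_gradient half_space U G" and tr: "has_trace U U0" using H by (auto simp: H_rad_def)
  show "sq_integrable U0" using H tr by (auto simp: H_rad_def sq_integrable_real has_trace_def)
  have en: "integrable lborel (\<lambda>p. indicator ?H p *\<^sub>R ((norm (G p))\<^sup>2 + m\<^sup>2 * (U p)\<^sup>2))"
    using H by (simp add: H_rad_def set_integrable_def)
  have Gm[measurable]: "(\<lambda>p. indicator ?H p *\<^sub>R G p) \<in> borel_measurable borel"
    and Um[measurable]: "(\<lambda>p. indicator ?H p *\<^sub>R U p) \<in> borel_measurable borel"
    using w locally_integrable_half_space_measurable[of G] locally_integrable_half_space_measurable[of U]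
    unfolding weak_gradient_def by blast+
  show "set_integrable lborel half_space (\<lambda>p. (norm (G p))\<^sup>2)"
    unfolding set_integrable_def
  proof (rule Bochner_Integration.integrable_bound[OF en])
    have "indicator ?H p *\<^sub>R (norm (G p))\<^sup>2 = (norm (indicator ?H p *\<^sub>R G p))\<^sup>2" for p by (simp add: indicator_def)
    moreover have "(\<lambda>p. (norm (indicator ?H p *\<^sub>R G p))\<^sup>2) \<in> borel_measurable borel"
      by (intro borel_measurable_power measurable_compose[OF Gm borel_measurable_norm])
    ultimately show "(\<lambda>p. indicator ?H p *\<^sub>R (norm (G p))\<^sup>2) \<in> borel_measurable lborel" by (simp only:) simp
    show "AE p in lborel. norm (indicator ?H p *\<^sub>R (norm (G p))\<^sup>2) \<le> norm (indicator ?H p *\<^sub>R ((norm (G p))\<^sup>2 + m\<^sup>2 * (U p)\<^sup>2))"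
      by (intro AE_I2) (auto simp: indicator_def)
  qed
  show "set_integrable lborel half_space (\<lambda>p. (U p)\<^sup>2)"
    unfolding set_integrable_def
  proof (rule Bochner_Integration.integrable_bound)
    show "integrable lborel (\<lambda>p. (1 / m\<^sup>2) * (indicator ?H p *\<^sub>R ((norm (G p))\<^sup>2 + m\<^sup>2 * (U p)\<^sup>2)))"
      using en by (rule integrable_mult_right)
    have "indicator ?H p *\<^sub>R (U p)\<^sup>2 = (indicator ?H p *\<^sub>R U p)\<^sup>2" for p by (simp add: indicator_def)
    moreover have "(\<lambda>p. (indicator ?H p *\<^sub>R U p)\<^sup>2) \<in> borel_measurable borel"
      by (intro borel_measurable_power Um)
    ultimately show "(\<lambda>p. indicator ?H p *\<^sub>R (U p)\<^sup>2) \<in> borel_measurable lborel" by (simp only:) simp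
    have "(U p)\<^sup>2 \<le> (1 / m\<^sup>2) * ((norm (G p))\<^sup>2 + m\<^sup>2 * (U p)\<^sup>2)" for p
      using m by (simp add: distrib_left)
    then show "AE p in lborel. norm (indicator ?H p *\<^sub>R (U p)\<^sup>2) \<le> norm ((1 / m\<^sup>2) * (indicator ?H p *\<^sub>R ((norm (G p))\<^sup>2 + m\<^sup>2 * (U p)\<^sup>2)))"
      by (intro AE_I2) (auto simp: indicator_def)
  qed
qed

theorem proposition3p4:
  fixes m W_inf lam1 lam2 \<mu> :: real
    and W \<phi>1 \<phi>2 \<Xi>0 :: "'a::euclidean_space \<Rightarrow> real"
    and \<Phi>1 \<Phi>2 \<Xi> :: "'a \<times> real \<Rightarrow> real"
  assumes "0 < m"
    and "W \<in> borel_measurable borel"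
    and "bounded (range W)"
    and "\<And>x y. norm x = norm y \<Longrightarrow> W x = W y"
    and "(W \<longlongrightarrow> W_inf) at_infinity"
    and "radial_eigenfunction m W lam1 (\<lambda>x. complex_of_real (\<phi>1 x))"
    and "radial_eigenfunction m W lam2 (\<lambda>x. complex_of_real (\<phi>2 x))"
    and "\<And>l. radial_eigenvalue m W l \<Longrightarrow> lam1 \<le> l"
    and "\<And>l. radial_eigenvalue m W l \<Longrightarrow> lam1 < l \<Longrightarrow> lam2 \<le> l"
    and "lam1 < lam2"
    and "lam2 < m + W_inf"
    and "AE x in lborel. 0 < \<phi>1 x"
    and "\<mu> = lam2 - lam1"
    and "massive_extension m \<phi>1 \<Phi>1"
    and "massive_extension m \<phi>2 \<Phi>2"
    and "\<Xi> = (\<lambda>p. \<Phi>2 p / \<Phi>1 p)"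
    and "\<Xi>0 = (\<lambda>x. \<Xi> (x, 0))"
  shows "(\<forall>p\<in>half_space. 0 < \<Phi>1 p) \<and> (AE x in lborel. 0 < \<Phi>1 (x, 0))
    \<and> (AE x in lborel. \<Xi>0 x = \<phi>2 x / \<phi>1 x)
    \<and> weak_solution_rad m W \<mu> \<Phi>1 \<phi>1 \<Xi> \<Xi>0"
proof -
  have m: "0 < m" and m0: "0 \<le> m" using assms(1) by auto
  have Wm: "W \<in> borel_measurable borel" and Wb: "bounded (range W)" by fact+
  have \<mu>: "0 < \<mu>" using assms(10,13) by simp
  have \<mu>': "\<mu> = lam2 - lam1" by fact
  let ?H = "half_space :: ('a \<times> real) set"
  \<comment> \<open>By the eigenvalue equations \<open>g1\<close> and \<open>g2\<close> represent
    \<open>A\<^sub>m \<phi>1\<close> and \<open>A\<^sub>m \<phi>2\<close>.\<close>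
  define g1 where "g1 x = (lam1 - W x) * \<phi>1 x" for x
  define g2 where "g2 x = (lam2 - W x) * \<phi>2 x" for x
  obtain fh1 w1 C1 where E1: "L2_fourier (\<lambda>x. complex_of_real (\<phi>1 x)) fh1"
    "L2_fourier w1 (\<lambda>\<xi>. complex_of_real (massive_symbol m \<xi>) * fh1 \<xi>)"
    "AE x in lborel. w1 x = complex_of_real (g1 x)"
    "sq_integrable \<phi>1" "sq_integrable g1" "0 < C1" "\<And>x. \<bar>lam1 - W x\<bar> \<le> C1"
    using radial_eigenfunction_data[OF assms(6) Wm Wb] unfolding g1_def[abs_def] by blast
  obtain fh2 w2 C2 where E2: "L2_fourier (\<lambda>x. complex_of_real (\<phi>2 x)) fh2"
    "L2_fourier w2 (\<lambda>\<xi>. complex_of_real (massive_symbol m \<xi>) * fh2 \<xi>)"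
    "AE x in lborel. w2 x = complex_of_real (g2 x)"
    "sq_integrable \<phi>2" "sq_integrable g2" "0 < C2" "\<And>x. \<bar>lam2 - W x\<bar> \<le> C2"
    using radial_eigenfunction_data[OF assms(7) Wm Wb] unfolding g2_def[abs_def] by blast
  have gC1: "\<bar>g1 x\<bar> \<le> C1 * \<bar>\<phi>1 x\<bar>" and gC2: "\<bar>g2 x\<bar> \<le> C2 * \<bar>\<phi>2 x\<bar>" for x
    unfolding g1_def g2_def abs_mult by (intro mult_right_mono E1(7) E2(7); simp)+
  have meas[measurable]: "\<phi>1 \<in> borel_measurable borel" "\<phi>2 \<in> borel_measurable borel"
      "g1 \<in> borel_measurable borel" "g2 \<in> borel_measurable borel"
    using E1(4,5) E2(4,5) by (auto simp: sq_integrable_def)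
  obtain M1 where M1: "0 \<le> M1" "AE x in lborel. \<bar>\<phi>1 x\<bar> \<le> M1"
    using eigenfunction_bounded[OF m0 E1(1-6) AE_I2[OF gC1]] by blast
  obtain M2 where M2: "0 \<le> M2" "AE x in lborel. \<bar>\<phi>2 x\<bar> \<le> M2"
    using eigenfunction_bounded[OF m0 E2(1-6) AE_I2[OF gC2]] by blast
  have g1b: "AE x in lborel. \<bar>g1 x\<bar> \<le> C1 * M1"
    using M1(2)
  proof eventually_elim
    case (elim x)
    show ?case using order_trans[OF gC1[of x] mult_left_mono[OF elim]] E1(6) by simp
  qed
  have g2b: "AE x in lborel. \<bar>g2 x\<bar> \<le> C2 * M2"
    using M2(2)
  proof eventually_elim
    case (elim x)
    show ?case using order_trans[OF gC2[of x] mult_left_mono[OF elim]] E2(6) by simp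
  qed
  note I1 = massive_extension_eq_poisson[OF m E1(1-4) meas(3) assms(14)]
  note I2 = massive_extension_eq_poisson[OF m E2(1-4) meas(4) assms(15)]
  have pos: "0 < \<Phi>1 p" if p: "p \<in> ?H" for p
    unfolding I1(1)[OF p] using p assms(12)
    by (intro massive_poisson_pos[OF _ m0 E1(4)]) (simp_all add: half_space_def)
  have bd1: "\<bar>\<Phi>1 p\<bar> \<le> M1" if p: "p \<in> ?H" for p
    unfolding I1(1)[OF p] using p M1
    by (intro massive_poisson_bound[OF _ m0 E1(4)]) (simp_all add: half_space_def)
  have bd2: "\<bar>\<Phi>2 p\<bar> \<le> M2" if p: "p \<in> ?H" for p
    unfolding I2(1)[OF p] using p M2
    by (intro massive_poisson_bound[OF _ m0 E2(4)]) (simp_all add: half_space_def)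
  have K1: "Ck_on 2 ?H \<Phi>1" and K2: "Ck_on 2 ?H \<Phi>2"
    and L1: "\<And>p. p \<in> ?H \<Longrightarrow> laplacian \<Phi>1 p = m\<^sup>2 * \<Phi>1 p" and L2: "\<And>p. p \<in> ?H \<Longrightarrow> laplacian \<Phi>2 p = m\<^sup>2 * \<Phi>2 p"
    and en1: "set_integrable lborel ?H (\<lambda>p. (norm (gradient \<Phi>1 p))\<^sup>2 + m\<^sup>2 * (\<Phi>1 p)\<^sup>2)"
    and en2: "set_integrable lborel ?H (\<lambda>p. (norm (gradient \<Phi>2 p))\<^sup>2 + m\<^sup>2 * (\<Phi>2 p)\<^sup>2)"
    and bv1: "\<And>x. \<Phi>1 (x, 0) = \<phi>1 x" and bv2: "\<And>x. \<Phi>2 (x, 0) = \<phi>2 x"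
    using assms(14,15) by (auto simp: massive_extension_def)
  note D1 = Ck_on_2_gradient[OF open_half_space K1] and D2 = Ck_on_2_gradient[OF open_half_space K2]
  \<comment> \<open>This form of the field involves no division by \<open>\<Phi>1\<close>, for which
    positivity but no positive lower bound is available.\<close>
  define F where "F p = \<Phi>1 p *\<^sub>R gradient \<Phi>2 p - \<Phi>2 p *\<^sub>R gradient \<Phi>1 p" for p
  define dF where "dF b p = (\<Phi>1 p *\<^sub>R gradient (\<lambda>q. gradient \<Phi>2 q \<bullet> b) p + (gradient \<Phi>2 p \<bullet> b) *\<^sub>R gradient \<Phi>1 p)
     - (\<Phi>2 p *\<^sub>R gradient (\<lambda>q. gradient \<Phi>1 q \<bullet> b) p + (gradient \<Phi>1 p \<bullet> b) *\<^sub>R gradient \<Phi>2 p)" for b p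
  have Fb: "F p \<bullet> b = \<Phi>1 p * (gradient \<Phi>2 p \<bullet> b) - \<Phi>2 p * (gradient \<Phi>1 p \<bullet> b)" for p b
    by (simp add: F_def inner_diff_left)
  have dF: "GDERIV (\<lambda>p. F p \<bullet> b) p :> dF b p" if "b \<in> Basis" "p \<in> ?H" for b p
    unfolding Fb dF_def by (intro GDERIV_diff GDERIV_mult D1(1,4) D2(1,4) that)
  obtain p0 :: "'a \<times> real" where p0: "p0 \<in> ?H"
    using that[of "(0, 1)"] by (simp add: half_space_def)
  have cF: "continuous_on ?H (dF b)" if "b \<in> Basis" for b
    unfolding dF_def by (intro continuous_intros D1(2,3,5)[OF p0] D2(2,3,5)[OF p0] that)
  \<comment> \<open>Both extensions solve the equation with the same \<open>m\<close>, so the zeroth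
    order terms cancel, as do the products of the two gradients.\<close>
  have div: "(\<Sum>b\<in>Basis. dF b p \<bullet> b) = 0" if p: "p \<in> ?H" for p
  proof -
    have "(\<Sum>b\<in>Basis. dF b p \<bullet> b) = \<Phi>1 p * laplacian \<Phi>2 p - \<Phi>2 p * laplacian \<Phi>1 p"
      unfolding laplacian_eq_sum dF_def
      by (simp add: inner_diff_left inner_add_left sum_subtractf sum_distrib_left sum.distrib mult.commute)
    then show ?thesis by (simp add: L1[OF p] L2[OF p])
  qed
  \<comment> \<open>Each product pairs a bounded extension with a square integrable
    gradient.\<close>
  have F2: "set_integrable lborel ?H (\<lambda>p. (norm (F p))\<^sup>2)"
    unfolding set_integrable_def
  proof (rule Bochner_Integration.integrable_bound)
    show "integrable lborel (\<lambda>p. 2 * M1\<^sup>2 * (indicator ?H p *\<^sub>R (norm (gradient \<Phi>2 p))\<^sup>2) + 2 * M2\<^sup>2 * (indicator ?H p *\<^sub>R (norm (gradient \<Phi>1 p))\<^sup>2))"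
      using set_integrable_norm_gradient[OF K1 en1] set_integrable_norm_gradient[OF K2 en2]
      unfolding set_integrable_def by (intro Bochner_Integration.integrable_add integrable_mult_right)
    have "continuous_on ?H (\<lambda>p. (norm (F p))\<^sup>2)"
      unfolding F_def by (intro continuous_intros D1(2,3)[OF p0] D2(2,3)[OF p0])
    then show "(\<lambda>p. indicator ?H p *\<^sub>R (norm (F p))\<^sup>2) \<in> borel_measurable lborel"
      using borel_measurable_continuous_on_indicator[OF half_space_measurable, of "\<lambda>p. (norm (F p))\<^sup>2"] by simp
    have "(norm (F p))\<^sup>2 \<le> 2 * M1\<^sup>2 * (norm (gradient \<Phi>2 p))\<^sup>2 + 2 * M2\<^sup>2 * (norm (gradient \<Phi>1 p))\<^sup>2" if p: "p \<in> ?H" for p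
    proof -
      let ?a = "\<bar>\<Phi>1 p\<bar> * norm (gradient \<Phi>2 p)" and ?b = "\<bar>\<Phi>2 p\<bar> * norm (gradient \<Phi>1 p)"
      have "norm (F p) \<le> ?a + ?b" unfolding F_def by (rule order_trans[OF norm_triangle_ineq4]) simp
      then have "(norm (F p))\<^sup>2 \<le> (?a + ?b)\<^sup>2" by (rule power_mono) simp
      also have "\<dots> \<le> 2 * ?a\<^sup>2 + 2 * ?b\<^sup>2"
        using zero_le_power2[of "?a - ?b"] by (simp add: power2_eq_square algebra_simps)
      also have "?a\<^sup>2 \<le> M1\<^sup>2 * (norm (gradient \<Phi>2 p))\<^sup>2"
        unfolding power_mult_distrib by (intro mult_right_mono power_mono bd1[OF p]) simp_all
      also have "?b\<^sup>2 \<le> M2\<^sup>2 * (norm (gradient \<Phi>1 p))\<^sup>2"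
        unfolding power_mult_distrib by (intro mult_right_mono power_mono bd2[OF p]) simp_all
      finally show ?thesis by simp
    qed
    then show "AE p in lborel. norm (indicator ?H p *\<^sub>R (norm (F p))\<^sup>2)
       \<le> norm (2 * M1\<^sup>2 * (indicator ?H p *\<^sub>R (norm (gradient \<Phi>2 p))\<^sup>2) + 2 * M2\<^sup>2 * (indicator ?H p *\<^sub>R (norm (gradient \<Phi>1 p))\<^sup>2))"
      by (intro AE_I2) (auto simp: indicator_def)
  qed
  define f0 where "f0 x = - (\<mu> * (\<phi>1 x * \<phi>2 x))" for x
  have sf: "sq_integrable f0"
    unfolding sq_integrable_real
  proof
    show fm: "f0 \<in> borel_measurable lborel" unfolding f0_def[abs_def] by measurable
    show "integrable lborel (\<lambda>x. (f0 x)\<^sup>2)"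
    proof (rule Bochner_Integration.integrable_bound)
      show "integrable lborel (\<lambda>x. (\<mu> * M1)\<^sup>2 * (\<phi>2 x)\<^sup>2)"
        using E2(4) by (simp add: sq_integrable_real)
      show "(\<lambda>x. (f0 x)\<^sup>2) \<in> borel_measurable lborel" using fm by measurable
      show "AE x in lborel. norm ((f0 x)\<^sup>2) \<le> norm ((\<mu> * M1)\<^sup>2 * (\<phi>2 x)\<^sup>2)"
        using M1(2)
      proof eventually_elim
        case (elim x)
        have "(\<phi>1 x)\<^sup>2 \<le> M1\<^sup>2" using power_mono[OF elim, of 2] by simp
        then have "\<mu>\<^sup>2 * ((\<phi>1 x)\<^sup>2 * (\<phi>2 x)\<^sup>2) \<le> \<mu>\<^sup>2 * (M1\<^sup>2 * (\<phi>2 x)\<^sup>2)"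
          by (intro mult_left_mono mult_right_mono) simp_all
        then show ?case by (simp add: f0_def power_mult_distrib mult.assoc)
      qed
    qed
  qed
  have tF: "has_trace (\<lambda>p. F p \<bullet> (0, 1)) f0"
  proof -
    let ?P = "\<lambda>f p. massive_poisson m (snd p) f (fst p)"
    have sl: "(\<lambda>x. ?P f (x, y)) \<in> borel_measurable borel" if "f \<in> borel_measurable borel" for f :: "'a \<Rightarrow> real" and y
      using massive_poisson_slice_measurable[OF that] by simp
    \<comment> \<open>In each product the extension of an eigenfunction is the factor bounded at all
      heights, and \<open>g2\<close> or \<open>g1\<close> is the bounded boundary value.\<close>
    have t1: "has_trace (\<lambda>p. ?P \<phi>1 p * ?P g2 p) (\<lambda>x. \<phi>1 x * g2 x)"
      by (rule has_trace_product[OF massive_poisson_has_trace[OF m0 E1(4)] massive_poisson_has_trace[OF m0 E2(5)] sl sl _ g2b])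
         (use massive_poisson_bound[OF _ m0 E1(4) M1(2,1)] in simp_all)
    have t2: "has_trace (\<lambda>p. ?P \<phi>2 p * ?P g1 p) (\<lambda>x. \<phi>2 x * g1 x)"
      by (rule has_trace_product[OF massive_poisson_has_trace[OF m0 E2(4)] massive_poisson_has_trace[OF m0 E1(5)] sl sl _ g1b])
         (use massive_poisson_bound[OF _ m0 E2(4) M2(2,1)] in simp_all)
    have "has_trace (\<lambda>p. - (?P \<phi>1 p * ?P g2 p) + ?P \<phi>2 p * ?P g1 p) f0"
    proof (rule has_trace_dominated[OF t1 t2, where c=2])
      show "f0 \<in> borel_measurable borel" using sf by (simp add: sq_integrable_def)
      show "(\<lambda>x. ?P \<phi>1 (x, y) * ?P g2 (x, y)) \<in> borel_measurable borel"
        "(\<lambda>x. ?P \<phi>2 (x, y) * ?P g1 (x, y)) \<in> borel_measurable borel" for y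
        by (intro borel_measurable_times sl meas)+
      have f0: "f0 x = - (\<phi>1 x * g2 x) + \<phi>2 x * g1 x" for x
        by (simp add: f0_def g1_def g2_def \<mu>' algebra_simps)
      have "(- a + b - (- a0 + b0))\<^sup>2 \<le> 2 * ((a - a0)\<^sup>2 + (b - b0)\<^sup>2)" for a b a0 b0 :: real
        using zero_le_power2[of "(a - a0) + (b - b0)"] by (simp add: power2_eq_square algebra_simps)
      then show "AE x in lborel. (- (?P \<phi>1 (x, y) * ?P g2 (x, y)) + ?P \<phi>2 (x, y) * ?P g1 (x, y) - f0 x)\<^sup>2
         \<le> 2 * ((?P \<phi>1 (x, y) * ?P g2 (x, y) - \<phi>1 x * g2 x)\<^sup>2 + (?P \<phi>2 (x, y) * ?P g1 (x, y) - \<phi>2 x * g1 x)\<^sup>2)" for y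
        unfolding f0 by (intro AE_I2)
    qed simp
    then show ?thesis
    proof (rule has_trace_cong)
      fix x :: 'a and y :: real assume "0 < y"
      then have p: "(x, y) \<in> ?H" by (simp add: half_space_def)
      have b: "(0, 1) \<in> (Basis :: ('a \<times> real) set)" by (simp add: Basis_prod_def)
      show "F (x, y) \<bullet> (0, 1) = - (?P \<phi>1 (x, y) * ?P g2 (x, y)) + ?P \<phi>2 (x, y) * ?P g1 (x, y)"
        unfolding Fb gradient_inner_Basis[OF b] I1(2)[OF p] I2(2)[OF p] I1(1)[OF p] I2(1)[OF p] by simp
    qed
  qed
  have \<Xi>d: "GDERIV \<Xi> p :> \<Phi>2 p *\<^sub>R (- (inverse (\<Phi>1 p))\<^sup>2 *\<^sub>R gradient \<Phi>1 p) + inverse (\<Phi>1 p) *\<^sub>R gradient \<Phi>2 p"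
    if p: "p \<in> ?H" for p
    unfolding assms(16) divide_inverse
    by (intro GDERIV_mult GDERIV_inverse D1(1)[OF p] D2(1)[OF p]) (use pos[OF p] in simp)
  have \<Xi>F: "(\<Phi>1 p)\<^sup>2 * (gradient \<Xi> p \<bullet> v) = F p \<bullet> v" if p: "p \<in> ?H" for p v
    unfolding GDERIV_gradient[OF \<Xi>d[OF p]] F_def inner_add_left inner_diff_left inner_scaleR_left
    using pos[OF p] by (simp add: power2_eq_square field_simps)
  have \<Xi>0: "\<Xi>0 x = \<phi>2 x / \<phi>1 x" for x
    unfolding assms(17) assms(16) by (simp add: bv1 bv2)
  have "weak_solution_rad m W \<mu> \<Phi>1 \<phi>1 \<Xi> \<Xi>0"
    unfolding weak_solution_rad_def
  proof (intro conjI allI impI)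
    show "\<Xi> differentiable_on ?H"
      unfolding differentiable_on_eq_differentiable_at[OF open_half_space]
      using \<Xi>d unfolding gderiv_def differentiable_def by blast
    fix U G U0 assume H: "H_rad m W U G U0"
    note h = H_rad_integrable[OF H m]
    note gr = weak_green[OF dF cF div F2 h(1,4,5,2,3) tF sf]
    have e: "indicator ?H p *\<^sub>R ((\<Phi>1 p)\<^sup>2 * (gradient \<Xi> p \<bullet> G p)) = indicator ?H p *\<^sub>R (F p \<bullet> G p)" for p
      using \<Xi>F[of p] by (cases "p \<in> ?H") simp_all
    show "set_integrable lborel ?H (\<lambda>p. (\<Phi>1 p)\<^sup>2 * (gradient \<Xi> p \<bullet> G p))"
      using gr(1) unfolding set_integrable_def e .
    \<comment> \<open>Valid at every \<open>x\<close>: where \<open>\<phi>1 x = 0\<close>, both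
      sides are 0 whatever value the quotient takes.\<close>
    have e0: "(\<phi>1 x)\<^sup>2 * \<Xi>0 x * U0 x = (- 1 / \<mu>) * (f0 x * U0 x)" for x
      using \<mu> by (simp add: \<Xi>0 f0_def power2_eq_square)
    have "set_integrable lborel UNIV (\<lambda>x. f0 x \<bullet> U0 x)"
      by (rule set_integrable_product_L2) (use sf h(3) in \<open>simp_all add: sq_integrable_real set_integrable_def\<close>)
    then have i: "integrable lborel (\<lambda>x. f0 x * U0 x)" by (simp add: set_integrable_def)
    show "integrable lborel (\<lambda>x. (\<phi>1 x)\<^sup>2 * \<Xi>0 x * U0 x)"
      unfolding e0 using i by (rule integrable_mult_right)
    have "(LINT p:?H|lborel. (\<Phi>1 p)\<^sup>2 * (gradient \<Xi> p \<bullet> G p)) = (LINT p:?H|lborel. F p \<bullet> G p)"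
      unfolding set_lebesgue_integral_def e ..
    also have "\<dots> = - (LINT x|lborel. f0 x * U0 x)" by (rule gr(2))
    also have "\<dots> = \<mu> * (LINT x|lborel. (\<phi>1 x)\<^sup>2 * \<Xi>0 x * U0 x)"
      unfolding e0 integral_mult_right_zero using \<mu> by simp
    finally show "(LINT p:?H|lborel. (\<Phi>1 p)\<^sup>2 * (gradient \<Xi> p \<bullet> G p)) = \<mu> * (LINT x|lborel. (\<phi>1 x)\<^sup>2 * \<Xi>0 x * U0 x)" .
  qed
  moreover have "AE x in lborel. 0 < \<Phi>1 (x, 0)" using assms(12) by (simp add: bv1)
  ultimately show ?thesis using pos \<Xi>0 by simp
qed

end
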